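(* Let $d \geq 1$ be an integer and $T>0$. Let $\alpha>0$ and let $s$ be a real number with $s>\frac{d}{2}-\alpha$. Let $\rho:\mathbb{R}^d\to\mathbb{R}$ be a $\mathcal{C}^\infty$ compactly-supported function and let $2\leq p<\infty$. Let $(\Psi_n)_{n\in\mathbb{N}}$ be the sequence of truncated stochastic convolutions associated with a space-time white noise and the exponent $\alpha$. Then the sequence $(\rho\Psi_n)_{n\in\mathbb{N}}$ converges almost surely in the space $\mathcal{C}([0,T];\mathcal{W}^{-s,p}(\mathbb{R}^d))$. In particular its almost sure limit, denoted $\rho\Psi$, satisfies $\rho\Psi\in\mathcal{C}([0,T];\mathcal{W}^{-s,p}(\mathbb{R}^d))$.
   Context: Fourier transform: $\mathcal{F}f(\xi)=\int_{\mathbb{R}^d}f(y)e^{-i\langle \xi,y\rangle}dy$. For $\sigma\in\mathbb{R}$ and $1\leq p<\infty$, $\mathcal{W}^{\sigma,p}(\mathbb{R}^d)=\{f\in\mathcal{S}'(\mathbb{R}^d):\ \|f\|_{\mathcal{W}^{\sigma,p}}=\|\mathcal{F}^{-1}(\{1+|\cdot|^2\}^{\sigma/2}\mathcal{F}f)\|_{L^p(\mathbb{R}^d)}<\infty\}$. $\dot W$ is a (real) space-time white noise on $[0,T]\times\mathbb{R}^d$: a centered Gaussian family with $\mathbb{E}[|\langle\dot W,f\rangle|^2]=\|f\|^2_{L^2([0,T]\times\mathbb{R}^d)}$ for test functions $f$; $W(dt',dx')$ denotes the associated Wiener integral. For $n\in\mathbb{N}$ let $B_n=\{\xi\in\mathbb{R}^d:|\xi|\leq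 n\}$ and $$a_n(t,x)=\frac{1}{(2\pi)^d}\int_{B_n}\frac{e^{it|\xi|^2}}{(1+|\xi|^2)^{\alpha/2}}e^{i\langle x,\xi\rangle}d\xi .$$ The truncated stochastic convolution is the centered complex Gaussian process $$\Psi_n(t,x)=-i\int_0^t\int_{\mathbb{R}^d}a_n(t-t',x-x')\,W(dt',dx'),\qquad (t,x)\in[0,T]\times\mathbb{R}^d$$ (a continuous version is taken). It is the solution, started from $0$, of $i\partial_t\Psi_n-\Delta\Psi_n=\langle\nabla\rangle^{-\alpha}\chi_n(\nabla)\dot W$, where $\chi_n$ is the indicator function of $B_n$ and $\langle\nabla\rangle^{-\alpha}$ is the Fourier multiplier $(1+|\xi|^2)^{-\alpha/2}$. *)

theory Defs
  imports "HOL-Probability.Probability"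
begin

section \<open>Smooth functions\<close>

text \<open>\<open>partials bs f\<close> is the iterated partial derivative of \<open>f\<close> along the basis vectors listed
  in \<open>bs\<close>; a list with entries in \<open>Basis\<close> plays the role of a multi-index.\<close>

fun partials :: "'a::euclidean_space list \<Rightarrow> ('a \<Rightarrow> 'b::real_normed_vector) \<Rightarrow> 'a \<Rightarrow> 'b" where
  "partials [] f = f"
| "partials (b # bs) f = (\<lambda>x. frechet_derivative (partials bs f) (at x) b)"

definition smooth :: "('a::euclidean_space \<Rightarrow> 'b::real_normed_vector) \<Rightarrow> bool" where
  "smooth f \<longleftrightarrow> (\<forall>bs. set bs \<subseteq> Basis \<longrightarrow> (\<forall>x. partials bs f differentiable at x))"

definition supp :: "('a::topological_space \<Rightarrow> 'b::zero) \<Rightarrow> 'a set" where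
  "supp f = closure {x. f x \<noteq> 0}"


section \<open>Schwartz functions and tempered distributions\<close>

definition schwartz :: "('a::euclidean_space \<Rightarrow> complex) set" where
  "schwartz = {\<phi>. smooth \<phi> \<and>
     (\<forall>N bs. set bs \<subseteq> Basis \<longrightarrow> bdd_above (range (\<lambda>x. (1 + norm x) ^ N * cmod (partials bs \<phi> x))))}"

definition schwartz_norm :: "nat \<Rightarrow> ('a::euclidean_space \<Rightarrow> complex) \<Rightarrow> real" where
  "schwartz_norm N \<phi> =
     (SUP (bs, x) \<in> {bs. set bs \<subseteq> Basis \<and> length bs \<le> N} \<times> UNIV.
        (1 + norm x) ^ N * cmod (partials bs \<phi> x))"

text \<open>A distribution is a functional on all functions that is required to vanish off
  \<^const>\<open>schwartz\<close>. Hence two distributions are equal as soon as they agree on Schwartz functions.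
  Since the norms \<^const>\<open>schwartz_norm\<close> are increasing in \<open>N\<close> and generate the topology of the
  Schwartz space, the last clause is continuity.\<close>

type_synonym 'a distribution = "('a \<Rightarrow> complex) \<Rightarrow> complex"

definition tempered :: "'a::euclidean_space distribution set" where
  "tempered = {u.
     (\<forall>\<phi>. \<phi> \<notin> schwartz \<longrightarrow> u \<phi> = 0) \<and>
     (\<forall>\<phi>\<in>schwartz. \<forall>\<psi>\<in>schwartz. \<forall>c. u (\<lambda>x. \<phi> x + c * \<psi> x) = u \<phi> + c * u \<psi>) \<and>
     (\<exists>C N. \<forall>\<phi>\<in>schwartz. cmod (u \<phi>) \<le> C * schwartz_norm N \<phi>)}"

text \<open>The distribution given by integration against a function.\<close>

definition distribution_of :: "('a::euclidean_space \<Rightarrow> complex) \<Rightarrow> 'a distribution" where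
  "distribution_of g = (\<lambda>\<phi>. if \<phi> \<in> schwartz then (LINT x|lborel. g x * \<phi> x) else 0)"


section \<open>Fourier transform\<close>

definition fourier :: "('a::euclidean_space \<Rightarrow> complex) \<Rightarrow> 'a \<Rightarrow> complex" where
  "fourier f \<xi> = (LINT y|lborel. f y * cis (- (\<xi> \<bullet> y)))"

definition inv_fourier :: "('a::euclidean_space \<Rightarrow> complex) \<Rightarrow> 'a \<Rightarrow> complex" where
  "inv_fourier f x = 1 / (2 * pi) ^ DIM('a) * (LINT \<xi>|lborel. f \<xi> * cis (x \<bullet> \<xi>))"

text \<open>On distributions, the Fourier transform, its inverse and the multiplication by a smooth
  function are defined by duality.\<close>

definition fourier_dist :: "'a::euclidean_space distribution \<Rightarrow> 'a distribution" where
  "fourier_dist u = (\<lambda>\<phi>. if \<phi> \<in> schwartz then u (fourier \<phi>) else 0)"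

definition inv_fourier_dist :: "'a::euclidean_space distribution \<Rightarrow> 'a distribution" where
  "inv_fourier_dist u = (\<lambda>\<phi>. if \<phi> \<in> schwartz then u (inv_fourier \<phi>) else 0)"

definition mult_dist :: "('a::euclidean_space \<Rightarrow> complex) \<Rightarrow> 'a distribution \<Rightarrow> 'a distribution" where
  "mult_dist m u = (\<lambda>\<phi>. if \<phi> \<in> schwartz then u (\<lambda>x. m x * \<phi> x) else 0)"


section \<open>Sobolev spaces\<close>

text \<open>The \<open>L\<^sup>p\<close> norm of a distribution, which is infinite when it is not given by an \<open>L\<^sup>p\<close>
  function. The infimum is over the representatives of one almost-everywhere class, on which the
  norm is constant.\<close>

definition Lp_norm_dist :: "real \<Rightarrow> 'a::euclidean_space distribution \<Rightarrow> ennreal" where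
  "Lp_norm_dist p u =
     (INF g \<in> {g \<in> borel_measurable lborel.
                integrable lborel (\<lambda>x. cmod (g x) powr p) \<and> u = distribution_of g}.
        ennreal ((LINT x|lborel. cmod (g x) powr p) powr (1 / p)))"

definition sobolev_norm :: "real \<Rightarrow> real \<Rightarrow> 'a::euclidean_space distribution \<Rightarrow> ennreal" where
  "sobolev_norm \<sigma> p u =
     Lp_norm_dist p (inv_fourier_dist
       (mult_dist (\<lambda>\<xi>. of_real ((1 + (norm \<xi>)\<^sup>2) powr (\<sigma> / 2))) (fourier_dist u)))"

definition sobolev :: "real \<Rightarrow> real \<Rightarrow> 'a::euclidean_space distribution set" where
  "sobolev \<sigma> p = {u \<in> tempered. sobolev_norm \<sigma> p u < \<infinity>}"

text \<open>The space of continuous functions from \<open>[0,T]\<close> to the Sobolev space, and convergence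
  in it (that is, for the supremum norm). Values outside \<open>[0,T]\<close> are irrelevant.\<close>

definition C_sobolev :: "real \<Rightarrow> real \<Rightarrow> real \<Rightarrow> (real \<Rightarrow> 'a::euclidean_space distribution) set" where
  "C_sobolev T \<sigma> p = {u.
     (\<forall>t\<in>{0..T}. u t \<in> sobolev \<sigma> p) \<and>
     (\<forall>t\<^sub>0\<in>{0..T}. ((\<lambda>t. sobolev_norm \<sigma> p (u t - u t\<^sub>0)) \<longlongrightarrow> 0) (at t\<^sub>0 within {0..T}))}"

definition converges_C_sobolev ::
  "real \<Rightarrow> real \<Rightarrow> real \<Rightarrow> (nat \<Rightarrow> real \<Rightarrow> 'a::euclidean_space distribution)
    \<Rightarrow> (real \<Rightarrow> 'a distribution) \<Rightarrow> bool" where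
  "converges_C_sobolev T \<sigma> p u v \<longleftrightarrow>
     (\<forall>n. u n \<in> C_sobolev T \<sigma> p) \<and> v \<in> C_sobolev T \<sigma> p \<and>
     (\<lambda>n. SUP t\<in>{0..T}. sobolev_norm \<sigma> p (u n t - v t)) \<longlonglongrightarrow> 0"


section \<open>Space-time white noise and the Wiener integral\<close>

text \<open>Degenerate Gaussian variables are allowed.\<close>

definition centered_gaussian :: "'w measure \<Rightarrow> ('w \<Rightarrow> real) \<Rightarrow> bool" where
  "centered_gaussian M X \<longleftrightarrow> X \<in> borel_measurable M \<and>
     ((AE \<omega> in M. X \<omega> = 0) \<or>
      (\<exists>\<sigma>>0. distributed M lborel X (\<lambda>x. ennreal (normal_density 0 \<sigma> x))))"

definition centered_gaussian_family :: "'w measure \<Rightarrow> 'i set \<Rightarrow> ('i \<Rightarrow> 'w \<Rightarrow> real) \<Rightarrow> bool" where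
  "centered_gaussian_family M I X \<longleftrightarrow>
     (\<forall>F c. finite F \<and> F \<subseteq> I \<longrightarrow> centered_gaussian M (\<lambda>\<omega>. \<Sum>i\<in>F. c i * X i \<omega>))"

definition test_functions :: "real \<Rightarrow> (real \<times> 'a::euclidean_space \<Rightarrow> real) set" where
  "test_functions T = {f. smooth f \<and> compact (supp f) \<and> supp f \<subseteq> {0<..<T} \<times> UNIV}"

text \<open>\<open>W f\<close> is the pairing of the noise with the test function \<open>f\<close>. It is linear in \<open>f\<close> almost
  surely, so the second moments determine the covariances.\<close>

definition white_noise ::
  "'w measure \<Rightarrow> real \<Rightarrow> ((real \<times> 'a::euclidean_space \<Rightarrow> real) \<Rightarrow> 'w \<Rightarrow> real) \<Rightarrow> bool" where
  "white_noise M T W \<longleftrightarrow>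
     centered_gaussian_family M (test_functions T) W \<and>
     (\<forall>f\<in>test_functions T. \<forall>g\<in>test_functions T. \<forall>c.
        AE \<omega> in M. W (\<lambda>z. f z + c * g z) \<omega> = W f \<omega> + c * W g \<omega>) \<and>
     (\<forall>f\<in>test_functions T.
        (LINT \<omega>|M. (W f \<omega>)\<^sup>2) = (LINT z:{0..T} \<times> UNIV|lborel. (f z)\<^sup>2))"

text \<open>\<open>X\<close> is (a version of) the Wiener integral of \<open>h\<close> over \<open>[0,T] \<times> \<real>\<^sup>d\<close>: the extension of \<open>W\<close>
  by \<open>L\<^sup>2\<close>-continuity from test functions to square-integrable functions.\<close>

definition wiener_integral ::
  "'w measure \<Rightarrow> real \<Rightarrow> ((real \<times> 'a::euclidean_space \<Rightarrow> real) \<Rightarrow> 'w \<Rightarrow> real)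
    \<Rightarrow> (real \<times> 'a \<Rightarrow> real) \<Rightarrow> ('w \<Rightarrow> real) \<Rightarrow> bool" where
  "wiener_integral M T W h X \<longleftrightarrow>
     h \<in> borel_measurable lborel \<and> X \<in> borel_measurable M \<and>
     (\<exists>f. (\<forall>k. f k \<in> test_functions T) \<and>
        (\<lambda>k::nat. \<integral>\<^sup>+z\<in>{0..T} \<times> UNIV. ennreal ((f k z - h z)\<^sup>2) \<partial>lborel) \<longlonglongrightarrow> 0 \<and>
        (\<lambda>k. \<integral>\<^sup>+\<omega>. ennreal ((W (f k) \<omega> - X \<omega>)\<^sup>2) \<partial>M) \<longlonglongrightarrow> 0)"

definition complex_wiener_integral ::
  "'w measure \<Rightarrow> real \<Rightarrow> ((real \<times> 'a::euclidean_space \<Rightarrow> real) \<Rightarrow> 'w \<Rightarrow> real)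
    \<Rightarrow> (real \<times> 'a \<Rightarrow> complex) \<Rightarrow> ('w \<Rightarrow> complex) \<Rightarrow> bool" where
  "complex_wiener_integral M T W h X \<longleftrightarrow>
     wiener_integral M T W (\<lambda>z. Re (h z)) (\<lambda>\<omega>. Re (X \<omega>)) \<and>
     wiener_integral M T W (\<lambda>z. Im (h z)) (\<lambda>\<omega>. Im (X \<omega>))"


section \<open>The truncated stochastic convolution\<close>

definition trunc_kernel :: "real \<Rightarrow> nat \<Rightarrow> real \<Rightarrow> 'a::euclidean_space \<Rightarrow> complex" where
  "trunc_kernel \<alpha> n t x =
     1 / (2 * pi) ^ DIM('a) *
     (LINT \<xi>:cball 0 (real n)|lborel.
        cis (t * (norm \<xi>)\<^sup>2) / of_real ((1 + (norm \<xi>)\<^sup>2) powr (\<alpha> / 2)) * cis (x \<bullet> \<xi>))"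

text \<open>\<open>\<Psi>\<close> is a continuous version of the \<open>n\<close>-th truncated convolution. The equality with the
  Wiener integral holds almost surely for each \<open>(t,x)\<close> separately.\<close>

definition truncated_convolution ::
  "'w measure \<Rightarrow> real \<Rightarrow> ((real \<times> 'a::euclidean_space \<Rightarrow> real) \<Rightarrow> 'w \<Rightarrow> real)
    \<Rightarrow> real \<Rightarrow> nat \<Rightarrow> (real \<Rightarrow> 'a \<Rightarrow> 'w \<Rightarrow> complex) \<Rightarrow> bool" where
  "truncated_convolution M T W \<alpha> n \<Psi> \<longleftrightarrow>
     (\<forall>t\<in>{0..T}. \<forall>x. \<Psi> t x \<in> borel_measurable M \<and>
        (\<exists>X. complex_wiener_integral M T W
               (\<lambda>(t', x'). indicator {0..t} t' * trunc_kernel \<alpha> n (t - t') (x - x')) X \<and>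
             (AE \<omega> in M. \<Psi> t x \<omega> = - \<i> * X \<omega>))) \<and>
     (AE \<omega> in M. continuous_on ({0..T} \<times> UNIV) (\<lambda>(t, x). \<Psi> t x \<omega>))"

end

theory Submission
  imports Defs
begin

text \<open>Write \<open>G n t\<close> for the Bessel potential \<open>\<langle>\<nabla>\<rangle>\<^bsup>-s\<^esup> (\<rho> \<Psi>\<^sub>n(t))\<close>, a random function on \<open>\<real>\<^sup>d\<close>. The Sobolev norm of order \<open>-s\<close>
  of \<open>\<rho> \<Psi>\<^sub>n(t)\<close> is the \<open>L\<^sup>p\<close> norm of \<open>G n t\<close>, so that the claim is that \<open>G n\<close> converges in \<open>L\<^sup>p\<close> uniformly in time.
  It follows from pointwise bounds at fixed \<open>x\<close> whose constants are in \<open>L\<^sup>p\<close> as functions of \<open>x\<close>.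

  Moments. At a fixed time the process \<open>\<Psi>\<^sub>n\<close> is Gaussian and stationary in space. By the isometry of the Wiener integral
  and Bessel's inequality (\<open>ft_bessel\<close>), even moments of linear combinations of its values are bounded by powers of
  an integral against a spectral density \<open>v\<close>, and the same holds for increments in \<open>n\<close> and \<open>t\<close>; this is
  \<open>truncated_convolution_spectrally_dominated\<close>. Passing from linear combinations to integrals gives \<open>potential_moment\<close>:
  the moment of order \<open>2 K\<close> of the potential at \<open>x\<close> is bounded by the \<open>K\<close>-th power of
  \<open>\<integral> v(\<xi>) |\<langle>\<nabla>\<rangle>\<^bsup>-s\<^esup> (\<rho> e\<^bsup>i\<xi>y\<^esup>)(x)|\<^sup>2 d\<xi>\<close>, up to a constant. The function in this integral is \<open>O(\<langle>\<xi>\<rangle>\<^bsup>-s\<^esup> \<langle>x\<rangle>\<^bsup>-N\<^esup>)\<close> for every \<open>N\<close>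
  (\<open>symbol_bound\<close>, by Peetre's inequality and integration by parts). The density of an increment between \<open>(m, t\<^sub>0)\<close> and
  \<open>(n, t)\<close> is \<open>O(|t - t\<^sub>0|\<^sup>\<kappa> \<langle>\<xi>\<rangle>\<^bsup>2\<kappa>-2\<alpha>\<^esup>)\<close> and supported in \<open>m < |\<xi>| \<le> n\<close>. As \<open>2 (s + \<alpha>) > d\<close>, a small \<open>\<kappa>\<close> leaves the integral
  convergent and even small in \<open>m\<close>; this is \<open>increment_moment\<close>.

  Chaining. High moments beat the number of dyadic increments. Summing over the dyadic levels of time and of the
  truncation produces, almost surely, one function \<open>A\<close> that is integrable together with \<open>A\<^sup>p\<close> and such that \<open>A x\<close> bounds all
  normalised increments at \<open>x\<close> (\<open>pathwise_bound\<close>). Kolmogorov's chaining argument in both parameters (\<open>double_chaining\<close>)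
  then shows that \<open>G n t x\<close> is Hoelder continuous in \<open>t\<close> and geometrically Cauchy in \<open>n\<close> along dyadic scales, with
  constants proportional to \<open>A x\<close>.

  Conclusion. For one realisation, \<open>pathwise_convergence\<close> integrates these bounds. The limit of the \<open>G n t\<close> is an
  integrable function, and Fourier inversion on the Schwartz space provides the distribution of which it is the potential.\<close>

section \<open>Calculus of iterated partial derivatives\<close>

lemma partials_append: "partials (bs @ cs) f = partials bs (partials cs f)"
  by (induction bs) auto

lemma smooth_partials:
  assumes "smooth f" "set cs \<subseteq> Basis"
  shows "smooth (partials cs f)"
  using assms unfolding smooth_def partials_append[symmetric] by auto

lemma smooth_differentiable: "smooth f \<Longrightarrow> f differentiable at x"
  unfolding smooth_def by (metis empty_set empty_subsetI partials.simps(1))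

lemma smooth_has_derivative:
  "smooth f \<Longrightarrow> (f has_derivative frechet_derivative f (at x)) (at x)"
  using smooth_differentiable frechet_derivative_works by blast

lemma partials_has_derivative:
  "smooth f \<Longrightarrow> set bs \<subseteq> Basis \<Longrightarrow>
    (partials bs f has_derivative frechet_derivative (partials bs f) (at x)) (at x)"
  by (intro smooth_has_derivative smooth_partials)

lemma smooth_continuous_on: "smooth f \<Longrightarrow> continuous_on S f"
  by (meson continuous_at_imp_continuous_on differentiable_imp_continuous_within smooth_differentiable)

lemma smooth_borel_measurable [measurable_dest]:
  "smooth f \<Longrightarrow> f \<in> borel_measurable borel"
  by (intro borel_measurable_continuous_onI smooth_continuous_on)

lemma partials_bounded_linear:
  assumes h: "bounded_linear h" and f: "smooth f" and bs: "set bs \<subseteq> Basis"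
  shows "partials bs (\<lambda>x. h (f x)) = (\<lambda>x. h (partials bs f x))"
  using bs
proof (induction bs)
  case (Cons b bs)
  then have IH: "partials bs (\<lambda>x. h (f x)) = (\<lambda>x. h (partials bs f x))" by auto
  show ?case
  proof
    fix x
    have "((\<lambda>x. h (partials bs f x)) has_derivative
        (\<lambda>v. h (frechet_derivative (partials bs f) (at x) v))) (at x)"
      using partials_has_derivative[OF f] Cons(2) by (intro bounded_linear.has_derivative[OF h]) auto
    from frechet_derivative_at[OF this, symmetric] IH
    show "partials (b # bs) (\<lambda>x. h (f x)) x = h (partials (b # bs) f x)" by simp
  qed
qed auto

lemma smooth_bounded_linear:
  fixes f :: "'a::euclidean_space \<Rightarrow> 'b::real_normed_vector"
  assumes "bounded_linear h" "smooth f"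
  shows "smooth (\<lambda>x. h (f x))"
  unfolding smooth_def
proof (intro allI impI)
  fix bs :: "'a list" and x assume "set bs \<subseteq> Basis"
  with assms show "partials bs (\<lambda>x. h (f x)) differentiable at x"
    by (simp add: partials_bounded_linear)
       (metis assms differentiable_def bounded_linear.has_derivative partials_has_derivative)
qed

lemma partials_add:
  assumes f: "smooth f" and g: "smooth g" and bs: "set bs \<subseteq> Basis"
  shows "partials bs (\<lambda>x. f x + g x) = (\<lambda>x. partials bs f x + partials bs g x)"
  using bs
proof (induction bs)
  case (Cons b bs)
  then have IH: "partials bs (\<lambda>x. f x + g x) = (\<lambda>x. partials bs f x + partials bs g x)" by auto
  show ?case
  proof
    fix x
    have "((\<lambda>x. partials bs f x + partials bs g x) has_derivative
        (\<lambda>v. frechet_derivative (partials bs f) (at x) v + frechet_derivative (partials bs g) (at x) v)) (at x)"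
      using Cons(2) by (intro has_derivative_add partials_has_derivative f g) auto
    from frechet_derivative_at[OF this, symmetric] IH
    show "partials (b # bs) (\<lambda>x. f x + g x) x = partials (b # bs) f x + partials (b # bs) g x" by simp
  qed
qed auto

lemma smooth_add:
  assumes "smooth f" "smooth g"
  shows "smooth (\<lambda>x. f x + g x)"
  unfolding smooth_def
proof (intro allI impI)
  fix bs :: "'a list" and x assume "set bs \<subseteq> Basis"
  with assms show "partials bs (\<lambda>x. f x + g x) differentiable at x"
    by (simp add: partials_add) (intro differentiable_add smooth_differentiable smooth_partials)
qed

lemma partials_translate:
  assumes f: "smooth f" and bs: "set bs \<subseteq> Basis"
  shows "partials bs (\<lambda>x. f (x + c)) = (\<lambda>x. partials bs f (x + c))"
  using bs
proof (induction bs)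
  case (Cons b bs)
  then have IH: "partials bs (\<lambda>x. f (x + c)) = (\<lambda>x. partials bs f (x + c))" by auto
  show ?case
  proof
    fix x
    have "(partials bs f has_derivative frechet_derivative (partials bs f) (at (x + c))) (at (x + c))"
      using Cons(2) by (intro partials_has_derivative f) auto
    moreover have "((\<lambda>x. x + c) has_derivative (\<lambda>v. v)) (at x)"
      by (auto intro!: derivative_eq_intros)
    ultimately have "((\<lambda>x. partials bs f (x + c)) has_derivative
        frechet_derivative (partials bs f) (at (x + c))) (at x)"
      using has_derivative_compose by blast
    from frechet_derivative_at[OF this, symmetric] IH
    show "partials (b # bs) (\<lambda>x. f (x + c)) x = partials (b # bs) f (x + c)" by simp
  qed
qed auto

lemma smooth_translate:
  assumes "smooth f" shows "smooth (\<lambda>x. f (x + c))"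
  unfolding smooth_def
proof (intro allI impI)
  fix bs :: "'a list" and x assume bs: "set bs \<subseteq> Basis"
  have "(partials bs f has_derivative frechet_derivative (partials bs f) (at (x + c))) (at (x + c))"
    using bs by (intro partials_has_derivative assms) auto
  moreover have "((\<lambda>x. x + c) has_derivative (\<lambda>v. v)) (at x)"
    by (auto intro!: derivative_eq_intros)
  ultimately have "((\<lambda>x. partials bs f (x + c)) has_derivative
      frechet_derivative (partials bs f) (at (x + c))) (at x)"
    using has_derivative_compose by blast
  then show "partials bs (\<lambda>x. f (x + c)) differentiable at x"
    using partials_translate[OF assms bs] unfolding differentiable_def by metis
qed

text \<open>The Leibniz rule: the entries of \<open>leibniz bs\<close> are the ways of distributing the derivatives
  of \<open>bs\<close> over the two factors of a product.\<close>

fun leibniz :: "'a list \<Rightarrow> ('a list \<times> 'a list) list" where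
  "leibniz [] = [([], [])]"
| "leibniz (b # bs) = map (\<lambda>(c, d). (b # c, d)) (leibniz bs) @ map (\<lambda>(c, d). (c, b # d)) (leibniz bs)"

lemma set_leibniz: "(c, d) \<in> set (leibniz bs) \<Longrightarrow> set c \<subseteq> set bs \<and> set d \<subseteq> set bs"
  by (induction bs arbitrary: c d) fastforce+

lemma has_derivative_leibniz_sum:
  fixes f g :: "'a::euclidean_space \<Rightarrow> complex"
  assumes f: "smooth f" and g: "smooth g"
    and L: "\<And>c d. (c, d) \<in> set L \<Longrightarrow> set c \<subseteq> Basis \<and> set d \<subseteq> Basis"
  shows "((\<lambda>x. \<Sum>(c, d)\<leftarrow>L. partials c f x * partials d g x) has_derivative
    (\<lambda>b. (\<Sum>(c, d)\<leftarrow>L. partials (b # c) f x * partials d g x)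
       + (\<Sum>(c, d)\<leftarrow>L. partials c f x * partials (b # d) g x))) (at x)"
  using L
proof (induction L)
  case (Cons cd L)
  obtain c d where cd: "cd = (c, d)" by force
  have s: "set c \<subseteq> Basis" "set d \<subseteq> Basis" using Cons.prems[of c d] cd by auto
  have "((\<lambda>x. \<Sum>(c, d)\<leftarrow>L. partials c f x * partials d g x) has_derivative
    (\<lambda>b. (\<Sum>(c, d)\<leftarrow>L. partials (b # c) f x * partials d g x)
       + (\<Sum>(c, d)\<leftarrow>L. partials c f x * partials (b # d) g x))) (at x)"
    using Cons.prems by (intro Cons.IH) auto
  note D = has_derivative_add[OF has_derivative_mult[OF partials_has_derivative[OF f s(1)]
        partials_has_derivative[OF g s(2)]] this]
  show ?case unfolding cd list.map sum_list.Cons prod.case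
    by (rule has_derivative_eq_rhs[OF D]) (simp add: fun_eq_iff algebra_simps)
qed simp

lemma partials_mult:
  fixes f g :: "'a::euclidean_space \<Rightarrow> complex"
  assumes f: "smooth f" and g: "smooth g" and bs: "set bs \<subseteq> Basis"
  shows "partials bs (\<lambda>x. f x * g x) = (\<lambda>x. \<Sum>(c, d)\<leftarrow>leibniz bs. partials c f x * partials d g x)"
  using bs
proof (induction bs)
  case (Cons b bs)
  have "((\<lambda>x. \<Sum>(c, d)\<leftarrow>leibniz bs. partials c f x * partials d g x) has_derivative
    (\<lambda>b. (\<Sum>(c, d)\<leftarrow>leibniz bs. partials (b # c) f x * partials d g x)
       + (\<Sum>(c, d)\<leftarrow>leibniz bs. partials c f x * partials (b # d) g x))) (at x)" for x
    using Cons.prems set_leibniz by (intro has_derivative_leibniz_sum f g) fastforce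
  note D = frechet_derivative_at[OF this, symmetric]
  from Cons have "partials bs (\<lambda>x. f x * g x) = (\<lambda>x. \<Sum>(c, d)\<leftarrow>leibniz bs. partials c f x * partials d g x)"
    by simp
  then have "partials (b # bs) (\<lambda>x. f x * g x)
      = (\<lambda>x. frechet_derivative (\<lambda>x. \<Sum>(c, d)\<leftarrow>leibniz bs. partials c f x * partials d g x) (at x) b)"
    by simp
  then show ?case unfolding D by (simp add: fun_eq_iff case_prod_unfold comp_def)
qed auto

lemma smooth_mult:
  fixes f g :: "'a::euclidean_space \<Rightarrow> complex"
  assumes f: "smooth f" and g: "smooth g"
  shows "smooth (\<lambda>x. f x * g x)"
  unfolding smooth_def
proof (intro allI impI)
  fix bs :: "'a list" and x :: 'a assume bs: "set bs \<subseteq> Basis"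
  show "partials bs (\<lambda>x. f x * g x) differentiable at x"
    unfolding partials_mult[OF f g bs]
    by (intro differentiableI[OF has_derivative_leibniz_sum] f g) (use set_leibniz bs in blast)
qed

text \<open>Bounds on all derivatives, uniform over a family of functions. Since multiplication adds up
  such bounds, both the Schwartz space and symbol estimates are instances.\<close>

definition bounded_partials ::
  "('i \<Rightarrow> 'a::euclidean_space \<Rightarrow> real) \<Rightarrow> ('i \<Rightarrow> 'a \<Rightarrow> complex) \<Rightarrow> bool" where
  "bounded_partials w f \<longleftrightarrow> (\<forall>i. smooth (f i)) \<and>
     (\<forall>bs. set bs \<subseteq> Basis \<longrightarrow> (\<exists>C\<ge>0. \<forall>i x. cmod (partials bs (f i) x) \<le> C * w i x))"

lemma bounded_partials_mult:
  assumes f: "bounded_partials v f" and g: "bounded_partials w g"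
    and nonneg: "\<And>i x. 0 \<le> v i x"
  shows "bounded_partials (\<lambda>i x. v i x * w i x) (\<lambda>i x. f i x * g i x)"
  unfolding bounded_partials_def
proof (intro conjI allI impI)
  have sm: "smooth (f i)" "smooth (g i)" for i
    using f g unfolding bounded_partials_def by auto
  then show "smooth (\<lambda>x. f i x * g i x)" for i by (intro smooth_mult) auto
  fix bs :: "'b list" assume bs: "set bs \<subseteq> Basis"
  have sum_bound: "\<exists>C\<ge>0. \<forall>i x. cmod (\<Sum>(c, d)\<leftarrow>L. partials c (f i) x * partials d (g i) x) \<le> C * (v i x * w i x)"
    if "\<And>c d. (c, d) \<in> set L \<Longrightarrow> set c \<subseteq> Basis \<and> set d \<subseteq> Basis" for L
    using that
  proof (induction L)
    case (Cons cd L)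
    obtain c d where cd: "cd = (c, d)" by force
    have s: "set c \<subseteq> Basis" "set d \<subseteq> Basis" using Cons.prems[of c d] cd by auto
    obtain A where A: "A \<ge> 0" "\<And>i x. cmod (partials c (f i) x) \<le> A * v i x"
      using f s unfolding bounded_partials_def by blast
    obtain B where B: "B \<ge> 0" "\<And>i x. cmod (partials d (g i) x) \<le> B * w i x"
      using g s unfolding bounded_partials_def by blast
    obtain C where C: "C \<ge> 0"
      "\<And>i x. cmod (\<Sum>(c, d)\<leftarrow>L. partials c (f i) x * partials d (g i) x) \<le> C * (v i x * w i x)"
      using Cons by force
    have "cmod (\<Sum>(c, d)\<leftarrow>cd # L. partials c (f i) x * partials d (g i) x) \<le> (A * B + C) * (v i x * w i x)" for i x
    proof -
      have "cmod (partials c (f i) x) * cmod (partials d (g i) x) \<le> (A * v i x) * (B * w i x)"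
        using A B nonneg by (intro mult_mono) auto
      then have "cmod (partials c (f i) x * partials d (g i) x) \<le> A * B * (v i x * w i x)"
        by (simp add: norm_mult algebra_simps)
      moreover have "cmod (\<Sum>(c, d)\<leftarrow>cd # L. partials c (f i) x * partials d (g i) x)
          \<le> cmod (partials c (f i) x * partials d (g i) x) + cmod (\<Sum>(c, d)\<leftarrow>L. partials c (f i) x * partials d (g i) x)"
        unfolding cd by (simp add: norm_triangle_ineq)
      ultimately show ?thesis using C(2)[of i x] by (simp add: algebra_simps)
    qed
    moreover have "A * B + C \<ge> 0" using A B C by auto
    ultimately show ?case by blast
  qed auto
  show "\<exists>C\<ge>0. \<forall>i x. cmod (partials bs (\<lambda>x. f i x * g i x) x) \<le> C * (v i x * w i x)"
    unfolding partials_mult[OF sm bs] using set_leibniz bs by (intro sum_bound) blast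
qed

lemma bounded_partials_mono:
  assumes "bounded_partials v f" "\<And>i x. v i x \<le> K * w i x" "K \<ge> 0"
  shows "bounded_partials w f"
  unfolding bounded_partials_def
proof (intro conjI allI impI)
  fix bs :: "'b list" assume "set bs \<subseteq> Basis"
  then obtain C where C: "C \<ge> 0" "\<And>i x. cmod (partials bs (f i) x) \<le> C * v i x"
    using assms(1) unfolding bounded_partials_def by blast
  have "cmod (partials bs (f i) x) \<le> C * K * w i x" for i x
    using order_trans[OF C(2) mult_left_mono[OF assms(2) C(1)]] by (simp add: mult.assoc)
  with C(1) assms(3) show "\<exists>C\<ge>0. \<forall>i x. cmod (partials bs (f i) x) \<le> C * w i x"
    by (intro exI[of _ "C * K"]) auto
qed (use assms(1) in \<open>auto simp: bounded_partials_def\<close>)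


section \<open>The Japanese bracket\<close>

definition jap :: "real \<Rightarrow> 'a::euclidean_space \<Rightarrow> real" where
  "jap \<sigma> x = (1 + (norm x)\<^sup>2) powr (\<sigma> / 2)"

lemma one_plus_norm_sq_pos [simp]: "0 < 1 + (norm x)\<^sup>2"
  by (smt (verit) zero_le_power2)

lemma jap_pos [simp]: "0 < jap \<sigma> x"
  unfolding jap_def using one_plus_norm_sq_pos[of x] by (metis less_irrefl powr_gt_zero)

lemma jap_nonneg [simp]: "0 \<le> jap \<sigma> x"
  using jap_pos less_imp_le by blast

lemma jap_neq_0 [simp]: "jap \<sigma> x \<noteq> 0"
  using jap_pos[of \<sigma> x] by linarith

lemma jap_0 [simp]: "jap 0 x = 1"
  unfolding jap_def using one_plus_norm_sq_pos[of x] by (metis divide_eq_0_iff less_irrefl powr_zero_eq_one)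

lemma jap_add: "jap (\<sigma> + \<tau>) x = jap \<sigma> x * jap \<tau> x"
  by (simp add: jap_def powr_add add_divide_distrib)

lemma jap_minus: "jap (- \<sigma>) x = inverse (jap \<sigma> x)"
  by (simp add: jap_def powr_minus)

lemma jap_mono: "\<sigma> \<le> \<tau> \<Longrightarrow> jap \<sigma> x \<le> jap \<tau> x"
  unfolding jap_def by (intro powr_mono) auto

lemma jap_powr: "jap \<sigma> x powr a = jap (\<sigma> * a) x"
  by (simp add: jap_def powr_powr)

lemma jap_power: "jap \<sigma> x ^ n = jap (\<sigma> * n) x"
  by (simp flip: powr_realpow add: jap_powr)

lemma norm_le_jap: "norm x \<le> jap 1 x"
  by (simp add: jap_def powr_half_sqrt real_le_rsqrt)

lemma jap_one_le: "jap 1 x \<le> 1 + norm x"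
  by (simp add: jap_def powr_half_sqrt) (intro real_le_lsqrt; simp add: power2_eq_square algebra_simps)

lemma one_plus_norm_le_jap: "1 + norm x \<le> 2 * jap 1 x"
  using norm_le_jap[of x] jap_mono[of 0 1 x] by simp

lemma jap_measurable [measurable]: "jap \<sigma> \<in> borel_measurable borel"
  unfolding jap_def by measurable

lemma continuous_on_jap: "continuous_on S (jap \<sigma>)"
  unfolding jap_def by (intro continuous_intros) (auto simp: less_imp_neq[OF one_plus_norm_sq_pos, symmetric])

text \<open>The case of order 2 is \<open>1 + |u + v|\<^sup>2 \<le> 2 (1 + |u|\<^sup>2) (1 + |v|\<^sup>2)\<close>. Positive orders follow by taking
  powers, and negative ones by exchanging the roles of \<open>y\<close> and \<open>x + y\<close>.\<close>

lemma peetre_inequality: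
  "jap \<sigma> (x + y) \<le> 2 powr (\<bar>\<sigma>\<bar> / 2) * jap \<sigma> y * jap \<bar>\<sigma>\<bar> x"
proof -
  have *: "1 + (norm (u + v))\<^sup>2 \<le> 2 * (1 + (norm v)\<^sup>2) * (1 + (norm u)\<^sup>2)" for u v :: 'a
  proof -
    have "(norm (u + v))\<^sup>2 \<le> (norm u + norm v)\<^sup>2" by (intro power_mono norm_triangle_ineq) auto
    also have "\<dots> \<le> 2 * (norm u)\<^sup>2 + 2 * (norm v)\<^sup>2"
      using zero_le_power2[of "norm u - norm v"] by (simp add: power2_eq_square algebra_simps)
    finally have "(norm (u + v))\<^sup>2 \<le> 2 * (norm u)\<^sup>2 + 2 * (norm v)\<^sup>2" .
    moreover have "1 + c \<le> 2 * (1 + b) * (1 + a)" if "c \<le> 2 * a + 2 * b" "0 \<le> a" "0 \<le> b" for a b c :: real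
    proof -
      have "1 + c \<le> 2 * a + 2 * b + 2 + 2 * (a * b)" using that mult_nonneg_nonneg[OF that(2,3)] by linarith
      then show ?thesis by (simp add: algebra_simps)
    qed
    ultimately show ?thesis by simp
  qed
  show ?thesis
  proof (cases "\<sigma> \<ge> 0")
    case True
    have "(1 + (norm (x + y))\<^sup>2) powr (\<sigma> / 2) \<le> (2 * (1 + (norm y)\<^sup>2) * (1 + (norm x)\<^sup>2)) powr (\<sigma> / 2)"
      using True *[of x y] by (intro powr_mono2) auto
    with True show ?thesis by (simp add: jap_def powr_mult del: distrib_left_numeral)
  next
    case False
    have "1 + (norm y)\<^sup>2 \<le> 2 * (1 + (norm (x + y))\<^sup>2) * (1 + (norm x)\<^sup>2)"
      using *[of "- x" "x + y"] by simp
    then have "(1 + (norm y)\<^sup>2) powr (- \<sigma> / 2) \<le> (2 * (1 + (norm (x + y))\<^sup>2) * (1 + (norm x)\<^sup>2)) powr (- \<sigma> / 2)"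
      using False by (intro powr_mono2) auto
    then have "jap (- \<sigma>) y \<le> 2 powr (- \<sigma> / 2) * jap (- \<sigma>) (x + y) * jap (- \<sigma>) x"
      by (simp add: jap_def powr_mult del: distrib_left_numeral)
    then have "jap \<sigma> (x + y) * (jap \<sigma> y * jap (- \<sigma>) y)
        \<le> jap \<sigma> (x + y) * (jap \<sigma> y * (2 powr (- \<sigma> / 2) * jap (- \<sigma>) (x + y) * jap (- \<sigma>) x))"
      by (intro mult_left_mono) auto
    with False show ?thesis by (simp add: jap_minus field_simps)
  qed
qed

text \<open>The derivatives of the bracket are combinations of products of coordinates with brackets.
  The class below is closed under differentiation, and differentiation lowers the order; this
  yields the symbol estimates without a formula for the derivatives.\<close>

inductive bracket_symbol :: "real \<Rightarrow> ('a::euclidean_space \<Rightarrow> real) \<Rightarrow> bool" where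
  jap: "bracket_symbol \<sigma> (jap \<sigma>)"
| coord: "bracket_symbol \<sigma> f \<Longrightarrow> b \<in> Basis \<Longrightarrow> bracket_symbol (\<sigma> + 1) (\<lambda>x. (x \<bullet> b) * f x)"
| scale: "bracket_symbol \<sigma> f \<Longrightarrow> bracket_symbol \<sigma> (\<lambda>x. c * f x)"
| add: "bracket_symbol \<sigma> f \<Longrightarrow> bracket_symbol \<sigma> g \<Longrightarrow> bracket_symbol \<sigma> (\<lambda>x. f x + g x)"

lemma bracket_symbol_bound:
  "bracket_symbol \<sigma> f \<Longrightarrow> \<exists>C\<ge>0. \<forall>x. \<bar>f x\<bar> \<le> C * jap \<sigma> x"
proof (induction rule: bracket_symbol.induct)
  case (jap \<sigma>)
  show ?case by (intro exI[of _ 1]) auto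
next
  case (coord \<sigma> f b)
  then obtain C where C: "C \<ge> 0" "\<And>x. \<bar>f x\<bar> \<le> C * jap \<sigma> x" by blast
  have "\<bar>(x \<bullet> b) * f x\<bar> \<le> C * jap (\<sigma> + 1) x" for x
  proof -
    have "\<bar>x \<bullet> b\<bar> \<le> jap 1 x" using Basis_le_norm[OF coord(2), of x] norm_le_jap[of x] by linarith
    then have "\<bar>x \<bullet> b\<bar> * \<bar>f x\<bar> \<le> jap 1 x * (C * jap \<sigma> x)" using C by (intro mult_mono) auto
    then show ?thesis by (simp add: abs_mult jap_add mult_ac)
  qed
  with C(1) show ?case by blast
next
  case (scale \<sigma> f c)
  then obtain C where C: "C \<ge> 0" "\<And>x. \<bar>f x\<bar> \<le> C * jap \<sigma> x" by blast
  have "\<bar>c * f x\<bar> \<le> \<bar>c\<bar> * C * jap \<sigma> x" for x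
    using mult_left_mono[OF C(2), of "\<bar>c\<bar>" x] by (simp add: abs_mult mult_ac)
  with C(1) show ?case by (intro exI[of _ "\<bar>c\<bar> * C"]) auto
next
  case (add \<sigma> f g)
  then obtain C D where C: "C \<ge> 0" "\<And>x. \<bar>f x\<bar> \<le> C * jap \<sigma> x" and D: "D \<ge> 0" "\<And>x. \<bar>g x\<bar> \<le> D * jap \<sigma> x" by blast
  have "\<bar>f x + g x\<bar> \<le> (C + D) * jap \<sigma> x" for x
    using C(2)[of x] D(2)[of x] by (simp add: algebra_simps)
  with C(1) D(1) show ?case by (intro exI[of _ "C + D"]) auto
qed

lemma has_derivative_jap:
  fixes x :: "'a::euclidean_space"
  shows "(jap \<sigma> has_derivative (\<lambda>v. \<sigma> * ((x \<bullet> v) * jap (\<sigma> - 2) x))) (at x)"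
proof -
  have p: "0 < 1 + x \<bullet> x" using one_plus_norm_sq_pos[of x] by (simp add: power2_norm_eq_inner)
  have "((\<lambda>x. (1 + x \<bullet> x) powr (\<sigma> / 2)) has_derivative
      (\<lambda>v. (1 + x \<bullet> x) powr (\<sigma> / 2) * (0 * ln (1 + x \<bullet> x) + (x \<bullet> v + v \<bullet> x) * (\<sigma> / 2) / (1 + x \<bullet> x)))) (at x)"
    by (rule has_derivative_powr) (auto intro!: derivative_eq_intros simp: p)
  moreover have *: "jap (\<sigma> - 2) x = (1 + x \<bullet> x) powr (\<sigma> / 2) / (1 + x \<bullet> x)"
    using p by (simp add: jap_def power2_norm_eq_inner diff_divide_distrib powr_diff)
  moreover have "jap \<sigma> = (\<lambda>x::'a. (1 + x \<bullet> x) powr (\<sigma> / 2))"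
    by (simp add: jap_def power2_norm_eq_inner fun_eq_iff)
  ultimately have "(jap \<sigma> has_derivative
      (\<lambda>v. (1 + x \<bullet> x) powr (\<sigma> / 2) * (0 * ln (1 + x \<bullet> x) + (x \<bullet> v + v \<bullet> x) * (\<sigma> / 2) / (1 + x \<bullet> x)))) (at x)"
    by simp
  then show ?thesis
    by (rule has_derivative_eq_rhs) (auto simp: fun_eq_iff inner_commute *)
qed

lemma bracket_symbol_deriv:
  "bracket_symbol \<sigma> f \<Longrightarrow>
    \<exists>D. (\<forall>x. (f has_derivative (\<lambda>v. D v x)) (at x)) \<and> (\<forall>b\<in>Basis. bracket_symbol (\<sigma> - 1) (D b))"
proof (induction rule: bracket_symbol.induct)
  case (jap \<sigma>)
  have "bracket_symbol (\<sigma> - 1) (\<lambda>x. \<sigma> * ((x \<bullet> b) * jap (\<sigma> - 2) x))" if "b \<in> Basis" for b :: 'a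
    using bracket_symbol.scale[OF bracket_symbol.coord[OF bracket_symbol.jap[of "\<sigma> - 2"] that]] by simp
  then show ?case using has_derivative_jap[of \<sigma>]
    by (intro exI[of _ "\<lambda>b x. \<sigma> * ((x \<bullet> b) * jap (\<sigma> - 2) x)"]) auto
next
  case (coord \<sigma> f b)
  then obtain D where D: "\<And>x. (f has_derivative (\<lambda>v. D v x)) (at x)"
    "\<And>b. b \<in> Basis \<Longrightarrow> bracket_symbol (\<sigma> - 1) (D b)" by blast
  have "((\<lambda>x. (x \<bullet> b) * f x) has_derivative (\<lambda>v. (v \<bullet> b) * f x + (x \<bullet> b) * D v x)) (at x)" for x
    using D(1)[of x] by (auto intro!: derivative_eq_intros simp: fun_eq_iff)
  moreover have "bracket_symbol (\<sigma> + 1 - 1) (\<lambda>x. (c \<bullet> b) * f x + (x \<bullet> b) * D c x)" if "c \<in> Basis" for c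
    using bracket_symbol.add[OF bracket_symbol.scale[OF coord(1)]
        bracket_symbol.coord[OF D(2)[OF that] coord(2), simplified], of "c \<bullet> b"] by simp
  ultimately show ?case
    by (intro exI[of _ "\<lambda>v x. (v \<bullet> b) * f x + (x \<bullet> b) * D v x"]) blast
next
  case (scale \<sigma> f c)
  then obtain D where D: "\<And>x. (f has_derivative (\<lambda>v. D v x)) (at x)"
    "\<And>b. b \<in> Basis \<Longrightarrow> bracket_symbol (\<sigma> - 1) (D b)" by blast
  have "((\<lambda>x. c * f x) has_derivative (\<lambda>v. c * D v x)) (at x)" for x
    by (rule has_derivative_mult_right[OF D(1)])
  with D(2) bracket_symbol.scale show ?case
    by (intro exI[of _ "\<lambda>v x. c * D v x"]) blast
next
  case (add \<sigma> f g)
  then obtain D E where D: "\<And>x. (f has_derivative (\<lambda>v. D v x)) (at x)"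
    "\<And>b. b \<in> Basis \<Longrightarrow> bracket_symbol (\<sigma> - 1) (D b)"
    and E: "\<And>x. (g has_derivative (\<lambda>v. E v x)) (at x)"
    "\<And>b. b \<in> Basis \<Longrightarrow> bracket_symbol (\<sigma> - 1) (E b)" by blast
  have "((\<lambda>x. f x + g x) has_derivative (\<lambda>v. D v x + E v x)) (at x)" for x
    by (rule has_derivative_add[OF D(1) E(1)])
  with D(2) E(2) bracket_symbol.add show ?case
    by (intro exI[of _ "\<lambda>v x. D v x + E v x"]) blast
qed

lemma bracket_symbol_partials:
  assumes f: "bracket_symbol \<sigma> f" and bs: "set bs \<subseteq> Basis"
  shows "bracket_symbol (\<sigma> - length bs) (partials bs f)"
  using bs
proof (induction bs)
  case (Cons b bs)
  then have IH: "bracket_symbol (\<sigma> - length bs) (partials bs f)" by auto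
  from bracket_symbol_deriv[OF this] obtain D where
    D: "\<And>x. (partials bs f has_derivative (\<lambda>v. D v x)) (at x)"
       "\<And>b. b \<in> Basis \<Longrightarrow> bracket_symbol (\<sigma> - length bs - 1) (D b)" by blast
  have "partials (b # bs) f = D b"
    using frechet_derivative_at[OF D(1), symmetric] by auto
  then show ?case using D(2)[of b] Cons.prems by (simp add: algebra_simps)
qed (use f in auto)

lemma smooth_bracket_symbol:
  assumes "bracket_symbol \<sigma> f" shows "smooth f"
  unfolding smooth_def
proof (intro allI impI)
  fix bs :: "'a list" and x assume "set bs \<subseteq> Basis"
  from bracket_symbol_deriv[OF bracket_symbol_partials[OF assms this]]
  show "partials bs f differentiable at x" unfolding differentiable_def by blast
qed

lemma bounded_partials_bracket_symbol:
  fixes f :: "'a::euclidean_space \<Rightarrow> real"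
  assumes f: "bracket_symbol \<sigma> f"
  shows "bounded_partials (\<lambda>c x. jap \<sigma> (x + c)) (\<lambda>c x. of_real (f (x + c)))"
  unfolding bounded_partials_def
proof (intro conjI allI impI)
  note sm = smooth_bracket_symbol[OF f]
  show "smooth (\<lambda>x. complex_of_real (f (x + c)))" for c
    by (intro smooth_bounded_linear[OF bounded_linear_of_real] smooth_translate sm)
  fix bs :: "'a list" assume bs: "set bs \<subseteq> Basis"
  obtain C where C: "C \<ge> 0" "\<And>x. \<bar>partials bs f x\<bar> \<le> C * jap (\<sigma> - length bs) x"
    using bracket_symbol_bound[OF bracket_symbol_partials[OF f bs]] by blast
  have "cmod (partials bs (\<lambda>x. complex_of_real (f (x + c))) x) \<le> C * jap \<sigma> (x + c)" for c x
  proof -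
    have "cmod (partials bs (\<lambda>x. complex_of_real (f (x + c))) x) = \<bar>partials bs f (x + c)\<bar>"
      by (simp add: partials_bounded_linear[OF bounded_linear_of_real smooth_translate[OF sm] bs]
          partials_translate[OF sm bs])
    also have "\<dots> \<le> C * jap (\<sigma> - length bs) (x + c)" by (rule C)
    also have "\<dots> \<le> C * jap \<sigma> (x + c)" using C(1) by (intro mult_left_mono jap_mono) auto
    finally show ?thesis .
  qed
  with C(1) show "\<exists>C\<ge>0. \<forall>i x. cmod (partials bs (\<lambda>x. complex_of_real (f (x + i))) x) \<le> C * jap \<sigma> (x + i)"
    by blast
qed

section \<open>Integrability of powers of the bracket\<close>

lemma nn_integral_bracket_1:
  fixes a :: real assumes a: "a > 1"
  shows "(\<integral>\<^sup>+u. ennreal ((1 + u\<^sup>2) powr (- a / 2)) \<partial>lborel) < \<infinity>"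
proof -
  have half: "(\<integral>\<^sup>+u. ennreal ((1 + u) powr - a) * indicator {0..} u \<partial>lborel) < \<infinity>"
  proof -
    have "(\<integral>\<^sup>+u. ennreal ((1 + u) powr - a) * indicator {0..} u \<partial>lborel)
        = ennreal (0 - (1 + 0) powr (1 - a) / (1 - a))"
    proof (rule nn_integral_FTC_atLeast)
      show "((\<lambda>u. (1 + u) powr (1 - a) / (1 - a)) has_real_derivative (1 + u) powr - a) (at u)" if "0 \<le> u" for u
        using that a by (auto intro!: derivative_eq_intros)
      have "((\<lambda>u::real. (1 + u) powr (1 - a)) \<longlongrightarrow> 0) at_top"
        using a by (intro tendsto_neg_powr filterlim_tendsto_add_at_top[OF tendsto_const]) (auto intro: filterlim_ident)
      then show "((\<lambda>u::real. (1 + u) powr (1 - a) / (1 - a)) \<longlongrightarrow> 0) at_top"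
        by (auto intro: tendsto_divide_zero)
    qed auto
    then show ?thesis by simp
  qed
  have bound: "ennreal ((1 + u\<^sup>2) powr (- a / 2))
      \<le> 2 powr (a / 2) * (ennreal ((1 + u) powr - a) * indicator {0..} u)
        + 2 powr (a / 2) * (ennreal ((1 - u) powr - a) * indicator {0..} (- u))" for u :: real
  proof -
    have "(1 + \<bar>u\<bar>)\<^sup>2 \<le> 2 * (1 + u\<^sup>2)"
      using zero_le_power2[of "1 - \<bar>u\<bar>"] by (simp add: power2_eq_square algebra_simps)
    then have "(2 * (1 + u\<^sup>2)) powr (- a / 2) \<le> ((1 + \<bar>u\<bar>)\<^sup>2) powr (- a / 2)"
      using a by (intro powr_mono2') auto
    also have "((1 + \<bar>u\<bar>)\<^sup>2) powr (- a / 2) = ((1 + \<bar>u\<bar>) powr 2) powr (- a / 2)"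
      by simp
    also have "\<dots> = (1 + \<bar>u\<bar>) powr - a"
      by (simp only: powr_powr) simp
    finally have "2 powr (- a / 2) * (1 + u\<^sup>2) powr (- a / 2) \<le> (1 + \<bar>u\<bar>) powr - a"
      by (simp add: powr_mult del: distrib_left_numeral)
    then have "2 powr (a / 2) * (2 powr (- a / 2) * (1 + u\<^sup>2) powr (- a / 2)) \<le> 2 powr (a / 2) * (1 + \<bar>u\<bar>) powr - a"
      by (intro mult_left_mono) auto
    then have "(1 + u\<^sup>2) powr (- a / 2) \<le> 2 powr (a / 2) * (1 + \<bar>u\<bar>) powr - a"
      by (simp flip: mult.assoc powr_add)
    then have "ennreal ((1 + u\<^sup>2) powr (- a / 2)) \<le> 2 powr (a / 2) * ennreal ((1 + \<bar>u\<bar>) powr - a)"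
      by (simp flip: ennreal_mult)
    then show ?thesis by (cases "u \<ge> 0") (auto intro: add_increasing add_increasing2)
  qed
  have neg: "(\<integral>\<^sup>+u. ennreal ((1 - u) powr - a) * indicator {0..} (- u) \<partial>lborel)
      = (\<integral>\<^sup>+u. ennreal ((1 + u) powr - a) * indicator {0..} u \<partial>lborel)"
    by (subst nn_integral_real_affine[where c="-1" and t=0]) auto
  have "(\<integral>\<^sup>+u. ennreal ((1 + u\<^sup>2) powr (- a / 2)) \<partial>lborel)
      \<le> (\<integral>\<^sup>+u. 2 powr (a / 2) * (ennreal ((1 + u) powr - a) * indicator {0..} u)
        + 2 powr (a / 2) * (ennreal ((1 - u) powr - a) * indicator {0..} (- u)) \<partial>lborel)"
    by (intro nn_integral_mono bound)
  also have "\<dots> < \<infinity>"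
    using half by (subst nn_integral_add) (auto simp: nn_integral_cmult neg ennreal_mult_less_top)
  finally show ?thesis .
qed

text \<open>In \<open>d\<close> dimensions, \<open>1 + |x|\<^sup>2\<close> dominates the geometric mean of the \<open>d\<close> numbers \<open>1 + (x \<bullet> b)\<^sup>2\<close>,
  which reduces the claim to one dimension.\<close>

lemma nn_integral_jap_finite:
  fixes r :: real
  assumes r: "r > DIM('a)"
  shows "(\<integral>\<^sup>+x. ennreal (jap (- r) (x::'a::euclidean_space)) \<partial>lborel) < \<infinity>"
proof -
  define a where "a = r / DIM('a)"
  have a: "a > 1" using r by (simp add: a_def)
  have "jap (- r) x \<le> (\<Prod>b\<in>Basis. (1 + (x \<bullet> b)\<^sup>2) powr (- a / 2))" for x :: 'a
  proof -
    have "(1 + (norm x)\<^sup>2) powr (- a / 2) \<le> (1 + (x \<bullet> b)\<^sup>2) powr (- a / 2)" if "b \<in> Basis" for b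
      using Basis_le_norm[OF that, of x] a
      by (intro powr_mono2') (auto simp: abs_le_square_iff[symmetric] intro: add_pos_nonneg)
    then have "(\<Prod>b\<in>(Basis::'a set). (1 + (norm x)\<^sup>2) powr (- a / 2)) \<le> (\<Prod>b\<in>Basis. (1 + (x \<bullet> b)\<^sup>2) powr (- a / 2))"
      by (intro prod_mono) auto
    moreover have "(\<Prod>b\<in>(Basis::'a set). (1 + (norm x)\<^sup>2) powr (- a / 2)) = jap (- r) x"
      using jap_power[of "- a" x "DIM('a)"] by (simp add: jap_def a_def)
    ultimately show ?thesis by simp
  qed
  then have "(\<integral>\<^sup>+x. ennreal (jap (- r) (x::'a)) \<partial>lborel)
      \<le> (\<integral>\<^sup>+x. (\<Prod>b\<in>(Basis::'a set). ennreal ((1 + (x \<bullet> b)\<^sup>2) powr (- a / 2))) \<partial>lborel)"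
    by (intro nn_integral_mono) (auto simp: prod_ennreal intro!: ennreal_leI)
  also have "\<dots> = (\<Prod>b\<in>(Basis::'a set). (\<integral>\<^sup>+u. ennreal ((1 + u\<^sup>2) powr (- a / 2)) \<partial>lborel))"
    by (subst nn_integral_lborel_prod) auto
  also have "\<dots> < \<infinity>"
    using nn_integral_bracket_1[OF a] by (auto simp: power_less_top_ennreal)
  finally show ?thesis .
qed

lemma integrable_jap:
  "r < - real DIM('a) \<Longrightarrow> integrable lborel (jap r :: 'a::euclidean_space \<Rightarrow> real)"
  using nn_integral_jap_finite[of "- r", where 'a='a]
  by (intro integrableI_nonneg) auto

lemma integrable_bound_jap:
  fixes f :: "'a::euclidean_space \<Rightarrow> 'b::{banach, second_countable_topology}"
  assumes "f \<in> borel_measurable borel" "\<And>x. norm (f x) \<le> C * jap r x" "r < - real DIM('a)"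
  shows "integrable lborel f"
  by (rule Bochner_Integration.integrable_bound[OF integrable_mult_right[OF integrable_jap[OF assms(3)], of C]])
     (use assms(1,2) in \<open>auto intro!: AE_I2 order_trans[OF _ abs_ge_self]\<close>)


section \<open>Schwartz functions\<close>

lemma schwartz_smooth: "\<phi> \<in> schwartz \<Longrightarrow> smooth \<phi>"
  unfolding schwartz_def by auto

lemma schwartz_measurable [measurable_dest]: "\<phi> \<in> schwartz \<Longrightarrow> \<phi> \<in> borel_measurable borel"
  by (intro smooth_borel_measurable schwartz_smooth)

lemma one_plus_norm_power_bounds:
  "jap (real N) x \<le> (1 + norm x) ^ N" "(1 + norm x) ^ N \<le> 2 ^ N * jap (real N) x"
proof -
  show "jap (real N) x \<le> (1 + norm x) ^ N"
    using power_mono[OF jap_one_le[of x], of N] by (simp add: jap_power)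
  show "(1 + norm x) ^ N \<le> 2 ^ N * jap (real N) x"
    using power_mono[OF one_plus_norm_le_jap[of x], of N] by (simp add: jap_power power_mult_distrib)
qed

text \<open>Brackets of all real orders form a multiplicative group of smooth weights, so that decay estimates
  reduce to adding exponents.\<close>

lemma schwartz_iff:
  "\<phi> \<in> schwartz \<longleftrightarrow> (\<forall>r. bounded_partials (\<lambda>_. jap r) (\<lambda>_::unit. \<phi>))"
proof
  assume \<phi>: "\<phi> \<in> schwartz"
  show "\<forall>r. bounded_partials (\<lambda>_. jap r) (\<lambda>_::unit. \<phi>)"
    unfolding bounded_partials_def
  proof (intro allI conjI impI)
    fix r :: real and bs :: "'a list" assume bs: "set bs \<subseteq> Basis"
    define N where "N = nat \<lceil>- r\<rceil>"
    have N: "- r \<le> real N" unfolding N_def by linarith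
    have "bdd_above (range (\<lambda>x. (1 + norm x) ^ N * cmod (partials bs \<phi> x)))"
      using \<phi> bs unfolding schwartz_def by auto
    then obtain C where C: "\<And>x. (1 + norm x) ^ N * cmod (partials bs \<phi> x) \<le> C"
      unfolding bdd_above_def by auto
    have "cmod (partials bs \<phi> x) \<le> C * jap r x" for x
    proof -
      have "jap (- r) x * cmod (partials bs \<phi> x) \<le> (1 + norm x) ^ N * cmod (partials bs \<phi> x)"
        using one_plus_norm_power_bounds(1)[of N x] jap_mono[OF N, of x] by (intro mult_right_mono) auto
      also note C
      finally have "jap (- r) x * cmod (partials bs \<phi> x) \<le> C" .
      then show ?thesis by (simp add: jap_minus field_simps)
    qed
    moreover have "C \<ge> 0" using order_trans[OF _ C[of 0]] by simp
    ultimately show "\<exists>C\<ge>0. \<forall>(i::unit) x. cmod (partials bs \<phi> x) \<le> C * jap r x" by blast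
  qed (use \<phi> schwartz_smooth in auto)
next
  assume R: "\<forall>r. bounded_partials (\<lambda>_. jap r) (\<lambda>_::unit. \<phi>)"
  then have sm: "smooth \<phi>" unfolding bounded_partials_def by auto
  have "bdd_above (range (\<lambda>x. (1 + norm x) ^ N * cmod (partials bs \<phi> x)))"
    if bs: "set bs \<subseteq> Basis" for N bs
  proof -
    obtain C where C: "C \<ge> 0" "\<And>x. cmod (partials bs \<phi> x) \<le> C * jap (- real N) x"
      using R bs unfolding bounded_partials_def by blast
    have "(1 + norm x) ^ N * cmod (partials bs \<phi> x) \<le> 2 ^ N * C" for x
    proof -
      have "(1 + norm x) ^ N * cmod (partials bs \<phi> x) \<le> (2 ^ N * jap (real N) x) * (C * jap (- real N) x)"
        using one_plus_norm_power_bounds(2) C by (intro mult_mono) auto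
      then show ?thesis by (simp add: jap_minus field_simps)
    qed
    then show ?thesis unfolding bdd_above_def by auto
  qed
  with sm show "\<phi> \<in> schwartz" unfolding schwartz_def by auto
qed

lemma schwartz_bound:
  assumes "\<phi> \<in> schwartz" "set bs \<subseteq> Basis"
  obtains C where "C \<ge> 0" "\<And>x. cmod (partials bs \<phi> x) \<le> C * jap r x"
  using assms unfolding schwartz_iff bounded_partials_def by blast

lemma schwartz_bound':
  assumes "\<phi> \<in> schwartz"
  obtains C where "C \<ge> 0" "\<And>x. cmod (\<phi> x) \<le> C * jap r x"
  using schwartz_bound[OF assms, of "[]"] by auto

lemma schwartz_partials: "\<phi> \<in> schwartz \<Longrightarrow> set bs \<subseteq> Basis \<Longrightarrow> partials bs \<phi> \<in> schwartz"
  unfolding schwartz_def using smooth_partials by (auto simp flip: partials_append)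

lemma schwartz_integrable:
  fixes \<phi> :: "'a::euclidean_space \<Rightarrow> complex"
  assumes "\<phi> \<in> schwartz" shows "integrable lborel \<phi>"
  by (rule schwartz_bound'[OF assms, of "- real DIM('a) - 1"], rule integrable_bound_jap)
     (auto intro: schwartz_measurable assms)

lemma schwartz_mult_bracket_symbol:
  assumes f: "bracket_symbol \<sigma> f" and \<phi>: "\<phi> \<in> schwartz"
  shows "(\<lambda>x. of_real (f x) * \<phi> x) \<in> schwartz"
  unfolding schwartz_iff
proof
  fix r
  have "bounded_partials (\<lambda>_::unit. jap \<sigma>) (\<lambda>_ x. of_real (f x))"
    using bounded_partials_bracket_symbol[OF f] unfolding bounded_partials_def
    by (metis (no_types, lifting) add.right_neutral ext)
  moreover have "bounded_partials (\<lambda>_::unit. jap (r - \<sigma>)) (\<lambda>_. \<phi>)"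
    using \<phi> unfolding schwartz_iff by blast
  ultimately have "bounded_partials (\<lambda>_::unit. \<lambda>x. jap \<sigma> x * jap (r - \<sigma>) x) (\<lambda>_ x. of_real (f x) * \<phi> x)"
    by (intro bounded_partials_mult) auto
  then show "bounded_partials (\<lambda>_::unit. jap r) (\<lambda>_ x. of_real (f x) * \<phi> x)"
    by (simp flip: jap_add)
qed

lemma schwartz_mult_jap: "\<phi> \<in> schwartz \<Longrightarrow> (\<lambda>x. of_real (jap \<sigma> x) * \<phi> x) \<in> schwartz"
  by (intro schwartz_mult_bracket_symbol[OF bracket_symbol.jap])

lemma schwartz_mult_coord:
  "\<phi> \<in> schwartz \<Longrightarrow> b \<in> Basis \<Longrightarrow> (\<lambda>x. of_real (x \<bullet> b) * \<phi> x) \<in> schwartz"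
  using schwartz_mult_bracket_symbol[OF bracket_symbol.coord[OF bracket_symbol.jap[of 0]]] by simp

lemma schwartz_scale:
  fixes c :: complex
  assumes \<phi>: "\<phi> \<in> schwartz"
  shows "(\<lambda>x. c * \<phi> x) \<in> schwartz"
  unfolding schwartz_def
proof (intro CollectI conjI allI impI)
  have bl: "bounded_linear (\<lambda>z. c * z)" by (rule bounded_linear_mult_right)
  show "smooth (\<lambda>x. c * \<phi> x)" by (intro smooth_bounded_linear[OF bl] schwartz_smooth \<phi>)
  fix N and bs :: "'a list" assume bs: "set bs \<subseteq> Basis"
  then obtain B where B: "\<And>x. (1 + norm x) ^ N * cmod (partials bs \<phi> x) \<le> B"
    using \<phi> unfolding schwartz_def bdd_above_def by fast
  have "(1 + norm x) ^ N * cmod (partials bs (\<lambda>x. c * \<phi> x) x) \<le> cmod c * B" for x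
    using mult_left_mono[OF B[of x], of "cmod c"]
    by (simp add: partials_bounded_linear[OF bl schwartz_smooth[OF \<phi>] bs] norm_mult mult_ac)
  then show "bdd_above (range (\<lambda>x. (1 + norm x) ^ N * cmod (partials bs (\<lambda>x. c * \<phi> x) x)))"
    unfolding bdd_above_def by auto
qed

lemma partials_eq_0_outside_supp:
  fixes f :: "'a::euclidean_space \<Rightarrow> 'b::real_normed_vector"
  assumes x: "x \<notin> supp f"
  shows "partials bs f x = 0"
  using x
proof (induction bs arbitrary: x)
  case Nil
  then show ?case using closure_subset[of "{x. f x \<noteq> 0}"] by (auto simp: supp_def)
next
  case (Cons b bs)
  have "open (- supp f)" by (simp add: supp_def open_Compl)
  then have "(partials bs f has_derivative (\<lambda>_. 0)) (at x)"
  proof (rule has_derivative_transform_within_open[OF has_derivative_const[of 0]])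
    show "x \<in> - supp f" using Cons.prems by simp
    show "0 = partials bs f y" if "y \<in> - supp f" for y
      using Cons.IH[of y] that by simp
  qed
  from frechet_derivative_at[OF this, symmetric] show ?case by simp
qed

lemma schwartz_of_compact_supp:
  fixes f :: "'a::euclidean_space \<Rightarrow> complex"
  assumes sm: "smooth f" and K: "compact (supp f)"
  shows "f \<in> schwartz"
  unfolding schwartz_def
proof (intro CollectI conjI allI impI sm)
  fix N and bs :: "'a list" assume bs: "set bs \<subseteq> Basis"
  let ?g = "\<lambda>x. (1 + norm x) ^ N * cmod (partials bs f x)"
  have c: "continuous_on (supp f) (partials bs f)"
    by (rule smooth_continuous_on[OF smooth_partials[OF sm bs]])
  have "bounded (?g ` supp f)"
    by (intro compact_imp_bounded compact_continuous_image[OF _ K] continuous_intros c)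
  then obtain B where B: "\<And>x. x \<in> supp f \<Longrightarrow> norm (?g x) \<le> B"
    unfolding bounded_iff by (metis imageI)
  have "?g x \<le> max B 0" for x
  proof (cases "x \<in> supp f")
    case True
    then show ?thesis using B[of x] by simp
  next
    case False
    then show ?thesis by (simp add: partials_eq_0_outside_supp)
  qed
  then show "bdd_above (range ?g)" by (rule bdd_aboveI2)
qed

section \<open>The Fourier transform of Schwartz functions\<close>

text \<open>Up to a constant, \<^const>\<open>fourier\<close> and \<^const>\<open>inv_fourier\<close> are the cases \<open>e = -1\<close> and
  \<open>e = 1\<close>.\<close>

definition ft :: "real \<Rightarrow> ('a::euclidean_space \<Rightarrow> complex) \<Rightarrow> 'a \<Rightarrow> complex" where
  "ft e f \<xi> = (LINT y|lborel. f y * cis (e * (\<xi> \<bullet> y)))"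

lemma fourier_eq_ft: "fourier f = ft (-1) f"
  by (simp add: fourier_def ft_def fun_eq_iff)

lemma inv_fourier_eq_ft: "inv_fourier f = (\<lambda>x. of_real (1 / (2 * pi) ^ DIM('a)) * ft 1 f x)"
  for f :: "'a::euclidean_space \<Rightarrow> complex"
  by (simp add: inv_fourier_def ft_def fun_eq_iff)

lemma cis_measurable [measurable]: "cis \<in> borel_measurable borel"
  by (intro borel_measurable_continuous_onI continuous_intros)

lemma integrable_mult_cis:
  fixes f :: "'a::euclidean_space \<Rightarrow> complex"
  assumes "integrable lborel f"
  shows "integrable lborel (\<lambda>y. f y * cis (e * (\<xi> \<bullet> y)))"
  using borel_measurable_integrable[OF assms]
  by (intro Bochner_Integration.integrable_bound[OF assms]) (auto simp: norm_mult)

lemma norm_ft_le: "cmod (ft e f \<xi>) \<le> (LINT y|lborel. cmod (f y))"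
  unfolding ft_def by (rule order_trans[OF integral_norm_bound]) (simp add: norm_mult)

lemma ft_add:
  assumes "integrable lborel f" "integrable lborel g"
  shows "ft e (\<lambda>y. f y + g y) \<xi> = ft e f \<xi> + ft e g \<xi>"
  unfolding ft_def distrib_right by (intro Bochner_Integration.integral_add integrable_mult_cis assms)

lemma ft_scale: "ft e (\<lambda>y. c * f y) \<xi> = c * ft e f \<xi>"
  unfolding ft_def mult.assoc by (rule integral_mult_right_zero)

lemma cis_approx: "cmod (cis (a + d) - cis a - \<i> * d * cis a) \<le> d\<^sup>2"
proof -
  have "cmod (cis d - (1 + \<i> * d)) \<le> d\<^sup>2 / 2"
    using iexp_approx1[of d 1] by (simp add: cis_conv_exp power2_eq_square numeral_2_eq_2)
  moreover have "cis (a + d) - cis a - \<i> * d * cis a = cis a * (cis d - (1 + \<i> * d))"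
    by (simp add: cis_mult[symmetric] algebra_simps)
  moreover have "d\<^sup>2 / 2 \<le> d\<^sup>2" by simp
  ultimately show ?thesis by (simp only: norm_mult norm_cis mult_1_left)
qed

lemma has_derivative_quadratic:
  assumes D: "bounded_linear D" and q: "\<And>h. norm (f (x + h) - f x - D h) \<le> C * (norm h)\<^sup>2"
  shows "(f has_derivative D) (at x)"
proof (rule has_derivativeI_sandwich[where e=1 and H="\<lambda>y. C * norm (y - x)"])
  have "((\<lambda>y. C * norm (y - x)) \<longlongrightarrow> C * norm (x - x)) (at x)" by (intro tendsto_intros)
  then show "((\<lambda>y. C * norm (y - x)) \<longlongrightarrow> 0) (at x)" by simp
  show "norm (f y - f x - D (y - x)) / norm (y - x) \<le> C * norm (y - x)" if "y \<noteq> x" for y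
    using q[of "y - x"] that by (simp add: field_simps power2_eq_square)
qed (use D in auto)

text \<open>Differentiation under the integral sign. The second-order Taylor bound for \<^const>\<open>cis\<close> gives an
  explicit remainder, quadratic in the increment and integrable because \<open>\<phi>\<close> has second moments.\<close>

lemma ft_has_derivative:
  fixes \<phi> :: "'a::euclidean_space \<Rightarrow> complex"
  assumes \<phi>: "\<phi> \<in> schwartz"
  shows "(ft e \<phi> has_derivative
     (\<lambda>h. LINT y|lborel. \<phi> y * (\<i> * (e * (h \<bullet> y))) * cis (e * (\<xi> \<bullet> y)))) (at \<xi>)"
proof -
  note [measurable] = schwartz_measurable[OF \<phi>]
  have I: "integrable lborel (\<lambda>y. (norm y) ^ k * cmod (\<phi> y))" for k
  proof -
    obtain C where C: "C \<ge> 0" "\<And>x. cmod (\<phi> x) \<le> C * jap (- real DIM('a) - 1 - real k) x"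
      using schwartz_bound'[OF \<phi>] by blast
    show ?thesis
    proof (rule integrable_bound_jap[where C=C and r="- real DIM('a) - 1"])
      fix x
      have "(norm x) ^ k * cmod (\<phi> x) \<le> jap (real k) x * (C * jap (- real DIM('a) - 1 - real k) x)"
        using C power_mono[OF norm_le_jap[of x], of k] by (intro mult_mono) (auto simp: jap_power)
      also have "\<dots> = C * (jap (real k) x * jap (- real DIM('a) - 1 - real k) x)" by simp
      also have "\<dots> = C * jap (- real DIM('a) - 1) x" by (simp flip: jap_add)
      finally show "norm ((norm x) ^ k * cmod (\<phi> x)) \<le> C * jap (- real DIM('a) - 1) x" by simp
    qed auto
  qed
  define D where "D h = (LINT y|lborel. \<phi> y * (\<i> * (e * (h \<bullet> y))) * cis (e * (\<xi> \<bullet> y)))" for h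
  have int: "integrable lborel (\<lambda>y. \<phi> y * (\<i> * (e * (h \<bullet> y))) * cis (e * (\<xi> \<bullet> y)))" for h
  proof (rule Bochner_Integration.integrable_bound[OF integrable_mult_right[OF I[of 1], of "\<bar>e\<bar> * norm h"]])
    have "cmod (\<phi> y) * (\<bar>e\<bar> * \<bar>h \<bullet> y\<bar>) \<le> \<bar>e\<bar> * norm h * (norm y * cmod (\<phi> y))" for y
      using mult_left_mono[OF Cauchy_Schwarz_ineq2[of h y], of "\<bar>e\<bar> * cmod (\<phi> y)"] by (simp add: mult_ac)
    then show "AE y in lborel. norm (\<phi> y * (\<i> * (e * (h \<bullet> y))) * cis (e * (\<xi> \<bullet> y)))
        \<le> norm (\<bar>e\<bar> * norm h * (norm y ^ 1 * cmod (\<phi> y)))"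
      by (intro AE_I2) (simp add: norm_mult abs_mult mult_ac)
  qed measurable
  have "bounded_linear D"
  proof (rule bounded_linear_intro)
    show "D (g + h) = D g + D h" for g h
      unfolding D_def using int[of g] int[of h]
      by (subst Bochner_Integration.integral_add[symmetric]) (auto simp: algebra_simps inner_add_left)
    show "D (r *\<^sub>R h) = r *\<^sub>R D h" for r h
      unfolding D_def by (subst integral_scaleR_right[symmetric]) (auto simp: scaleR_conv_of_real algebra_simps)
    show "norm (D h) \<le> norm h * (\<bar>e\<bar> * (LINT y|lborel. norm y * cmod (\<phi> y)))" for h
    proof -
      have "norm (D h) \<le> (LINT y|lborel. norm (\<phi> y * (\<i> * (e * (h \<bullet> y))) * cis (e * (\<xi> \<bullet> y))))"
        unfolding D_def by (rule integral_norm_bound)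
      also have "\<dots> \<le> (LINT y|lborel. \<bar>e\<bar> * norm h * (norm y * cmod (\<phi> y)))"
      proof (rule integral_mono)
        show "norm (\<phi> y * (\<i> * (e * (h \<bullet> y))) * cis (e * (\<xi> \<bullet> y))) \<le> \<bar>e\<bar> * norm h * (norm y * cmod (\<phi> y))" for y
          using mult_left_mono[OF Cauchy_Schwarz_ineq2[of h y], of "\<bar>e\<bar> * cmod (\<phi> y)"]
          by (simp add: norm_mult abs_mult mult_ac)
      qed (use int I[of 1] in auto)
      also have "\<dots> = norm h * (\<bar>e\<bar> * (LINT y|lborel. norm y * cmod (\<phi> y)))"
        by (subst integral_mult_right_zero) simp
      finally show ?thesis .
    qed
  qed
  moreover have "norm (ft e \<phi> (\<xi> + h) - ft e \<phi> \<xi> - D h) \<le> (e\<^sup>2 * (LINT y|lborel. (norm y)\<^sup>2 * cmod (\<phi> y))) * (norm h)\<^sup>2" for h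
  proof -
    have i: "integrable lborel (\<lambda>y. \<phi> y * cis (e * (\<zeta> \<bullet> y)))" for \<zeta>
      by (rule integrable_mult_cis[OF schwartz_integrable[OF \<phi>]])
    define R where "R y = \<phi> y * cis (e * ((\<xi> + h) \<bullet> y)) - \<phi> y * cis (e * (\<xi> \<bullet> y))
        - \<phi> y * (\<i> * (e * (h \<bullet> y))) * cis (e * (\<xi> \<bullet> y))" for y
    have iR: "integrable lborel R"
      unfolding R_def by (intro Bochner_Integration.integrable_diff i int)
    have eq: "ft e \<phi> (\<xi> + h) - ft e \<phi> \<xi> - D h = (LINT y|lborel. R y)"
      unfolding ft_def D_def R_def
      by (simp only: Bochner_Integration.integral_diff[OF Bochner_Integration.integrable_diff[OF i i] int]
          Bochner_Integration.integral_diff[OF i i])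
    have R: "norm (R y) \<le> (e\<^sup>2 * (norm h)\<^sup>2) * ((norm y)\<^sup>2 * cmod (\<phi> y))" for y
    proof -
      have "R y = \<phi> y * (cis (e * (\<xi> \<bullet> y) + e * (h \<bullet> y)) - cis (e * (\<xi> \<bullet> y))
          - \<i> * complex_of_real (e * (h \<bullet> y)) * cis (e * (\<xi> \<bullet> y)))"
        by (simp add: R_def inner_add_left algebra_simps)
      then have "norm (R y) \<le> cmod (\<phi> y) * (e * (h \<bullet> y))\<^sup>2"
        using mult_left_mono[OF cis_approx[of "e * (\<xi> \<bullet> y)" "e * (h \<bullet> y)"], of "cmod (\<phi> y)"] by (simp add: norm_mult)
      moreover have "(h \<bullet> y)\<^sup>2 \<le> (norm h * norm y)\<^sup>2"
        using power_mono[OF Cauchy_Schwarz_ineq2[of h y], of 2] by simp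
      then have "cmod (\<phi> y) * (e * (h \<bullet> y))\<^sup>2 \<le> cmod (\<phi> y) * (e\<^sup>2 * (norm h * norm y)\<^sup>2)"
        unfolding power_mult_distrib[of e] by (intro mult_left_mono) auto
      ultimately show ?thesis by (simp add: power_mult_distrib mult_ac)
    qed
    have "norm (LINT y|lborel. R y) \<le> (LINT y|lborel. norm (R y))"
      by (rule integral_norm_bound)
    also have "\<dots> \<le> (LINT y|lborel. (e\<^sup>2 * (norm h)\<^sup>2) * ((norm y)\<^sup>2 * cmod (\<phi> y)))"
      using iR I[of 2] R by (intro integral_mono) auto
    also have "\<dots> = (e\<^sup>2 * (LINT y|lborel. (norm y)\<^sup>2 * cmod (\<phi> y))) * (norm h)\<^sup>2"
      by (subst integral_mult_right_zero) simp
    finally show ?thesis unfolding eq .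
  qed
  ultimately show ?thesis unfolding D_def by (rule has_derivative_quadratic)
qed

lemma partials_ft:
  fixes \<phi> :: "'a::euclidean_space \<Rightarrow> complex"
  assumes "\<phi> \<in> schwartz" "set bs \<subseteq> Basis"
  shows "\<exists>\<psi>\<in>schwartz. partials bs (ft e \<phi>) = ft e \<psi>"
  using assms(2)
proof (induction bs)
  case (Cons b bs)
  then obtain \<psi> where \<psi>: "\<psi> \<in> schwartz" "partials bs (ft e \<phi>) = ft e \<psi>" by auto
  have "partials (b # bs) (ft e \<phi>) = ft e (\<lambda>y. (\<i> * e) * (of_real (y \<bullet> b) * \<psi> y))"
  proof
    fix \<xi>
    have "partials (b # bs) (ft e \<phi>) \<xi> = (LINT y|lborel. \<psi> y * (\<i> * (e * (b \<bullet> y))) * cis (e * (\<xi> \<bullet> y)))"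
      using frechet_derivative_at[OF ft_has_derivative[OF \<psi>(1), of e \<xi>], symmetric] \<psi>(2) by simp
    then show "partials (b # bs) (ft e \<phi>) \<xi> = ft e (\<lambda>y. (\<i> * e) * (of_real (y \<bullet> b) * \<psi> y)) \<xi>"
      by (simp add: ft_def inner_commute mult_ac)
  qed
  moreover have "(\<lambda>y. (\<i> * e) * (of_real (y \<bullet> b) * \<psi> y)) \<in> schwartz"
    using Cons.prems \<psi>(1) by (intro schwartz_scale schwartz_mult_coord) auto
  ultimately show ?case by blast
qed (use assms in auto)

lemma smooth_ft:
  assumes "\<phi> \<in> schwartz" shows "smooth (ft e \<phi>)"
  unfolding smooth_def
proof (intro allI impI)
  fix bs :: "'a list" and x assume "set bs \<subseteq> Basis"
  then obtain \<psi> where "\<psi> \<in> schwartz" "partials bs (ft e \<phi>) = ft e \<psi>"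
    using partials_ft[OF assms] by blast
  with differentiableI[OF ft_has_derivative[of \<psi> e x]]
  show "partials bs (ft e \<phi>) differentiable at x" by simp
qed

text \<open>By translation invariance the integrals of the difference quotients vanish. The decay of the derivative
  dominates the quotients, so that their limit integrates to zero as well.\<close>

lemma integral_partial_eq_0:
  fixes G :: "'a::euclidean_space \<Rightarrow> complex"
  assumes G: "\<And>x. (G has_derivative G' x) (at x)" and intG: "integrable lborel G"
    and bnd: "\<And>x. cmod (G' x b) \<le> C * jap r x" and r: "r < - real DIM('a)" and b: "norm b \<le> 1"
  shows "(LINT x|lborel. G' x b) = 0"
proof -
  define h where "h k = inverse (real (Suc k))" for k
  have h: "0 < h k" "h k \<le> 1" for k by (auto simp: h_def field_simps)
  have h0: "h \<longlonglongrightarrow> 0" unfolding h_def by (rule LIMSEQ_inverse_real_of_nat)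
  have C: "C \<ge> 0" using bnd[of 0] jap_pos[of r "0::'a"] by (smt (verit) norm_ge_zero zero_le_mult_iff)
  define Q where "Q k x = (G (x + h k *\<^sub>R b) - G x) /\<^sub>R h k" for k x
  have contG: "continuous_on UNIV G"
    by (intro continuous_at_imp_continuous_on ballI has_derivative_continuous[OF G])
  then have [measurable]: "G \<in> borel_measurable borel" by (rule borel_measurable_continuous_onI)
  have line: "((\<lambda>t. G (x + t *\<^sub>R b)) has_derivative (\<lambda>s. s *\<^sub>R G' (x + t *\<^sub>R b) b)) (at t)" for x t
  proof -
    have "((\<lambda>t. G (x + t *\<^sub>R b)) has_derivative (\<lambda>s. G' (x + t *\<^sub>R b) (s *\<^sub>R b))) (at t)"
      by (rule has_derivative_compose[OF _ G]) (auto intro!: derivative_eq_intros)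
    then show ?thesis
      by (simp add: linear_cmul[OF has_derivative_linear[OF G]])
  qed
  have lim: "(\<lambda>k. Q k x) \<longlonglongrightarrow> G' x b" for x
  proof -
    have "((\<lambda>t. norm (G (x + t *\<^sub>R b) - G x - t *\<^sub>R G' x b) / norm t) \<longlongrightarrow> 0) (at 0)"
      using line[of x 0] unfolding has_derivative_at by simp
    moreover have "filterlim h (at 0) sequentially"
      using h0 h(1) by (auto simp: filterlim_at less_imp_neq[symmetric])
    ultimately have "((\<lambda>k. norm (G (x + h k *\<^sub>R b) - G x - h k *\<^sub>R G' x b) / norm (h k)) \<longlonglongrightarrow> 0)"
      by (rule filterlim_compose)
    moreover have "norm (G (x + h k *\<^sub>R b) - G x - h k *\<^sub>R G' x b) / norm (h k) = norm (Q k x - G' x b)" for k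
    proof -
      have "Q k x - G' x b = (G (x + h k *\<^sub>R b) - G x - h k *\<^sub>R G' x b) /\<^sub>R h k"
        using h(1)[of k] by (simp add: Q_def scaleR_diff_right)
      then show ?thesis by (simp add: divide_inverse)
    qed
    ultimately have "(\<lambda>k. norm (Q k x - G' x b)) \<longlonglongrightarrow> 0" by simp
    then show ?thesis by (simp add: tendsto_norm_zero_iff LIM_zero_iff)
  qed
  define K where "K = 2 powr (\<bar>r\<bar> / 2) * 2 powr (\<bar>r\<bar> / 2)"
  have Qb: "cmod (Q k x) \<le> C * K * jap r x" for k x
  proof -
    have "continuous_on {0..h k} (\<lambda>t. G (x + t *\<^sub>R b))"
      using has_derivative_continuous[OF line[of x]] by (auto intro!: continuous_at_imp_continuous_on)
    then obtain t where t: "0 < t" "t < h k"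
      and *: "cmod (G (x + h k *\<^sub>R b) - G (x + 0 *\<^sub>R b)) \<le> cmod ((h k - 0) *\<^sub>R G' (x + t *\<^sub>R b) b)"
      using mvt_general[OF h(1)[of k], of "\<lambda>t. G (x + t *\<^sub>R b)" "\<lambda>t s. s *\<^sub>R G' (x + t *\<^sub>R b) b"]
        line[of x] by auto
    have "cmod (Q k x) = cmod (G (x + h k *\<^sub>R b) - G x) / h k"
      using h(1)[of k] by (simp add: Q_def divide_inverse mult.commute)
    also have "\<dots> \<le> cmod (G' (x + t *\<^sub>R b) b)"
      using h(1)[of k] * by (simp add: divide_le_eq mult.commute)
    also have "\<dots> \<le> C * jap r (x + t *\<^sub>R b)" by (rule bnd)
    finally have 1: "cmod (Q k x) \<le> C * jap r (x + t *\<^sub>R b)" .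
    have 2: "jap r (x + t *\<^sub>R b) \<le> 2 powr (\<bar>r\<bar> / 2) * jap r x * jap \<bar>r\<bar> (t *\<^sub>R b)"
      using peetre_inequality[of r "t *\<^sub>R b" x] by (simp add: add.commute)
    have 3: "jap \<bar>r\<bar> (t *\<^sub>R b) \<le> 2 powr (\<bar>r\<bar> / 2)"
    proof -
      have "norm (t *\<^sub>R b) \<le> 1" using t h(2)[of k] b by (simp add: mult_le_one)
      then have "(norm (t *\<^sub>R b))\<^sup>2 \<le> 1" by (simp add: power_le_one)
      then show ?thesis unfolding jap_def by (intro powr_mono2) auto
    qed
    have "jap r (x + t *\<^sub>R b) \<le> 2 powr (\<bar>r\<bar> / 2) * jap r x * 2 powr (\<bar>r\<bar> / 2)"
      by (rule order_trans[OF 2 mult_left_mono[OF 3]]) simp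
    from order_trans[OF 1 mult_left_mono[OF this C]] show ?thesis by (simp add: K_def mult_ac)
  qed
  have "(\<lambda>k. LINT x|lborel. Q k x) \<longlonglongrightarrow> (LINT x|lborel. G' x b)"
  proof (rule integral_dominated_convergence[where w="\<lambda>x. C * K * jap r x"])
    show m: "(\<lambda>x. Q k x) \<in> borel_measurable lborel" for k unfolding Q_def by measurable
    show "(\<lambda>x. G' x b) \<in> borel_measurable lborel"
      by (rule borel_measurable_LIMSEQ_metric[OF m lim])
    show "integrable lborel (\<lambda>x::'a. C * K * jap r x)"
      using r by (intro integrable_mult_right integrable_jap)
  qed (use lim Qb in auto)
  moreover have "(LINT x|lborel. Q k x) = 0" for k
  proof -
    have "(LINT x|lborel. G (h k *\<^sub>R b + x)) = (LINT x|lborel. G x)"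
      by (subst (2) lborel_distr_plus[of "h k *\<^sub>R b", symmetric]) (simp add: integral_distr)
    moreover have "integrable lborel (\<lambda>x. G (h k *\<^sub>R b + x))"
      using intG by (subst (asm) lborel_distr_plus[of "h k *\<^sub>R b", symmetric]) (simp add: integrable_distr_eq)
    ultimately show ?thesis unfolding Q_def using intG
      by (simp add: add.commute)
  qed
  ultimately show ?thesis by (simp add: LIMSEQ_const_iff)
qed

lemma ft_partial:
  fixes \<phi> :: "'a::euclidean_space \<Rightarrow> complex"
  assumes \<phi>: "\<phi> \<in> schwartz" and b: "b \<in> Basis"
  shows "ft e (partials [b] \<phi>) \<xi> = - (\<i> * e * (\<xi> \<bullet> b)) * ft e \<phi> \<xi>"
proof -
  let ?c = "\<lambda>y. cis (e * (\<xi> \<bullet> y))"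
  define G' where "G' x h = \<phi> x * (\<i> * (e * (\<xi> \<bullet> h)) * ?c x) + frechet_derivative \<phi> (at x) h * ?c x" for x h
  have dc: "(?c has_derivative (\<lambda>h. \<i> * (e * (\<xi> \<bullet> h)) * ?c x)) (at x)" for x
  proof -
    have "((\<lambda>y. \<i> * complex_of_real (e * (\<xi> \<bullet> y))) has_derivative (\<lambda>h. \<i> * complex_of_real (e * (\<xi> \<bullet> h)))) (at x)"
      by (auto intro!: derivative_eq_intros)
    from has_derivative_compose[OF this DERIV_exp[unfolded has_field_derivative_def]]
    show ?thesis by (simp add: cis_conv_exp mult_ac)
  qed
  have G: "((\<lambda>x. \<phi> x * ?c x) has_derivative G' x) (at x)" for x
    unfolding G'_def by (intro has_derivative_mult smooth_has_derivative schwartz_smooth \<phi> dc)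
  obtain C D where C: "C \<ge> 0" "\<And>x. cmod (partials [] \<phi> x) \<le> C * jap (- real DIM('a) - 1) x"
    and D: "D \<ge> 0" "\<And>x. cmod (partials [b] \<phi> x) \<le> D * jap (- real DIM('a) - 1) x"
    using schwartz_bound[OF \<phi>, of "[]" "- real DIM('a) - 1"] schwartz_bound[OF \<phi>, of "[b]" "- real DIM('a) - 1"] b
    by (metis empty_set empty_subsetI insert_subset list.simps(15))
  have bnd: "cmod (G' x b) \<le> (C * \<bar>e * (\<xi> \<bullet> b)\<bar> + D) * jap (- real DIM('a) - 1) x" for x
  proof -
    have "cmod (G' x b) \<le> cmod (\<phi> x) * \<bar>e * (\<xi> \<bullet> b)\<bar> + cmod (partials [b] \<phi> x)"
      unfolding G'_def by (rule order_trans[OF norm_triangle_ineq]) (simp add: norm_mult abs_mult)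
    also have "\<dots> \<le> (C * jap (- real DIM('a) - 1) x) * \<bar>e * (\<xi> \<bullet> b)\<bar> + D * jap (- real DIM('a) - 1) x"
      using C(2)[of x] D(2)[of x] by (intro add_mono mult_right_mono) auto
    finally show ?thesis by (simp add: algebra_simps)
  qed
  have "0 = (LINT x|lborel. G' x b)"
    by (rule integral_partial_eq_0[OF G integrable_mult_cis[OF schwartz_integrable[OF \<phi>]] bnd, symmetric])
       (use b in auto)
  also have "\<dots> = ft e (\<lambda>y. (\<i> * e * (\<xi> \<bullet> b)) * \<phi> y + partials [b] \<phi> y) \<xi>"
    unfolding ft_def G'_def by (intro Bochner_Integration.integral_cong) (auto simp: algebra_simps)
  also have "\<dots> = (\<i> * e * (\<xi> \<bullet> b)) * ft e \<phi> \<xi> + ft e (partials [b] \<phi>) \<xi>"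
    using b by (subst ft_add)
      (auto simp del: partials.simps simp: ft_scale intro!: schwartz_integrable schwartz_scale \<phi> schwartz_partials)
  finally show ?thesis by (simp add: algebra_simps add_eq_0_iff)
qed

lemma ft_partials_replicate:
  fixes \<phi> :: "'a::euclidean_space \<Rightarrow> complex"
  assumes \<phi>: "\<phi> \<in> schwartz" and b: "b \<in> Basis"
  shows "ft e (partials (replicate N b) \<phi>) \<xi> = (- (\<i> * e * (\<xi> \<bullet> b))) ^ N * ft e \<phi> \<xi>"
proof (induction N)
  case (Suc N)
  have "partials (replicate N b) \<phi> \<in> schwartz" using b by (intro schwartz_partials \<phi>) auto
  from ft_partial[OF this b, of e \<xi>] Suc show ?case by (simp add: mult_ac)
qed auto

text \<open>Integration by parts \<open>N\<close> times in the direction of the largest coordinate of \<open>\<xi>\<close>. The bound depends only on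
  \<open>L\<^sup>1\<close>-norms of derivatives; it is therefore uniform over families of functions and continuous for the Schwartz
  topology.\<close>

lemma ft_decay:
  fixes \<phi> :: "'a::euclidean_space \<Rightarrow> complex"
  assumes \<phi>: "\<phi> \<in> schwartz" and e: "\<bar>e\<bar> = 1"
  shows "jap (real N) \<xi> * cmod (ft e \<phi> \<xi>) \<le> (1 + real DIM('a)) ^ N *
    ((LINT y|lborel. cmod (\<phi> y)) + (\<Sum>b\<in>Basis. LINT y|lborel. cmod (partials (replicate N b) \<phi> y)))"
proof -
  define m where "m = Max ((\<lambda>b. \<bar>\<xi> \<bullet> b\<bar>) ` Basis)"
  have "m \<in> (\<lambda>b. \<bar>\<xi> \<bullet> b\<bar>) ` Basis" unfolding m_def by (intro Max_in) auto
  then obtain b0 where b0: "b0 \<in> Basis" "m = \<bar>\<xi> \<bullet> b0\<bar>" by auto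
  have mle: "\<bar>\<xi> \<bullet> b\<bar> \<le> m" if "b \<in> Basis" for b using that unfolding m_def by (intro Max_ge) auto
  have m0: "0 \<le> m" using b0 by simp
  have "norm \<xi> \<le> (\<Sum>b\<in>Basis. \<bar>\<xi> \<bullet> b\<bar>)" by (rule norm_le_l1)
  also have "\<dots> \<le> (\<Sum>b\<in>(Basis::'a set). m)" using mle by (intro sum_mono) auto
  finally have "norm \<xi> \<le> real DIM('a) * m" by simp
  also have "\<dots> \<le> real DIM('a) * max 1 m" by (intro mult_left_mono) auto
  finally have "jap 1 \<xi> \<le> (1 + real DIM('a)) * max 1 m"
    using jap_one_le[of \<xi>] by (simp add: distrib_right)
  from power_mono[OF this, of N] have "jap (real N) \<xi> \<le> (1 + real DIM('a)) ^ N * max 1 m ^ N"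
    by (simp add: jap_power power_mult_distrib)
  also have "max 1 m ^ N \<le> 1 + m ^ N" using m0 by (cases "m \<le> 1") (auto simp: max_def)
  also have "m ^ N \<le> (\<Sum>b\<in>Basis. \<bar>\<xi> \<bullet> b\<bar> ^ N)"
    unfolding b0(2) using b0(1) by (intro member_le_sum) auto
  finally have *: "jap (real N) \<xi> \<le> (1 + real DIM('a)) ^ N * (1 + (\<Sum>b\<in>Basis. \<bar>\<xi> \<bullet> b\<bar> ^ N))"
    by (simp add: mult_left_mono)
  have p: "\<bar>\<xi> \<bullet> b\<bar> ^ N * cmod (ft e \<phi> \<xi>) \<le> (LINT y|lborel. cmod (partials (replicate N b) \<phi> y))" if "b \<in> Basis" for b
    using norm_ft_le[of e "partials (replicate N b) \<phi>" \<xi>] e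
    by (simp add: ft_partials_replicate[OF \<phi> that] norm_mult norm_power power_mult_distrib)
  have "jap (real N) \<xi> * cmod (ft e \<phi> \<xi>) \<le> (1 + real DIM('a)) ^ N * (1 + (\<Sum>b\<in>Basis. \<bar>\<xi> \<bullet> b\<bar> ^ N)) * cmod (ft e \<phi> \<xi>)"
    using * by (intro mult_right_mono) auto
  also have "\<dots> = (1 + real DIM('a)) ^ N * (cmod (ft e \<phi> \<xi>) + (\<Sum>b\<in>Basis. \<bar>\<xi> \<bullet> b\<bar> ^ N * cmod (ft e \<phi> \<xi>)))"
    by (simp add: algebra_simps sum_distrib_left)
  also have "\<dots> \<le> (1 + real DIM('a)) ^ N *
    ((LINT y|lborel. cmod (\<phi> y)) + (\<Sum>b\<in>Basis. LINT y|lborel. cmod (partials (replicate N b) \<phi> y)))"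
    by (intro mult_left_mono add_mono norm_ft_le sum_mono p) auto
  finally show ?thesis .
qed

lemma ft_schwartz:
  fixes \<phi> :: "'a::euclidean_space \<Rightarrow> complex"
  assumes \<phi>: "\<phi> \<in> schwartz" and e: "\<bar>e\<bar> = 1"
  shows "ft e \<phi> \<in> schwartz"
  unfolding schwartz_iff bounded_partials_def
proof (intro allI conjI impI smooth_ft \<phi>)
  fix r :: real and bs :: "'a list" assume bs: "set bs \<subseteq> Basis"
  define N where "N = nat \<lceil>- r\<rceil>"
  have N: "- r \<le> real N" unfolding N_def by linarith
  obtain \<psi> where \<psi>: "\<psi> \<in> schwartz" "partials bs (ft e \<phi>) = ft e \<psi>"
    using partials_ft[OF \<phi> bs] by blast
  define C where "C = (1 + real DIM('a)) ^ N *
    ((LINT y|lborel. cmod (\<psi> y)) + (\<Sum>b\<in>Basis. LINT y|lborel. cmod (partials (replicate N b) \<psi> y)))"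
  have "C \<ge> 0" unfolding C_def by (intro mult_nonneg_nonneg add_nonneg_nonneg sum_nonneg integral_nonneg) auto
  moreover have "cmod (ft e \<psi> \<xi>) \<le> C * jap r \<xi>" for \<xi>
  proof -
    have "jap (- r) \<xi> * cmod (ft e \<psi> \<xi>) \<le> jap (real N) \<xi> * cmod (ft e \<psi> \<xi>)"
      by (intro mult_right_mono jap_mono N) auto
    also have "\<dots> \<le> C" unfolding C_def by (rule ft_decay[OF \<psi>(1) e])
    finally show ?thesis by (simp add: jap_minus field_simps)
  qed
  ultimately show "\<exists>C\<ge>0. \<forall>(i::unit) x. cmod (partials bs (ft e \<phi>) x) \<le> C * jap r x"
    unfolding \<psi>(2) by blast
qed

lemma fourier_schwartz: "\<phi> \<in> schwartz \<Longrightarrow> fourier \<phi> \<in> schwartz"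
  unfolding fourier_eq_ft by (rule ft_schwartz) auto

lemma inv_fourier_schwartz: "\<phi> \<in> schwartz \<Longrightarrow> inv_fourier \<phi> \<in> schwartz"
  unfolding inv_fourier_eq_ft by (intro schwartz_scale ft_schwartz) auto

section \<open>Gaussian regularisation: Fourier inversion and Bessel's inequality\<close>

lemma lborel_fubini:
  fixes K :: "'a::euclidean_space \<Rightarrow> 'b::euclidean_space \<Rightarrow> complex"
  assumes K: "(\<lambda>(x, y). K x y) \<in> borel_measurable (lborel \<Otimes>\<^sub>M lborel)"
    and g: "integrable lborel g" and h: "integrable lborel h"
    and bound: "\<And>x y. cmod (K x y) \<le> g x * h y"
  shows "(LINT x|lborel. LINT y|lborel. K x y) = (LINT y|lborel. LINT x|lborel. K x y)"
    and "integrable lborel (\<lambda>x. LINT y|lborel. K x y)"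
proof -
  have [measurable]: "g \<in> borel_measurable borel" "h \<in> borel_measurable borel"
    using borel_measurable_integrable[OF g] borel_measurable_integrable[OF h] by auto
  have bound': "ennreal (cmod (K x y)) \<le> ennreal \<bar>g x\<bar> * ennreal \<bar>h y\<bar>" for x y
    using order_trans[OF bound abs_ge_self, of x y] by (simp add: abs_mult flip: ennreal_mult)
  have "(\<integral>\<^sup>+z. ennreal (norm (case z of (x, y) \<Rightarrow> K x y)) \<partial>(lborel \<Otimes>\<^sub>M lborel))
      \<le> (\<integral>\<^sup>+z. (case z of (x, y) \<Rightarrow> ennreal \<bar>g x\<bar> * ennreal \<bar>h y\<bar>) \<partial>(lborel \<Otimes>\<^sub>M lborel))"
    by (intro nn_integral_mono) (auto intro: bound')
  also have "\<dots> = (\<integral>\<^sup>+x. \<integral>\<^sup>+y. ennreal \<bar>g x\<bar> * ennreal \<bar>h y\<bar> \<partial>lborel \<partial>lborel)"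
    by (subst lborel.nn_integral_fst[symmetric]) auto
  also have "\<dots> = (\<integral>\<^sup>+x. ennreal \<bar>g x\<bar> \<partial>lborel) * (\<integral>\<^sup>+y. ennreal \<bar>h y\<bar> \<partial>lborel)"
    by (simp add: nn_integral_cmult nn_integral_multc)
  also have "\<dots> < \<infinity>"
    using g h by (auto simp: integrable_iff_bounded ennreal_mult_less_top)
  finally have *: "integrable (lborel \<Otimes>\<^sub>M lborel) (\<lambda>(x, y). K x y)"
    using K by (intro integrableI_bounded) auto
  show "(LINT x|lborel. LINT y|lborel. K x y) = (LINT y|lborel. LINT x|lborel. K x y)"
    by (rule lborel_pair.Fubini_integral[OF *, symmetric])
  show "integrable lborel (\<lambda>x. LINT y|lborel. K x y)"
    using lborel_pair.integrable_fst[OF *] by simp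
qed

lemma lborel_integral_prod:
  fixes f :: "'a::euclidean_space \<Rightarrow> real \<Rightarrow> complex"
  assumes f: "\<And>b. b \<in> Basis \<Longrightarrow> integrable lborel (f b)"
  shows "(LINT x|lborel. (\<Prod>b\<in>Basis. f b (x \<bullet> b))) = (\<Prod>b\<in>Basis. LINT u|lborel. f b u)"
    and "integrable lborel (\<lambda>x. \<Prod>b\<in>Basis. f b (x \<bullet> b))"
proof -
  interpret product_sigma_finite "\<lambda>_::'a. lborel :: real measure" by standard
  have [measurable]: "\<And>b. b \<in> Basis \<Longrightarrow> f b \<in> borel_measurable borel"
    using borel_measurable_integrable[OF f] by auto
  have m: "(\<lambda>x. \<Prod>b\<in>Basis. f b (x \<bullet> b)) \<in> borel_measurable borel" by measurable
  have T: "(\<lambda>g. \<Sum>b\<in>Basis. g b *\<^sub>R b) \<in> (\<Pi>\<^sub>M b\<in>(Basis::'a set). (lborel::real measure)) \<rightarrow>\<^sub>M borel"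
    by measurable
  have eq: "(\<Prod>b\<in>Basis. f b ((\<Sum>c\<in>Basis. g c *\<^sub>R c) \<bullet> b)) = (\<Prod>b\<in>Basis. f b (g b))" for g
    by (intro prod.cong refl) (simp add: inner_sum_left_Basis)
  show "(LINT x|lborel. (\<Prod>b\<in>Basis. f b (x \<bullet> b))) = (\<Prod>b\<in>Basis. LINT u|lborel. f b u)"
    by (subst lborel_eq, subst integral_distr[OF T m], subst eq, rule product_integral_prod) (use f in auto)
  show "integrable lborel (\<lambda>x. \<Prod>b\<in>Basis. f b (x \<bullet> b))"
    by (subst lborel_eq, subst integrable_distr_eq[OF T m], subst eq, rule product_integrable_prod) (use f in auto)
qed

lemma cnj_measurable [measurable]: "cnj \<in> borel_measurable borel"
  by (intro borel_measurable_continuous_onI continuous_intros)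

text \<open>The characteristic function of the normal distribution, rescaled.\<close>

lemma gaussian_ft_1:
  fixes \<epsilon> w :: real assumes \<epsilon>: "\<epsilon> > 0"
  shows "(LINT u|lborel. of_real (exp (- (\<epsilon> * u)\<^sup>2 / 2)) * cis (w * u))
      = of_real (sqrt (2 * pi) / \<epsilon> * exp (- (w / \<epsilon>)\<^sup>2 / 2))"
    and "integrable lborel (\<lambda>u. of_real (exp (- (\<epsilon> * u)\<^sup>2 / 2)) * cis (w * u))"
proof -
  have int0: "integrable lborel (\<lambda>u::real. exp (- u\<^sup>2 / 2))"
  proof -
    have "integrable lborel (\<lambda>u. sqrt (2 * pi) * std_normal_density u)"
      using integrable_std_normal_moment[of 0] by (intro integrable_mult_right) auto
    then show ?thesis by (simp add: std_normal_density_def)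
  qed
  have base: "(LINT u|lborel. of_real (exp (- u\<^sup>2 / 2)) * cis (v * u)) = complex_of_real (sqrt (2 * pi) * exp (- v\<^sup>2 / 2))" for v :: real
  proof -
    have "complex_of_real (exp (- (v\<^sup>2) / 2)) = char std_normal_distribution v"
      by (simp add: char_std_normal_distribution)
    also have "\<dots> = (LINT u|lborel. std_normal_density u *\<^sub>R iexp (v * u))"
      unfolding char_def by (subst integral_density) (auto simp: normal_density_nonneg)
    also have "\<dots> = (LINT u|lborel. of_real (1 / sqrt (2 * pi)) * (of_real (exp (- u\<^sup>2 / 2)) * cis (v * u)))"
      by (intro Bochner_Integration.integral_cong)
         (auto simp: std_normal_density_def cis_conv_exp scaleR_conv_of_real mult_ac)
    also have "\<dots> = of_real (1 / sqrt (2 * pi)) * (LINT u|lborel. of_real (exp (- u\<^sup>2 / 2)) * cis (v * u))"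
      by (rule integral_mult_right_zero)
    finally show ?thesis by (simp add: field_simps)
  qed
  have int1: "integrable lborel (\<lambda>u. complex_of_real (exp (- u\<^sup>2 / 2)) * cis (v * u))" for v
    by (rule Bochner_Integration.integrable_bound[OF int0]) (auto simp: norm_mult)
  have "(LINT u|lborel. complex_of_real (exp (- (\<epsilon> * u)\<^sup>2 / 2)) * cis (w * u))
      = \<bar>1 / \<epsilon>\<bar> *\<^sub>R (LINT u|lborel. complex_of_real (exp (- (\<epsilon> * (0 + 1 / \<epsilon> * u))\<^sup>2 / 2)) * cis (w * (0 + 1 / \<epsilon> * u)))"
    using \<epsilon> by (intro lborel_integral_real_affine) auto
  also have "(LINT u|lborel. complex_of_real (exp (- (\<epsilon> * (0 + 1 / \<epsilon> * u))\<^sup>2 / 2)) * cis (w * (0 + 1 / \<epsilon> * u)))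
      = (LINT u|lborel. of_real (exp (- u\<^sup>2 / 2)) * cis (w / \<epsilon> * u))"
    using \<epsilon> by (intro Bochner_Integration.integral_cong) auto
  finally show "(LINT u|lborel. of_real (exp (- (\<epsilon> * u)\<^sup>2 / 2)) * cis (w * u))
      = of_real (sqrt (2 * pi) / \<epsilon> * exp (- (w / \<epsilon>)\<^sup>2 / 2))"
    using \<epsilon> by (simp only: base) (simp add: scaleR_conv_of_real field_simps)
  have "integrable lborel (\<lambda>u. complex_of_real (exp (- (0 + \<epsilon> * u)\<^sup>2 / 2)) * cis (w / \<epsilon> * (0 + \<epsilon> * u)))"
    using \<epsilon> by (intro lborel_integrable_real_affine[OF int1]) auto
  then show "integrable lborel (\<lambda>u. of_real (exp (- (\<epsilon> * u)\<^sup>2 / 2)) * cis (w * u))"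
    using \<epsilon> by simp
qed

definition gauss :: "real \<Rightarrow> 'a::euclidean_space \<Rightarrow> real" where
  "gauss \<epsilon> x = exp (- (\<epsilon> * norm x)\<^sup>2 / 2)"

lemma gauss_measurable [measurable]: "gauss \<epsilon> \<in> borel_measurable borel"
  unfolding gauss_def by measurable

lemma gauss_bounds [simp]: "0 < gauss \<epsilon> x" "0 \<le> gauss \<epsilon> x" "gauss \<epsilon> x \<le> 1"
  by (auto simp: gauss_def)

text \<open>The Fourier transform of the Gaussian cut-off \<^term>\<open>gauss \<epsilon>\<close>, a multiple of an approximate identity.\<close>

definition gauss_ft :: "real \<Rightarrow> 'a::euclidean_space \<Rightarrow> real" where
  "gauss_ft \<epsilon> w = (sqrt (2 * pi) / \<epsilon>) ^ DIM('a) * gauss (1 / \<epsilon>) w"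

lemma gaussian_ft:
  fixes w :: "'a::euclidean_space" assumes \<epsilon>: "\<epsilon> > 0"
  shows "(LINT x|lborel. of_real (gauss \<epsilon> x) * cis (w \<bullet> x)) = complex_of_real (gauss_ft \<epsilon> w)"
    and "integrable lborel (\<lambda>x. of_real (gauss \<epsilon> x) * cis (w \<bullet> x))"
proof -
  have exp_prod: "exp (- (c * norm x)\<^sup>2 / 2) = (\<Prod>b\<in>Basis. exp (- (c * (x \<bullet> b))\<^sup>2 / 2))" for c and x :: 'a
  proof -
    have "(norm x)\<^sup>2 = (\<Sum>b\<in>Basis. (x \<bullet> b)\<^sup>2)"
      unfolding power2_norm_eq_inner euclidean_inner[of x x] by (simp add: power2_eq_square)
    then show ?thesis
      by (simp add: exp_sum[symmetric] power_mult_distrib sum_negf sum_divide_distrib sum_distrib_left)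
  qed
  have cis_prod: "cis (w \<bullet> x) = (\<Prod>b\<in>Basis. cis ((w \<bullet> b) * (x \<bullet> b)))" for x
    unfolding euclidean_inner[of w x] by (simp add: cis_conv_exp exp_sum sum_distrib_left)
  have eq: "of_real (gauss \<epsilon> x) * cis (w \<bullet> x)
      = (\<Prod>b\<in>Basis. of_real (exp (- (\<epsilon> * (x \<bullet> b))\<^sup>2 / 2)) * cis ((w \<bullet> b) * (x \<bullet> b)))" for x
    unfolding gauss_def exp_prod cis_prod by (simp add: prod.distrib)
  have "(\<Prod>b\<in>(Basis::'a set). complex_of_real (sqrt (2 * pi) / \<epsilon> * exp (- ((w \<bullet> b) / \<epsilon>)\<^sup>2 / 2)))
      = complex_of_real (\<Prod>b\<in>(Basis::'a set). sqrt (2 * pi) / \<epsilon> * exp (- (1 / \<epsilon> * (w \<bullet> b))\<^sup>2 / 2))"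
    by simp
  also have "\<dots> = complex_of_real (gauss_ft \<epsilon> w)"
    unfolding gauss_ft_def gauss_def exp_prod prod.distrib by simp
  finally show "(LINT x|lborel. of_real (gauss \<epsilon> x) * cis (w \<bullet> x)) = complex_of_real (gauss_ft \<epsilon> w)"
    unfolding eq by (subst lborel_integral_prod(1)) (use gaussian_ft_1[OF \<epsilon>] in auto)
  show "integrable lborel (\<lambda>x. of_real (gauss \<epsilon> x) * cis (w \<bullet> x))"
    unfolding eq by (rule lborel_integral_prod(2)) (use gaussian_ft_1[OF \<epsilon>] in auto)
qed

lemma gauss_integrable:
  assumes "\<epsilon> > 0" shows "integrable lborel (gauss \<epsilon> :: 'a::euclidean_space \<Rightarrow> real)"
proof -
  have "integrable lborel (\<lambda>x::'a. complex_of_real (gauss \<epsilon> x))"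
    using gaussian_ft(2)[OF assms, of 0] by simp
  then show ?thesis by (simp add: complex_of_real_integrable_eq)
qed

lemma gauss_ft_nonneg [simp]: "\<epsilon> > 0 \<Longrightarrow> 0 \<le> gauss_ft \<epsilon> x"
  by (simp add: gauss_ft_def)

lemma gauss_ft_measurable [measurable]: "gauss_ft \<epsilon> \<in> borel_measurable borel"
  unfolding gauss_ft_def by measurable

lemma gauss_ft_uminus: "gauss_ft \<epsilon> (- x) = gauss_ft \<epsilon> x"
  by (simp add: gauss_ft_def gauss_def)

lemma gauss_integral:
  assumes "\<epsilon> > 0"
  shows "(LINT x|lborel. gauss \<epsilon> (x::'a::euclidean_space)) = (sqrt (2 * pi) / \<epsilon>) ^ DIM('a)"
proof -
  have "complex_of_real (LINT x|lborel. gauss \<epsilon> (x::'a)) = complex_of_real (gauss_ft \<epsilon> (0::'a))"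
    using gaussian_ft(1)[OF assms, of "0::'a"] by (simp add: integral_complex_of_real)
  moreover have "gauss (1 / \<epsilon>) (0::'a) = 1" by (simp add: gauss_def)
  ultimately show ?thesis unfolding of_real_eq_iff by (simp add: gauss_ft_def)
qed

lemma gauss_ft_nn_integral:
  assumes "\<epsilon> > 0"
  shows "(\<integral>\<^sup>+x. ennreal (gauss_ft \<epsilon> (x::'a::euclidean_space)) \<partial>lborel) = ennreal ((2 * pi) ^ DIM('a))"
proof -
  have "(\<integral>\<^sup>+x. ennreal (gauss_ft \<epsilon> (x::'a)) \<partial>lborel)
      = ennreal ((sqrt (2 * pi) / \<epsilon>) ^ DIM('a)) * (\<integral>\<^sup>+x. ennreal (gauss (1 / \<epsilon>) (x::'a)) \<partial>lborel)"
    using assms by (simp add: gauss_ft_def ennreal_mult nn_integral_cmult)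
  also have "(\<integral>\<^sup>+x. ennreal (gauss (1 / \<epsilon>) (x::'a)) \<partial>lborel) = ennreal (LINT x|lborel. gauss (1 / \<epsilon>) (x::'a))"
    using assms by (intro nn_integral_eq_integral gauss_integrable) auto
  also have "\<dots> = ennreal ((sqrt (2 * pi) * \<epsilon>) ^ DIM('a))"
    using assms by (simp add: gauss_integral)
  also have "ennreal ((sqrt (2 * pi) / \<epsilon>) ^ DIM('a)) * ennreal ((sqrt (2 * pi) * \<epsilon>) ^ DIM('a)) = ennreal ((2 * pi) ^ DIM('a))"
  proof -
    have "(sqrt (2 * pi) / \<epsilon>) ^ DIM('a) * (sqrt (2 * pi) * \<epsilon>) ^ DIM('a) = (2 * pi) ^ DIM('a)"
      using assms by (subst power_mult_distrib[symmetric]) simp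
    then show ?thesis using assms by (subst ennreal_mult[symmetric]) auto
  qed
  finally show ?thesis .
qed

text \<open>The inner integral in \<open>x\<close> is the Fourier transform of the Gaussian, by Fubini's theorem.\<close>

lemma gauss_regularised_ft:
  fixes f :: "'a::euclidean_space \<Rightarrow> complex"
  assumes \<epsilon>: "\<epsilon> > 0" and f: "integrable lborel f"
  shows "(LINT x|lborel. of_real (gauss \<epsilon> x) * ft e f x * cis (v \<bullet> x))
    = (LINT y|lborel. f y * of_real (gauss_ft \<epsilon> (e *\<^sub>R y + v)))"
proof -
  note [measurable] = borel_measurable_integrable[OF f]
  define K where "K x y = (of_real (gauss \<epsilon> x) * cis (v \<bullet> x)) * (f y * cis (e * (x \<bullet> y)))" for x y
  have "(LINT x|lborel. of_real (gauss \<epsilon> x) * ft e f x * cis (v \<bullet> x)) = (LINT x|lborel. LINT y|lborel. K x y)"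
    unfolding K_def ft_def integral_mult_right_zero by (simp add: mult_ac)
  also have "\<dots> = (LINT y|lborel. LINT x|lborel. K x y)"
    by (rule lborel_fubini(1)[OF _ gauss_integrable[OF \<epsilon>] integrable_norm[OF f]])
       (auto simp: K_def norm_mult)
  also have "\<dots> = (LINT y|lborel. f y * of_real (gauss_ft \<epsilon> (e *\<^sub>R y + v)))"
  proof (intro Bochner_Integration.integral_cong refl)
    fix y
    have "K x y = f y * (of_real (gauss \<epsilon> x) * cis ((e *\<^sub>R y + v) \<bullet> x))" for x
    proof -
      have "(e *\<^sub>R y + v) \<bullet> x = v \<bullet> x + e * (x \<bullet> y)" by (simp add: inner_add_left inner_commute[of x y])
      then show ?thesis by (simp add: K_def cis_mult[symmetric] mult_ac)
    qed
    then show "(LINT x|lborel. K x y) = f y * of_real (gauss_ft \<epsilon> (e *\<^sub>R y + v))"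
      by (simp add: gaussian_ft(1)[OF \<epsilon>])
  qed
  finally show ?thesis .
qed

lemma gauss_tendsto_1:
  "(\<lambda>k. gauss (inverse (real (Suc k))) x) \<longlonglongrightarrow> 1"
proof -
  have "(\<lambda>k. exp (- (inverse (real (Suc k)) * norm x)\<^sup>2 / 2)) \<longlonglongrightarrow> exp (- (0 * norm x)\<^sup>2 / 2)"
    by (intro tendsto_intros LIMSEQ_inverse_real_of_nat) auto
  then show ?thesis by (simp add: gauss_def)
qed

text \<open>The upper bound in Plancherel's theorem. After inserting a Gaussian cut-off the left-hand side is a
  quadratic form in \<open>f\<close> with a positive convolution kernel of mass \<open>(2 \<pi>)\<^sup>d\<close>, and
  \<open>2 |f y| |f z| \<le> |f y|\<^sup>2 + |f z|\<^sup>2\<close> bounds it.\<close>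

lemma ft_bessel:
  fixes f :: "'a::euclidean_space \<Rightarrow> complex"
  assumes f: "integrable lborel f" and e: "\<bar>e\<bar> = 1"
  shows "(\<integral>\<^sup>+x. ennreal ((cmod (ft e f x))\<^sup>2) \<partial>lborel)
    \<le> ennreal ((2 * pi) ^ DIM('a)) * (\<integral>\<^sup>+y. ennreal ((cmod (f y))\<^sup>2) \<partial>lborel)"
proof -
  note [measurable] = borel_measurable_integrable[OF f]
  define B where "B = (LINT y|lborel. cmod (f y))"
  have B: "cmod (ft e f x) \<le> B" for x unfolding B_def by (rule norm_ft_le)
  have [measurable]: "ft e f \<in> borel_measurable borel"
    unfolding ft_def by measurable
  let ?C = "ennreal ((2 * pi) ^ DIM('a)) * (\<integral>\<^sup>+y. ennreal ((cmod (f y))\<^sup>2) \<partial>lborel)"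
  have reg: "(\<integral>\<^sup>+x. ennreal (gauss \<epsilon> x * (cmod (ft e f x))\<^sup>2) \<partial>lborel) \<le> ?C" if \<epsilon>: "\<epsilon> > 0" for \<epsilon>
  proof -
    have i: "integrable lborel (\<lambda>x. gauss \<epsilon> x * (cmod (ft e f x))\<^sup>2)"
      by (rule Bochner_Integration.integrable_bound[OF integrable_mult_right[OF gauss_integrable[OF \<epsilon>], of "B\<^sup>2"]])
         (auto simp: mult.commute intro!: mult_mono power_mono B)
    have cz: "cnj z * z = of_real ((cmod z)\<^sup>2)" for z
      by (metis complex_norm_square mult.commute)
    define K where "K x y = of_real (gauss \<epsilon> x) * cnj (ft e f x) * (f y * cis (e * (x \<bullet> y)))" for x y
    have "complex_of_real (LINT x|lborel. gauss \<epsilon> x * (cmod (ft e f x))\<^sup>2)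
        = (LINT x|lborel. of_real (gauss \<epsilon> x) * cnj (ft e f x) * ft e f x)"
      by (subst integral_complex_of_real[symmetric], intro Bochner_Integration.integral_cong refl)
         (simp add: cz mult.assoc del: of_real_power)
    also have "\<dots> = (LINT x|lborel. LINT y|lborel. K x y)"
      unfolding K_def ft_def by (simp add: mult.assoc)
    also have "\<dots> = (LINT y|lborel. LINT x|lborel. K x y)"
    proof (rule lborel_fubini(1)[OF _ integrable_mult_right[OF gauss_integrable[OF \<epsilon>], of B] integrable_norm[OF f]])
      show "cmod (K x y) \<le> B * gauss \<epsilon> x * norm (f y)" for x y
        unfolding K_def using mult_right_mono[OF B[of x], of "gauss \<epsilon> x * norm (f y)"]
        by (simp add: norm_mult mult_ac)
    qed (unfold K_def, measurable)
    also have "\<dots> = (LINT y|lborel. f y * (LINT z|lborel. cnj (f z) * of_real (gauss_ft \<epsilon> (e *\<^sub>R (y - z)))))"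
    proof (intro Bochner_Integration.integral_cong refl)
      fix y
      have cnj: "cnj (ft e f x) = ft (- e) (\<lambda>z. cnj (f z)) x" for x
        unfolding ft_def by (subst Bochner_Integration.integral_cnj[symmetric]) (simp add: cis_cnj)
      have "(LINT x|lborel. K x y) = f y * (LINT x|lborel. of_real (gauss \<epsilon> x) * ft (- e) (\<lambda>z. cnj (f z)) x * cis ((e *\<^sub>R y) \<bullet> x))"
        unfolding K_def cnj by (subst integral_mult_right_zero[symmetric]) (simp add: inner_commute mult_ac)
      also have "\<dots> = f y * (LINT z|lborel. cnj (f z) * of_real (gauss_ft \<epsilon> ((- e) *\<^sub>R z + e *\<^sub>R y)))"
        using f by (subst gauss_regularised_ft[OF \<epsilon>]) (auto simp: integrable_cnj)
      finally show "(LINT x|lborel. K x y) = f y * (LINT z|lborel. cnj (f z) * of_real (gauss_ft \<epsilon> (e *\<^sub>R (y - z))))"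
        by (simp add: scaleR_diff_right)
    qed
    finally have eq: "complex_of_real (LINT x|lborel. gauss \<epsilon> x * (cmod (ft e f x))\<^sup>2)
        = (LINT y|lborel. f y * (LINT z|lborel. cnj (f z) * of_real (gauss_ft \<epsilon> (e *\<^sub>R (y - z)))))" .
    have nn: "norm (LINT x|N. h x) \<le> (\<integral>\<^sup>+x. ennreal (norm (h x)) \<partial>N)" for N and h :: "'a \<Rightarrow> complex"
      by (cases "integrable N h") (auto simp: integral_norm_bound_ennreal not_integrable_integral_eq)
    have gs: "gauss_ft \<epsilon> (e *\<^sub>R (y - z)) = gauss_ft \<epsilon> (y - z)" for y z :: 'a
      using e by (simp add: gauss_ft_def gauss_def)
    have "(\<integral>\<^sup>+x. ennreal (gauss \<epsilon> x * (cmod (ft e f x))\<^sup>2) \<partial>lborel) = ennreal (LINT x|lborel. gauss \<epsilon> x * (cmod (ft e f x))\<^sup>2)"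
      by (rule nn_integral_eq_integral[OF i]) auto
    also have "\<dots> = ennreal (cmod (complex_of_real (LINT x|lborel. gauss \<epsilon> x * (cmod (ft e f x))\<^sup>2)))"
      by (simp add: integral_nonneg)
    also have "\<dots> \<le> (\<integral>\<^sup>+y. ennreal (cmod (f y * (LINT z|lborel. cnj (f z) * of_real (gauss_ft \<epsilon> (e *\<^sub>R (y - z)))))) \<partial>lborel)"
      unfolding eq by (rule nn)
    also have "\<dots> \<le> (\<integral>\<^sup>+y. \<integral>\<^sup>+z. ennreal ((cmod (f y))\<^sup>2 / 2) * ennreal (gauss_ft \<epsilon> (y - z))
        + ennreal ((cmod (f z))\<^sup>2 / 2) * ennreal (gauss_ft \<epsilon> (y - z)) \<partial>lborel \<partial>lborel)"
    proof (intro nn_integral_mono)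
      fix y
      have "ennreal (cmod (f y * (LINT z|lborel. cnj (f z) * of_real (gauss_ft \<epsilon> (e *\<^sub>R (y - z))))))
          \<le> ennreal (cmod (f y)) * (\<integral>\<^sup>+z. ennreal (cmod (cnj (f z) * of_real (gauss_ft \<epsilon> (e *\<^sub>R (y - z))))) \<partial>lborel)"
        unfolding norm_mult[of "f y"] by (subst ennreal_mult) (auto intro!: mult_left_mono nn)
      also have "\<dots> = (\<integral>\<^sup>+z. ennreal (cmod (f y) * cmod (f z) * gauss_ft \<epsilon> (y - z)) \<partial>lborel)"
        using \<epsilon> by (subst nn_integral_cmult[symmetric]) (auto simp: gs norm_mult ennreal_mult mult_ac)
      also have "\<dots> \<le> (\<integral>\<^sup>+z. ennreal ((cmod (f y))\<^sup>2 / 2) * ennreal (gauss_ft \<epsilon> (y - z))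
        + ennreal ((cmod (f z))\<^sup>2 / 2) * ennreal (gauss_ft \<epsilon> (y - z)) \<partial>lborel)"
      proof (intro nn_integral_mono)
        fix z
        have "cmod (f y) * cmod (f z) \<le> (cmod (f y))\<^sup>2 / 2 + (cmod (f z))\<^sup>2 / 2"
          using zero_le_power2[of "cmod (f y) - cmod (f z)"] by (simp add: power2_eq_square algebra_simps)
        then have "cmod (f y) * cmod (f z) * gauss_ft \<epsilon> (y - z) \<le> ((cmod (f y))\<^sup>2 / 2 + (cmod (f z))\<^sup>2 / 2) * gauss_ft \<epsilon> (y - z)"
          using \<epsilon> by (intro mult_right_mono) auto
        then show "ennreal (cmod (f y) * cmod (f z) * gauss_ft \<epsilon> (y - z)) \<le>
           ennreal ((cmod (f y))\<^sup>2 / 2) * ennreal (gauss_ft \<epsilon> (y - z)) + ennreal ((cmod (f z))\<^sup>2 / 2) * ennreal (gauss_ft \<epsilon> (y - z))"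
          using \<epsilon> by (simp add: distrib_right flip: ennreal_mult ennreal_plus)
      qed
      finally show "ennreal (cmod (f y * (LINT z|lborel. cnj (f z) * of_real (gauss_ft \<epsilon> (e *\<^sub>R (y - z)))))) \<le>
        (\<integral>\<^sup>+z. ennreal ((cmod (f y))\<^sup>2 / 2) * ennreal (gauss_ft \<epsilon> (y - z))
        + ennreal ((cmod (f z))\<^sup>2 / 2) * ennreal (gauss_ft \<epsilon> (y - z)) \<partial>lborel)" .
    qed
    also have "\<dots> = (\<integral>\<^sup>+y. \<integral>\<^sup>+z. ennreal ((cmod (f y))\<^sup>2 / 2) * ennreal (gauss_ft \<epsilon> (y - z)) \<partial>lborel \<partial>lborel)
        + (\<integral>\<^sup>+y. \<integral>\<^sup>+z. ennreal ((cmod (f z))\<^sup>2 / 2) * ennreal (gauss_ft \<epsilon> (y - z)) \<partial>lborel \<partial>lborel)"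
      by (subst nn_integral_add[symmetric]; (subst nn_integral_add)?) auto
    also have "(\<integral>\<^sup>+y. \<integral>\<^sup>+z. ennreal ((cmod (f z))\<^sup>2 / 2) * ennreal (gauss_ft \<epsilon> (y - z)) \<partial>lborel \<partial>lborel)
        = (\<integral>\<^sup>+z. \<integral>\<^sup>+y. ennreal ((cmod (f z))\<^sup>2 / 2) * ennreal (gauss_ft \<epsilon> (y - z)) \<partial>lborel \<partial>lborel)"
      by (rule lborel_pair.Fubini') auto
    also have "(\<lambda>z. \<integral>\<^sup>+y. ennreal ((cmod (f z))\<^sup>2 / 2) * ennreal (gauss_ft \<epsilon> (y - z)) \<partial>lborel)
        = (\<lambda>z. ennreal ((cmod (f z))\<^sup>2 / 2) * ennreal ((2 * pi) ^ DIM('a)))"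
    proof
      fix z :: 'a
      have "(\<integral>\<^sup>+y. ennreal (gauss_ft \<epsilon> (y - z)) \<partial>lborel) = (\<integral>\<^sup>+y. ennreal (gauss_ft \<epsilon> (y::'a)) \<partial>lborel)"
        by (subst (2) lborel_distr_plus[of "- z", symmetric]) (simp add: nn_integral_distr)
      then show "(\<integral>\<^sup>+y. ennreal ((cmod (f z))\<^sup>2 / 2) * ennreal (gauss_ft \<epsilon> (y - z)) \<partial>lborel)
        = ennreal ((cmod (f z))\<^sup>2 / 2) * ennreal ((2 * pi) ^ DIM('a))"
        by (simp add: nn_integral_cmult gauss_ft_nn_integral[OF \<epsilon>])
    qed
    also have "(\<lambda>y. \<integral>\<^sup>+z. ennreal ((cmod (f y))\<^sup>2 / 2) * ennreal (gauss_ft \<epsilon> (y - z)) \<partial>lborel)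
        = (\<lambda>y. ennreal ((cmod (f y))\<^sup>2 / 2) * ennreal ((2 * pi) ^ DIM('a)))"
    proof
      fix y :: 'a
      have "(\<integral>\<^sup>+z. ennreal (gauss_ft \<epsilon> (y - z)) \<partial>lborel) = (\<integral>\<^sup>+z. ennreal (gauss_ft \<epsilon> (- y + z)) \<partial>lborel)"
        using gauss_ft_uminus[of \<epsilon> "y - _"] by (simp add: algebra_simps)
      also have "\<dots> = (\<integral>\<^sup>+z. ennreal (gauss_ft \<epsilon> (z::'a)) \<partial>lborel)"
        by (subst (2) lborel_distr_plus[of "- y", symmetric]) (simp add: nn_integral_distr)
      finally show "(\<integral>\<^sup>+z. ennreal ((cmod (f y))\<^sup>2 / 2) * ennreal (gauss_ft \<epsilon> (y - z)) \<partial>lborel)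
        = ennreal ((cmod (f y))\<^sup>2 / 2) * ennreal ((2 * pi) ^ DIM('a))"
        by (simp add: nn_integral_cmult gauss_ft_nn_integral[OF \<epsilon>])
    qed
    also have "(\<integral>\<^sup>+y. ennreal ((cmod (f y))\<^sup>2 / 2) * ennreal ((2 * pi) ^ DIM('a)) \<partial>lborel)
        + (\<integral>\<^sup>+y. ennreal ((cmod (f y))\<^sup>2 / 2) * ennreal ((2 * pi) ^ DIM('a)) \<partial>lborel) = ?C"
      by (subst nn_integral_add[symmetric])
         (auto simp: nn_integral_multc mult.commute simp flip: distrib_left ennreal_plus)
    finally show ?thesis .
  qed
  have "(\<integral>\<^sup>+x. ennreal ((cmod (ft e f x))\<^sup>2) \<partial>lborel)
      = (\<integral>\<^sup>+x. liminf (\<lambda>k. ennreal (gauss (inverse (real (Suc k))) x * (cmod (ft e f x))\<^sup>2)) \<partial>lborel)"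
  proof (intro nn_integral_cong)
    fix x
    have "(\<lambda>k. gauss (inverse (real (Suc k))) x * (cmod (ft e f x))\<^sup>2) \<longlonglongrightarrow> 1 * (cmod (ft e f x))\<^sup>2"
      by (intro tendsto_intros gauss_tendsto_1)
    then have "(\<lambda>k. ennreal (gauss (inverse (real (Suc k))) x * (cmod (ft e f x))\<^sup>2)) \<longlonglongrightarrow> ennreal ((cmod (ft e f x))\<^sup>2)"
      by (intro tendsto_ennrealI) auto
    then show "ennreal ((cmod (ft e f x))\<^sup>2) = liminf (\<lambda>k. ennreal (gauss (inverse (real (Suc k))) x * (cmod (ft e f x))\<^sup>2))"
      by (intro lim_imp_Liminf[symmetric]) auto
  qed
  also have "\<dots> \<le> liminf (\<lambda>k. \<integral>\<^sup>+x. ennreal (gauss (inverse (real (Suc k))) x * (cmod (ft e f x))\<^sup>2) \<partial>lborel)"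
    by (intro nn_integral_liminf) auto
  also have "\<dots> \<le> liminf (\<lambda>k::nat. ?C)"
    by (intro Liminf_mono always_eventually allI reg) auto
  also have "\<dots> = ?C" by (simp add: Liminf_const)
  finally show ?thesis .
qed

text \<open>A Gaussian cut-off on the outer integral turns into an approximate identity acting on \<open>\<phi>\<close>; both sides
  converge by dominated convergence when the cut-off is removed.\<close>

lemma ft_inversion:
  fixes \<phi> :: "'a::euclidean_space \<Rightarrow> complex"
  assumes \<phi>: "\<phi> \<in> schwartz" and e: "\<bar>e\<bar> = 1"
  shows "ft (- e) (ft e \<phi>) x = of_real ((2 * pi) ^ DIM('a)) * \<phi> x"
proof -
  note [measurable] = schwartz_measurable[OF \<phi>]
  note F = ft_schwartz[OF \<phi> e]
  note [measurable] = schwartz_measurable[OF F]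
  define \<epsilon> where "\<epsilon> k = inverse (real (Suc k))" for k
  have \<epsilon>: "\<epsilon> k > 0" for k by (simp add: \<epsilon>_def)
  have \<epsilon>0: "\<epsilon> \<longlonglongrightarrow> 0" unfolding \<epsilon>_def by (rule LIMSEQ_inverse_real_of_nat)
  obtain C where C: "C \<ge> 0" "\<And>x. cmod (\<phi> x) \<le> C * jap 0 x" using schwartz_bound'[OF \<phi>] by blast
  define L where "L k = (LINT \<xi>|lborel. of_real (gauss (\<epsilon> k) \<xi>) * ft e \<phi> \<xi> * cis (((- e) *\<^sub>R x) \<bullet> \<xi>))" for k
  have "L \<longlonglongrightarrow> (LINT \<xi>|lborel. ft e \<phi> \<xi> * cis (((- e) *\<^sub>R x) \<bullet> \<xi>))"
    unfolding L_def
  proof (rule integral_dominated_convergence[where w="\<lambda>\<xi>. cmod (ft e \<phi> \<xi>)"])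
    show "integrable lborel (\<lambda>\<xi>. cmod (ft e \<phi> \<xi>))" using schwartz_integrable[OF F] by simp
    show "AE \<xi> in lborel. (\<lambda>k. of_real (gauss (\<epsilon> k) \<xi>) * ft e \<phi> \<xi> * cis (((- e) *\<^sub>R x) \<bullet> \<xi>)) \<longlonglongrightarrow> ft e \<phi> \<xi> * cis (((- e) *\<^sub>R x) \<bullet> \<xi>)"
    proof (intro AE_I2)
      fix \<xi>
      have "(\<lambda>k. of_real (gauss (\<epsilon> k) \<xi>) * ft e \<phi> \<xi> * cis (((- e) *\<^sub>R x) \<bullet> \<xi>)) \<longlonglongrightarrow> of_real 1 * ft e \<phi> \<xi> * cis (((- e) *\<^sub>R x) \<bullet> \<xi>)"
        unfolding \<epsilon>_def by (intro tendsto_intros gauss_tendsto_1)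
      then show "(\<lambda>k. of_real (gauss (\<epsilon> k) \<xi>) * ft e \<phi> \<xi> * cis (((- e) *\<^sub>R x) \<bullet> \<xi>)) \<longlonglongrightarrow> ft e \<phi> \<xi> * cis (((- e) *\<^sub>R x) \<bullet> \<xi>)" by simp
    qed
  qed (auto simp: norm_mult mult_left_le_one_le)
  moreover have "(LINT \<xi>|lborel. ft e \<phi> \<xi> * cis (((- e) *\<^sub>R x) \<bullet> \<xi>)) = ft (- e) (ft e \<phi>) x"
    by (simp add: ft_def)
  moreover have "L \<longlonglongrightarrow> of_real ((2 * pi) ^ DIM('a)) * \<phi> x"
  proof -
    have Leq: "L k = (LINT z|lborel. \<phi> (x + \<epsilon> k *\<^sub>R z) * of_real (sqrt (2 * pi) ^ DIM('a) * gauss 1 z))" for k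
    proof -
      have "L k = (LINT y|lborel. \<phi> y * of_real (gauss_ft (\<epsilon> k) (e *\<^sub>R y + (- e) *\<^sub>R x)))"
        unfolding L_def by (rule gauss_regularised_ft[OF \<epsilon> schwartz_integrable[OF \<phi>]])
      also have "\<dots> = (LINT y|lborel. \<phi> y * of_real (gauss_ft (\<epsilon> k) (y - x)))"
      proof -
        have "e *\<^sub>R y + (- e) *\<^sub>R x = e *\<^sub>R (y - x)" for y by (simp add: scaleR_diff_right)
        then show ?thesis using e by (simp add: gauss_ft_def gauss_def)
      qed
      also have "\<dots> = (LINT z|lborel. (\<bar>\<epsilon> k\<bar> ^ DIM('a)) *\<^sub>R (\<phi> (x + \<epsilon> k *\<^sub>R z) * of_real (gauss_ft (\<epsilon> k) (x + \<epsilon> k *\<^sub>R z - x))))"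
        using \<epsilon>[of k] by (subst lborel_affine[of "\<epsilon> k" x]) (auto simp: integral_density integral_distr)
      also have "\<dots> = (LINT z|lborel. \<phi> (x + \<epsilon> k *\<^sub>R z) * of_real (sqrt (2 * pi) ^ DIM('a) * gauss 1 z))"
      proof (intro Bochner_Integration.integral_cong refl)
        fix z :: 'a
        have "\<bar>\<epsilon> k\<bar> ^ DIM('a) * gauss_ft (\<epsilon> k) (\<epsilon> k *\<^sub>R z) = sqrt (2 * pi) ^ DIM('a) * gauss 1 z"
          using \<epsilon>[of k] by (simp add: gauss_ft_def gauss_def power_divide)
        then show "(\<bar>\<epsilon> k\<bar> ^ DIM('a)) *\<^sub>R (\<phi> (x + \<epsilon> k *\<^sub>R z) * of_real (gauss_ft (\<epsilon> k) (x + \<epsilon> k *\<^sub>R z - x)))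
          = \<phi> (x + \<epsilon> k *\<^sub>R z) * of_real (sqrt (2 * pi) ^ DIM('a) * gauss 1 z)"
          by (simp add: scaleR_conv_of_real mult_ac flip: of_real_mult of_real_power)
      qed
      finally show ?thesis .
    qed
    have "L \<longlonglongrightarrow> (LINT z|lborel. \<phi> x * of_real (sqrt (2 * pi) ^ DIM('a) * gauss 1 (z::'a)))"
      unfolding Leq
    proof (rule integral_dominated_convergence[where w="\<lambda>z. C * (sqrt (2 * pi) ^ DIM('a) * gauss 1 z)"])
      show "integrable lborel (\<lambda>z::'a. C * (sqrt (2 * pi) ^ DIM('a) * gauss 1 z))"
        by (intro integrable_mult_right gauss_integrable) auto
      show "AE z in lborel. (\<lambda>k. \<phi> (x + \<epsilon> k *\<^sub>R z) * of_real (sqrt (2 * pi) ^ DIM('a) * gauss 1 z))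
          \<longlonglongrightarrow> \<phi> x * of_real (sqrt (2 * pi) ^ DIM('a) * gauss 1 z)"
      proof (intro AE_I2 tendsto_intros)
        fix z
        have "isCont \<phi> x"
          using smooth_continuous_on[OF schwartz_smooth[OF \<phi>], of UNIV] by (simp add: continuous_on_eq_continuous_at)
        moreover have "(\<lambda>k. x + \<epsilon> k *\<^sub>R z) \<longlonglongrightarrow> x + 0 *\<^sub>R z" by (intro tendsto_intros \<epsilon>0)
        ultimately show "(\<lambda>k. \<phi> (x + \<epsilon> k *\<^sub>R z)) \<longlonglongrightarrow> \<phi> x"
          using isCont_tendsto_compose by force
      qed
      show "AE z in lborel. norm (\<phi> (x + \<epsilon> k *\<^sub>R z) * of_real (sqrt (2 * pi) ^ DIM('a) * gauss 1 z))
          \<le> C * (sqrt (2 * pi) ^ DIM('a) * gauss 1 z)" for k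
        using C(2) by (intro AE_I2) (simp add: norm_mult norm_power mult_right_mono)
    qed auto
    also have "(LINT z|lborel. \<phi> x * of_real (sqrt (2 * pi) ^ DIM('a) * gauss 1 (z::'a)))
        = \<phi> x * of_real (sqrt (2 * pi) ^ DIM('a) * (LINT z|lborel. gauss 1 (z::'a)))"
      by (simp add: integral_complex_of_real)
    also have "\<dots> = of_real ((2 * pi) ^ DIM('a)) * \<phi> x"
    proof -
      have "sqrt (2 * pi) ^ DIM('a) * (LINT z|lborel. gauss 1 (z::'a)) = sqrt (2 * pi) ^ DIM('a) * sqrt (2 * pi) ^ DIM('a)"
        by (subst gauss_integral) auto
      also have "\<dots> = (2 * pi) ^ DIM('a)" by (subst power_mult_distrib[symmetric]) simp
      finally show ?thesis by (simp only: mult.commute)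
    qed
    finally show ?thesis .
  qed
  ultimately show ?thesis using LIMSEQ_unique by metis
qed

lemma fourier_inv_fourier:
  fixes \<phi> :: "'a::euclidean_space \<Rightarrow> complex"
  assumes "\<phi> \<in> schwartz" shows "fourier (inv_fourier \<phi>) = \<phi>"
proof
  fix x
  have "fourier (inv_fourier \<phi>) x = of_real (1 / (2 * pi) ^ DIM('a)) * ft (- 1) (ft 1 \<phi>) x"
    unfolding fourier_eq_ft inv_fourier_eq_ft by (rule ft_scale)
  also have "\<dots> = of_real (1 / (2 * pi) ^ DIM('a)) * (of_real ((2 * pi) ^ DIM('a)) * \<phi> x)"
    using ft_inversion[OF assms, of 1 x] by simp
  also have "\<dots> = of_real (1 / (2 * pi) ^ DIM('a) * (2 * pi) ^ DIM('a)) * \<phi> x"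
    by (simp only: of_real_mult mult.assoc)
  also have "1 / (2 * pi) ^ DIM('a) * (2 * pi) ^ DIM('a) = 1" by simp
  finally show "fourier (inv_fourier \<phi>) x = \<phi> x" by simp
qed

lemma inv_fourier_fourier:
  fixes \<phi> :: "'a::euclidean_space \<Rightarrow> complex"
  assumes "\<phi> \<in> schwartz" shows "inv_fourier (fourier \<phi>) = \<phi>"
proof
  fix x
  have "inv_fourier (fourier \<phi>) x = of_real (1 / (2 * pi) ^ DIM('a)) * ft (- (- 1)) (ft (- 1) \<phi>) x"
    unfolding fourier_eq_ft inv_fourier_eq_ft by simp
  also have "\<dots> = of_real (1 / (2 * pi) ^ DIM('a)) * (of_real ((2 * pi) ^ DIM('a)) * \<phi> x)"
    by (subst ft_inversion[OF assms]) simp_all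
  also have "\<dots> = of_real (1 / (2 * pi) ^ DIM('a) * (2 * pi) ^ DIM('a)) * \<phi> x"
    by (simp only: of_real_mult mult.assoc)
  also have "1 / (2 * pi) ^ DIM('a) * (2 * pi) ^ DIM('a) = 1" by simp
  finally show "inv_fourier (fourier \<phi>) x = \<phi> x" by simp
qed

section \<open>Moments of Wiener integrals\<close>

lemma test_functions_comb:
  assumes f: "f \<in> test_functions T" and g: "g \<in> test_functions T"
  shows "(\<lambda>z. f z + c * g z) \<in> test_functions T"
proof -
  have sub: "supp (\<lambda>z. f z + c * g z) \<subseteq> supp f \<union> supp g"
  proof -
    have "{z. f z + c * g z \<noteq> 0} \<subseteq> {z. f z \<noteq> 0} \<union> {z. g z \<noteq> 0}" by auto
    from closure_mono[OF this] show ?thesis by (simp add: supp_def closure_Un)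
  qed
  have "compact (supp f \<union> supp g)" using f g by (auto simp: test_functions_def intro: compact_Un)
  then have "compact ((supp f \<union> supp g) \<inter> supp (\<lambda>z. f z + c * g z))"
    by (rule compact_Int_closed) (simp add: supp_def)
  then have "compact (supp (\<lambda>z. f z + c * g z))"
    using sub by (simp add: Int_absorb1)
  moreover have "smooth (\<lambda>z. f z + c * g z)"
    using f g by (intro smooth_add smooth_bounded_linear[OF bounded_linear_mult_right]) (auto simp: test_functions_def)
  ultimately show ?thesis using sub f g by (auto simp: test_functions_def)
qed

lemma zero_test_function: "(\<lambda>_. 0) \<in> test_functions T"
proof -
  have "partials bs (\<lambda>_::real \<times> 'a. 0::real) = (\<lambda>_. 0)" for bs by (induction bs) auto
  then have "smooth (\<lambda>_::real \<times> 'a. 0::real)" by (simp add: smooth_def)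
  then show ?thesis by (simp add: test_functions_def supp_def)
qed

lemma test_function_measurable: "f \<in> test_functions T \<Longrightarrow> f \<in> borel_measurable borel"
  by (auto simp: test_functions_def intro: smooth_borel_measurable)

lemma power2_add_le: "(a + b)\<^sup>2 \<le> 2 * a\<^sup>2 + 2 * b\<^sup>2" for a b :: real
  using zero_le_power2[of "a - b"] by (simp add: power2_eq_square algebra_simps)

lemma two_ennreal: "0 \<le> x \<Longrightarrow> 2 * ennreal x = ennreal (2 * x)"
  by (simp add: ennreal_mult)

definition gauss_moment :: "nat \<Rightarrow> real" where
  "gauss_moment K = fact (2 * K) / (2 ^ K * fact K)"

lemma gauss_moment_pos: "gauss_moment K > 0"
  by (simp add: gauss_moment_def)

lemma centered_gaussian_moment:
  assumes "prob_space M" and X: "centered_gaussian M X"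
  shows "(\<integral>\<^sup>+\<omega>. ennreal ((X \<omega>) ^ (2 * K)) \<partial>M) \<le> ennreal (gauss_moment K * (LINT \<omega>|M. (X \<omega>)\<^sup>2) ^ K)"
proof -
  interpret prob_space M by fact
  from X have [measurable]: "X \<in> borel_measurable M" by (simp add: centered_gaussian_def)
  from X consider "AE \<omega> in M. X \<omega> = 0" | \<sigma> where "\<sigma> > 0" "distributed M lborel X (\<lambda>x. ennreal (normal_density 0 \<sigma> x))"
    unfolding centered_gaussian_def by blast
  then show ?thesis
  proof cases
    case 1
    have "(\<integral>\<^sup>+\<omega>. ennreal ((X \<omega>) ^ (2 * K)) \<partial>M) = (\<integral>\<^sup>+\<omega>. ennreal (0 ^ (2 * K)) \<partial>M)"
      using 1 by (intro nn_integral_cong_AE) auto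
    moreover have "(LINT \<omega>|M. (X \<omega>)\<^sup>2) = (LINT \<omega>|M. 0)"
      using 1 by (intro integral_cong_AE) auto
    ultimately show ?thesis by (cases "K = 0") (auto simp: gauss_moment_def power_0_left emeasure_space_1)
  next
    case 2
    have m: "(\<integral>\<^sup>+\<omega>. ennreal ((X \<omega>) ^ (2 * k)) \<partial>M) = ennreal (gauss_moment k * (\<sigma>\<^sup>2) ^ k)" for k
    proof -
      have "(\<integral>\<^sup>+\<omega>. ennreal ((X \<omega>) ^ (2 * k)) \<partial>M) = (\<integral>\<^sup>+x. ennreal (normal_density 0 \<sigma> x) * ennreal (x ^ (2 * k)) \<partial>lborel)"
        by (rule distributed_nn_integral[OF 2(2), symmetric]) auto
      also have "\<dots> = (\<integral>\<^sup>+x. ennreal (normal_density 0 \<sigma> x * (x - 0) ^ (2 * k)) \<partial>lborel)"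
        by (simp add: ennreal_mult normal_density_nonneg)
      also have "\<dots> = ennreal (fact (2 * k) / ((2 / \<sigma>\<^sup>2) ^ k * fact k))"
        using normal_moment_even[OF 2(1), of 0 k]
        by (subst nn_integral_eq_integral) (auto simp: has_bochner_integral_iff normal_density_nonneg)
      also have "fact (2 * k) / ((2 / \<sigma>\<^sup>2) ^ k * fact k) = gauss_moment k * (\<sigma>\<^sup>2) ^ k"
        using 2(1) by (simp add: gauss_moment_def power_divide field_simps)
      finally show ?thesis .
    qed
    have "(\<integral>\<^sup>+\<omega>. ennreal ((X \<omega>)\<^sup>2) \<partial>M) = ennreal (\<sigma>\<^sup>2)"
      using m[of 1] by (simp add: gauss_moment_def)
    then have "(LINT \<omega>|M. (X \<omega>)\<^sup>2) = \<sigma>\<^sup>2"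
      by (subst integral_eq_nn_integral) auto
    then show ?thesis using m[of K] by simp
  qed
qed

context
  fixes M :: "'w measure" and T :: real and W :: "(real \<times> 'a::euclidean_space \<Rightarrow> real) \<Rightarrow> 'w \<Rightarrow> real"
  assumes M: "prob_space M" and W: "white_noise M T W"
begin

lemma white_noise_linear:
  assumes "f \<in> test_functions T" "g \<in> test_functions T"
  shows "AE \<omega> in M. W (\<lambda>z. f z + c * g z) \<omega> = W f \<omega> + c * W g \<omega>"
  using W assms by (simp add: white_noise_def)

lemma white_noise_isometry:
  "f \<in> test_functions T \<Longrightarrow> (LINT \<omega>|M. (W f \<omega>)\<^sup>2) = (LINT z:{0..T} \<times> UNIV|lborel. (f z)\<^sup>2)"
  using W by (simp add: white_noise_def)

lemma white_noise_centered_gaussian: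
  assumes f: "f \<in> test_functions T"
  shows "centered_gaussian M (W f)"
proof -
  have "centered_gaussian_family M (test_functions T) W" using W by (simp add: white_noise_def)
  then have "finite {f} \<and> {f} \<subseteq> test_functions T \<longrightarrow> centered_gaussian M (\<lambda>\<omega>. \<Sum>i\<in>{f}. (\<lambda>_. 1) i * W i \<omega>)"
    unfolding centered_gaussian_family_def by (elim allE)
  with f show "centered_gaussian M (W f)" by simp
qed

lemma white_noise_measurable: "f \<in> test_functions T \<Longrightarrow> W f \<in> borel_measurable M"
  using white_noise_centered_gaussian by (simp add: centered_gaussian_def)

lemma white_noise_moment:
  assumes f: "f \<in> test_functions T"
  shows "(\<integral>\<^sup>+\<omega>. ennreal ((W f \<omega>) ^ (2 * K)) \<partial>M)
    \<le> ennreal (gauss_moment K) * (\<integral>\<^sup>+z\<in>{0..T} \<times> UNIV. ennreal ((f z)\<^sup>2) \<partial>lborel) ^ K"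
proof -
  have [measurable]: "f \<in> borel_measurable borel" by (rule test_function_measurable[OF f])
  have nonneg: "0 \<le> (LINT \<omega>|M. (W f \<omega>)\<^sup>2)" by (intro Bochner_Integration.integral_nonneg) auto
  have "(LINT \<omega>|M. (W f \<omega>)\<^sup>2) = (LINT z:{0..T} \<times> UNIV|lborel. (f z)\<^sup>2)"
    by (rule white_noise_isometry[OF f])
  also have "\<dots> = (LINT z|lborel. indicator ({0..T} \<times> UNIV) z * (f z)\<^sup>2)"
    by (simp add: set_lebesgue_integral_def)
  also have "ennreal \<dots> \<le> (\<integral>\<^sup>+z. ennreal (norm (indicator ({0..T} \<times> UNIV) z * (f z)\<^sup>2)) \<partial>lborel)"
    by (cases "integrable lborel (\<lambda>z. indicator ({0..T} \<times> UNIV) z * (f z)\<^sup>2)")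
       (auto simp: nn_integral_eq_integral not_integrable_integral_eq)
  also have "\<dots> = (\<integral>\<^sup>+z\<in>{0..T} \<times> UNIV. ennreal ((f z)\<^sup>2) \<partial>lborel)"
    by (intro nn_integral_cong) (auto split: split_indicator)
  finally have *: "ennreal (LINT \<omega>|M. (W f \<omega>)\<^sup>2) \<le> (\<integral>\<^sup>+z\<in>{0..T} \<times> UNIV. ennreal ((f z)\<^sup>2) \<partial>lborel)" .
  have "(\<integral>\<^sup>+\<omega>. ennreal ((W f \<omega>) ^ (2 * K)) \<partial>M) \<le> ennreal (gauss_moment K * (LINT \<omega>|M. (W f \<omega>)\<^sup>2) ^ K)"
    by (rule centered_gaussian_moment[OF M white_noise_centered_gaussian[OF f]])
  also have "\<dots> = ennreal (gauss_moment K) * ennreal (LINT \<omega>|M. (W f \<omega>)\<^sup>2) ^ K"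
    using nonneg gauss_moment_pos[of K] by (simp add: ennreal_mult ennreal_power)
  also have "\<dots> \<le> ennreal (gauss_moment K) * (\<integral>\<^sup>+z\<in>{0..T} \<times> UNIV. ennreal ((f z)\<^sup>2) \<partial>lborel) ^ K"
    using * by (intro mult_left_mono power_mono) auto
  finally show ?thesis .
qed

text \<open>Moments pass to the \<open>L\<^sup>2\<close>-limit by Fatou's lemma along an almost surely convergent subsequence.
  The factor 2 comes from \<open>(a + b)\<^sup>2 \<le> 2 a\<^sup>2 + 2 b\<^sup>2\<close> and is harmless, since only the order of magnitude
  of the moments matters.\<close>

lemma wiener_integral_moment:
  assumes h: "wiener_integral M T W h X" and K: "K > 0"
  shows "(\<integral>\<^sup>+\<omega>. ennreal ((X \<omega>) ^ (2 * K)) \<partial>M)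
    \<le> ennreal (gauss_moment K) * (2 * (\<integral>\<^sup>+z\<in>{0..T} \<times> UNIV. ennreal ((h z)\<^sup>2) \<partial>lborel)) ^ K"
proof -
  let ?S = "{0..T} \<times> (UNIV::'a set)"
  define H where "H = (\<integral>\<^sup>+z\<in>?S. ennreal ((h z)\<^sup>2) \<partial>lborel)"
  obtain f where f: "\<And>k. f k \<in> test_functions T"
    and fh: "(\<lambda>k::nat. \<integral>\<^sup>+z\<in>?S. ennreal ((f k z - h z)\<^sup>2) \<partial>lborel) \<longlonglongrightarrow> 0"
    and WX: "(\<lambda>k. \<integral>\<^sup>+\<omega>. ennreal ((W (f k) \<omega> - X \<omega>)\<^sup>2) \<partial>M) \<longlonglongrightarrow> 0"
    and [measurable]: "h \<in> borel_measurable borel" "X \<in> borel_measurable M"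
    using h unfolding wiener_integral_def by auto
  have [measurable]: "f k \<in> borel_measurable borel" for k by (rule test_function_measurable[OF f])
  have [measurable]: "W (f k) \<in> borel_measurable M" for k by (rule white_noise_measurable[OF f])
  have [measurable]: "?S \<in> sets borel" by (intro borel_closed closed_Times) auto
  show ?thesis
  proof (cases "H = \<infinity>")
    case True
    then show ?thesis using K gauss_moment_pos[of K]
      unfolding H_def[symmetric] by (simp add: ennreal_mult_top ennreal_top_mult power_eq_top_ennreal_iff top_power_ennreal)
  next
    case False
    then obtain \<eta> where \<eta>: "\<eta> \<ge> 0" "H = ennreal \<eta>" by (cases H) auto
    have ev: "eventually (\<lambda>k. (\<integral>\<^sup>+\<omega>. ennreal ((W (f k) \<omega> - X \<omega>)\<^sup>2) \<partial>M) < 1) sequentially"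
      using order_tendstoD(2)[OF WX, of 1] by simp
    then obtain N where N: "\<And>k. k \<ge> N \<Longrightarrow> (\<integral>\<^sup>+\<omega>. ennreal ((W (f k) \<omega> - X \<omega>)\<^sup>2) \<partial>M) < 1"
      unfolding eventually_sequentially by blast
    define u where "u k \<omega> = (W (f (k + N)) \<omega> - X \<omega>)\<^sup>2" for k \<omega>
    have iu: "integrable M (u k)" for k
      using N[of "k + N"] unfolding u_def by (intro integrableI_nonneg) (auto intro: less_trans)
    have "(\<lambda>k. ennreal (LINT \<omega>|M. norm (u k \<omega>))) \<longlonglongrightarrow> 0"
    proof -
      have "ennreal (LINT \<omega>|M. norm (u k \<omega>)) = (\<integral>\<^sup>+\<omega>. ennreal ((W (f (k + N)) \<omega> - X \<omega>)\<^sup>2) \<partial>M)" for k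
        using iu[of k] by (subst nn_integral_eq_integral[symmetric]) (auto simp: u_def[abs_def])
      then show ?thesis using LIMSEQ_ignore_initial_segment[OF WX, of N] by simp
    qed
    then have "(\<lambda>k. LINT \<omega>|M. norm (u k \<omega>)) \<longlonglongrightarrow> 0"
      by (subst (asm) ennreal_tendsto_0_iff) auto
    from tendsto_L1_AE_subseq[OF iu this] obtain r where r: "strict_mono r"
      and conv: "AE \<omega> in M. (\<lambda>k. u (r k) \<omega>) \<longlonglongrightarrow> 0" by blast
    define g where "g k = f (r k + N)" for k
    have g: "g k \<in> test_functions T" for k using f by (simp add: g_def)
    have [measurable]: "g k \<in> borel_measurable borel" "W (g k) \<in> borel_measurable M" for k
      by (auto simp: g_def)
    have gh: "(\<lambda>k. \<integral>\<^sup>+z\<in>?S. ennreal ((g k z - h z)\<^sup>2) \<partial>lborel) \<longlonglongrightarrow> 0"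
      unfolding g_def using LIMSEQ_subseq_LIMSEQ[OF LIMSEQ_ignore_initial_segment[OF fh, of N] r] by (simp add: comp_def)
    have bound: "(\<integral>\<^sup>+\<omega>. ennreal ((X \<omega>) ^ (2 * K)) \<partial>M) \<le> ennreal (gauss_moment K) * (2 * H + 2 * ennreal \<epsilon>) ^ K"
      if \<epsilon>: "\<epsilon> > 0" for \<epsilon> :: real
    proof -
      have "(\<integral>\<^sup>+\<omega>. ennreal ((X \<omega>) ^ (2 * K)) \<partial>M) \<le> (\<integral>\<^sup>+\<omega>. liminf (\<lambda>k. ennreal ((W (g k) \<omega>) ^ (2 * K))) \<partial>M)"
      proof (intro nn_integral_mono_AE, use conv in eventually_elim)
        fix \<omega> assume "(\<lambda>k. u (r k) \<omega>) \<longlonglongrightarrow> 0"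
        then have "(\<lambda>k. sqrt (u (r k) \<omega>)) \<longlonglongrightarrow> sqrt 0" by (rule tendsto_real_sqrt)
        then have "(\<lambda>k. W (g k) \<omega> - X \<omega>) \<longlonglongrightarrow> 0"
          by (simp add: u_def g_def tendsto_rabs_zero_iff)
        then have "(\<lambda>k. W (g k) \<omega>) \<longlonglongrightarrow> X \<omega>" by (simp add: LIM_zero_iff)
        then have "(\<lambda>k. ennreal ((W (g k) \<omega>) ^ (2 * K))) \<longlonglongrightarrow> ennreal ((X \<omega>) ^ (2 * K))"
          by (intro tendsto_intros)
        then show "ennreal ((X \<omega>) ^ (2 * K)) \<le> liminf (\<lambda>k. ennreal ((W (g k) \<omega>) ^ (2 * K)))"
          by (intro eq_refl lim_imp_Liminf[symmetric]) auto
      qed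
      also have "\<dots> \<le> liminf (\<lambda>k. \<integral>\<^sup>+\<omega>. ennreal ((W (g k) \<omega>) ^ (2 * K)) \<partial>M)"
        by (intro nn_integral_liminf) auto
      also have "\<dots> \<le> liminf (\<lambda>k::nat. ennreal (gauss_moment K) * (2 * H + 2 * ennreal \<epsilon>) ^ K)"
      proof (intro Liminf_mono)
        have "eventually (\<lambda>k. (\<integral>\<^sup>+z\<in>?S. ennreal ((g k z - h z)\<^sup>2) \<partial>lborel) < ennreal \<epsilon>) sequentially"
          using order_tendstoD(2)[OF gh, of "ennreal \<epsilon>"] \<epsilon> by simp
        then show "eventually (\<lambda>k. (\<integral>\<^sup>+\<omega>. ennreal ((W (g k) \<omega>) ^ (2 * K)) \<partial>M)
            \<le> ennreal (gauss_moment K) * (2 * H + 2 * ennreal \<epsilon>) ^ K) sequentially"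
        proof eventually_elim
          case (elim k)
          have "(\<integral>\<^sup>+z\<in>?S. ennreal ((g k z)\<^sup>2) \<partial>lborel)
              \<le> (\<integral>\<^sup>+z. 2 * (ennreal ((h z)\<^sup>2) * indicator ?S z) + 2 * (ennreal ((g k z - h z)\<^sup>2) * indicator ?S z) \<partial>lborel)"
          proof (intro nn_integral_mono)
            fix z
            have "(g k z)\<^sup>2 \<le> 2 * (h z)\<^sup>2 + 2 * (g k z - h z)\<^sup>2"
              using power2_add_le[of "h z" "g k z - h z"] by simp
            then have "ennreal ((g k z)\<^sup>2) \<le> ennreal (2 * (h z)\<^sup>2 + 2 * (g k z - h z)\<^sup>2)" by (rule ennreal_leI)
            also have "\<dots> = 2 * ennreal ((h z)\<^sup>2) + 2 * ennreal ((g k z - h z)\<^sup>2)"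
              by (simp add: ennreal_mult)
            finally show "ennreal ((g k z)\<^sup>2) * indicator ?S z
                \<le> 2 * (ennreal ((h z)\<^sup>2) * indicator ?S z) + 2 * (ennreal ((g k z - h z)\<^sup>2) * indicator ?S z)"
              by (auto split: split_indicator)
          qed
          also have "\<dots> = 2 * H + 2 * (\<integral>\<^sup>+z\<in>?S. ennreal ((g k z - h z)\<^sup>2) \<partial>lborel)"
            unfolding H_def by (subst nn_integral_add; (subst nn_integral_cmult)?) (auto simp: nn_integral_cmult)
          also have "\<dots> \<le> 2 * H + 2 * ennreal \<epsilon>"
            using elim by (intro add_left_mono mult_left_mono) auto
          finally have "(\<integral>\<^sup>+z\<in>?S. ennreal ((g k z)\<^sup>2) \<partial>lborel) \<le> 2 * H + 2 * ennreal \<epsilon>" .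
          then show ?case
            by (intro order_trans[OF white_noise_moment[OF g]] mult_left_mono power_mono) auto
        qed
      qed
      also have "\<dots> = ennreal (gauss_moment K) * (2 * H + 2 * ennreal \<epsilon>) ^ K" by (simp add: Liminf_const)
      finally show ?thesis .
    qed
    have "(\<lambda>k. ennreal (gauss_moment K * (2 * \<eta> + 2 * inverse (real (Suc k))) ^ K))
        \<longlonglongrightarrow> ennreal (gauss_moment K * (2 * \<eta> + 2 * 0) ^ K)"
      by (intro tendsto_intros LIMSEQ_inverse_real_of_nat)
    moreover have "(\<integral>\<^sup>+\<omega>. ennreal ((X \<omega>) ^ (2 * K)) \<partial>M) \<le> ennreal (gauss_moment K * (2 * \<eta> + 2 * inverse (real (Suc k))) ^ K)" for k
    proof -
      have "2 * H + 2 * ennreal (inverse (real (Suc k))) = ennreal (2 * \<eta> + 2 * inverse (real (Suc k)))"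
        using \<eta> by (simp add: two_ennreal ennreal_plus[symmetric] del: ennreal_plus of_nat_Suc)
      moreover have "0 < inverse (real (Suc k))" by simp
      ultimately have "(\<integral>\<^sup>+\<omega>. ennreal ((X \<omega>) ^ (2 * K)) \<partial>M)
          \<le> ennreal (gauss_moment K) * ennreal (2 * \<eta> + 2 * inverse (real (Suc k))) ^ K"
        using bound[of "inverse (real (Suc k))"] by metis
      then show ?thesis
        using \<eta>(1) gauss_moment_pos[of K] by (simp add: ennreal_mult ennreal_power del: of_nat_Suc ennreal_plus)
    qed
    ultimately have "(\<integral>\<^sup>+\<omega>. ennreal ((X \<omega>) ^ (2 * K)) \<partial>M) \<le> ennreal (gauss_moment K * (2 * \<eta> + 2 * 0) ^ K)"
      by (intro LIMSEQ_le_const[of "\<lambda>k. ennreal (gauss_moment K * (2 * \<eta> + 2 * inverse (real (Suc k))) ^ K)"]) auto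
    then show ?thesis
      using \<eta> gauss_moment_pos[of K] unfolding H_def[symmetric]
      by (simp add: ennreal_mult ennreal_power[symmetric])
  qed
qed

lemma wiener_integral_comb:
  assumes h: "wiener_integral M T W h X" and k: "wiener_integral M T W k Y"
  shows "wiener_integral M T W (\<lambda>z. h z + c * k z) (\<lambda>\<omega>. X \<omega> + c * Y \<omega>)"
proof -
  let ?S = "{0..T} \<times> (UNIV::'a set)"
  obtain f where f: "\<And>j. f j \<in> test_functions T"
    and fh: "(\<lambda>j::nat. \<integral>\<^sup>+z\<in>?S. ennreal ((f j z - h z)\<^sup>2) \<partial>lborel) \<longlonglongrightarrow> 0"
    and WX: "(\<lambda>j. \<integral>\<^sup>+\<omega>. ennreal ((W (f j) \<omega> - X \<omega>)\<^sup>2) \<partial>M) \<longlonglongrightarrow> 0"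
    and [measurable]: "h \<in> borel_measurable borel" "X \<in> borel_measurable M"
    using h unfolding wiener_integral_def by auto
  obtain g where g: "\<And>j. g j \<in> test_functions T"
    and gk: "(\<lambda>j::nat. \<integral>\<^sup>+z\<in>?S. ennreal ((g j z - k z)\<^sup>2) \<partial>lborel) \<longlonglongrightarrow> 0"
    and WY: "(\<lambda>j. \<integral>\<^sup>+\<omega>. ennreal ((W (g j) \<omega> - Y \<omega>)\<^sup>2) \<partial>M) \<longlonglongrightarrow> 0"
    and [measurable]: "k \<in> borel_measurable borel" "Y \<in> borel_measurable M"
    using k unfolding wiener_integral_def by auto
  have [measurable]: "f j \<in> borel_measurable borel" "g j \<in> borel_measurable borel" for j
    by (auto intro: test_function_measurable f g)
  have [measurable]: "W (f j) \<in> borel_measurable M" "W (g j) \<in> borel_measurable M" for j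
    by (auto intro: white_noise_measurable f g)
  have [measurable]: "?S \<in> sets borel" by (intro borel_closed closed_Times) auto
  have sq: "ennreal ((a + c * b)\<^sup>2) \<le> 2 * ennreal (a\<^sup>2) + ennreal (2 * c\<^sup>2) * ennreal (b\<^sup>2)" for a b :: real
  proof -
    have "ennreal ((a + c * b)\<^sup>2) \<le> ennreal (2 * a\<^sup>2 + 2 * c\<^sup>2 * b\<^sup>2)"
      using power2_add_le[of a "c * b"] by (intro ennreal_leI) (simp add: power_mult_distrib)
    also have "\<dots> = 2 * ennreal (a\<^sup>2) + ennreal (2 * c\<^sup>2) * ennreal (b\<^sup>2)"
      by (subst ennreal_plus) (auto simp: ennreal_mult)
    finally show ?thesis .
  qed
  have lim0: "F \<longlonglongrightarrow> 0" if "A \<longlonglongrightarrow> 0" "B \<longlonglongrightarrow> 0" "\<And>j. F j \<le> 2 * A j + ennreal (2 * c\<^sup>2) * B j" for A B F :: "nat \<Rightarrow> ennreal"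
  proof (rule tendsto_sandwich[OF _ _ tendsto_const])
    have "(\<lambda>j. 2 * A j + ennreal (2 * c\<^sup>2) * B j) \<longlonglongrightarrow> 2 * 0 + ennreal (2 * c\<^sup>2) * 0"
      by (intro tendsto_add ennreal_tendsto_cmult that) auto
    then show "(\<lambda>j. 2 * A j + ennreal (2 * c\<^sup>2) * B j) \<longlonglongrightarrow> 0" by simp
  qed (use that in auto)
  show ?thesis
    unfolding wiener_integral_def
  proof (intro conjI exI allI)
    show "(\<lambda>z. f j z + c * g j z) \<in> test_functions T" for j by (intro test_functions_comb f g)
    show "(\<lambda>j. \<integral>\<^sup>+z\<in>?S. ennreal ((f j z + c * g j z - (h z + c * k z))\<^sup>2) \<partial>lborel) \<longlonglongrightarrow> 0"
    proof (rule lim0[OF fh gk])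
      fix j
      have "(\<integral>\<^sup>+z\<in>?S. ennreal ((f j z + c * g j z - (h z + c * k z))\<^sup>2) \<partial>lborel)
          \<le> (\<integral>\<^sup>+z. 2 * (ennreal ((f j z - h z)\<^sup>2) * indicator ?S z) + ennreal (2 * c\<^sup>2) * (ennreal ((g j z - k z)\<^sup>2) * indicator ?S z) \<partial>lborel)"
      proof (intro nn_integral_mono)
        fix z
        have e: "f j z + c * g j z - (h z + c * k z) = (f j z - h z) + c * (g j z - k z)" by (simp add: algebra_simps)
        show "ennreal ((f j z + c * g j z - (h z + c * k z))\<^sup>2) * indicator ?S z
            \<le> 2 * (ennreal ((f j z - h z)\<^sup>2) * indicator ?S z) + ennreal (2 * c\<^sup>2) * (ennreal ((g j z - k z)\<^sup>2) * indicator ?S z)"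
          unfolding e using sq[of "f j z - h z" "g j z - k z"] by (auto split: split_indicator)
      qed
      also have "\<dots> = 2 * (\<integral>\<^sup>+z\<in>?S. ennreal ((f j z - h z)\<^sup>2) \<partial>lborel)
          + ennreal (2 * c\<^sup>2) * (\<integral>\<^sup>+z\<in>?S. ennreal ((g j z - k z)\<^sup>2) \<partial>lborel)"
        by (subst nn_integral_add) (auto simp: nn_integral_cmult)
      finally show "(\<integral>\<^sup>+z\<in>?S. ennreal ((f j z + c * g j z - (h z + c * k z))\<^sup>2) \<partial>lborel) \<le> \<dots>" .
    qed
    show "(\<lambda>j. \<integral>\<^sup>+\<omega>. ennreal ((W (\<lambda>z. f j z + c * g j z) \<omega> - (X \<omega> + c * Y \<omega>))\<^sup>2) \<partial>M) \<longlonglongrightarrow> 0"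
    proof (rule lim0[OF WX WY])
      fix j
      have lin: "AE \<omega> in M. W (\<lambda>z. f j z + c * g j z) \<omega> = W (f j) \<omega> + c * W (g j) \<omega>"
        by (rule white_noise_linear[OF f g])
      have "(\<integral>\<^sup>+\<omega>. ennreal ((W (\<lambda>z. f j z + c * g j z) \<omega> - (X \<omega> + c * Y \<omega>))\<^sup>2) \<partial>M)
          \<le> (\<integral>\<^sup>+\<omega>. 2 * ennreal ((W (f j) \<omega> - X \<omega>)\<^sup>2) + ennreal (2 * c\<^sup>2) * ennreal ((W (g j) \<omega> - Y \<omega>)\<^sup>2) \<partial>M)"
      proof (intro nn_integral_mono_AE, use lin in eventually_elim)
        fix \<omega> assume l: "W (\<lambda>z. f j z + c * g j z) \<omega> = W (f j) \<omega> + c * W (g j) \<omega>"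
        have e: "W (f j) \<omega> + c * W (g j) \<omega> - (X \<omega> + c * Y \<omega>) = (W (f j) \<omega> - X \<omega>) + c * (W (g j) \<omega> - Y \<omega>)"
          by (simp add: algebra_simps)
        show "ennreal ((W (\<lambda>z. f j z + c * g j z) \<omega> - (X \<omega> + c * Y \<omega>))\<^sup>2)
            \<le> 2 * ennreal ((W (f j) \<omega> - X \<omega>)\<^sup>2) + ennreal (2 * c\<^sup>2) * ennreal ((W (g j) \<omega> - Y \<omega>)\<^sup>2)"
          unfolding l e by (rule sq)
      qed
      also have "\<dots> = 2 * (\<integral>\<^sup>+\<omega>. ennreal ((W (f j) \<omega> - X \<omega>)\<^sup>2) \<partial>M)
          + ennreal (2 * c\<^sup>2) * (\<integral>\<^sup>+\<omega>. ennreal ((W (g j) \<omega> - Y \<omega>)\<^sup>2) \<partial>M)"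
        by (subst nn_integral_add) (auto simp: nn_integral_cmult)
      finally show "(\<integral>\<^sup>+\<omega>. ennreal ((W (\<lambda>z. f j z + c * g j z) \<omega> - (X \<omega> + c * Y \<omega>))\<^sup>2) \<partial>M) \<le> \<dots>" .
    qed
  qed auto
qed

lemma wiener_integral_zero: "wiener_integral M T W (\<lambda>_. 0) (\<lambda>_. 0)"
  unfolding wiener_integral_def
proof (intro conjI exI[of _ "\<lambda>_::nat. \<lambda>_. 0"] allI zero_test_function)
  have "(\<integral>\<^sup>+\<omega>. ennreal ((W (\<lambda>_. 0) \<omega>)\<^sup>2) \<partial>M) = 0"
    using white_noise_moment[OF zero_test_function, of 1] by simp
  then show "(\<lambda>k. \<integral>\<^sup>+\<omega>. ennreal ((W (\<lambda>_. 0) \<omega> - 0)\<^sup>2) \<partial>M) \<longlonglongrightarrow> 0" by simp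
qed auto

lemma complex_wiener_integral_comb:
  assumes h: "complex_wiener_integral M T W h X" and k: "complex_wiener_integral M T W k Y"
  shows "complex_wiener_integral M T W (\<lambda>z. h z + c * k z) (\<lambda>\<omega>. X \<omega> + c * Y \<omega>)"
proof -
  have hR: "wiener_integral M T W (\<lambda>z. Re (h z)) (\<lambda>\<omega>. Re (X \<omega>))" and hI: "wiener_integral M T W (\<lambda>z. Im (h z)) (\<lambda>\<omega>. Im (X \<omega>))"
    and kR: "wiener_integral M T W (\<lambda>z. Re (k z)) (\<lambda>\<omega>. Re (Y \<omega>))" and kI: "wiener_integral M T W (\<lambda>z. Im (k z)) (\<lambda>\<omega>. Im (Y \<omega>))"
    using h k unfolding complex_wiener_integral_def by auto
  show ?thesis
    unfolding complex_wiener_integral_def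
    using wiener_integral_comb[OF wiener_integral_comb[OF hR kR, of "Re c"] kI, of "- Im c"]
      wiener_integral_comb[OF wiener_integral_comb[OF hI kI, of "Re c"] kR, of "Im c"]
    by (simp add: algebra_simps)
qed

lemma complex_wiener_integral_sum:
  assumes "finite F" and "\<And>i. i \<in> F \<Longrightarrow> complex_wiener_integral M T W (h i) (X i)"
  shows "complex_wiener_integral M T W (\<lambda>z. \<Sum>i\<in>F. c i * h i z) (\<lambda>\<omega>. \<Sum>i\<in>F. c i * X i \<omega>)"
  using assms
proof (induction F rule: finite_induct)
  case empty
  then show ?case using wiener_integral_zero by (simp add: complex_wiener_integral_def)
next
  case (insert i F)
  then show ?case
    using complex_wiener_integral_comb[of "\<lambda>z. \<Sum>i\<in>F. c i * h i z" "\<lambda>\<omega>. \<Sum>i\<in>F. c i * X i \<omega>" "h i" "X i" "c i"]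
    by (simp add: add.commute)
qed

text \<open>Real and imaginary parts are estimated separately; \<open>|X|\<^sup>2 \<le> 2 max (Re X)\<^sup>2 (Im X)\<^sup>2\<close> accounts for one of the two factors
  \<open>2\<^sup>K\<close>.\<close>

lemma complex_wiener_integral_moment:
  assumes h: "complex_wiener_integral M T W h X" and K: "K > 0"
  shows "(\<integral>\<^sup>+\<omega>. ennreal ((cmod (X \<omega>)) ^ (2 * K)) \<partial>M)
    \<le> ennreal (2 * 4 ^ K * gauss_moment K) * (\<integral>\<^sup>+z\<in>{0..T} \<times> UNIV. ennreal ((cmod (h z))\<^sup>2) \<partial>lborel) ^ K"
proof -
  let ?S = "{0..T} \<times> (UNIV::'a set)"
  let ?H = "\<integral>\<^sup>+z\<in>?S. ennreal ((cmod (h z))\<^sup>2) \<partial>lborel"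
  have hR: "wiener_integral M T W (\<lambda>z. Re (h z)) (\<lambda>\<omega>. Re (X \<omega>))" and hI: "wiener_integral M T W (\<lambda>z. Im (h z)) (\<lambda>\<omega>. Im (X \<omega>))"
    using h unfolding complex_wiener_integral_def by auto
  then have [measurable]: "(\<lambda>\<omega>. Re (X \<omega>)) \<in> borel_measurable M" "(\<lambda>\<omega>. Im (X \<omega>)) \<in> borel_measurable M"
    unfolding wiener_integral_def by auto
  have part: "(\<integral>\<^sup>+\<omega>. ennreal ((Y \<omega>) ^ (2 * K)) \<partial>M) \<le> ennreal (gauss_moment K) * (2 * ?H) ^ K"
    if "wiener_integral M T W k Y" "\<And>z. \<bar>k z\<bar> \<le> cmod (h z)" for k Y
  proof -
    have "(\<integral>\<^sup>+z\<in>?S. ennreal ((k z)\<^sup>2) \<partial>lborel) \<le> ?H"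
      using power_mono[OF that(2), of _ 2]
      by (intro nn_integral_mono mult_right_mono ennreal_leI) auto
    then show ?thesis
      by (intro order_trans[OF wiener_integral_moment[OF that(1) K]] mult_left_mono power_mono) auto
  qed
  have pw: "ennreal ((cmod z) ^ (2 * K)) \<le> ennreal (2 ^ K) * ennreal ((Re z) ^ (2 * K)) + ennreal (2 ^ K) * ennreal ((Im z) ^ (2 * K))" for z
  proof -
    have p: "(a + b) ^ K \<le> 2 ^ K * a ^ K + 2 ^ K * b ^ K" if "0 \<le> a" "0 \<le> b" for a b :: real
    proof -
      have "(a + b) ^ K \<le> (2 * max a b) ^ K" using that by (intro power_mono) auto
      also have "\<dots> = 2 ^ K * (max a b) ^ K" by (rule power_mult_distrib)
      also have "(max a b) ^ K \<le> a ^ K + b ^ K" using that by (cases "a \<le> b") (auto simp: max_def)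
      finally show ?thesis by (simp add: distrib_left)
    qed
    have "(cmod z) ^ (2 * K) = ((Re z)\<^sup>2 + (Im z)\<^sup>2) ^ K" by (simp add: power_mult cmod_power2)
    also have "\<dots> \<le> 2 ^ K * (Re z) ^ (2 * K) + 2 ^ K * (Im z) ^ (2 * K)"
      using p[of "(Re z)\<^sup>2" "(Im z)\<^sup>2"] by (simp add: power_mult)
    finally have "ennreal ((cmod z) ^ (2 * K)) \<le> ennreal (2 ^ K * (Re z) ^ (2 * K) + 2 ^ K * (Im z) ^ (2 * K))"
      by (rule ennreal_leI)
    also have "\<dots> = ennreal (2 ^ K) * ennreal ((Re z) ^ (2 * K)) + ennreal (2 ^ K) * ennreal ((Im z) ^ (2 * K))"
      by (subst ennreal_plus) (auto simp: ennreal_mult' power_mult)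
    finally show ?thesis .
  qed
  have "(\<integral>\<^sup>+\<omega>. ennreal ((cmod (X \<omega>)) ^ (2 * K)) \<partial>M)
      \<le> (\<integral>\<^sup>+\<omega>. ennreal (2 ^ K) * ennreal ((Re (X \<omega>)) ^ (2 * K)) + ennreal (2 ^ K) * ennreal ((Im (X \<omega>)) ^ (2 * K)) \<partial>M)"
    by (intro nn_integral_mono pw)
  also have "\<dots> = ennreal (2 ^ K) * (\<integral>\<^sup>+\<omega>. ennreal ((Re (X \<omega>)) ^ (2 * K)) \<partial>M) + ennreal (2 ^ K) * (\<integral>\<^sup>+\<omega>. ennreal ((Im (X \<omega>)) ^ (2 * K)) \<partial>M)"
    by (subst nn_integral_add) (auto simp: nn_integral_cmult)
  also have "\<dots> \<le> ennreal (2 ^ K) * (ennreal (gauss_moment K) * (2 * ?H) ^ K) + ennreal (2 ^ K) * (ennreal (gauss_moment K) * (2 * ?H) ^ K)"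
    using part[OF hR] part[OF hI] by (intro add_mono mult_left_mono) (auto simp: abs_Re_le_cmod abs_Im_le_cmod)
  also have "\<dots> = ennreal (2 * 4 ^ K * gauss_moment K) * ?H ^ K"
  proof -
    have "(4::real) ^ K = 2 ^ K * 2 ^ K" by (simp flip: power_mult_distrib)
    then have "ennreal (2 * 4 ^ K * gauss_moment K) = 2 * (ennreal (2 ^ K) * (ennreal (gauss_moment K) * 2 ^ K))"
      using gauss_moment_pos[of K] by (simp add: ennreal_mult mult_ac flip: ennreal_power)
    then show ?thesis
      by (simp only: power_mult_distrib mult_2[symmetric] mult_ac)
  qed
  finally show ?thesis .
qed

end

section \<open>Spectral domination\<close>

definition moment_const :: "nat \<Rightarrow> real" where
  "moment_const K = 2 * 4 ^ K * gauss_moment K"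

lemma moment_const_pos: "moment_const K > 0"
  unfolding moment_const_def using gauss_moment_pos by simp

text \<open>The process \<open>Z\<close> is dominated by a stationary Gaussian process with spectral density \<open>v\<close>: even moments of
  linear combinations are bounded as they would be for the latter. The noise enters the
  estimates below through this property.\<close>

definition spectrally_dominated :: "'w measure \<Rightarrow> ('a::euclidean_space \<Rightarrow> 'w \<Rightarrow> complex) \<Rightarrow> ('a \<Rightarrow> real) \<Rightarrow> bool" where
  "spectrally_dominated M Z v \<longleftrightarrow> (\<forall>z. Z z \<in> borel_measurable M) \<and>
     (\<forall>K>0. \<forall>F c. finite F \<longrightarrow>
       (\<integral>\<^sup>+\<omega>. ennreal (cmod (\<Sum>z\<in>F. c z * Z z \<omega>) ^ (2 * K)) \<partial>M)
       \<le> ennreal (moment_const K) * (\<integral>\<^sup>+\<xi>. ennreal (v \<xi> * (cmod (\<Sum>z\<in>F. c z * cis (z \<bullet> \<xi>)))\<^sup>2) \<partial>lborel) ^ K)"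

text \<open>The spatial Fourier transform of the kernel of the truncated convolution at time \<open>t\<close>, without the
  weight \<open>\<langle>\<xi>\<rangle>\<^bsup>-\<alpha>\<^esup>\<close> and the phase that carries the space variable. The noise acts at time \<open>t'\<close>.\<close>

definition oscillation :: "nat \<Rightarrow> real \<Rightarrow> real \<Rightarrow> 'a::euclidean_space \<Rightarrow> complex" where
  "oscillation n t t' \<xi> = (if 0 \<le> t' \<and> t' \<le> t \<and> norm \<xi> \<le> real n then cis ((t - t') * (norm \<xi>)\<^sup>2) else 0)"

lemma oscillation_measurable [measurable]:
  "(\<lambda>(t', \<xi>). oscillation n t t' \<xi>) \<in> borel_measurable (lborel \<Otimes>\<^sub>M lborel)"
  unfolding oscillation_def by measurable

lemma integrable_bounded_ball:
  fixes f :: "'a::euclidean_space \<Rightarrow> complex"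
  assumes [measurable]: "f \<in> borel_measurable borel" and B: "\<And>x. cmod (f x) \<le> B" and 0: "\<And>x. norm x > R \<Longrightarrow> f x = 0"
  shows "integrable lborel f"
proof (rule Bochner_Integration.integrable_bound)
  show "integrable lborel (\<lambda>x::'a. B * indicator (cball 0 R) x :: real)"
    by (intro integrable_mult_right) (use emeasure_bounded_finite[OF bounded_cball, of 0 R] in \<open>auto simp: integrable_indicator_iff\<close>)
  show "AE x in lborel. norm (f x) \<le> norm (B * indicator (cball 0 R) x :: real)"
  proof (intro AE_I2)
    fix x :: 'a
    have "0 \<le> B" using order_trans[OF norm_ge_zero B[of x]] .
    then show "norm (f x) \<le> norm (B * indicator (cball 0 R) x :: real)"
      using B[of x] 0[of x] by (cases "norm x \<le> R") auto
  qed
qed simp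

lemma ft_sum:
  assumes "finite I" "\<And>i. i \<in> I \<Longrightarrow> integrable lborel (f i)"
  shows "ft e (\<lambda>y. \<Sum>i\<in>I. c i * f i y) \<xi> = (\<Sum>i\<in>I. c i * ft e (f i) \<xi>)"
  using assms
proof (induction I rule: finite_induct)
  case (insert i I)
  then have "ft e (\<lambda>y. c i * f i y + (\<Sum>i\<in>I. c i * f i y)) \<xi> = ft e (\<lambda>y. c i * f i y) \<xi> + ft e (\<lambda>y. \<Sum>i\<in>I. c i * f i y) \<xi>"
    by (intro ft_add Bochner_Integration.integrable_sum integrable_mult_right) auto
  with insert show ?case by (simp add: ft_scale)
qed (simp add: ft_def)

lemma trunc_kernel_eq_ft:
  fixes z x' :: "'a::euclidean_space"
  shows "indicator {0..t} t' * trunc_kernel \<alpha> n (t - t') (z - x')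
    = of_real (1 / (2 * pi) ^ DIM('a)) * ft (-1) (\<lambda>\<xi>. oscillation n t t' \<xi> * of_real (jap (- \<alpha>) \<xi>) * cis (z \<bullet> \<xi>)) x'"
proof -
  have "trunc_kernel \<alpha> n (t - t') (z - x') = of_real (1 / (2 * pi) ^ DIM('a)) *
      (LINT \<xi>|lborel. of_real (indicator (cball 0 (real n)) \<xi>) * cis ((t - t') * (norm \<xi>)\<^sup>2) * of_real (jap (- \<alpha>) \<xi>)
         * cis (z \<bullet> \<xi>) * cis (-1 * (x' \<bullet> \<xi>)))"
  proof -
    have "indicator (cball 0 (real n)) \<xi> *\<^sub>R (cis ((t - t') * (norm \<xi>)\<^sup>2) / of_real ((1 + (norm \<xi>)\<^sup>2) powr (\<alpha> / 2)) * cis ((z - x') \<bullet> \<xi>))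
      = of_real (indicator (cball 0 (real n)) \<xi>) * cis ((t - t') * (norm \<xi>)\<^sup>2) * of_real (jap (- \<alpha>) \<xi>)
         * cis (z \<bullet> \<xi>) * cis (-1 * (x' \<bullet> \<xi>))" for \<xi> :: 'a
    proof -
      have "cis ((z - x') \<bullet> \<xi>) = cis (z \<bullet> \<xi>) * cis (-1 * (x' \<bullet> \<xi>))"
        by (simp add: inner_diff_left cis_mult)
      moreover have "complex_of_real (jap (- \<alpha>) \<xi>) = inverse (of_real ((1 + (norm \<xi>)\<^sup>2) powr (\<alpha> / 2)))"
        unfolding jap_minus of_real_inverse by (simp only: jap_def)
      ultimately show ?thesis by (simp only: scaleR_conv_of_real divide_inverse mult_ac)
    qed
    then show ?thesis
      by (simp add: trunc_kernel_def set_lebesgue_integral_def)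
  qed
  then show ?thesis
    by (cases "t' \<in> {0..t}")
       (auto simp: ft_def oscillation_def mult.assoc intro!: Bochner_Integration.integral_cong)
qed

text \<open>The \<open>L\<^sup>2\<close>-norm of a combination of kernels, by Bessel's inequality in the space variable.\<close>

lemma kernel_energy:
  fixes z :: "'i \<Rightarrow> 'a::euclidean_space"
  assumes I: "finite I"
    and H: "\<And>t' x'. H (t', x') = (\<Sum>i\<in>I. c i * (indicator {0..t i} t' * trunc_kernel \<alpha> (n i) (t i - t') (z i - x')))"
    and [measurable]: "H \<in> borel_measurable borel"
  shows "(\<integral>\<^sup>+p\<in>{0..T} \<times> UNIV. ennreal ((cmod (H p))\<^sup>2) \<partial>lborel)
    \<le> ennreal (1 / (2 * pi) ^ DIM('a)) * (\<integral>\<^sup>+\<xi>. (\<integral>\<^sup>+t'\<in>{0..T}.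
         ennreal (jap (- 2 * \<alpha>) \<xi> * (cmod (\<Sum>i\<in>I. c i * (oscillation (n i) (t i) t' \<xi> * cis (z i \<bullet> \<xi>))))\<^sup>2) \<partial>lborel) \<partial>lborel)"
proof -
  define \<Phi> where "\<Phi> t' \<xi> = (\<Sum>i\<in>I. c i * (oscillation (n i) (t i) t' \<xi> * of_real (jap (- \<alpha>) \<xi>) * cis (z i \<bullet> \<xi>)))" for t' \<xi>
  let ?k = "1 / (2 * pi) ^ DIM('a)"
  have int: "integrable lborel (\<lambda>\<xi>. oscillation (n i) (t i) t' \<xi> * of_real (jap (- \<alpha>) \<xi>) * cis (z i \<bullet> \<xi>))" for i t'
  proof (rule integrable_bounded_ball[where R="real (n i)" and B="jap \<bar>\<alpha>\<bar> (real (n i) *\<^sub>R (SOME b. b \<in> (Basis::'a set)))"])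
    fix \<xi> :: 'a
    show "cmod (oscillation (n i) (t i) t' \<xi> * of_real (jap (- \<alpha>) \<xi>) * cis (z i \<bullet> \<xi>)) \<le> jap \<bar>\<alpha>\<bar> (real (n i) *\<^sub>R (SOME b. b \<in> (Basis::'a set)))"
    proof (cases "norm \<xi> \<le> real (n i)")
      case True
      have "jap (- \<alpha>) \<xi> \<le> jap \<bar>\<alpha>\<bar> \<xi>" by (rule jap_mono) simp
      also have "\<dots> \<le> jap \<bar>\<alpha>\<bar> (real (n i) *\<^sub>R (SOME b. b \<in> (Basis::'a set)))"
        unfolding jap_def using True SOME_Basis[where 'a='a]
        by (intro powr_mono2) (auto intro!: power_mono)
      finally show ?thesis
        using jap_nonneg[of "\<bar>\<alpha>\<bar>" "real (n i) *\<^sub>R (SOME b. b \<in> (Basis::'a set))"]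
        by (simp add: oscillation_def norm_mult)
    next
      case False
      then show ?thesis by (simp add: oscillation_def)
    qed
    show "oscillation (n i) (t i) t' \<xi> * of_real (jap (- \<alpha>) \<xi>) * cis (z i \<bullet> \<xi>) = 0" if "norm \<xi> > real (n i)"
      using that by (simp add: oscillation_def)
  qed auto
  have \<Phi>int: "integrable lborel (\<Phi> t')" for t'
    unfolding \<Phi>_def by (intro Bochner_Integration.integrable_sum integrable_mult_right int)
  have [measurable]: "(\<lambda>(t', \<xi>). \<Phi> t' \<xi>) \<in> borel_measurable (lborel \<Otimes>\<^sub>M lborel)"
    unfolding \<Phi>_def by measurable
  have Hft: "H (t', x') = of_real ?k * ft (-1) (\<Phi> t') x'" for t' x'
  proof -
    have "ft (-1) (\<Phi> t') x' = (\<Sum>i\<in>I. c i * ft (-1) (\<lambda>\<xi>. oscillation (n i) (t i) t' \<xi> * of_real (jap (- \<alpha>) \<xi>) * cis (z i \<bullet> \<xi>)) x')"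
      unfolding \<Phi>_def by (intro ft_sum I int)
    then show ?thesis unfolding H trunc_kernel_eq_ft by (simp add: sum_distrib_left mult_ac)
  qed
  have \<Phi>sq: "(cmod (\<Phi> t' \<xi>))\<^sup>2 = jap (- 2 * \<alpha>) \<xi> * (cmod (\<Sum>i\<in>I. c i * (oscillation (n i) (t i) t' \<xi> * cis (z i \<bullet> \<xi>))))\<^sup>2" for t' \<xi>
  proof -
    have "\<Phi> t' \<xi> = of_real (jap (- \<alpha>) \<xi>) * (\<Sum>i\<in>I. c i * (oscillation (n i) (t i) t' \<xi> * cis (z i \<bullet> \<xi>)))"
      unfolding \<Phi>_def by (simp add: sum_distrib_left mult_ac)
    then show ?thesis by (simp add: norm_mult power_mult_distrib jap_power mult.commute)
  qed
  have S[measurable]: "{0..T} \<times> (UNIV::'a set) \<in> sets borel" by (intro borel_closed closed_Times) auto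
  have Hm: "H \<in> borel_measurable (lborel \<Otimes>\<^sub>M lborel)"
    unfolding lborel_prod by measurable
  have "(\<integral>\<^sup>+p\<in>{0..T} \<times> UNIV. ennreal ((cmod (H p))\<^sup>2) \<partial>lborel)
      = (\<integral>\<^sup>+p. ennreal ((cmod (H p))\<^sup>2) * indicator ({0..T} \<times> UNIV) p \<partial>(lborel \<Otimes>\<^sub>M lborel))"
    by (simp add: lborel_prod)
  also have "\<dots> = (\<integral>\<^sup>+t'. \<integral>\<^sup>+x'. ennreal ((cmod (H (t', x')))\<^sup>2) * indicator ({0..T} \<times> UNIV) (t', x') \<partial>lborel \<partial>lborel)"
    using Hm by (intro lborel.nn_integral_fst[symmetric]) (auto simp: lborel_prod)
  also have "\<dots> \<le> (\<integral>\<^sup>+t'. \<integral>\<^sup>+\<xi>. ennreal ?k * (ennreal ((cmod (\<Phi> t' \<xi>))\<^sup>2) * indicator {0..T} t') \<partial>lborel \<partial>lborel)"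
  proof (rule nn_integral_mono)
    fix t'
    have [measurable]: "\<Phi> t' \<in> borel_measurable borel" using borel_measurable_integrable[OF \<Phi>int] by simp
    have fm: "(\<lambda>x'. ft (- 1) (\<Phi> t') x') \<in> borel_measurable lborel"
      unfolding ft_def by measurable
    have "(\<integral>\<^sup>+x'. ennreal ((cmod (H (t', x')))\<^sup>2) * indicator ({0..T} \<times> UNIV) (t', x') \<partial>lborel)
        = (\<integral>\<^sup>+x'. (ennreal (?k\<^sup>2) * indicator {0..T} t') * ennreal ((cmod (ft (-1) (\<Phi> t') x'))\<^sup>2) \<partial>lborel)"
    proof (intro nn_integral_cong)
      have "ennreal ((cmod (of_real r * w))\<^sup>2) = ennreal (r\<^sup>2) * ennreal ((cmod w)\<^sup>2)" for r :: real and w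
        by (simp add: norm_mult power_mult_distrib ennreal_mult)
      then show "ennreal ((cmod (H (t', x')))\<^sup>2) * indicator ({0..T} \<times> UNIV) (t', x')
          = (ennreal (?k\<^sup>2) * indicator {0..T} t') * ennreal ((cmod (ft (-1) (\<Phi> t') x'))\<^sup>2)" for x'
        unfolding Hft by (auto split: split_indicator simp del: of_real_divide of_real_power)
    qed
    also have "\<dots> = (ennreal (?k\<^sup>2) * indicator {0..T} t') * (\<integral>\<^sup>+x'. ennreal ((cmod (ft (-1) (\<Phi> t') x'))\<^sup>2) \<partial>lborel)"
      using fm by (intro nn_integral_cmult) auto
    also have "\<dots> \<le> (ennreal (?k\<^sup>2) * indicator {0..T} t') * (ennreal ((2 * pi) ^ DIM('a)) * (\<integral>\<^sup>+\<xi>. ennreal ((cmod (\<Phi> t' \<xi>))\<^sup>2) \<partial>lborel))"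
      by (intro mult_left_mono ft_bessel \<Phi>int) auto
    also have "\<dots> = (ennreal (?k\<^sup>2) * ennreal ((2 * pi) ^ DIM('a))) * indicator {0..T} t' * (\<integral>\<^sup>+\<xi>. ennreal ((cmod (\<Phi> t' \<xi>))\<^sup>2) \<partial>lborel)"
      by (simp only: mult_ac)
    also have "ennreal (?k\<^sup>2) * ennreal ((2 * pi) ^ DIM('a)) = ennreal ?k"
      by (subst ennreal_mult[symmetric]) (auto simp: power2_eq_square)
    also have "ennreal ?k * indicator {0..T} t' * (\<integral>\<^sup>+\<xi>. ennreal ((cmod (\<Phi> t' \<xi>))\<^sup>2) \<partial>lborel)
        = (\<integral>\<^sup>+\<xi>. ennreal ?k * (ennreal ((cmod (\<Phi> t' \<xi>))\<^sup>2) * indicator {0..T} t') \<partial>lborel)"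
      by (subst nn_integral_cmult[symmetric]) (auto simp: mult_ac)
    finally show "(\<integral>\<^sup>+x'. ennreal ((cmod (H (t', x')))\<^sup>2) * indicator ({0..T} \<times> UNIV) (t', x') \<partial>lborel)
        \<le> (\<integral>\<^sup>+\<xi>. ennreal ?k * (ennreal ((cmod (\<Phi> t' \<xi>))\<^sup>2) * indicator {0..T} t') \<partial>lborel)" .
  qed
  also have "\<dots> = (\<integral>\<^sup>+\<xi>. \<integral>\<^sup>+t'. ennreal ?k * (ennreal ((cmod (\<Phi> t' \<xi>))\<^sup>2) * indicator {0..T} t') \<partial>lborel \<partial>lborel)"
    by (rule lborel_pair.Fubini'[symmetric]) measurable
  also have "\<dots> = (\<integral>\<^sup>+\<xi>. ennreal ?k * (\<integral>\<^sup>+t'. ennreal ((cmod (\<Phi> t' \<xi>))\<^sup>2) * indicator {0..T} t' \<partial>lborel) \<partial>lborel)"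
    by (intro nn_integral_cong nn_integral_cmult) measurable
  also have "\<dots> = ennreal ?k * (\<integral>\<^sup>+\<xi>. \<integral>\<^sup>+t'. ennreal ((cmod (\<Phi> t' \<xi>))\<^sup>2) * indicator {0..T} t' \<partial>lborel \<partial>lborel)"
    by (intro nn_integral_cmult) measurable
  finally show ?thesis unfolding \<Phi>sq .
qed

text \<open>Different truncations and times may enter one combination, since increments in both are of this kind.\<close>

lemma truncated_convolution_moment:
  fixes \<Psi> :: "nat \<Rightarrow> real \<Rightarrow> 'a::euclidean_space \<Rightarrow> 'w \<Rightarrow> complex"
  assumes M: "prob_space M" and W: "white_noise M T W"
    and \<Psi>: "\<And>n. truncated_convolution M T W \<alpha> n (\<Psi> n)"
    and I: "finite I" and t: "\<And>i. i \<in> I \<Longrightarrow> t i \<in> {0..T}" and K: "K > 0"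
  shows "(\<integral>\<^sup>+\<omega>. ennreal (cmod (\<Sum>i\<in>I. c i * \<Psi> (n i) (t i) (z i) \<omega>) ^ (2 * K)) \<partial>M)
    \<le> ennreal (moment_const K) * (ennreal (1 / (2 * pi) ^ DIM('a)) * (\<integral>\<^sup>+\<xi>. (\<integral>\<^sup>+t'\<in>{0..T}.
         ennreal (jap (- 2 * \<alpha>) \<xi> * (cmod (\<Sum>i\<in>I. c i * (oscillation (n i) (t i) t' \<xi> * cis (z i \<bullet> \<xi>))))\<^sup>2) \<partial>lborel) \<partial>lborel)) ^ K"
proof -
  have "\<forall>i\<in>I. \<exists>X. complex_wiener_integral M T W
      (\<lambda>(t', x'). indicator {0..t i} t' * trunc_kernel \<alpha> (n i) (t i - t') (z i - x')) X \<and> (AE \<omega> in M. \<Psi> (n i) (t i) (z i) \<omega> = - \<i> * X \<omega>)"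
    using \<Psi> t unfolding truncated_convolution_def by fast
  then obtain X where X: "\<And>i. i \<in> I \<Longrightarrow> complex_wiener_integral M T W
      (\<lambda>(t', x'). indicator {0..t i} t' * trunc_kernel \<alpha> (n i) (t i - t') (z i - x')) (X i)"
    and ae: "\<And>i. i \<in> I \<Longrightarrow> AE \<omega> in M. \<Psi> (n i) (t i) (z i) \<omega> = - \<i> * X i \<omega>"
    unfolding bchoice_iff by blast
  define H where "H = (\<lambda>p. \<Sum>i\<in>I. c i * (case p of (t', x') \<Rightarrow> indicator {0..t i} t' * trunc_kernel \<alpha> (n i) (t i - t') (z i - x')))"
  have CW: "complex_wiener_integral M T W H (\<lambda>\<omega>. \<Sum>i\<in>I. c i * X i \<omega>)"
    unfolding H_def by (rule complex_wiener_integral_sum[OF M W I X])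
  then have "(\<lambda>z. complex_of_real (Re (H z)) + \<i> * complex_of_real (Im (H z))) \<in> borel_measurable borel"
    unfolding complex_wiener_integral_def wiener_integral_def by (intro borel_measurable_add borel_measurable_times) auto
  then have Hm: "H \<in> borel_measurable borel" by (simp flip: complex_eq)
  have "(\<integral>\<^sup>+\<omega>. ennreal (cmod (\<Sum>i\<in>I. c i * \<Psi> (n i) (t i) (z i) \<omega>) ^ (2 * K)) \<partial>M)
      = (\<integral>\<^sup>+\<omega>. ennreal (cmod (\<Sum>i\<in>I. c i * X i \<omega>) ^ (2 * K)) \<partial>M)"
  proof (intro nn_integral_cong_AE)
    have "AE \<omega> in M. \<forall>i\<in>I. \<Psi> (n i) (t i) (z i) \<omega> = - \<i> * X i \<omega>"
      using I ae by (intro AE_finite_allI) auto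
    then show "AE \<omega> in M. ennreal (cmod (\<Sum>i\<in>I. c i * \<Psi> (n i) (t i) (z i) \<omega>) ^ (2 * K)) = ennreal (cmod (\<Sum>i\<in>I. c i * X i \<omega>) ^ (2 * K))"
    proof eventually_elim
      case (elim \<omega>)
      then have "(\<Sum>i\<in>I. c i * \<Psi> (n i) (t i) (z i) \<omega>) = - \<i> * (\<Sum>i\<in>I. c i * X i \<omega>)"
        by (auto simp: sum_distrib_left mult_ac intro!: sum.cong)
      then show ?case by (simp add: norm_mult)
    qed
  qed
  also have "\<dots> \<le> ennreal (2 * 4 ^ K * gauss_moment K) * (\<integral>\<^sup>+p\<in>{0..T} \<times> UNIV. ennreal ((cmod (H p))\<^sup>2) \<partial>lborel) ^ K"
    by (rule complex_wiener_integral_moment[OF M W CW K])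
  also have "\<dots> \<le> ennreal (moment_const K) * (ennreal (1 / (2 * pi) ^ DIM('a)) * (\<integral>\<^sup>+\<xi>. (\<integral>\<^sup>+t'\<in>{0..T}.
         ennreal (jap (- 2 * \<alpha>) \<xi> * (cmod (\<Sum>i\<in>I. c i * (oscillation (n i) (t i) t' \<xi> * cis (z i \<bullet> \<xi>))))\<^sup>2) \<partial>lborel) \<partial>lborel)) ^ K"
    unfolding moment_const_def by (intro mult_left_mono power_mono kernel_energy[OF I _ Hm]) (auto simp: H_def)
  finally show ?thesis .
qed

text \<open>The kernels at different points differ by a phase only. The sum over the points therefore factors out of
  the energy, and what remains is the time integral of the squared multiplier, which \<open>v\<close> dominates.\<close>

lemma truncated_convolution_spectrally_dominated:
  fixes \<Psi> :: "nat \<Rightarrow> real \<Rightarrow> 'a::euclidean_space \<Rightarrow> 'w \<Rightarrow> complex"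
  assumes M: "prob_space M" and W: "white_noise M T W"
    and \<Psi>: "\<And>n. truncated_convolution M T W \<alpha> n (\<Psi> n)"
    and J: "finite J" and t: "\<And>j. j \<in> J \<Longrightarrow> t j \<in> {0..T}"
    and v: "\<And>\<xi>. 0 \<le> v \<xi>" and [measurable]: "v \<in> borel_measurable borel"
    and energy: "\<And>\<xi>. (\<integral>\<^sup>+t'\<in>{0..T}. ennreal ((cmod (\<Sum>j\<in>J. e j * oscillation (n j) (t j) t' (\<xi>::'a)))\<^sup>2) \<partial>lborel) \<le> ennreal (v \<xi>)"
  shows "spectrally_dominated M (\<lambda>y \<omega>. \<Sum>j\<in>J. e j * \<Psi> (n j) (t j) y \<omega>) (\<lambda>\<xi>. 1 / (2 * pi) ^ DIM('a) * (jap (- 2 * \<alpha>) \<xi> * v \<xi>))"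
  unfolding spectrally_dominated_def
proof (intro conjI allI impI)
  have \<Psi>m: "\<Psi> (n j) (t j) y \<in> borel_measurable M" if "j \<in> J" for j y
    using \<Psi> t[OF that] unfolding truncated_convolution_def by blast
  then show "(\<lambda>\<omega>. \<Sum>j\<in>J. e j * \<Psi> (n j) (t j) y \<omega>) \<in> borel_measurable M" for y
    by (intro borel_measurable_sum borel_measurable_times) auto
  fix K :: nat and F :: "'a set" and c assume K: "K > 0" and F: "finite F"
  let ?k = "1 / (2 * pi) ^ DIM('a)"
  have FJ: "finite (F \<times> J)" using F J by simp
  have tt: "t (snd i) \<in> {0..T}" if "i \<in> F \<times> J" for i using that t by auto
  have prod_eq: "(\<Sum>i\<in>F \<times> J. (c (fst i) * e (snd i)) * (f (snd i) * g (fst i)))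
      = (\<Sum>z\<in>F. c z * g z) * (\<Sum>j\<in>J. e j * f j)" for f :: "_ \<Rightarrow> complex" and g
    by (simp add: sum_product sum.cartesian_product case_prod_unfold mult_ac)
  have dbl_eq: "(\<Sum>z\<in>F. c z * (\<Sum>j\<in>J. e j * \<Psi> (n j) (t j) z \<omega>)) = (\<Sum>i\<in>F \<times> J. (c (fst i) * e (snd i)) * \<Psi> (n (snd i)) (t (snd i)) (fst i) \<omega>)" for \<omega>
    by (simp add: sum_distrib_left sum.cartesian_product case_prod_unfold mult_ac)
  have 1: "(\<integral>\<^sup>+\<omega>. ennreal (cmod (\<Sum>z\<in>F. c z * (\<Sum>j\<in>J. e j * \<Psi> (n j) (t j) z \<omega>)) ^ (2 * K)) \<partial>M)
    \<le> ennreal (moment_const K) * (ennreal ?k * (\<integral>\<^sup>+\<xi>. (\<integral>\<^sup>+t'\<in>{0..T}. ennreal (jap (- 2 * \<alpha>) \<xi> *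
        (cmod (\<Sum>i\<in>F \<times> J. (c (fst i) * e (snd i)) * (oscillation (n (snd i)) (t (snd i)) t' \<xi> * cis (fst i \<bullet> \<xi>))))\<^sup>2) \<partial>lborel) \<partial>lborel)) ^ K"
    unfolding dbl_eq by (rule truncated_convolution_moment[OF M W \<Psi> FJ tt K])
  have 2: "(\<integral>\<^sup>+\<xi>. (\<integral>\<^sup>+t'\<in>{0..T}. ennreal (jap (- 2 * \<alpha>) \<xi> *
        (cmod (\<Sum>i\<in>F \<times> J. (c (fst i) * e (snd i)) * (oscillation (n (snd i)) (t (snd i)) t' \<xi> * cis (fst i \<bullet> \<xi>))))\<^sup>2) \<partial>lborel) \<partial>lborel)
     \<le> (\<integral>\<^sup>+\<xi>. ennreal (jap (- 2 * \<alpha>) \<xi> * v \<xi> * (cmod (\<Sum>z\<in>F. c z * cis (z \<bullet> \<xi>)))\<^sup>2) \<partial>lborel)"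
  proof (intro nn_integral_mono)
    fix \<xi> :: 'a
    let ?A = "jap (- 2 * \<alpha>) \<xi> * (cmod (\<Sum>z\<in>F. c z * cis (z \<bullet> \<xi>)))\<^sup>2"
    have "(\<integral>\<^sup>+t'\<in>{0..T}. ennreal (jap (- 2 * \<alpha>) \<xi> *
        (cmod (\<Sum>i\<in>F \<times> J. (c (fst i) * e (snd i)) * (oscillation (n (snd i)) (t (snd i)) t' \<xi> * cis (fst i \<bullet> \<xi>))))\<^sup>2) \<partial>lborel)
      = (\<integral>\<^sup>+t'. ennreal ?A * (ennreal ((cmod (\<Sum>j\<in>J. e j * oscillation (n j) (t j) t' \<xi>))\<^sup>2) * indicator {0..T} t') \<partial>lborel)"
      by (intro nn_integral_cong, subst prod_eq[of "\<lambda>j. oscillation (n j) (t j) _ \<xi>" "\<lambda>z. cis (z \<bullet> \<xi>)"])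
         (auto simp: norm_mult power_mult_distrib mult_ac simp flip: ennreal_mult split: split_indicator)
    also have "\<dots> = ennreal ?A * (\<integral>\<^sup>+t'\<in>{0..T}. ennreal ((cmod (\<Sum>j\<in>J. e j * oscillation (n j) (t j) t' \<xi>))\<^sup>2) \<partial>lborel)"
      by (intro nn_integral_cmult) (unfold oscillation_def, measurable)
    also have "\<dots> \<le> ennreal ?A * ennreal (v \<xi>)" by (intro mult_left_mono energy) auto
    also have "\<dots> = ennreal (jap (- 2 * \<alpha>) \<xi> * v \<xi> * (cmod (\<Sum>z\<in>F. c z * cis (z \<bullet> \<xi>)))\<^sup>2)"
      using v by (subst ennreal_mult[symmetric]) (auto simp: mult_ac)
    finally show "(\<integral>\<^sup>+t'\<in>{0..T}. ennreal (jap (- 2 * \<alpha>) \<xi> *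
        (cmod (\<Sum>i\<in>F \<times> J. (c (fst i) * e (snd i)) * (oscillation (n (snd i)) (t (snd i)) t' \<xi> * cis (fst i \<bullet> \<xi>))))\<^sup>2) \<partial>lborel)
      \<le> ennreal (jap (- 2 * \<alpha>) \<xi> * v \<xi> * (cmod (\<Sum>z\<in>F. c z * cis (z \<bullet> \<xi>)))\<^sup>2)" .
  qed
  have 3: "ennreal ?k * (\<integral>\<^sup>+\<xi>. ennreal (jap (- 2 * \<alpha>) \<xi> * v \<xi> * (cmod (\<Sum>z\<in>F. c z * cis (z \<bullet> \<xi>)))\<^sup>2) \<partial>lborel)
      = (\<integral>\<^sup>+\<xi>. ennreal (?k * (jap (- 2 * \<alpha>) \<xi> * v \<xi>) * (cmod (\<Sum>z\<in>F. c z * cis (z \<bullet> \<xi>)))\<^sup>2) \<partial>lborel)"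
    using v by (subst nn_integral_cmult[symmetric]) (auto intro!: nn_integral_cong simp: mult_ac simp flip: ennreal_mult)
  show "(\<integral>\<^sup>+\<omega>. ennreal (cmod (\<Sum>z\<in>F. c z * (\<Sum>j\<in>J. e j * \<Psi> (n j) (t j) z \<omega>)) ^ (2 * K)) \<partial>M)
    \<le> ennreal (moment_const K) * (\<integral>\<^sup>+\<xi>. ennreal (?k * (jap (- 2 * \<alpha>) \<xi> * v \<xi>) * (cmod (\<Sum>z\<in>F. c z * cis (z \<bullet> \<xi>)))\<^sup>2) \<partial>lborel) ^ K"
    unfolding 3[symmetric] by (rule order_trans[OF 1]) (intro mult_left_mono power_mono 2; simp)
qed

section \<open>From finite combinations to integrals\<close>

text \<open>Riemann sums adapted to measurable integrands: replacing \<open>Z y\<close> by \<open>Z (s k y)\<close> turns an integral over \<open>y\<close> into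
  a finite combination.\<close>

lemma simple_approximation_of_identity:
  obtains s :: "nat \<Rightarrow> 'a::euclidean_space \<Rightarrow> 'a" where
    "\<And>k. finite (range (s k))" "\<And>k. s k \<in> borel_measurable borel"
    "\<And>y. (\<lambda>k. s k y) \<longlonglongrightarrow> y" "\<And>k y. norm (s k y) \<le> 2 * norm y"
proof -
  have "(\<lambda>y. y) \<in> borel_measurable (borel :: 'a measure)" by simp
  from borel_measurable_implies_sequence_metric[OF this, of 0]
  obtain s :: "nat \<Rightarrow> 'a \<Rightarrow> 'a" where s: "\<And>k. simple_function borel (s k)" "\<And>y. (\<lambda>k. s k y) \<longlonglongrightarrow> y" "\<And>k y. norm (s k y) \<le> 2 * norm y"
    by auto
  show ?thesis
    by (rule that[of s]) (use s in \<open>auto simp: simple_function_def borel_measurable_simple_function\<close>)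
qed

lemma integral_finite_range:
  fixes c :: "'a::euclidean_space \<Rightarrow> complex" and s :: "'a \<Rightarrow> 'a"
  assumes c: "integrable lborel c" and F: "finite (range s)" and [measurable]: "s \<in> borel_measurable borel"
  shows "(LINT y|lborel. c y * h (s y)) = (\<Sum>z\<in>range s. (LINT y|lborel. c y * indicator {z} (s y)) * h z)"
proof -
  note [measurable] = borel_measurable_integrable[OF c]
  have int: "integrable lborel (\<lambda>y. c y * indicator {z} (s y))" for z
    by (rule Bochner_Integration.integrable_bound[OF c]) (auto simp: norm_mult split: split_indicator)
  have "c y * h (s y) = (\<Sum>z\<in>range s. c y * indicator {z} (s y) * h z)" for y
  proof -
    have "(\<Sum>z\<in>range s. c y * indicator {z} (s y) * h z) = (\<Sum>z\<in>{s y}. c y * indicator {z} (s y) * h z)"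
      using F by (intro sum.mono_neutral_right) (auto split: split_indicator)
    then show ?thesis by simp
  qed
  then have "(LINT y|lborel. c y * h (s y)) = (LINT y|lborel. (\<Sum>z\<in>range s. c y * indicator {z} (s y) * h z))" by simp
  also have "\<dots> = (\<Sum>z\<in>range s. (LINT y|lborel. c y * indicator {z} (s y) * h z))"
    by (intro Bochner_Integration.integral_sum integrable_mult_left int)
  finally show ?thesis by simp
qed

lemma continuous_process_measurable:
  fixes Z :: "'a::euclidean_space \<Rightarrow> 'w \<Rightarrow> complex"
  assumes Z: "\<And>y. Z y \<in> borel_measurable M" and cont: "\<And>\<omega>. continuous_on UNIV (\<lambda>y. Z y \<omega>)"
  shows "(\<lambda>(y, \<omega>). Z y \<omega>) \<in> borel_measurable (borel \<Otimes>\<^sub>M M)"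
proof -
  obtain s :: "nat \<Rightarrow> 'a \<Rightarrow> 'a" where s: "\<And>k. finite (range (s k))" "\<And>k. s k \<in> borel_measurable borel"
    "\<And>y. (\<lambda>k. s k y) \<longlonglongrightarrow> y" "\<And>k y. norm (s k y) \<le> 2 * norm y" using simple_approximation_of_identity by blast
  note [measurable] = s(2) Z
  have eq: "Z (s k y) \<omega> = (\<Sum>z\<in>range (s k). indicator {z} (s k y) * Z z \<omega>)" for k y \<omega>
  proof -
    have "(\<Sum>z\<in>range (s k). indicator {z} (s k y) * Z z \<omega>) = (\<Sum>z\<in>{s k y}. indicator {z} (s k y) * Z z \<omega>)"
      using s(1)[of k] by (intro sum.mono_neutral_right) (auto split: split_indicator)
    then show ?thesis by simp
  qed
  have "(\<lambda>p. Z (s k (fst p)) (snd p)) \<in> borel_measurable (borel \<Otimes>\<^sub>M M)" for k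
    unfolding eq by measurable
  moreover have "(\<lambda>k. Z (s k (fst p)) (snd p)) \<longlonglongrightarrow> Z (fst p) (snd p)" for p
    using cont[of "snd p"] s(3)[of "fst p"]
    by (intro isCont_tendsto_compose[of _ "\<lambda>y. Z y (snd p)"]) (auto simp: continuous_on_eq_continuous_at)
  ultimately have "(\<lambda>p. Z (fst p) (snd p)) \<in> borel_measurable (borel \<Otimes>\<^sub>M M)"
    by (rule borel_measurable_LIMSEQ_metric)
  then show ?thesis by (simp add: case_prod_unfold)
qed

lemma liminf_le_of_tendsto:
  fixes f g :: "nat \<Rightarrow> ennreal"
  assumes "g \<longlonglongrightarrow> l" "\<And>k. f k \<le> g k"
  shows "liminf f \<le> l"
proof -
  have "liminf f \<le> liminf g" using assms(2) by (intro Liminf_mono) auto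
  also have "\<dots> = l" using assms(1) by (intro lim_imp_Liminf) auto
  finally show ?thesis .
qed

text \<open>Fatou's lemma, in the form used for passing moment bounds to limits.\<close>

lemma moment_limit:
  fixes X :: "nat \<Rightarrow> 'w \<Rightarrow> complex"
  assumes X: "\<And>k. X k \<in> borel_measurable M" and conv: "AE \<omega> in M. (\<lambda>k. X k \<omega>) \<longlonglongrightarrow> Y \<omega>"
    and bound: "\<And>k. (\<integral>\<^sup>+\<omega>. ennreal (cmod (X k \<omega>) ^ m) \<partial>M) \<le> ennreal (b k)" and b: "b \<longlonglongrightarrow> B"
  shows "(\<integral>\<^sup>+\<omega>. ennreal (cmod (Y \<omega>) ^ m) \<partial>M) \<le> ennreal B"
proof -
  note [measurable] = X
  have "(\<integral>\<^sup>+\<omega>. ennreal (cmod (Y \<omega>) ^ m) \<partial>M) \<le> (\<integral>\<^sup>+\<omega>. liminf (\<lambda>k. ennreal (cmod (X k \<omega>) ^ m)) \<partial>M)"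
  proof (intro nn_integral_mono_AE, use conv in eventually_elim)
    fix \<omega> assume "(\<lambda>k. X k \<omega>) \<longlonglongrightarrow> Y \<omega>"
    then have "(\<lambda>k. ennreal (cmod (X k \<omega>) ^ m)) \<longlonglongrightarrow> ennreal (cmod (Y \<omega>) ^ m)" by (intro tendsto_intros)
    then show "ennreal (cmod (Y \<omega>) ^ m) \<le> liminf (\<lambda>k. ennreal (cmod (X k \<omega>) ^ m))"
      by (intro eq_refl lim_imp_Liminf[symmetric]) auto
  qed
  also have "\<dots> \<le> liminf (\<lambda>k. \<integral>\<^sup>+\<omega>. ennreal (cmod (X k \<omega>) ^ m) \<partial>M)"
    by (intro nn_integral_liminf) auto
  also have "\<dots> \<le> ennreal B"
    by (rule liminf_le_of_tendsto[OF _ bound]) (intro tendsto_ennrealI b)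
  finally show ?thesis .
qed

text \<open>The weighted integral is a limit of finite combinations of values of \<open>Z\<close>. The same combinations of characters
  converge boundedly to the Fourier transform of the weight, so that both sides of the moment bound pass to
  the limit.\<close>

lemma spectrally_dominated_integral:
  fixes Z :: "'a::euclidean_space \<Rightarrow> 'w \<Rightarrow> complex" and c :: "'a \<Rightarrow> complex"
  assumes Z: "spectrally_dominated M Z v" and cont: "\<And>\<omega>. continuous_on UNIV (\<lambda>y. Z y \<omega>)"
    and v: "integrable lborel v" "\<And>\<xi>. 0 \<le> v \<xi>"
    and c: "integrable lborel c" and supp: "\<And>y. norm y > R \<Longrightarrow> c y = 0" and K: "K > 0"
  shows "(\<integral>\<^sup>+\<omega>. ennreal (cmod (LINT y|lborel. c y * Z y \<omega>) ^ (2 * K)) \<partial>M)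
    \<le> ennreal (moment_const K * (LINT \<xi>|lborel. v \<xi> * (cmod (ft 1 c \<xi>))\<^sup>2) ^ K)"
proof -
  obtain s :: "nat \<Rightarrow> 'a \<Rightarrow> 'a" where s: "\<And>k. finite (range (s k))" "\<And>k. s k \<in> borel_measurable borel"
    "\<And>y. (\<lambda>k. s k y) \<longlonglongrightarrow> y" "\<And>k y. norm (s k y) \<le> 2 * norm y" using simple_approximation_of_identity by blast
  note [measurable] = s(2) borel_measurable_integrable[OF c] borel_measurable_integrable[OF v(1)]
  have Zm[measurable]: "Z y \<in> borel_measurable M" for y using Z by (simp add: spectrally_dominated_def)
  have Zc[measurable]: "(\<lambda>y. Z y \<omega>) \<in> borel_measurable borel" for \<omega>
    by (intro borel_measurable_continuous_onI cont)
  define a where "a k z = (LINT y|lborel. c y * indicator {z} (s k y))" for k z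
  define X where "X k \<omega> = (\<Sum>z\<in>range (s k). a k z * Z z \<omega>)" for k \<omega>
  define g where "g k \<xi> = (\<Sum>z\<in>range (s k). a k z * cis (z \<bullet> \<xi>))" for k \<xi>
  have Xeq: "X k \<omega> = (LINT y|lborel. c y * Z (s k y) \<omega>)" for k \<omega>
    unfolding X_def a_def by (rule integral_finite_range[OF c s(1,2), symmetric])
  have geq: "g k \<xi> = (LINT y|lborel. c y * cis (s k y \<bullet> \<xi>))" for k \<xi>
    unfolding g_def a_def by (rule integral_finite_range[OF c s(1,2), symmetric])
  have Xconv: "(\<lambda>k. X k \<omega>) \<longlonglongrightarrow> (LINT y|lborel. c y * Z y \<omega>)" for \<omega>
  proof -
    have "bounded ((\<lambda>y. Z y \<omega>) ` cball 0 (2 * R))"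
      by (intro compact_imp_bounded compact_continuous_image continuous_on_subset[OF cont]) auto
    then obtain B where B: "\<And>y. norm y \<le> 2 * R \<Longrightarrow> cmod (Z y \<omega>) \<le> B"
      unfolding bounded_iff by (metis imageI mem_cball_0)
    show ?thesis unfolding Xeq
    proof (rule integral_dominated_convergence[where w="\<lambda>y. cmod (c y) * B"])
      show "integrable lborel (\<lambda>y. cmod (c y) * B)" using c by (intro integrable_mult_left integrable_norm)
      show "AE y in lborel. (\<lambda>k. c y * Z (s k y) \<omega>) \<longlonglongrightarrow> c y * Z y \<omega>"
        using cont[of \<omega>] s(3)
        by (intro AE_I2 tendsto_mult_left isCont_tendsto_compose[of _ "\<lambda>y. Z y \<omega>"]) (auto simp: continuous_on_eq_continuous_at)
      show "AE y in lborel. norm (c y * Z (s k y) \<omega>) \<le> cmod (c y) * B" for k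
      proof (intro AE_I2)
        fix y
        show "norm (c y * Z (s k y) \<omega>) \<le> cmod (c y) * B"
        proof (cases "norm y > R")
          case False
          then have "norm (s k y) \<le> 2 * R" using s(4)[of k y] by linarith
          then show ?thesis using B by (simp add: norm_mult mult_left_mono)
        qed (simp add: supp)
      qed
    qed auto
  qed
  have gconv: "(\<lambda>k. g k \<xi>) \<longlonglongrightarrow> ft 1 c \<xi>" for \<xi>
  proof -
    have "(\<lambda>k. LINT y|lborel. c y * cis (s k y \<bullet> \<xi>)) \<longlonglongrightarrow> (LINT y|lborel. c y * cis (y \<bullet> \<xi>))"
    proof (rule integral_dominated_convergence[where w="\<lambda>y. cmod (c y)"])
      show "AE y in lborel. (\<lambda>k. c y * cis (s k y \<bullet> \<xi>)) \<longlonglongrightarrow> c y * cis (y \<bullet> \<xi>)"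
        by (intro AE_I2 tendsto_mult_left tendsto_cis tendsto_inner s(3) tendsto_const)
    qed (use c in \<open>auto simp: norm_mult\<close>)
    then show ?thesis unfolding geq ft_def by (simp add: inner_commute)
  qed
  have gbound: "cmod (g k \<xi>) \<le> (LINT y|lborel. cmod (c y))" for k \<xi>
    unfolding geq by (rule order_trans[OF integral_norm_bound]) (simp add: norm_mult)
  have gm[measurable]: "g k \<in> borel_measurable borel" for k unfolding g_def by measurable
  have w: "integrable lborel (\<lambda>\<xi>. v \<xi> * (LINT y|lborel. cmod (c y))\<^sup>2)" using v(1) by (rule integrable_mult_left)
  have sqb: "norm (v \<xi> * (cmod (g k \<xi>))\<^sup>2) \<le> v \<xi> * (LINT y|lborel. cmod (c y))\<^sup>2" for k \<xi>
    using v(2)[of \<xi>] power_mono[OF gbound[of k \<xi>], of 2] by (simp add: abs_mult mult_left_mono)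
  have gint: "integrable lborel (\<lambda>\<xi>. v \<xi> * (cmod (g k \<xi>))\<^sup>2)" for k
    by (rule Bochner_Integration.integrable_bound[OF w]) (use sqb[of _ k] in \<open>auto intro!: AE_I2 order_trans[OF _ abs_ge_self]\<close>)
  have lim: "(\<lambda>k. LINT \<xi>|lborel. v \<xi> * (cmod (g k \<xi>))\<^sup>2) \<longlonglongrightarrow> (LINT \<xi>|lborel. v \<xi> * (cmod (ft 1 c \<xi>))\<^sup>2)"
  proof (rule integral_dominated_convergence[OF _ _ w])
    show "AE \<xi> in lborel. (\<lambda>k. v \<xi> * (cmod (g k \<xi>))\<^sup>2) \<longlonglongrightarrow> v \<xi> * (cmod (ft 1 c \<xi>))\<^sup>2"
      by (intro AE_I2 tendsto_intros gconv)
    show "(\<lambda>\<xi>. v \<xi> * (cmod (ft 1 c \<xi>))\<^sup>2) \<in> borel_measurable lborel"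
      unfolding ft_def by measurable
  qed (use sqb in auto)
  show ?thesis
  proof (rule moment_limit[where X=X and b="\<lambda>k. moment_const K * (LINT \<xi>|lborel. v \<xi> * (cmod (g k \<xi>))\<^sup>2) ^ K"])
    show "X k \<in> borel_measurable M" for k unfolding X_def by measurable
    show "AE \<omega> in M. (\<lambda>k. X k \<omega>) \<longlonglongrightarrow> (LINT y|lborel. c y * Z y \<omega>)" by (simp add: Xconv)
    show "(\<integral>\<^sup>+\<omega>. ennreal (cmod (X k \<omega>) ^ (2 * K)) \<partial>M) \<le> ennreal (moment_const K * (LINT \<xi>|lborel. v \<xi> * (cmod (g k \<xi>))\<^sup>2) ^ K)" for k
    proof -
      have nonneg: "0 \<le> (LINT \<xi>|lborel. v \<xi> * (cmod (g k \<xi>))\<^sup>2)"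
        using v(2) by (intro Bochner_Integration.integral_nonneg) auto
      have "(\<integral>\<^sup>+\<omega>. ennreal (cmod (X k \<omega>) ^ (2 * K)) \<partial>M)
          \<le> ennreal (moment_const K) * (\<integral>\<^sup>+\<xi>. ennreal (v \<xi> * (cmod (g k \<xi>))\<^sup>2) \<partial>lborel) ^ K"
        using Z K s(1)[of k] unfolding spectrally_dominated_def X_def g_def by simp
      also have "(\<integral>\<^sup>+\<xi>. ennreal (v \<xi> * (cmod (g k \<xi>))\<^sup>2) \<partial>lborel) = ennreal (LINT \<xi>|lborel. v \<xi> * (cmod (g k \<xi>))\<^sup>2)"
        using v(2) by (intro nn_integral_eq_integral gint) auto
      also have "ennreal (moment_const K) * ennreal (LINT \<xi>|lborel. v \<xi> * (cmod (g k \<xi>))\<^sup>2) ^ K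
          = ennreal (moment_const K * (LINT \<xi>|lborel. v \<xi> * (cmod (g k \<xi>))\<^sup>2) ^ K)"
        using nonneg moment_const_pos[of K] by (simp add: ennreal_mult ennreal_power)
      finally show ?thesis .
    qed
    show "(\<lambda>k. moment_const K * (LINT \<xi>|lborel. v \<xi> * (cmod (g k \<xi>))\<^sup>2) ^ K)
        \<longlonglongrightarrow> moment_const K * (LINT \<xi>|lborel. v \<xi> * (cmod (ft 1 c \<xi>))\<^sup>2) ^ K"
      by (intro tendsto_intros lim)
  qed
qed

section \<open>Bessel potentials of localised processes\<close>

text \<open>The operator \<open>\<langle>\<nabla>\<rangle>\<^bsup>-s\<^esup>\<close> on functions whose weighted Fourier transform is integrable.\<close>

definition potential :: "real \<Rightarrow> ('a::euclidean_space \<Rightarrow> complex) \<Rightarrow> 'a \<Rightarrow> complex" where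
  "potential s g = inv_fourier (\<lambda>\<eta>. of_real (jap (- s) \<eta>) * fourier g \<eta>)"

lemma norm_inv_fourier_le:
  fixes f :: "'a::euclidean_space \<Rightarrow> complex"
  shows "cmod (inv_fourier f x) \<le> (LINT \<eta>|lborel. cmod (f \<eta>))"
proof -
  have "1 \<le> (2 * pi) ^ DIM('a)" using pi_gt3 by (intro one_le_power) simp
  then have "1 / (2 * pi) ^ DIM('a) \<le> 1" by simp
  then have "1 / (2 * pi) ^ DIM('a) * cmod (ft 1 f x) \<le> 1 * cmod (ft 1 f x)" by (intro mult_right_mono) auto
  then have "cmod (inv_fourier f x) \<le> cmod (ft 1 f x)"
    unfolding inv_fourier_eq_ft norm_mult norm_of_real by simp
  then show ?thesis using norm_ft_le[of 1 f x] by linarith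
qed

lemma lborel_integral_translate:
  fixes f :: "'a::euclidean_space \<Rightarrow> complex"
  assumes [measurable]: "f \<in> borel_measurable borel"
  shows "(LINT \<eta>|lborel. f \<eta>) = (LINT \<eta>|lborel. f (c + \<eta>))"
  by (subst lborel_distr_plus[of c, symmetric]) (simp add: integral_distr)

lemma ft_translate:
  fixes f :: "'a::euclidean_space \<Rightarrow> complex"
  assumes [measurable]: "f \<in> borel_measurable borel"
  shows
  "ft e (\<lambda>\<eta>. f (\<eta> - \<xi>)) x = cis (e * (x \<bullet> \<xi>)) * ft e f x"
proof -
  have "ft e (\<lambda>\<eta>. f (\<eta> - \<xi>)) x = (LINT \<eta>|lborel. f (\<xi> + \<eta> - \<xi>) * cis (e * (x \<bullet> (\<xi> + \<eta>))))"
    unfolding ft_def by (rule lborel_integral_translate) measurable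
  also have "\<dots> = (LINT \<eta>|lborel. cis (e * (x \<bullet> \<xi>)) * (f \<eta> * cis (e * (x \<bullet> \<eta>))))"
    by (simp add: inner_add_right distrib_left mult_ac flip: cis_mult)
  finally show ?thesis unfolding ft_def by simp
qed

lemma fourier_measurable [measurable]:
  assumes [measurable]: "g \<in> borel_measurable borel"
  shows "fourier g \<in> borel_measurable borel"
  unfolding fourier_def by measurable

lemma fourier_modulate: "fourier (\<lambda>y. f y * cis (y \<bullet> \<xi>)) \<eta> = fourier f (\<eta> - \<xi>)"
  unfolding fourier_def by (intro Bochner_Integration.integral_cong refl)
    (simp add: inner_diff_left inner_commute[of _ \<xi>] mult.assoc cis_mult)

subsection \<open>Truncation in frequency\<close>

definition cutoff :: "nat \<Rightarrow> 'a::euclidean_space \<Rightarrow> real" where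
  "cutoff k \<eta> = (if norm \<eta> \<le> real k then 1 else 0)"

lemma cutoff_measurable [measurable]: "cutoff k \<in> borel_measurable borel"
  unfolding cutoff_def by measurable

lemma cutoff_bounds [simp]: "0 \<le> cutoff k \<eta>" "cutoff k \<eta> \<le> 1"
  by (auto simp: cutoff_def)

lemma integrable_truncated_jap:
  "integrable lborel (\<lambda>\<eta>::'a::euclidean_space. cutoff k \<eta> * jap r \<eta>)"
proof -
  have "integrable lborel (\<lambda>\<eta>::'a. indicator (cball 0 (real k)) \<eta> *\<^sub>R jap r \<eta>)"
    by (rule borel_integrable_compact[OF compact_cball continuous_on_jap])
  also have "(\<lambda>\<eta>::'a. indicator (cball 0 (real k)) \<eta> *\<^sub>R jap r \<eta>) = (\<lambda>\<eta>. cutoff k \<eta> * jap r \<eta>)"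
    by (auto simp: fun_eq_iff cutoff_def indicator_def)
  finally show ?thesis .
qed

text \<open>The convolution kernel of \<open>\<langle>\<nabla>\<rangle>\<^bsup>-s\<^esup>\<close> is in general a singular distribution. Discarding the frequencies above \<open>k\<close>
  makes it a bounded function.\<close>

definition truncated_bessel_kernel :: "real \<Rightarrow> nat \<Rightarrow> 'a::euclidean_space \<Rightarrow> complex" where
  "truncated_bessel_kernel s k = inv_fourier (\<lambda>\<eta>. of_real (cutoff k \<eta> * jap (- s) \<eta>))"

lemma truncated_bessel_kernel_bound:
  "cmod (truncated_bessel_kernel s k w) \<le> (LINT \<eta>|lborel. cutoff k (\<eta>::'a) * jap (- s) \<eta>)"
  for w :: "'a::euclidean_space"
  unfolding truncated_bessel_kernel_def
  by (rule order_trans[OF norm_inv_fourier_le]) (simp only: norm_of_real abs_mult, simp)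

lemma truncated_bessel_kernel_measurable [measurable]: "truncated_bessel_kernel s k \<in> borel_measurable borel"
  unfolding truncated_bessel_kernel_def inv_fourier_def by measurable

lemma truncated_potential_eq:
  fixes g :: "'a::euclidean_space \<Rightarrow> complex"
  assumes g: "integrable lborel g"
  shows "(LINT y|lborel. g y * truncated_bessel_kernel s k (x - y))
    = inv_fourier (\<lambda>\<eta>. of_real (cutoff k \<eta>) * (of_real (jap (- s) \<eta>) * fourier g \<eta>)) x"
proof -
  note [measurable] = borel_measurable_integrable[OF g]
  let ?k = "complex_of_real (1 / (2 * pi) ^ DIM('a))"
  define w where "w \<eta> = cutoff k \<eta> * jap (- s) \<eta>" for \<eta> :: 'a
  have w: "integrable lborel w" unfolding w_def by (rule integrable_truncated_jap)
  have w0: "0 \<le> w \<eta>" for \<eta> by (simp add: w_def)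
  note [measurable] = borel_measurable_integrable[OF w]
  have "(LINT y|lborel. g y * truncated_bessel_kernel s k (x - y))
      = (LINT y|lborel. ?k * (LINT \<eta>|lborel. g y * (of_real (w \<eta>) * cis ((x - y) \<bullet> \<eta>))))"
    unfolding truncated_bessel_kernel_def inv_fourier_def w_def[symmetric]
    by (intro Bochner_Integration.integral_cong refl) (simp only: integral_mult_right_zero mult.left_commute)
  also have "\<dots> = ?k * (LINT y|lborel. LINT \<eta>|lborel. g y * (of_real (w \<eta>) * cis ((x - y) \<bullet> \<eta>)))"
    by (rule integral_mult_right_zero)
  also have "(LINT y|lborel. LINT \<eta>|lborel. g y * (of_real (w \<eta>) * cis ((x - y) \<bullet> \<eta>)))
      = (LINT \<eta>|lborel. LINT y|lborel. g y * (of_real (w \<eta>) * cis ((x - y) \<bullet> \<eta>)))"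
    by (rule lborel_fubini(1)[OF _ integrable_norm[OF g] w]) (auto simp: norm_mult w0)
  also have "\<dots> = (LINT \<eta>|lborel. (of_real (cutoff k \<eta>) * (of_real (jap (- s) \<eta>) * fourier g \<eta>)) * cis (x \<bullet> \<eta>))"
  proof (intro Bochner_Integration.integral_cong refl)
    fix \<eta> :: 'a
    have "g y * (of_real (w \<eta>) * cis ((x - y) \<bullet> \<eta>)) = (of_real (w \<eta>) * cis (x \<bullet> \<eta>)) * (g y * cis (- (\<eta> \<bullet> y)))" for y
    proof -
      have "cis ((x - y) \<bullet> \<eta>) = cis (x \<bullet> \<eta>) * cis (- (\<eta> \<bullet> y))"
        by (simp add: cis_mult inner_diff_left inner_commute[of \<eta> y])
      then show ?thesis by (simp only: mult_ac)
    qed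
    then have "(LINT y|lborel. g y * (of_real (w \<eta>) * cis ((x - y) \<bullet> \<eta>))) = (of_real (w \<eta>) * cis (x \<bullet> \<eta>)) * fourier g \<eta>"
      unfolding fourier_def by (simp only: integral_mult_right_zero)
    then show "(LINT y|lborel. g y * (of_real (w \<eta>) * cis ((x - y) \<bullet> \<eta>)))
        = (of_real (cutoff k \<eta>) * (of_real (jap (- s) \<eta>) * fourier g \<eta>)) * cis (x \<bullet> \<eta>)"
      by (simp add: w_def mult_ac)
  qed
  finally show ?thesis unfolding inv_fourier_def .
qed

lemma truncated_potential_tendsto:
  fixes g :: "'a::euclidean_space \<Rightarrow> complex"
  assumes [measurable]: "g \<in> borel_measurable borel"
    and int: "integrable lborel (\<lambda>\<eta>. of_real (jap (- s) \<eta>) * fourier g \<eta>)"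
  shows "(\<lambda>k. inv_fourier (\<lambda>\<eta>. of_real (cutoff k \<eta>) * (of_real (jap (- s) \<eta>) * fourier g \<eta>)) x)
    \<longlonglongrightarrow> potential s g x"
proof -
  note [measurable] = borel_measurable_integrable[OF int]
  have "(\<lambda>k. LINT \<eta>|lborel. of_real (cutoff k \<eta>) * (of_real (jap (- s) \<eta>) * fourier g \<eta>) * cis (x \<bullet> \<eta>))
      \<longlonglongrightarrow> (LINT \<eta>|lborel. (of_real (jap (- s) \<eta>) * fourier g \<eta>) * cis (x \<bullet> \<eta>))"
  proof (rule integral_dominated_convergence[where w="\<lambda>\<eta>. cmod (of_real (jap (- s) \<eta>) * fourier g \<eta>)"])
    show "integrable lborel (\<lambda>\<eta>. cmod (of_real (jap (- s) \<eta>) * fourier g \<eta>))" by (rule integrable_norm[OF int])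
    show "AE \<eta> in lborel. (\<lambda>k. of_real (cutoff k \<eta>) * (of_real (jap (- s) \<eta>) * fourier g \<eta>) * cis (x \<bullet> \<eta>))
        \<longlonglongrightarrow> (of_real (jap (- s) \<eta>) * fourier g \<eta>) * cis (x \<bullet> \<eta>)"
    proof (intro AE_I2 tendsto_eventually)
      fix \<eta> :: 'a
      obtain N where "norm \<eta> \<le> real N" using real_arch_simple by blast
      then show "\<forall>\<^sub>F k in sequentially. of_real (cutoff k \<eta>) * (of_real (jap (- s) \<eta>) * fourier g \<eta>) * cis (x \<bullet> \<eta>)
          = (of_real (jap (- s) \<eta>) * fourier g \<eta>) * cis (x \<bullet> \<eta>)"
        unfolding eventually_sequentially by (intro exI[of _ N]) (auto simp: cutoff_def)
    qed
    show "AE \<eta> in lborel. norm (of_real (cutoff k \<eta>) * (of_real (jap (- s) \<eta>) * fourier g \<eta>) * cis (x \<bullet> \<eta>))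
        \<le> cmod (of_real (jap (- s) \<eta>) * fourier g \<eta>)" for k
      by (intro AE_I2) (simp add: norm_mult mult_left_le_one_le)
  qed measurable
  then show ?thesis unfolding potential_def inv_fourier_def by (intro tendsto_mult_left)
qed

subsection \<open>The symbol of \<open>\<langle>\<nabla>\<rangle>\<^bsup>-s\<^esup>\<close> composed with multiplication by \<open>\<rho>\<close>\<close>

lemma jap_uminus [simp]: "jap r (- x) = jap r x"
  by (simp add: jap_def)

lemma peetre_inequality_diff: "jap \<sigma> \<eta> \<le> 2 powr (\<bar>\<sigma>\<bar> / 2) * jap \<sigma> \<xi> * jap \<bar>\<sigma>\<bar> (\<eta> - \<xi>)"
  using peetre_inequality[of \<sigma> "\<eta> - \<xi>" \<xi>] by simp

lemma integrable_jap_translate: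
  fixes \<xi> :: "'a::euclidean_space"
  assumes "r < - real DIM('a)"
  shows "integrable lborel (\<lambda>\<eta>. jap r (\<eta> - \<xi>))"
    and "(LINT \<eta>|lborel. jap r (\<eta> - \<xi>)) = (LINT \<eta>|lborel. jap r (\<eta>::'a))"
proof -
  have "integrable lborel (\<lambda>\<eta>::'a. jap r (- \<xi> + \<eta>))"
    using integrable_jap[OF assms]
    by (subst (asm) lborel_distr_plus[of "- \<xi>", symmetric]) (simp add: integrable_distr_eq)
  then show "integrable lborel (\<lambda>\<eta>. jap r (\<eta> - \<xi>))" by simp
  show "(LINT \<eta>|lborel. jap r (\<eta> - \<xi>)) = (LINT \<eta>|lborel. jap r (\<eta>::'a))"
    by (subst (2) lborel_distr_plus[of "- \<xi>", symmetric]) (simp add: integral_distr)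
qed

text \<open>Modulation by \<open>\<xi>\<close> concentrates the spectrum of \<open>\<rho>\<close> near \<open>\<xi>\<close>, where the weight \<open>\<langle>\<eta>\<rangle>\<^bsup>-s\<^esup>\<close> is comparable to \<open>\<langle>\<xi>\<rangle>\<^bsup>-s\<^esup>\<close>. The
  present crude form only provides integrability and dominating functions.\<close>

lemma modulated_weight_bound:
  fixes \<rho> :: "'a::euclidean_space \<Rightarrow> complex"
  assumes \<rho>: "\<rho> \<in> schwartz"
  obtains C where "C \<ge> 0"
    "\<And>\<xi> \<eta>. cmod (of_real (jap (- s) \<eta>) * fourier (\<lambda>y. \<rho> y * cis (y \<bullet> \<xi>)) \<eta>) \<le> C * jap \<bar>s\<bar> \<xi> * jap (- real DIM('a) - 1) (\<eta> - \<xi>)"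
proof -
  obtain C where C: "C \<ge> 0" "\<And>\<zeta>. cmod (fourier \<rho> \<zeta>) \<le> C * jap (- \<bar>s\<bar> - real DIM('a) - 1) \<zeta>"
    using schwartz_bound'[OF fourier_schwartz[OF \<rho>]] by blast
  show ?thesis
  proof (rule that[of "2 powr (\<bar>s\<bar> / 2) * C"])
    fix \<xi> \<eta> :: 'a
    have "jap (- s) \<eta> \<le> jap \<bar>s\<bar> \<eta>" by (rule jap_mono) simp
    also have "\<dots> \<le> 2 powr (\<bar>s\<bar> / 2) * jap \<bar>s\<bar> \<xi> * jap \<bar>s\<bar> (\<eta> - \<xi>)" using peetre_inequality_diff[of "\<bar>s\<bar>" \<eta> \<xi>] by simp
    finally have 1: "jap (- s) \<eta> \<le> 2 powr (\<bar>s\<bar> / 2) * jap \<bar>s\<bar> \<xi> * jap \<bar>s\<bar> (\<eta> - \<xi>)" .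
    have "cmod (of_real (jap (- s) \<eta>) * fourier (\<lambda>y. \<rho> y * cis (y \<bullet> \<xi>)) \<eta>) = jap (- s) \<eta> * cmod (fourier \<rho> (\<eta> - \<xi>))"
      by (simp add: fourier_modulate norm_mult)
    also have "\<dots> \<le> (2 powr (\<bar>s\<bar> / 2) * jap \<bar>s\<bar> \<xi> * jap \<bar>s\<bar> (\<eta> - \<xi>)) * (C * jap (- \<bar>s\<bar> - real DIM('a) - 1) (\<eta> - \<xi>))"
      using 1 C by (intro mult_mono) auto
    also have "\<dots> = 2 powr (\<bar>s\<bar> / 2) * C * jap \<bar>s\<bar> \<xi> * (jap \<bar>s\<bar> (\<eta> - \<xi>) * jap (- \<bar>s\<bar> - real DIM('a) - 1) (\<eta> - \<xi>))"
      by (simp only: mult_ac)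
    also have "jap \<bar>s\<bar> (\<eta> - \<xi>) * jap (- \<bar>s\<bar> - real DIM('a) - 1) (\<eta> - \<xi>) = jap (- real DIM('a) - 1) (\<eta> - \<xi>)"
      by (simp flip: jap_add)
    finally show "cmod (of_real (jap (- s) \<eta>) * fourier (\<lambda>y. \<rho> y * cis (y \<bullet> \<xi>)) \<eta>)
        \<le> 2 powr (\<bar>s\<bar> / 2) * C * jap \<bar>s\<bar> \<xi> * jap (- real DIM('a) - 1) (\<eta> - \<xi>)" .
  qed (use C in auto)
qed

text \<open>By Peetre's inequality the amplitude \<open>\<zeta> \<mapsto> \<langle>\<zeta> + \<xi>\<rangle>\<^bsup>-s\<^esup> \<rho>^(\<zeta>)\<close> and its derivatives are bounded by
  \<open>\<langle>\<xi>\<rangle>\<^bsup>-s\<^esup>\<close> times a rapidly decreasing function of \<open>\<zeta>\<close>; integrating by parts gives decay in \<open>x\<close>.\<close>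

lemma symbol_bound:
  fixes \<rho> :: "'a::euclidean_space \<Rightarrow> complex"
  assumes \<rho>: "\<rho> \<in> schwartz"
  obtains C where "C \<ge> 0"
    "\<And>\<xi> x. cmod (potential s (\<lambda>y. \<rho> y * cis (y \<bullet> \<xi>)) x) \<le> C * jap (- s) \<xi> * jap (- real N) x"
proof -
  define M where "M = - \<bar>s\<bar> - real DIM('a) - 1"
  define A where "A \<xi> \<zeta> = of_real (jap (- s) (\<zeta> + \<xi>)) * fourier \<rho> \<zeta>" for \<xi> \<zeta> :: 'a
  note F = fourier_schwartz[OF \<rho>]
  have As: "A \<xi> \<in> schwartz" for \<xi>
    unfolding schwartz_iff
  proof
    fix r
    have "bounded_partials (\<lambda>_::unit. \<lambda>x. jap (- s) (x + \<xi>)) (\<lambda>_ x. of_real (jap (- s) (x + \<xi>)))"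
      using bounded_partials_bracket_symbol[OF bracket_symbol.jap[of "- s", where 'a='a]]
      unfolding bounded_partials_def by blast
    moreover have "bounded_partials (\<lambda>_::unit. jap (r - \<bar>s\<bar>)) (\<lambda>_. fourier \<rho>)"
      using F unfolding schwartz_iff by blast
    ultimately have "bounded_partials (\<lambda>_::unit. \<lambda>x. jap (- s) (x + \<xi>) * jap (r - \<bar>s\<bar>) x) (\<lambda>_. A \<xi>)"
      unfolding A_def by (intro bounded_partials_mult) auto
    then show "bounded_partials (\<lambda>_::unit. jap r) (\<lambda>_. A \<xi>)"
    proof (rule bounded_partials_mono)
      show "jap (- s) (x + \<xi>) * jap (r - \<bar>s\<bar>) x \<le> (2 powr (\<bar>s\<bar> / 2) * jap (- s) \<xi>) * jap r x" for x
      proof -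
        have "jap (- s) (x + \<xi>) * jap (r - \<bar>s\<bar>) x \<le> (2 powr (\<bar>s\<bar> / 2) * jap (- s) \<xi> * jap \<bar>s\<bar> x) * jap (r - \<bar>s\<bar>) x"
          using peetre_inequality[of "- s" x \<xi>] by (intro mult_right_mono) auto
        also have "\<dots> = 2 powr (\<bar>s\<bar> / 2) * jap (- s) \<xi> * (jap \<bar>s\<bar> x * jap (r - \<bar>s\<bar>) x)" by (simp only: mult_ac)
        also have "jap \<bar>s\<bar> x * jap (r - \<bar>s\<bar>) x = jap r x" by (simp flip: jap_add)
        finally show ?thesis .
      qed
    qed auto
  qed
  have fam: "bounded_partials (\<lambda>\<xi> \<zeta>. jap (- s) \<xi> * jap (- real DIM('a) - 1) \<zeta>) A"
  proof (rule bounded_partials_mono)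
    show "bounded_partials (\<lambda>\<xi> \<zeta>. jap (- s) (\<zeta> + \<xi>) * jap M \<zeta>) A"
      unfolding A_def
    proof (intro bounded_partials_mult)
      show "bounded_partials (\<lambda>(i::'a) x. jap (- s) (x + i)) (\<lambda>i x. complex_of_real (jap (- s) (x + i)))"
        by (rule bounded_partials_bracket_symbol[OF bracket_symbol.jap])
      show "bounded_partials (\<lambda>_::'a. jap M) (\<lambda>_. fourier \<rho>)"
        using F unfolding schwartz_iff bounded_partials_def by blast
    qed auto
    show "jap (- s) (x + \<xi>) * jap M x \<le> 2 powr (\<bar>s\<bar> / 2) * (jap (- s) \<xi> * jap (- real DIM('a) - 1) x)" for \<xi> x :: 'a
    proof -
      have "jap (- s) (x + \<xi>) * jap M x \<le> (2 powr (\<bar>s\<bar> / 2) * jap (- s) \<xi> * jap \<bar>s\<bar> x) * jap M x"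
        using peetre_inequality[of "- s" x \<xi>] by (intro mult_right_mono) auto
      also have "\<dots> = 2 powr (\<bar>s\<bar> / 2) * jap (- s) \<xi> * (jap \<bar>s\<bar> x * jap M x)" by (simp only: mult_ac)
      also have "jap \<bar>s\<bar> x * jap M x = jap (- real DIM('a) - 1) x" unfolding M_def by (simp flip: jap_add)
      finally show ?thesis by simp
    qed
  qed auto
  define J where "J = (LINT \<zeta>|lborel. jap (- real DIM('a) - 1) (\<zeta>::'a))"
  have J0: "J \<ge> 0" unfolding J_def by (intro Bochner_Integration.integral_nonneg) auto
  have L1: "\<exists>B\<ge>0. \<forall>\<xi>. (LINT \<zeta>|lborel. cmod (partials bs (A \<xi>) \<zeta>)) \<le> B * jap (- s) \<xi>" if bs: "set bs \<subseteq> Basis" for bs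
  proof -
    obtain B where B: "B \<ge> 0" "\<And>\<xi> \<zeta>. cmod (partials bs (A \<xi>) \<zeta>) \<le> B * (jap (- s) \<xi> * jap (- real DIM('a) - 1) \<zeta>)"
      using fam bs unfolding bounded_partials_def by blast
    have "(LINT \<zeta>|lborel. cmod (partials bs (A \<xi>) \<zeta>)) \<le> (B * J) * jap (- s) \<xi>" for \<xi>
    proof -
      have "(LINT \<zeta>|lborel. cmod (partials bs (A \<xi>) \<zeta>)) \<le> (LINT \<zeta>|lborel. (B * jap (- s) \<xi>) * jap (- real DIM('a) - 1) (\<zeta>::'a))"
      proof (rule integral_mono)
        show "integrable lborel (\<lambda>\<zeta>. cmod (partials bs (A \<xi>) \<zeta>))"
          by (intro integrable_norm schwartz_integrable schwartz_partials As bs)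
        show "integrable lborel (\<lambda>\<zeta>::'a. (B * jap (- s) \<xi>) * jap (- real DIM('a) - 1) \<zeta>)"
          by (intro integrable_mult_right integrable_jap) auto
        show "cmod (partials bs (A \<xi>) \<zeta>) \<le> (B * jap (- s) \<xi>) * jap (- real DIM('a) - 1) \<zeta>" for \<zeta>
          using B(2)[of \<xi> \<zeta>] by (simp add: mult.assoc)
      qed
      also have "(LINT \<zeta>|lborel. (B * jap (- s) \<xi>) * jap (- real DIM('a) - 1) (\<zeta>::'a)) = (B * J) * jap (- s) \<xi>"
        unfolding J_def by simp
      finally show ?thesis .
    qed
    with B(1) J0 show ?thesis by (intro exI[of _ "B * J"]) auto
  qed
  obtain B0 where B0: "B0 \<ge> 0" "\<And>\<xi>. (LINT \<zeta>|lborel. cmod (A \<xi> \<zeta>)) \<le> B0 * jap (- s) \<xi>"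
    using L1[of "[]"] by auto
  have "\<forall>b\<in>(Basis::'a set). \<exists>B\<ge>0. \<forall>\<xi>. (LINT \<zeta>|lborel. cmod (partials (replicate N b) (A \<xi>) \<zeta>)) \<le> B * jap (- s) \<xi>"
  proof
    fix b :: 'a assume "b \<in> Basis"
    then have "set (replicate N b) \<subseteq> Basis" by auto
    from L1[OF this] show "\<exists>B\<ge>0. \<forall>\<xi>. (LINT \<zeta>|lborel. cmod (partials (replicate N b) (A \<xi>) \<zeta>)) \<le> B * jap (- s) \<xi>" .
  qed
  then obtain B where B: "\<And>b. b \<in> (Basis::'a set) \<Longrightarrow> B b \<ge> 0"
    "\<And>b \<xi>. b \<in> (Basis::'a set) \<Longrightarrow> (LINT \<zeta>|lborel. cmod (partials (replicate N b) (A \<xi>) \<zeta>)) \<le> B b * jap (- s) \<xi>"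
    unfolding bchoice_iff by blast
  define C where "C = (1 + real DIM('a)) ^ N * (B0 + (\<Sum>b\<in>(Basis::'a set). B b))"
  have C0: "C \<ge> 0" unfolding C_def using B0(1) B(1) by (intro mult_nonneg_nonneg add_nonneg_nonneg sum_nonneg) auto
  show ?thesis
  proof (rule that[OF C0])
    fix \<xi> x :: 'a
    have "potential s (\<lambda>y. \<rho> y * cis (y \<bullet> \<xi>)) x = of_real (1 / (2 * pi) ^ DIM('a)) * ft 1 (\<lambda>\<eta>. A \<xi> (\<eta> - \<xi>)) x"
      unfolding potential_def inv_fourier_eq_ft A_def by (simp add: fourier_modulate)
    then have "cmod (potential s (\<lambda>y. \<rho> y * cis (y \<bullet> \<xi>)) x) = 1 / (2 * pi) ^ DIM('a) * cmod (ft 1 (A \<xi>) x)"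
      unfolding ft_translate[OF schwartz_measurable[OF As]]
      by (simp only: norm_mult norm_of_real norm_cis mult_1_left) simp
    also have "\<dots> \<le> cmod (ft 1 (A \<xi>) x)"
    proof -
      have "1 \<le> (2 * pi) ^ DIM('a)" using pi_gt3 by (intro one_le_power) simp
      then have "1 / (2 * pi) ^ DIM('a) \<le> 1" by simp
      then have "1 / (2 * pi) ^ DIM('a) * cmod (ft 1 (A \<xi>) x) \<le> 1 * cmod (ft 1 (A \<xi>) x)" by (intro mult_right_mono) auto
      then show ?thesis by simp
    qed
    finally have 1: "cmod (potential s (\<lambda>y. \<rho> y * cis (y \<bullet> \<xi>)) x) \<le> cmod (ft 1 (A \<xi>) x)" .
    have "jap (real N) x * cmod (ft 1 (A \<xi>) x) \<le> (1 + real DIM('a)) ^ N *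
      ((LINT \<zeta>|lborel. cmod (A \<xi> \<zeta>)) + (\<Sum>b\<in>Basis. LINT \<zeta>|lborel. cmod (partials (replicate N b) (A \<xi>) \<zeta>)))"
      by (rule ft_decay[OF As]) simp
    also have "\<dots> \<le> (1 + real DIM('a)) ^ N * (B0 * jap (- s) \<xi> + (\<Sum>b\<in>Basis. B b * jap (- s) \<xi>))"
      using B0(2) B(2) by (intro mult_left_mono add_mono sum_mono) auto
    also have "\<dots> = C * jap (- s) \<xi>" unfolding C_def by (simp add: distrib_right sum_distrib_right mult.assoc)
    finally have 2: "jap (real N) x * cmod (ft 1 (A \<xi>) x) \<le> C * jap (- s) \<xi>" .
    have "cmod (ft 1 (A \<xi>) x) = jap (- real N) x * (jap (real N) x * cmod (ft 1 (A \<xi>) x))"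
      by (simp add: jap_minus)
    also have "\<dots> \<le> jap (- real N) x * (C * jap (- s) \<xi>)" by (intro mult_left_mono 2) simp
    finally show "cmod (potential s (\<lambda>y. \<rho> y * cis (y \<bullet> \<xi>)) x) \<le> C * jap (- s) \<xi> * jap (- real N) x"
      using 1 by (simp add: mult_ac)
  qed
qed

subsection \<open>Moments of the potential of a localised process\<close>

context
  fixes M :: "'w measure" and Z :: "'a::euclidean_space \<Rightarrow> 'w \<Rightarrow> complex" and v :: "'a \<Rightarrow> real"
    and \<rho> :: "'a \<Rightarrow> complex" and R :: real
  assumes M: "prob_space M"
    and Z: "spectrally_dominated M Z v" and cont: "\<And>\<omega>. continuous_on UNIV (\<lambda>y. Z y \<omega>)"
    and v0: "\<And>\<xi>. 0 \<le> v \<xi>" and v: "\<And>r. integrable lborel (\<lambda>\<xi>. jap r \<xi> * v \<xi>)"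
    and \<rho>: "\<rho> \<in> schwartz" and supp: "\<And>y. norm y > R \<Longrightarrow> \<rho> y = 0"
begin

lemma spectral_density_integrable: "integrable lborel v"
  using v[of 0] by simp

lemma localised_process_integrable: "integrable lborel (\<lambda>y. \<rho> y * Z y \<omega>)"
proof -
  note [measurable] = schwartz_measurable[OF \<rho>] borel_measurable_continuous_onI[OF cont]
  have "bounded ((\<lambda>y. Z y \<omega>) ` cball 0 R)"
    by (intro compact_imp_bounded compact_continuous_image continuous_on_subset[OF cont]) auto
  then obtain B where B: "\<And>y. norm y \<le> R \<Longrightarrow> cmod (Z y \<omega>) \<le> B"
    unfolding bounded_iff by (metis imageI mem_cball_0)
  show ?thesis
  proof (rule Bochner_Integration.integrable_bound[OF integrable_mult_right[OF integrable_norm[OF schwartz_integrable[OF \<rho>]], of B]])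
    show "AE y in lborel. norm (\<rho> y * Z y \<omega>) \<le> norm (B * norm (\<rho> y))"
    proof (intro AE_I2)
      fix y
      show "norm (\<rho> y * Z y \<omega>) \<le> norm (B * norm (\<rho> y))"
      proof (cases "norm y > R")
        case False
        with B[of y] have "cmod (Z y \<omega>) \<le> \<bar>B\<bar>" by auto
        then have "cmod (\<rho> y) * cmod (Z y \<omega>) \<le> cmod (\<rho> y) * \<bar>B\<bar>" by (intro mult_left_mono) auto
        then show ?thesis by (simp add: norm_mult abs_mult mult.commute)
      qed (simp add: supp)
    qed
  qed measurable
qed

lemma process_jointly_measurable [measurable]: "(\<lambda>(\<omega>, y). Z y \<omega>) \<in> borel_measurable (M \<Otimes>\<^sub>M borel)"
proof -
  have "(\<lambda>(y, \<omega>). Z y \<omega>) \<in> borel_measurable (borel \<Otimes>\<^sub>M M)"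
    using Z by (intro continuous_process_measurable cont) (simp add: spectrally_dominated_def)
  then show ?thesis by (subst measurable_pair_swap_iff) (simp add: case_prod_unfold)
qed

text \<open>For frequency-bounded \<open>v\<close> the Fourier transform of the localised process decays rapidly in mean square, so
  that its potential is almost surely given by an absolutely convergent integral.\<close>

lemma localised_process_weighted_integrable:
  "AE \<omega> in M. integrable lborel (\<lambda>\<eta>. of_real (jap (- s) \<eta>) * fourier (\<lambda>y. \<rho> y * Z y \<omega>) \<eta>)"
proof -
  interpret prob_space M by (rule M)
  note [measurable] = schwartz_measurable[OF \<rho>] borel_measurable_integrable[OF spectral_density_integrable]
  note F = fourier_schwartz[OF \<rho>]
  note [measurable] = schwartz_measurable[OF F]
  let ?d = "real DIM('a)"
  \<comment> \<open>First moments are bounded through \<open>a \<le> \<langle>\<eta>\<rangle>\<^sup>L a\<^sup>2 + \<langle>\<eta>\<rangle>\<^bsup>-L\<^esup>\<close>. The exponents \<open>L\<close> and \<open>Q\<close> reduce both terms, after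
    multiplication by \<open>\<langle>\<eta>\<rangle>\<^bsup>|s|\<^esup>\<close>, to \<open>\<langle>\<eta>\<rangle>\<^bsup>-d-1\<^esup>\<close>.\<close>
  define L where "L = \<bar>s\<bar> + ?d + 1"
  define Q where "Q = L + \<bar>s\<bar> + ?d + 1"
  obtain C where C: "C \<ge> 0" "\<And>\<zeta>. cmod (fourier \<rho> \<zeta>) \<le> C * jap (- Q / 2) \<zeta>"
    using schwartz_bound'[OF F] by blast
  define G where "G \<omega> \<eta> = fourier (\<lambda>y. \<rho> y * Z y \<omega>) \<eta>" for \<omega> \<eta>
  have Gm[measurable]: "(\<lambda>(\<omega>, \<eta>). G \<omega> \<eta>) \<in> borel_measurable (M \<Otimes>\<^sub>M borel)"
    unfolding G_def fourier_def by measurable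
  have Q0: "Q \<ge> 0" unfolding Q_def L_def by simp
  define D where "D = C\<^sup>2 * 2 powr (Q / 2) * (LINT \<xi>|lborel. jap Q \<xi> * v \<xi>)"
  have G2: "(\<integral>\<^sup>+\<omega>. ennreal ((cmod (G \<omega> \<eta>))\<^sup>2) \<partial>M) \<le> ennreal (moment_const 1 * D * jap (- Q) \<eta>)" for \<eta>
  proof -
    have c: "integrable lborel (\<lambda>y. \<rho> y * cis (- 1 * (\<eta> \<bullet> y)))"
      by (intro integrable_mult_cis schwartz_integrable \<rho>)
    have ft: "ft 1 (\<lambda>y. \<rho> y * cis (- 1 * (\<eta> \<bullet> y))) \<xi> = fourier \<rho> (\<eta> - \<xi>)" for \<xi>
      unfolding ft_def fourier_def
      by (intro Bochner_Integration.integral_cong refl) (simp add: mult.assoc cis_mult inner_diff_left)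
    have "(\<integral>\<^sup>+\<omega>. ennreal (cmod (LINT y|lborel. \<rho> y * cis (- 1 * (\<eta> \<bullet> y)) * Z y \<omega>) ^ (2 * 1)) \<partial>M)
      \<le> ennreal (moment_const 1 * (LINT \<xi>|lborel. v \<xi> * (cmod (ft 1 (\<lambda>y. \<rho> y * cis (- 1 * (\<eta> \<bullet> y))) \<xi>))\<^sup>2) ^ 1)"
      by (rule spectrally_dominated_integral[OF Z cont spectral_density_integrable v0 c, where R=R]) (auto simp: supp)
    then have "(\<integral>\<^sup>+\<omega>. ennreal ((cmod (G \<omega> \<eta>))\<^sup>2) \<partial>M)
      \<le> ennreal (moment_const 1 * (LINT \<xi>|lborel. v \<xi> * (cmod (fourier \<rho> (\<eta> - \<xi>)))\<^sup>2))"
      unfolding ft by (simp add: G_def fourier_def mult_ac)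
    also have "\<dots> \<le> ennreal (moment_const 1 * (D * jap (- Q) \<eta>))"
    proof (intro ennreal_leI mult_left_mono less_imp_le[OF moment_const_pos])
      have pt: "v \<xi> * (cmod (fourier \<rho> (\<eta> - \<xi>)))\<^sup>2 \<le> (C\<^sup>2 * 2 powr (Q / 2) * jap (- Q) \<eta>) * (jap Q \<xi> * v \<xi>)" for \<xi>
      proof -
        have "(cmod (fourier \<rho> (\<eta> - \<xi>)))\<^sup>2 \<le> (C * jap (- Q / 2) (\<eta> - \<xi>))\<^sup>2" by (intro power_mono C) auto
        also have "\<dots> = C\<^sup>2 * jap (- Q) (\<eta> - \<xi>)" by (simp add: power_mult_distrib jap_power)
        also have "\<dots> \<le> C\<^sup>2 * (2 powr (Q / 2) * jap (- Q) \<eta> * jap Q \<xi>)"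
          using peetre_inequality[of "- Q" "- \<xi>" \<eta>] Q0 by (intro mult_left_mono) auto
        finally have "v \<xi> * (cmod (fourier \<rho> (\<eta> - \<xi>)))\<^sup>2 \<le> v \<xi> * (C\<^sup>2 * (2 powr (Q / 2) * jap (- Q) \<eta> * jap Q \<xi>))"
          by (intro mult_left_mono v0)
        then show ?thesis by (simp only: mult_ac)
      qed
      have "(LINT \<xi>|lborel. v \<xi> * (cmod (fourier \<rho> (\<eta> - \<xi>)))\<^sup>2) \<le> (LINT \<xi>|lborel. (C\<^sup>2 * 2 powr (Q / 2) * jap (- Q) \<eta>) * (jap Q \<xi> * v \<xi>))"
      proof (rule integral_mono)
        show i: "integrable lborel (\<lambda>\<xi>. (C\<^sup>2 * 2 powr (Q / 2) * jap (- Q) \<eta>) * (jap Q \<xi> * v \<xi>))"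
          by (intro integrable_mult_right v)
        show "integrable lborel (\<lambda>\<xi>. v \<xi> * (cmod (fourier \<rho> (\<eta> - \<xi>)))\<^sup>2)"
          by (rule Bochner_Integration.integrable_bound[OF i])
             (use pt v0 in \<open>auto intro!: AE_I2 order_trans[OF _ abs_ge_self]\<close>)
      qed (rule pt)
      also have "(LINT \<xi>|lborel. (C\<^sup>2 * 2 powr (Q / 2) * jap (- Q) \<eta>) * (jap Q \<xi> * v \<xi>)) = D * jap (- Q) \<eta>"
        unfolding D_def integral_mult_right_zero by simp
      finally show "(LINT \<xi>|lborel. v \<xi> * (cmod (fourier \<rho> (\<eta> - \<xi>)))\<^sup>2) \<le> D * jap (- Q) \<eta>" .
    qed
    finally show ?thesis by (simp add: mult.assoc)
  qed
  have D0: "D \<ge> 0" unfolding D_def using v0 by (intro mult_nonneg_nonneg Bochner_Integration.integral_nonneg) auto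
  have "(\<integral>\<^sup>+\<omega>. (\<integral>\<^sup>+\<eta>. ennreal (jap \<bar>s\<bar> \<eta> * cmod (G \<omega> \<eta>)) \<partial>lborel) \<partial>M) = (\<integral>\<^sup>+\<eta>. (\<integral>\<^sup>+\<omega>. ennreal (jap \<bar>s\<bar> \<eta> * cmod (G \<omega> \<eta>)) \<partial>M) \<partial>lborel)"
  proof -
    interpret pair_sigma_finite M "lborel :: 'a measure" by standard
    show ?thesis by (rule Fubini'[symmetric]) measurable
  qed
  also have "\<dots> \<le> (\<integral>\<^sup>+\<eta>. ennreal ((moment_const 1 * D + 1) * jap (- ?d - 1) (\<eta>::'a)) \<partial>lborel)"
  proof (intro nn_integral_mono)
    fix \<eta> :: 'a
    have amgm: "a \<le> jap L \<eta> * a\<^sup>2 + jap (- L) \<eta>" for a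
    proof -
      have "0 \<le> (jap (L / 2) \<eta> * a - jap (- L / 2) \<eta>)\<^sup>2" by simp
      also have "\<dots> = jap L \<eta> * a\<^sup>2 - 2 * a * (jap (L / 2) \<eta> * jap (- L / 2) \<eta>) + jap (- L) \<eta>"
        by (simp add: power2_diff power_mult_distrib jap_power mult_ac)
      also have "jap (L / 2) \<eta> * jap (- L / 2) \<eta> = 1" by (simp flip: jap_add)
      finally have "2 * a \<le> jap L \<eta> * a\<^sup>2 + jap (- L) \<eta>" by simp
      moreover have "0 \<le> jap L \<eta> * a\<^sup>2 + jap (- L) \<eta>" by (simp add: add_nonneg_nonneg)
      ultimately show ?thesis by linarith
    qed
    have "(\<integral>\<^sup>+\<omega>. ennreal (jap \<bar>s\<bar> \<eta> * cmod (G \<omega> \<eta>)) \<partial>M)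
        \<le> (\<integral>\<^sup>+\<omega>. ennreal (jap \<bar>s\<bar> \<eta> * jap L \<eta>) * ennreal ((cmod (G \<omega> \<eta>))\<^sup>2) + ennreal (jap \<bar>s\<bar> \<eta> * jap (- L) \<eta>) \<partial>M)"
    proof (intro nn_integral_mono)
      fix \<omega>
      have "jap \<bar>s\<bar> \<eta> * cmod (G \<omega> \<eta>) \<le> jap \<bar>s\<bar> \<eta> * (jap L \<eta> * (cmod (G \<omega> \<eta>))\<^sup>2 + jap (- L) \<eta>)"
        by (intro mult_left_mono amgm) auto
      then have "ennreal (jap \<bar>s\<bar> \<eta> * cmod (G \<omega> \<eta>)) \<le> ennreal ((jap \<bar>s\<bar> \<eta> * jap L \<eta>) * (cmod (G \<omega> \<eta>))\<^sup>2 + jap \<bar>s\<bar> \<eta> * jap (- L) \<eta>)"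
        by (intro ennreal_leI) (simp add: distrib_left mult.assoc)
      also have "\<dots> = ennreal (jap \<bar>s\<bar> \<eta> * jap L \<eta>) * ennreal ((cmod (G \<omega> \<eta>))\<^sup>2) + ennreal (jap \<bar>s\<bar> \<eta> * jap (- L) \<eta>)"
        by (simp add: ennreal_mult ennreal_plus)
      finally show "ennreal (jap \<bar>s\<bar> \<eta> * cmod (G \<omega> \<eta>))
        \<le> ennreal (jap \<bar>s\<bar> \<eta> * jap L \<eta>) * ennreal ((cmod (G \<omega> \<eta>))\<^sup>2) + ennreal (jap \<bar>s\<bar> \<eta> * jap (- L) \<eta>)" .
    qed
    also have "\<dots> = ennreal (jap \<bar>s\<bar> \<eta> * jap L \<eta>) * (\<integral>\<^sup>+\<omega>. ennreal ((cmod (G \<omega> \<eta>))\<^sup>2) \<partial>M) + ennreal (jap \<bar>s\<bar> \<eta> * jap (- L) \<eta>)"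
      by (subst nn_integral_add) (auto simp: nn_integral_cmult emeasure_space_1)
    also have "\<dots> \<le> ennreal (jap \<bar>s\<bar> \<eta> * jap L \<eta>) * ennreal (moment_const 1 * D * jap (- Q) \<eta>) + ennreal (jap \<bar>s\<bar> \<eta> * jap (- L) \<eta>)"
      by (intro add_mono mult_left_mono G2) auto
    also have "\<dots> = ennreal ((moment_const 1 * D + 1) * jap (- ?d - 1) \<eta>)"
    proof -
      have "jap \<bar>s\<bar> \<eta> * jap L \<eta> * (moment_const 1 * D * jap (- Q) \<eta>) = moment_const 1 * D * (jap \<bar>s\<bar> \<eta> * (jap L \<eta> * jap (- Q) \<eta>))"
        by (simp only: mult_ac)
      also have "jap \<bar>s\<bar> \<eta> * (jap L \<eta> * jap (- Q) \<eta>) = jap (- ?d - 1) \<eta>" unfolding Q_def by (simp flip: jap_add)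
      moreover have "jap \<bar>s\<bar> \<eta> * jap (- L) \<eta> = jap (- ?d - 1) \<eta>" unfolding L_def by (simp flip: jap_add)
      ultimately have "jap \<bar>s\<bar> \<eta> * jap L \<eta> * (moment_const 1 * D * jap (- Q) \<eta>) + jap \<bar>s\<bar> \<eta> * jap (- L) \<eta>
          = (moment_const 1 * D + 1) * jap (- ?d - 1) \<eta>" by (simp add: distrib_right)
      then show ?thesis using D0 moment_const_pos[of 1] by (simp flip: ennreal_mult ennreal_plus)
    qed
    finally show "(\<integral>\<^sup>+\<omega>. ennreal (jap \<bar>s\<bar> \<eta> * cmod (G \<omega> \<eta>)) \<partial>M) \<le> ennreal ((moment_const 1 * D + 1) * jap (- ?d - 1) \<eta>)" .
  qed
  also have "\<dots> < \<infinity>"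
  proof -
    have "integrable lborel (\<lambda>\<eta>::'a. (moment_const 1 * D + 1) * jap (- ?d - 1) \<eta>)"
      by (intro integrable_mult_right integrable_jap) simp
    moreover have "0 \<le> (moment_const 1 * D + 1) * jap (- ?d - 1) \<eta>" for \<eta> :: 'a
      using D0 moment_const_pos[of 1] by (intro mult_nonneg_nonneg add_nonneg_nonneg) auto
    ultimately show ?thesis by (subst nn_integral_eq_integral) auto
  qed
  finally have fin: "(\<integral>\<^sup>+\<omega>. (\<integral>\<^sup>+\<eta>. ennreal (jap \<bar>s\<bar> \<eta> * cmod (G \<omega> \<eta>)) \<partial>lborel) \<partial>M) < \<infinity>" .
  have "AE \<omega> in M. (\<integral>\<^sup>+\<eta>. ennreal (jap \<bar>s\<bar> \<eta> * cmod (G \<omega> \<eta>)) \<partial>lborel) \<noteq> \<infinity>"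
  proof (rule nn_integral_PInf_AE)
    show "(\<lambda>\<omega>. \<integral>\<^sup>+\<eta>. ennreal (jap \<bar>s\<bar> \<eta> * cmod (G \<omega> \<eta>)) \<partial>lborel) \<in> borel_measurable M"
      by measurable
    show "(\<integral>\<^sup>+\<omega>. (\<integral>\<^sup>+\<eta>. ennreal (jap \<bar>s\<bar> \<eta> * cmod (G \<omega> \<eta>)) \<partial>lborel) \<partial>M) \<noteq> \<infinity>"
      using fin by simp
  qed
  then show ?thesis
  proof eventually_elim
    case (elim \<omega>)
    have gm: "G \<omega> \<in> borel_measurable borel"
      unfolding G_def using borel_measurable_integrable[OF localised_process_integrable[of \<omega>]]
      by (intro fourier_measurable) simp
    show ?case
      unfolding G_def[symmetric]
    proof (rule integrableI_bounded)
      have "(\<integral>\<^sup>+\<eta>. ennreal (norm (of_real (jap (- s) \<eta>) * G \<omega> \<eta>)) \<partial>lborel) \<le> (\<integral>\<^sup>+\<eta>. ennreal (jap \<bar>s\<bar> \<eta> * cmod (G \<omega> \<eta>)) \<partial>lborel)"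
        by (intro nn_integral_mono ennreal_leI) (auto simp: norm_mult intro!: mult_right_mono jap_mono)
      also have "\<dots> < \<infinity>" using elim by (simp add: less_top)
      finally show "(\<integral>\<^sup>+\<eta>. ennreal (norm (of_real (jap (- s) \<eta>) * G \<omega> \<eta>)) \<partial>lborel) < \<infinity>" .
    qed (use gm in measurable)
  qed
qed

text \<open>With the truncated kernel the potential at \<open>x\<close> is an integral of \<open>Z\<close> against a fixed compactly supported function,
  to which spectral domination applies. The truncation is removed by Fatou's lemma on the left-hand side and by
  dominated convergence on the right-hand side.\<close>

lemma potential_moment:
  assumes K: "K > 0"
  shows "(\<integral>\<^sup>+\<omega>. ennreal (cmod (potential s (\<lambda>y. \<rho> y * Z y \<omega>) x) ^ (2 * K)) \<partial>M)
    \<le> ennreal (moment_const K * (LINT \<xi>|lborel. v \<xi> * (cmod (potential s (\<lambda>y. \<rho> y * cis (y \<bullet> \<xi>)) x))\<^sup>2) ^ K)"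
proof -
  note [measurable] = schwartz_measurable[OF \<rho>] borel_measurable_integrable[OF spectral_density_integrable]
  define c where "c k y = \<rho> y * truncated_bessel_kernel s k (x - y)" for k y
  define X where "X k \<omega> = (LINT y|lborel. c k y * Z y \<omega>)" for k \<omega>
  have X: "X k \<omega> = inv_fourier (\<lambda>\<eta>. of_real (cutoff k \<eta>) * (of_real (jap (- s) \<eta>) * fourier (\<lambda>y. \<rho> y * Z y \<omega>) \<eta>)) x" for k \<omega>
    using truncated_potential_eq[OF localised_process_integrable[of \<omega>], of s k x] unfolding X_def c_def by (simp add: mult_ac)
  have \<rho>c: "integrable lborel (\<lambda>y. \<rho> y * cis (y \<bullet> \<xi>))" for \<xi>
    using integrable_mult_cis[OF schwartz_integrable[OF \<rho>], of 1 \<xi>] by (simp add: inner_commute)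
  have ftc: "ft 1 (c k) \<xi> = inv_fourier (\<lambda>\<eta>. of_real (cutoff k \<eta>) * (of_real (jap (- s) \<eta>) * fourier (\<lambda>y. \<rho> y * cis (y \<bullet> \<xi>)) \<eta>)) x" for k \<xi>
    using truncated_potential_eq[OF \<rho>c[of \<xi>], of s k x] unfolding ft_def c_def by (simp add: mult_ac inner_commute)
  obtain C where C: "C \<ge> 0"
    "\<And>\<xi> \<eta>. cmod (of_real (jap (- s) \<eta>) * fourier (\<lambda>y. \<rho> y * cis (y \<bullet> \<xi>)) \<eta>) \<le> C * jap \<bar>s\<bar> \<xi> * jap (- real DIM('a) - 1) (\<eta> - \<xi>)"
    using modulated_weight_bound[OF \<rho>] by blast
  have r: "- real DIM('a) - 1 < - real DIM('a)" by simp
  have wint: "integrable lborel (\<lambda>\<eta>. of_real (jap (- s) \<eta>) * fourier (\<lambda>y. \<rho> y * cis (y \<bullet> \<xi>)) \<eta>)" for \<xi>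
    by (rule Bochner_Integration.integrable_bound[OF integrable_mult_right[OF integrable_jap_translate(1)[OF r, of \<xi>], of "C * jap \<bar>s\<bar> \<xi>"]])
       (use C in \<open>auto intro!: AE_I2 order_trans[OF _ abs_ge_self]\<close>)
  define J where "J = (LINT \<zeta>|lborel. jap (- real DIM('a) - 1) (\<zeta>::'a))"
  have ftb: "cmod (ft 1 (c k) \<xi>) \<le> C * J * jap \<bar>s\<bar> \<xi>" for k \<xi>
  proof -
    have "cmod (ft 1 (c k) \<xi>) \<le> (LINT \<eta>|lborel. cmod (of_real (cutoff k \<eta>) * (of_real (jap (- s) \<eta>) * fourier (\<lambda>y. \<rho> y * cis (y \<bullet> \<xi>)) \<eta>)))"
      unfolding ftc by (rule norm_inv_fourier_le)
    also have "\<dots> \<le> (LINT \<eta>|lborel. (C * jap \<bar>s\<bar> \<xi>) * jap (- real DIM('a) - 1) (\<eta> - \<xi>))"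
    proof (rule integral_mono)
      have le: "cmod (of_real (cutoff k \<eta>) * (of_real (jap (- s) \<eta>) * fourier (\<lambda>y. \<rho> y * cis (y \<bullet> \<xi>)) \<eta>))
          \<le> cmod (of_real (jap (- s) \<eta>) * fourier (\<lambda>y. \<rho> y * cis (y \<bullet> \<xi>)) \<eta>)" for \<eta>
        by (subst norm_mult) (simp add: mult_left_le_one_le)
      show "integrable lborel (\<lambda>\<eta>. cmod (of_real (cutoff k \<eta>) * (of_real (jap (- s) \<eta>) * fourier (\<lambda>y. \<rho> y * cis (y \<bullet> \<xi>)) \<eta>)))"
        by (intro integrable_norm Bochner_Integration.integrable_bound[OF wint[of \<xi>]])
           (use le in \<open>auto intro!: AE_I2\<close>)
      show "integrable lborel (\<lambda>\<eta>. (C * jap \<bar>s\<bar> \<xi>) * jap (- real DIM('a) - 1) (\<eta> - \<xi>))"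
        by (intro integrable_mult_right integrable_jap_translate r)
      show "cmod (of_real (cutoff k \<eta>) * (of_real (jap (- s) \<eta>) * fourier (\<lambda>y. \<rho> y * cis (y \<bullet> \<xi>)) \<eta>))
          \<le> (C * jap \<bar>s\<bar> \<xi>) * jap (- real DIM('a) - 1) (\<eta> - \<xi>)" for \<eta>
        using order_trans[OF le C(2)] .
    qed
    also have "(LINT \<eta>|lborel. (C * jap \<bar>s\<bar> \<xi>) * jap (- real DIM('a) - 1) (\<eta> - \<xi>)) = C * J * jap \<bar>s\<bar> \<xi>"
      unfolding integral_mult_right_zero integrable_jap_translate(2)[OF r] J_def by simp
    finally show ?thesis .
  qed
  have cint: "integrable lborel (c k)" for k
    unfolding c_def
    by (rule Bochner_Integration.integrable_bound[OF integrable_mult_left[OF integrable_norm[OF schwartz_integrable[OF \<rho>]],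
          of "LINT \<eta>|lborel. cutoff k (\<eta>::'a) * jap (- s) \<eta>"]])
       (auto intro!: AE_I2 order_trans[OF _ abs_ge_self] mult_left_mono truncated_bessel_kernel_bound simp: norm_mult)
  show ?thesis
  proof (rule moment_limit[where X=X and b="\<lambda>k. moment_const K * (LINT \<xi>|lborel. v \<xi> * (cmod (ft 1 (c k) \<xi>))\<^sup>2) ^ K"])
    show "X k \<in> borel_measurable M" for k
      unfolding X_def c_def by measurable
    show "AE \<omega> in M. (\<lambda>k. X k \<omega>) \<longlonglongrightarrow> potential s (\<lambda>y. \<rho> y * Z y \<omega>) x"
      using localised_process_weighted_integrable[of s]
    proof eventually_elim
      case (elim \<omega>)
      have "(\<lambda>y. \<rho> y * Z y \<omega>) \<in> borel_measurable borel"
        using borel_measurable_integrable[OF localised_process_integrable[of \<omega>]] by simp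
      from truncated_potential_tendsto[OF this elim] show ?case unfolding X .
    qed
    show "(\<integral>\<^sup>+\<omega>. ennreal (cmod (X k \<omega>) ^ (2 * K)) \<partial>M) \<le> ennreal (moment_const K * (LINT \<xi>|lborel. v \<xi> * (cmod (ft 1 (c k) \<xi>))\<^sup>2) ^ K)" for k
      unfolding X_def
      by (rule spectrally_dominated_integral[OF Z cont spectral_density_integrable v0 cint _ K, where R=R]) (simp add: c_def supp)
    have "(\<lambda>k. LINT \<xi>|lborel. v \<xi> * (cmod (ft 1 (c k) \<xi>))\<^sup>2)
        \<longlonglongrightarrow> (LINT \<xi>|lborel. v \<xi> * (cmod (potential s (\<lambda>y. \<rho> y * cis (y \<bullet> \<xi>)) x))\<^sup>2)"
    proof (rule integral_dominated_convergence[where w="\<lambda>\<xi>. (C * J)\<^sup>2 * (jap (2 * \<bar>s\<bar>) \<xi> * v \<xi>)"])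
      show "integrable lborel (\<lambda>\<xi>. (C * J)\<^sup>2 * (jap (2 * \<bar>s\<bar>) \<xi> * v \<xi>))" by (intro integrable_mult_right v)
      have cv: "(\<lambda>k. ft 1 (c k) \<xi>) \<longlonglongrightarrow> potential s (\<lambda>y. \<rho> y * cis (y \<bullet> \<xi>)) x" for \<xi>
        unfolding ftc by (rule truncated_potential_tendsto[OF _ wint]) measurable
      then show "AE \<xi> in lborel. (\<lambda>k. v \<xi> * (cmod (ft 1 (c k) \<xi>))\<^sup>2) \<longlonglongrightarrow> v \<xi> * (cmod (potential s (\<lambda>y. \<rho> y * cis (y \<bullet> \<xi>)) x))\<^sup>2"
        by (intro AE_I2 tendsto_intros)
      have [measurable]: "(\<lambda>\<xi>. ft 1 (c k) \<xi>) \<in> borel_measurable borel" for k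
        unfolding ft_def c_def by measurable
      show "(\<lambda>\<xi>. v \<xi> * (cmod (ft 1 (c k) \<xi>))\<^sup>2) \<in> borel_measurable lborel" for k by measurable
      have "(\<lambda>\<xi>. potential s (\<lambda>y. \<rho> y * cis (y \<bullet> \<xi>)) x) \<in> borel_measurable borel"
        by (rule borel_measurable_LIMSEQ_metric[OF _ cv]) measurable
      then show "(\<lambda>\<xi>. v \<xi> * (cmod (potential s (\<lambda>y. \<rho> y * cis (y \<bullet> \<xi>)) x))\<^sup>2) \<in> borel_measurable lborel"
        by measurable
      show "AE \<xi> in lborel. norm (v \<xi> * (cmod (ft 1 (c k) \<xi>))\<^sup>2) \<le> (C * J)\<^sup>2 * (jap (2 * \<bar>s\<bar>) \<xi> * v \<xi>)" for k
      proof (intro AE_I2)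
        fix \<xi>
        have "v \<xi> * (cmod (ft 1 (c k) \<xi>))\<^sup>2 \<le> v \<xi> * (C * J * jap \<bar>s\<bar> \<xi>)\<^sup>2"
          by (intro mult_left_mono power_mono ftb v0) auto
        also have "\<dots> = (C * J)\<^sup>2 * (jap (2 * \<bar>s\<bar>) \<xi> * v \<xi>)"
          by (simp add: power_mult_distrib jap_power mult_ac)
        finally show "norm (v \<xi> * (cmod (ft 1 (c k) \<xi>))\<^sup>2) \<le> (C * J)\<^sup>2 * (jap (2 * \<bar>s\<bar>) \<xi> * v \<xi>)" using v0 by simp
      qed
    qed
    then show "(\<lambda>k. moment_const K * (LINT \<xi>|lborel. v \<xi> * (cmod (ft 1 (c k) \<xi>))\<^sup>2) ^ K)
        \<longlonglongrightarrow> moment_const K * (LINT \<xi>|lborel. v \<xi> * (cmod (potential s (\<lambda>y. \<rho> y * cis (y \<bullet> \<xi>)) x))\<^sup>2) ^ K"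
      by (intro tendsto_intros)
  qed
qed

end

section \<open>Dyadic chaining\<close>

lemma geometric_chain:
  fixes a :: "nat \<Rightarrow> complex"
  assumes step: "\<And>i. cmod (a (Suc i) - a i) \<le> B * r ^ i" and r: "0 < r" "r < 1" and mn: "m \<le> n" and B: "0 \<le> B"
  shows "cmod (a n - a m) \<le> B * r ^ m / (1 - r)"
proof -
  have "cmod (a n - a m) \<le> B * (r ^ m - r ^ n) / (1 - r)"
    using mn
  proof (induction n rule: dec_induct)
    case (step n)
    have "cmod (a (Suc n) - a m) \<le> cmod (a (Suc n) - a n) + cmod (a n - a m)"
      using norm_triangle_ineq[of "a (Suc n) - a n" "a n - a m"] by simp
    also have "\<dots> \<le> B * r ^ n + B * (r ^ m - r ^ n) / (1 - r)"
      using assms(1)[of n] step.IH by linarith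
    also have "\<dots> = B * (r ^ m - r ^ Suc n) / (1 - r)" using r by (simp add: field_simps)
    finally show ?case .
  qed auto
  also have "\<dots> \<le> B * r ^ m / (1 - r)"
    using r B by (intro divide_right_mono mult_left_mono) auto
  finally show ?thesis .
qed

definition dyadic :: "real \<Rightarrow> nat \<Rightarrow> nat \<Rightarrow> real" where
  "dyadic T k j = T * real j / 2 ^ k"

definition dyadics :: "real \<Rightarrow> real set" where
  "dyadics T = {dyadic T k j |k j. j \<le> 2 ^ k}"

lemma dyadic_in: "j \<le> 2 ^ k \<Longrightarrow> dyadic T k j \<in> dyadics T"
  unfolding dyadics_def by blast

lemma countable_dyadics: "countable (dyadics T)"
proof -
  have "dyadics T \<subseteq> (\<lambda>(k, j). dyadic T k j) ` UNIV" unfolding dyadics_def by auto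
  then show ?thesis by (rule countable_subset) auto
qed

lemma zero_in_dyadics: "0 \<in> dyadics T"
  using dyadic_in[of 0 0 T] by (simp add: dyadic_def)

lemma dyadics_bounds:
  assumes T: "T > 0" and t: "t \<in> dyadics T" shows "0 \<le> t" "t \<le> T"
proof -
  obtain k j where t: "t = dyadic T k j" "j \<le> 2 ^ k" using t unfolding dyadics_def by auto
  then have "real j \<le> real (2 ^ k)" by (simp only: of_nat_le_iff)
  then have "real j \<le> 2 ^ k" by simp
  then show "0 \<le> t" "t \<le> T" unfolding t(1) dyadic_def using T by (auto simp: divide_le_eq)
qed

definition dyadic_index :: "real \<Rightarrow> nat \<Rightarrow> real \<Rightarrow> nat" where
  "dyadic_index T k t = nat \<lfloor>t * 2 ^ k / T\<rfloor>"

definition dyadic_floor :: "real \<Rightarrow> nat \<Rightarrow> real \<Rightarrow> real" where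
  "dyadic_floor T k t = dyadic T k (dyadic_index T k t)"

context
  fixes T :: real assumes T: "T > 0"
begin

lemma dyadic_index_bounds:
  assumes "0 \<le> t"
  shows "real (dyadic_index T k t) \<le> t * 2 ^ k / T" "t * 2 ^ k / T < real (dyadic_index T k t) + 1"
proof -
  have "0 \<le> t * 2 ^ k / T" using assms T by simp
  then have "real (dyadic_index T k t) = of_int \<lfloor>t * 2 ^ k / T\<rfloor>" unfolding dyadic_index_def by simp
  then show "real (dyadic_index T k t) \<le> t * 2 ^ k / T" "t * 2 ^ k / T < real (dyadic_index T k t) + 1"
    by linarith+
qed

lemma dyadic_index_le:
  assumes "0 \<le> t" "t \<le> T" shows "dyadic_index T k t \<le> 2 ^ k"
proof -
  have "t * 2 ^ k / T \<le> 2 ^ k" using assms T by (simp add: field_simps)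
  then have "real (dyadic_index T k t) \<le> 2 ^ k" using dyadic_index_bounds(1)[OF assms(1), of k] by linarith
  then show ?thesis by (metis of_nat_le_iff of_nat_numeral of_nat_power)
qed

lemma dyadic_floor_in: "0 \<le> t \<Longrightarrow> t \<le> T \<Longrightarrow> dyadic_floor T k t \<in> dyadics T"
  unfolding dyadic_floor_def by (intro dyadic_in dyadic_index_le)

lemma dyadic_floor_bounds:
  assumes "0 \<le> t" shows "dyadic_floor T k t \<le> t" "t < dyadic_floor T k t + T / 2 ^ k"
  using dyadic_index_bounds[OF assms, of k] T by (simp_all add: dyadic_floor_def dyadic_def field_simps)

lemma dyadic_floor_tendsto:
  assumes "0 \<le> t" shows "(\<lambda>k. dyadic_floor T k t) \<longlonglongrightarrow> t"
proof (rule tendsto_sandwich)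
  have "(\<lambda>k. t - T * (1 / 2) ^ k) \<longlonglongrightarrow> t - T * 0" by (intro tendsto_intros LIMSEQ_power_zero) auto
  then show "(\<lambda>k. t - T * (1 / 2) ^ k) \<longlonglongrightarrow> t" by simp
  show "\<forall>\<^sub>F k in sequentially. t - T * (1 / 2) ^ k \<le> dyadic_floor T k t"
    using dyadic_floor_bounds(2)[OF assms] by (intro always_eventually allI) (simp add: power_divide algebra_simps less_imp_le)
  show "\<forall>\<^sub>F k in sequentially. dyadic_floor T k t \<le> t"
    using dyadic_floor_bounds(1)[OF assms] by simp
qed simp

lemma dyadic_floor_eq:
  assumes t: "t = dyadic T K j" and k: "K \<le> k" shows "dyadic_floor T k t = t"
proof -
  have p: "(2::real) ^ k = 2 ^ (k - K) * 2 ^ K" using k by (simp flip: power_add)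
  have "t * 2 ^ k / T = real (j * 2 ^ (k - K))"
    using T by (simp add: t dyadic_def p)
  then have i: "dyadic_index T k t = j * 2 ^ (k - K)" unfolding dyadic_index_def by (simp only: floor_of_nat nat_int)
  have "dyadic_floor T k t = T * real (j * 2 ^ (k - K)) / 2 ^ k" unfolding dyadic_floor_def i dyadic_def ..
  also have "\<dots> = t" by (simp add: t dyadic_def p)
  finally show ?thesis .
qed

lemma dyadic_double: "dyadic T (Suc k) (2 * i) = dyadic T k i"
  by (simp add: dyadic_def)

text \<open>Kolmogorov's chaining argument: control of the increments between neighbours on every dyadic grid gives
  a Hoelder bound.\<close>

lemma dyadic_chaining:
  fixes f :: "real \<Rightarrow> complex"
  assumes \<theta>: "\<theta> > 0" and A: "A \<ge> 0"
    and inc: "\<And>k j. j < 2 ^ k \<Longrightarrow> cmod (f (dyadic T k (Suc j)) - f (dyadic T k j)) \<le> A * (2 powr - \<theta>) ^ k"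
    and t: "t \<in> dyadics T" and t0: "t0 \<in> dyadics T"
  shows "cmod (f t - f t0) \<le> A * (1 + 2 / (1 - 2 powr - \<theta>)) * (2 / T * \<bar>t - t0\<bar>) powr \<theta>"
proof -
  define r where "r = 2 powr - \<theta>"
  have "2 powr - \<theta> < 2 powr 0" using \<theta> by (intro powr_less_mono) auto
  then have r: "0 < r" "r < 1" by (auto simp: r_def)
  have rr: "0 \<le> r" using r by simp
  define a where "a k u = f (dyadic_floor T k u)" for k u
  have step: "cmod (a (Suc k) u - a k u) \<le> A * r ^ k" if u: "u \<in> dyadics T" for k u
  proof -
    note ub = dyadics_bounds[OF T u]
    let ?i = "dyadic_index T k u" and ?i' = "dyadic_index T (Suc k) u"
    have "u * 2 ^ Suc k / T = 2 * (u * 2 ^ k / T)" by simp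
    then have "real ?i' < 2 * real ?i + 2" "2 * real ?i < real ?i' + 1"
      using dyadic_index_bounds[OF ub(1), of k] dyadic_index_bounds[OF ub(1), of "Suc k"] by linarith+
    then have "?i' = 2 * ?i \<or> ?i' = Suc (2 * ?i)" by linarith
    then show ?thesis
    proof
      assume "?i' = 2 * ?i"
      then have "a (Suc k) u = a k u" by (simp add: a_def dyadic_floor_def dyadic_double)
      then show ?thesis using A rr by simp
    next
      assume eq: "?i' = Suc (2 * ?i)"
      then have "2 * ?i < 2 ^ Suc k" using dyadic_index_le[OF ub, of "Suc k"] by simp
      from inc[OF this] have "cmod (a (Suc k) u - a k u) \<le> A * r ^ Suc k"
        by (simp add: a_def dyadic_floor_def eq dyadic_double r_def)
      also have "\<dots> \<le> A * r ^ k" using A r by (intro mult_left_mono power_decreasing) auto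
      finally show ?thesis .
    qed
  qed
  have tail: "cmod (f u - a k u) \<le> A * r ^ k / (1 - r)" if u: "u \<in> dyadics T" for k u
  proof -
    obtain K j where "u = dyadic T K j" using u unfolding dyadics_def by auto
    then have "a (max k K) u = f u" using dyadic_floor_eq[of u K j "max k K"] by (simp add: a_def)
    moreover have "cmod (a (max k K) u - a k u) \<le> A * r ^ k / (1 - r)"
      by (rule geometric_chain[where a="\<lambda>k. a k u", OF step[OF u] r _ A]) simp
    ultimately show ?thesis by simp
  qed
  have main: "cmod (f t - f t0) \<le> A * (1 + 2 / (1 - r)) * (2 / T * (t - t0)) powr \<theta>"
    if t: "t \<in> dyadics T" and t0: "t0 \<in> dyadics T" and less: "t0 < t" for t t0
  proof -
    note tb = dyadics_bounds[OF T t] and t0b = dyadics_bounds[OF T t0]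
    define x where "x = (t - t0) / T"
    have x: "0 < x" "x \<le> 1" using less tb t0b T by (auto simp: x_def)
    obtain k where k: "(1 / 2) ^ Suc k < x" "x \<le> (1 / 2) ^ k"
    proof -
      define N where "N = (LEAST n. (1 / 2) ^ n < x)"
      have "\<exists>n. (1 / 2) ^ n < x" using x(1) by (intro real_arch_pow_inv) auto
      then have N: "(1 / 2) ^ N < x" unfolding N_def by (rule LeastI_ex)
      have "N \<noteq> 0" using N x(2) by (cases N) auto
      then obtain k where "N = Suc k" by (cases N) auto
      moreover have "\<not> (1 / 2) ^ k < x" using not_less_Least[of k "\<lambda>n. (1 / 2) ^ n < x"] \<open>N = Suc k\<close> unfolding N_def by simp
      ultimately show ?thesis using N that[of k] by auto
    qed
    let ?i = "dyadic_index T k t" and ?m = "dyadic_index T k t0"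
    have "t * 2 ^ k / T - t0 * 2 ^ k / T = x * 2 ^ k"
      by (simp add: x_def left_diff_distrib diff_divide_distrib)
    also have "\<dots> \<le> (1 / 2) ^ k * 2 ^ k" by (intro mult_right_mono k(2)) auto
    finally have d: "t * 2 ^ k / T - t0 * 2 ^ k / T \<le> 1" by (simp add: power_divide)
    have d0: "t0 * 2 ^ k / T \<le> t * 2 ^ k / T" using less T by (simp add: field_simps)
    have "real ?i < real ?m + 2" "real ?m < real ?i + 1"
      using dyadic_index_bounds[OF tb(1), of k] dyadic_index_bounds[OF t0b(1), of k] d d0 by linarith+
    then have "?i = ?m \<or> ?i = Suc ?m" by linarith
    then have mid: "cmod (a k t - a k t0) \<le> A * r ^ k"
    proof
      assume eq: "?i = ?m"
      have "a k t = a k t0" unfolding a_def dyadic_floor_def eq ..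
      then show ?thesis using A rr by simp
    next
      assume eq: "?i = Suc ?m"
      then have "?m < 2 ^ k" using dyadic_index_le[OF tb, of k] by simp
      from inc[OF this] show ?thesis by (simp add: a_def dyadic_floor_def eq r_def)
    qed
    have "f t - f t0 = (f t - a k t) + (a k t - a k t0) - (f t0 - a k t0)" by simp
    then have "cmod (f t - f t0) \<le> cmod (f t - a k t) + cmod (a k t - a k t0) + cmod (f t0 - a k t0)"
      using norm_triangle_ineq4[of "(f t - a k t) + (a k t - a k t0)" "f t0 - a k t0"]
        norm_triangle_ineq[of "f t - a k t" "a k t - a k t0"] by simp
    also have "\<dots> \<le> A * r ^ k / (1 - r) + A * r ^ k + A * r ^ k / (1 - r)"
      by (intro add_mono tail mid t t0)
    also have "\<dots> = A * (1 + 2 / (1 - r)) * r ^ k" by (simp add: algebra_simps)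
    also have "r ^ k = ((1 / 2) ^ k) powr \<theta>"
    proof -
      have "(1 / 2 :: real) ^ k = 2 powr (- real k)"
        by (simp add: powr_minus powr_realpow power_divide inverse_eq_divide)
      moreover have "r ^ k = r powr real k" using r by (simp add: powr_realpow)
      ultimately show ?thesis by (simp add: r_def powr_powr mult.commute)
    qed
    also have "A * (1 + 2 / (1 - r)) * ((1 / 2) ^ k) powr \<theta> \<le> A * (1 + 2 / (1 - r)) * (2 / T * (t - t0)) powr \<theta>"
    proof (intro mult_left_mono powr_mono2)
      show "(1 / 2) ^ k \<le> 2 / T * (t - t0)" using k(1) by (simp add: x_def field_simps)
      show "0 \<le> A * (1 + 2 / (1 - r))" using A r by auto
    qed (use \<theta> in auto)
    finally show ?thesis .
  qed
  show ?thesis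
  proof (cases t t0 rule: linorder_cases)
    case less
    from main[OF t0 t less] show ?thesis using less by (simp add: r_def norm_minus_commute)
  next
    case greater
    from main[OF t t0 greater] show ?thesis using greater by (simp add: r_def)
  qed simp
qed

text \<open>The same argument in the truncation parameter: the index \<open>n\<close> is compared with the last \<open>2\<^sup>l - 1\<close> before
  it, and the latter form a chain that starts at \<open>0\<close>. Chaining in both parameters bounds a whole sequence of
  paths by one number \<open>A\<close>.\<close>

lemma double_chaining:
  assumes \<theta>: "\<theta> > 0"
  obtains C where "C \<ge> 0" and
    "\<And>(g :: nat \<Rightarrow> real \<Rightarrow> complex) A t t0 n. \<lbrakk>A \<ge> 0; \<And>t. t \<in> dyadics T \<Longrightarrow> g 0 t = 0; \<And>n. g n 0 = 0;
      \<And>l i k j. i \<le> 2 ^ l \<Longrightarrow> j < 2 ^ k \<Longrightarrow>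
        cmod (g (2 ^ l - 1 + i) (dyadic T k (Suc j)) - g (2 ^ l - 1) (dyadic T k (Suc j))
            - (g (2 ^ l - 1 + i) (dyadic T k j) - g (2 ^ l - 1) (dyadic T k j)))
          \<le> A * (2 powr - \<theta>) ^ l * (2 powr - \<theta>) ^ k;
      t \<in> dyadics T; t0 \<in> dyadics T\<rbrakk> \<Longrightarrow> cmod (g n t - g n t0) \<le> C * A * \<bar>t - t0\<bar> powr \<theta>"
    "\<And>(g :: nat \<Rightarrow> real \<Rightarrow> complex) A t l n m. \<lbrakk>A \<ge> 0; \<And>t. t \<in> dyadics T \<Longrightarrow> g 0 t = 0; \<And>n. g n 0 = 0;
      \<And>l i k j. i \<le> 2 ^ l \<Longrightarrow> j < 2 ^ k \<Longrightarrow>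
        cmod (g (2 ^ l - 1 + i) (dyadic T k (Suc j)) - g (2 ^ l - 1) (dyadic T k (Suc j))
            - (g (2 ^ l - 1 + i) (dyadic T k j) - g (2 ^ l - 1) (dyadic T k j)))
          \<le> A * (2 powr - \<theta>) ^ l * (2 powr - \<theta>) ^ k;
      t \<in> dyadics T; 2 ^ l \<le> Suc n; 2 ^ l \<le> Suc m\<rbrakk> \<Longrightarrow> cmod (g n t - g m t) \<le> C * A * (2 powr - \<theta>) ^ l"
proof -
  define r where "r = 2 powr - \<theta>"
  have "2 powr - \<theta> < 2 powr 0" using \<theta> by (intro powr_less_mono) auto
  then have r: "0 < r" "r < 1" by (auto simp: r_def)
  define c where "c = (1 + 2 / (1 - r)) * (2 / T) powr \<theta>"
  define C where "C = 2 * (c + c * T powr \<theta>) * (1 + 1 / (1 - r))"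
  have c0: "c \<ge> 0" unfolding c_def using r by auto
  have C0: "C \<ge> 0" unfolding C_def using r c0 by auto
  {
    fix g :: "nat \<Rightarrow> real \<Rightarrow> complex" and A
    assume A: "A \<ge> 0" and g0: "\<And>t. t \<in> dyadics T \<Longrightarrow> g 0 t = 0" and gn: "\<And>n. g n 0 = 0"
      and inc: "\<And>l i k j. i \<le> 2 ^ l \<Longrightarrow> j < 2 ^ k \<Longrightarrow>
        cmod (g (2 ^ l - 1 + i) (dyadic T k (Suc j)) - g (2 ^ l - 1) (dyadic T k (Suc j))
            - (g (2 ^ l - 1 + i) (dyadic T k j) - g (2 ^ l - 1) (dyadic T k j)))
          \<le> A * (2 powr - \<theta>) ^ l * (2 powr - \<theta>) ^ k"
    define b where "b i t = g (2 ^ i - 1) t" for i :: nat and t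
    have hoelder: "cmod ((g (2 ^ l - 1 + i) t - b l t) - (g (2 ^ l - 1 + i) t0 - b l t0)) \<le> c * A * r ^ l * \<bar>t - t0\<bar> powr \<theta>"
      if "i \<le> 2 ^ l" "t \<in> dyadics T" "t0 \<in> dyadics T" for l i t t0
    proof -
      have "cmod ((g (2 ^ l - 1 + i) t - b l t) - (g (2 ^ l - 1 + i) t0 - b l t0))
          \<le> A * r ^ l * (1 + 2 / (1 - 2 powr - \<theta>)) * (2 / T * \<bar>t - t0\<bar>) powr \<theta>"
        using inc[OF that(1)] A r
        by (intro dyadic_chaining[where f="\<lambda>t. g (2 ^ l - 1 + i) t - b l t", OF \<theta> _ _ that(2,3)]) (auto simp: b_def r_def)
      also have "(2 / T * \<bar>t - t0\<bar>) powr \<theta> = (2 / T) powr \<theta> * \<bar>t - t0\<bar> powr \<theta>"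
        by (rule powr_mult)
      finally show ?thesis by (simp add: c_def r_def mult_ac)
    qed
    have unif: "cmod (g (2 ^ l - 1 + i) t - b l t) \<le> c * T powr \<theta> * A * r ^ l" if "i \<le> 2 ^ l" "t \<in> dyadics T" for l i t
    proof -
      have "cmod (g (2 ^ l - 1 + i) t - b l t) \<le> c * A * r ^ l * \<bar>t - 0\<bar> powr \<theta>"
        using hoelder[OF that zero_in_dyadics] gn by (simp add: b_def)
      also have "\<dots> \<le> c * A * r ^ l * T powr \<theta>"
        using dyadics_bounds[OF T that(2)] c0 A r \<theta> by (intro mult_left_mono powr_mono2) auto
      finally show ?thesis by (simp add: mult_ac)
    qed
    have bsuc: "b (Suc l) t = g (2 ^ l - 1 + 2 ^ l) t" for l t
      by (simp add: b_def mult_2)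
    have block: "\<exists>l i. i \<le> 2 ^ l \<and> n = 2 ^ l - 1 + i \<and> Suc n < 2 ^ Suc l" for n :: nat
    proof -
      obtain l where l: "2 ^ l \<le> Suc n" "Suc n < 2 ^ (l + 1)" using ex_power_ivl1[of 2 "Suc n"] by auto
      have "1 \<le> (2::nat) ^ l" by simp
      with l show ?thesis by (intro exI[of _ l] exI[of _ "Suc n - 2 ^ l"]) auto
    qed
    have h: "cmod (g n t - g n t0) \<le> C * A * \<bar>t - t0\<bar> powr \<theta>" if tt: "t \<in> dyadics T" "t0 \<in> dyadics T" for n t t0
    proof -
      let ?P = "\<bar>t - t0\<bar> powr \<theta>"
      obtain l i where li: "i \<le> 2 ^ l" "n = 2 ^ l - 1 + i" using block by blast
      have "cmod ((b l t - b l t0) - (b 0 t - b 0 t0)) \<le> c * A * ?P * r ^ 0 / (1 - r)"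
      proof (rule geometric_chain[where a="\<lambda>i. b i t - b i t0", OF _ r])
        show "cmod (b (Suc i) t - b (Suc i) t0 - (b i t - b i t0)) \<le> c * A * ?P * r ^ i" for i
          using hoelder[of "2 ^ i" i, OF _ tt] unfolding bsuc[symmetric] by (simp add: algebra_simps)
      qed (use c0 A in auto)
      then have 1: "cmod (b l t - b l t0) \<le> c * A * ?P / (1 - r)" using g0 tt by (simp add: b_def)
      have "c * A * r ^ l * ?P \<le> c * A * 1 * ?P" using c0 A r by (intro mult_right_mono mult_left_mono power_le_one) auto
      with hoelder[OF li(1) tt] have 2: "cmod ((g n t - b l t) - (g n t0 - b l t0)) \<le> c * A * ?P" unfolding li(2) by simp
      have "g n t - g n t0 = ((g n t - b l t) - (g n t0 - b l t0)) + (b l t - b l t0)" by simp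
      then have "cmod (g n t - g n t0) \<le> c * A * ?P + c * A * ?P / (1 - r)"
        using 1 2 norm_triangle_ineq[of "(g n t - b l t) - (g n t0 - b l t0)" "b l t - b l t0"] by simp
      also have "\<dots> = (c * (1 + 1 / (1 - r))) * (A * ?P)" by (simp add: algebra_simps)
      also have "\<dots> \<le> C * (A * ?P)"
      proof (intro mult_right_mono)
        have "c \<le> 2 * (c + c * T powr \<theta>)" using c0 by simp
        then show "c * (1 + 1 / (1 - r)) \<le> C" unfolding C_def using r by (intro mult_right_mono) auto
      qed (use A in auto)
      finally show ?thesis by (simp add: mult.assoc)
    qed
    have u1: "cmod (g n t - b l t) \<le> (c * T powr \<theta> * (1 + 1 / (1 - r))) * (A * r ^ l)" if t: "t \<in> dyadics T" and n: "2 ^ l \<le> Suc n" for n l t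
    proof -
      obtain l' i where li: "i \<le> 2 ^ l'" "n = 2 ^ l' - 1 + i" "Suc n < 2 ^ Suc l'" using block by blast
      have "(2::nat) ^ l < 2 ^ Suc l'" using n li(3) by linarith
      then have "l < Suc l'" by (rule power_less_imp_less_exp[rotated]) simp
      then have ll: "l \<le> l'" by simp
      have "cmod (b l' t - b l t) \<le> c * T powr \<theta> * A * r ^ l / (1 - r)"
      proof (rule geometric_chain[where a="\<lambda>i. b i t", OF _ r ll])
        show "cmod (b (Suc i) t - b i t) \<le> c * T powr \<theta> * A * r ^ i" for i
          using unif[of "2 ^ i" i, OF _ t] unfolding bsuc[symmetric] by simp
      qed (use c0 A in auto)
      moreover have "cmod (g n t - b l' t) \<le> c * T powr \<theta> * A * r ^ l"
      proof -
        have "r ^ l' \<le> r ^ l" using r ll by (intro power_decreasing) auto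
        then have "c * T powr \<theta> * A * r ^ l' \<le> c * T powr \<theta> * A * r ^ l" using c0 A by (intro mult_left_mono) auto
        then show ?thesis using unif[OF li(1) t] unfolding li(2) by simp
      qed
      ultimately have "cmod (g n t - b l t) \<le> c * T powr \<theta> * A * r ^ l + c * T powr \<theta> * A * r ^ l / (1 - r)"
        using norm_triangle_ineq[of "g n t - b l' t" "b l' t - b l t"] by simp
      then show ?thesis by (simp add: algebra_simps)
    qed
    have u: "cmod (g n t - g m t) \<le> C * A * r ^ l" if t: "t \<in> dyadics T" and n: "2 ^ l \<le> Suc n" and m: "2 ^ l \<le> Suc m" for n m l t
    proof -
      have "cmod (g n t - g m t) \<le> cmod (g n t - b l t) + cmod (g m t - b l t)"
        using norm_triangle_ineq4[of "g n t - b l t" "g m t - b l t"] by simp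
      also have "\<dots> \<le> 2 * ((c * T powr \<theta> * (1 + 1 / (1 - r))) * (A * r ^ l))"
        using add_mono[OF u1[OF t n] u1[OF t m]] by (simp only: mult_2)
      also have "\<dots> = (2 * (c * T powr \<theta>) * (1 + 1 / (1 - r))) * (A * r ^ l)" by (simp only: mult.assoc)
      also have "\<dots> \<le> C * (A * r ^ l)"
      proof (intro mult_right_mono)
        have "2 * (c * T powr \<theta>) \<le> 2 * (c + c * T powr \<theta>)" using c0 by simp
        then show "2 * (c * T powr \<theta>) * (1 + 1 / (1 - r)) \<le> C" unfolding C_def using r by (intro mult_right_mono) auto
      qed (use A r in auto)
      finally show ?thesis by (simp add: mult.assoc)
    qed
    note h u
  }
  note facts = this[unfolded r_def]
  show ?thesis
    by (rule that[OF C0]; (rule facts(1) | rule facts(2)); assumption)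
qed

end

section \<open>Bessel potentials of distributions\<close>

definition bessel_dist :: "real \<Rightarrow> 'a::euclidean_space distribution \<Rightarrow> 'a distribution" where
  "bessel_dist s u = inv_fourier_dist (mult_dist (\<lambda>\<xi>. of_real (jap (- s) \<xi>)) (fourier_dist u))"

text \<open>The transpose of \<^term>\<open>bessel_dist s\<close>, acting on test functions.\<close>

definition bessel_op :: "real \<Rightarrow> ('a::euclidean_space \<Rightarrow> complex) \<Rightarrow> 'a \<Rightarrow> complex" where
  "bessel_op s \<phi> = fourier (\<lambda>\<xi>. of_real (jap (- s) \<xi>) * inv_fourier \<phi> \<xi>)"

lemma sobolev_norm_eq: "sobolev_norm (- s) p u = Lp_norm_dist p (bessel_dist s u)"
  unfolding sobolev_norm_def bessel_dist_def by (simp only: jap_def[abs_def])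

lemma bessel_op_schwartz: "\<phi> \<in> schwartz \<Longrightarrow> bessel_op s \<phi> \<in> schwartz"
  unfolding bessel_op_def by (intro fourier_schwartz schwartz_mult_jap inv_fourier_schwartz)

lemma bessel_dist_apply:
  "\<phi> \<in> schwartz \<Longrightarrow> bessel_dist s u \<phi> = u (bessel_op s \<phi>)"
  by (simp add: bessel_dist_def inv_fourier_dist_def mult_dist_def fourier_dist_def bessel_op_def
      inv_fourier_schwartz schwartz_mult_jap)

lemma bessel_dist_off: "\<phi> \<notin> schwartz \<Longrightarrow> bessel_dist s u \<phi> = 0"
  by (simp add: bessel_dist_def inv_fourier_dist_def)

lemma bessel_op_inverse:
  assumes "\<phi> \<in> schwartz" shows "bessel_op (- s) (bessel_op s \<phi>) = \<phi>"
proof -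
  have "inv_fourier (bessel_op s \<phi>) = (\<lambda>\<xi>. of_real (jap (- s) \<xi>) * inv_fourier \<phi> \<xi>)"
    unfolding bessel_op_def by (intro inv_fourier_fourier schwartz_mult_jap inv_fourier_schwartz assms)
  then have "bessel_op (- s) (bessel_op s \<phi>) = fourier (\<lambda>\<xi>. of_real (jap s \<xi>) * (of_real (jap (- s) \<xi>) * inv_fourier \<phi> \<xi>))"
    by (simp add: bessel_op_def[of "- s"])
  also have "(\<lambda>\<xi>. of_real (jap s \<xi>) * (of_real (jap (- s) \<xi>) * inv_fourier \<phi> \<xi>)) = inv_fourier \<phi>"
    by (simp add: fun_eq_iff jap_minus)
  finally show ?thesis using fourier_inv_fourier[OF assms] by simp
qed

lemma schwartz_add:
  assumes \<phi>: "\<phi> \<in> schwartz" and \<psi>: "\<psi> \<in> schwartz" shows "(\<lambda>x. \<phi> x + \<psi> x) \<in> schwartz"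
  unfolding schwartz_iff bounded_partials_def
proof (intro allI conjI impI)
  show "smooth (\<lambda>x. \<phi> x + \<psi> x)" by (intro smooth_add schwartz_smooth assms)
  fix r :: real and bs :: "'a list" assume bs: "set bs \<subseteq> Basis"
  obtain C where C: "C \<ge> 0" "\<And>x. cmod (partials bs \<phi> x) \<le> C * jap r x" using schwartz_bound[OF \<phi> bs] by blast
  obtain D where D: "D \<ge> 0" "\<And>x. cmod (partials bs \<psi> x) \<le> D * jap r x" using schwartz_bound[OF \<psi> bs] by blast
  have "cmod (partials bs (\<lambda>x. \<phi> x + \<psi> x) x) \<le> (C + D) * jap r x" for x
    using norm_triangle_ineq[of "partials bs \<phi> x" "partials bs \<psi> x"] C(2)[of x] D(2)[of x]
    by (simp add: partials_add[OF schwartz_smooth[OF \<phi>] schwartz_smooth[OF \<psi>] bs] distrib_right)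
  then show "\<exists>C\<ge>0. \<forall>(i::unit) x. cmod (partials bs (\<lambda>x. \<phi> x + \<psi> x) x) \<le> C * jap r x"
    using C(1) D(1) by (intro exI[of _ "C + D"]) auto
qed

lemma fourier_comb:
  assumes "integrable lborel f" "integrable lborel g"
  shows "fourier (\<lambda>x. f x + c * g x) \<xi> = fourier f \<xi> + c * fourier g \<xi>"
  unfolding fourier_eq_ft using ft_add[OF assms(1) integrable_mult_right[OF assms(2), of c]] by (simp add: ft_scale)

lemma inv_fourier_comb:
  assumes "integrable lborel f" "integrable lborel g"
  shows "inv_fourier (\<lambda>x. f x + c * g x) \<xi> = inv_fourier f \<xi> + c * inv_fourier g \<xi>"
  unfolding inv_fourier_eq_ft using ft_add[OF assms(1) integrable_mult_right[OF assms(2), of c]]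
  by (simp add: ft_scale distrib_left mult.left_commute)

lemma bessel_op_comb:
  assumes \<phi>: "\<phi> \<in> schwartz" and \<psi>: "\<psi> \<in> schwartz"
  shows "bessel_op s (\<lambda>x. \<phi> x + c * \<psi> x) = (\<lambda>x. bessel_op s \<phi> x + c * bessel_op s \<psi> x)"
proof
  fix x
  have "bessel_op s (\<lambda>x. \<phi> x + c * \<psi> x) x
      = fourier (\<lambda>\<xi>. of_real (jap (- s) \<xi>) * inv_fourier \<phi> \<xi> + c * (of_real (jap (- s) \<xi>) * inv_fourier \<psi> \<xi>)) x"
    unfolding bessel_op_def
    using inv_fourier_comb[OF schwartz_integrable[OF \<phi>] schwartz_integrable[OF \<psi>], of c]
    by (simp add: distrib_left mult.left_commute)
  also have "\<dots> = bessel_op s \<phi> x + c * bessel_op s \<psi> x"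
    unfolding bessel_op_def
    by (intro fourier_comb schwartz_integrable schwartz_mult_jap inv_fourier_schwartz assms)
  finally show "bessel_op s (\<lambda>x. \<phi> x + c * \<psi> x) x = bessel_op s \<phi> x + c * bessel_op s \<psi> x" .
qed

subsection \<open>Continuity on the Schwartz space\<close>

lemma schwartz_norm_bound:
  fixes \<phi> :: "'a::euclidean_space \<Rightarrow> complex"
  assumes \<phi>: "\<phi> \<in> schwartz" and bs: "set bs \<subseteq> Basis" "length bs \<le> N"
  shows "(1 + norm x) ^ N * cmod (partials bs \<phi> x) \<le> schwartz_norm N \<phi>"
proof -
  let ?L = "{bs::'a list. set bs \<subseteq> Basis \<and> length bs \<le> N}"
  let ?f = "\<lambda>(bs, x). (1 + norm x) ^ N * cmod (partials bs \<phi> x)"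
  have "finite ?L" by (rule finite_lists_length_le) auto
  moreover have "\<forall>bs\<in>?L. bdd_above (range (\<lambda>x. (1 + norm x) ^ N * cmod (partials bs \<phi> x)))"
    using \<phi> unfolding schwartz_def by auto
  ultimately have "bdd_above (\<Union>bs\<in>?L. range (\<lambda>x. (1 + norm x) ^ N * cmod (partials bs \<phi> x)))"
    by (simp add: bdd_above_UN)
  also have "(\<Union>bs\<in>?L. range (\<lambda>x. (1 + norm x) ^ N * cmod (partials bs \<phi> x))) = ?f ` (?L \<times> UNIV)"
    by auto
  finally have "bdd_above (?f ` (?L \<times> UNIV))" .
  moreover have "(bs, x) \<in> ?L \<times> UNIV" using bs by auto
  ultimately have "?f (bs, x) \<le> (SUP z\<in>?L \<times> UNIV. ?f z)" by (intro cSUP_upper) auto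
  then show ?thesis unfolding schwartz_norm_def by (simp add: case_prod_unfold)
qed

lemma integral_partials_le:
  fixes \<phi> :: "'a::euclidean_space \<Rightarrow> complex"
  assumes \<phi>: "\<phi> \<in> schwartz" and bs: "set bs \<subseteq> Basis" "length bs \<le> N" and N: "DIM('a) < N"
  shows "(LINT y|lborel. cmod (partials bs \<phi> y)) \<le> (LINT y|lborel. jap (- real N) (y::'a)) * schwartz_norm N \<phi>"
proof -
  have r: "- real N < - real DIM('a)" using N by simp
  have "(LINT y|lborel. cmod (partials bs \<phi> y)) \<le> (LINT y|lborel. jap (- real N) (y::'a) * schwartz_norm N \<phi>)"
  proof (rule integral_mono)
    show "integrable lborel (\<lambda>y. cmod (partials bs \<phi> y))"
      by (intro integrable_norm schwartz_integrable schwartz_partials \<phi> bs)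
    show "integrable lborel (\<lambda>y::'a. jap (- real N) y * schwartz_norm N \<phi>)"
      by (intro integrable_mult_left integrable_jap r)
    fix y
    have "jap (real N) y * cmod (partials bs \<phi> y) \<le> (1 + norm y) ^ N * cmod (partials bs \<phi> y)"
      by (intro mult_right_mono one_plus_norm_power_bounds) auto
    also have "\<dots> \<le> schwartz_norm N \<phi>" by (rule schwartz_norm_bound[OF \<phi> bs])
    finally have "jap (- real N) y * (jap (real N) y * cmod (partials bs \<phi> y)) \<le> jap (- real N) y * schwartz_norm N \<phi>"
      by (intro mult_left_mono) auto
    moreover have "jap (- real N) y * (jap (real N) y * cmod (partials bs \<phi> y)) = cmod (partials bs \<phi> y)"
      by (simp add: jap_minus)
    ultimately show "cmod (partials bs \<phi> y) \<le> jap (- real N) y * schwartz_norm N \<phi>" by (simp only:)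
  qed
  then show ?thesis by simp
qed

text \<open>Temperedness of the image of an integrable function under \<^term>\<open>bessel_dist s\<close> amounts to this bound by duality. The
  two Fourier transforms are estimated by \<open>ft_decay\<close>, which controls them by finitely many derivatives.\<close>

lemma bessel_op_bound:
  obtains C N where "C \<ge> 0" "\<And>\<phi> x. \<phi> \<in> (schwartz :: ('a::euclidean_space \<Rightarrow> complex) set) \<Longrightarrow> cmod (bessel_op s \<phi> x) \<le> C * schwartz_norm N \<phi>"
proof -
  let ?d = "real DIM('a)"
  define N where "N = nat \<lceil>\<bar>s\<bar> + ?d + 1\<rceil>"
  have N: "\<bar>s\<bar> + ?d + 1 \<le> real N" unfolding N_def by linarith
  then have dN: "DIM('a) < N" by linarith
  define J where "J = (LINT y|lborel. jap (- real N) (y::'a))"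
  define J' where "J' = (LINT y|lborel. jap (- ?d - 1) (y::'a))"
  define C where "C = (1 + ?d) ^ N * ((1 + ?d) * J)"
  have J: "J \<ge> 0" "J' \<ge> 0" unfolding J_def J'_def by (auto intro!: Bochner_Integration.integral_nonneg)
  show ?thesis
  proof (rule that[of "C * J'" N])
    show "0 \<le> C * J'" unfolding C_def using J by auto
    fix \<phi> :: "'a \<Rightarrow> complex" and x assume \<phi>: "\<phi> \<in> schwartz"
    let ?S = "schwartz_norm N \<phi>"
    have pt: "cmod (of_real (jap (- s) \<xi>) * inv_fourier \<phi> \<xi>) \<le> (C * ?S) * jap (- ?d - 1) \<xi>" for \<xi>
    proof -
      have "1 \<le> (2 * pi) ^ DIM('a)" using pi_gt3 by (intro one_le_power) simp
      then have "1 / (2 * pi) ^ DIM('a) \<le> 1" by simp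
      then have "1 / (2 * pi) ^ DIM('a) * cmod (ft 1 \<phi> \<xi>) \<le> 1 * cmod (ft 1 \<phi> \<xi>)" by (intro mult_right_mono) auto
      then have 1: "cmod (inv_fourier \<phi> \<xi>) \<le> cmod (ft 1 \<phi> \<xi>)"
        unfolding inv_fourier_eq_ft norm_mult norm_of_real by simp
      have "jap (real N) \<xi> * cmod (ft 1 \<phi> \<xi>) \<le> (1 + ?d) ^ N *
        ((LINT y|lborel. cmod (\<phi> y)) + (\<Sum>b\<in>Basis. LINT y|lborel. cmod (partials (replicate N b) \<phi> y)))"
        by (rule ft_decay[OF \<phi>]) simp
      also have "\<dots> \<le> (1 + ?d) ^ N * (J * ?S + (\<Sum>b\<in>(Basis::'a set). J * ?S))"
        unfolding J_def using integral_partials_le[OF \<phi>, of "[]" N] dN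
        by (intro mult_left_mono add_mono sum_mono integral_partials_le[OF \<phi>]) auto
      also have "\<dots> = C * ?S" by (simp add: C_def algebra_simps)
      finally have 2: "jap (real N) \<xi> * cmod (ft 1 \<phi> \<xi>) \<le> C * ?S" .
      have "cmod (of_real (jap (- s) \<xi>) * inv_fourier \<phi> \<xi>) \<le> jap (- s) \<xi> * cmod (ft 1 \<phi> \<xi>)"
        unfolding norm_mult using 1 by (simp add: mult_left_mono)
      also have "jap (- s) \<xi> \<le> jap (- ?d - 1 + real N) \<xi>" using N by (intro jap_mono) linarith
      then have "jap (- s) \<xi> * cmod (ft 1 \<phi> \<xi>) \<le> jap (- ?d - 1) \<xi> * (jap (real N) \<xi> * cmod (ft 1 \<phi> \<xi>))"
        unfolding jap_add mult.assoc[symmetric] by (intro mult_right_mono) auto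
      also have "\<dots> \<le> jap (- ?d - 1) \<xi> * (C * ?S)" by (intro mult_left_mono 2) auto
      finally show ?thesis by (simp add: mult.commute)
    qed
    have "cmod (bessel_op s \<phi> x) \<le> (LINT \<xi>|lborel. cmod (of_real (jap (- s) \<xi>) * inv_fourier \<phi> \<xi>))"
      unfolding bessel_op_def fourier_eq_ft by (rule norm_ft_le)
    also have "\<dots> \<le> (LINT \<xi>|lborel. (C * ?S) * jap (- ?d - 1) (\<xi>::'a))"
      by (intro integral_mono pt integrable_norm schwartz_integrable schwartz_mult_jap inv_fourier_schwartz \<phi>
          integrable_mult_right integrable_jap) auto
    also have "\<dots> = C * J' * ?S" by (simp add: J'_def)
    finally show "cmod (bessel_op s \<phi> x) \<le> C * J' * ?S" .
  qed
qed

lemma integrable_mult_schwartz: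
  fixes f :: "'a::euclidean_space \<Rightarrow> complex"
  assumes f: "integrable lborel f" and \<phi>: "\<phi> \<in> schwartz"
  shows "integrable lborel (\<lambda>x. f x * \<phi> x)"
proof -
  note [measurable] = borel_measurable_integrable[OF f] schwartz_measurable[OF \<phi>]
  obtain C where C: "C \<ge> 0" "\<And>x. cmod (\<phi> x) \<le> C * jap 0 x" using schwartz_bound'[OF \<phi>] by blast
  show ?thesis
    by (rule Bochner_Integration.integrable_bound[OF integrable_mult_right[OF integrable_norm[OF f], of C]])
       (use C in \<open>auto intro!: AE_I2 mult_right_mono simp: norm_mult abs_mult mult.commute\<close>)
qed

lemma distribution_of_tempered:
  fixes f :: "'a::euclidean_space \<Rightarrow> complex"
  assumes f: "integrable lborel f"
  shows "distribution_of f \<in> tempered"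
  unfolding tempered_def
proof (intro CollectI conjI allI ballI impI)
  show "distribution_of f \<phi> = 0" if "\<phi> \<notin> schwartz" for \<phi> using that by (simp add: distribution_of_def)
  show "distribution_of f (\<lambda>x. \<phi> x + c * \<psi> x) = distribution_of f \<phi> + c * distribution_of f \<psi>"
    if \<phi>: "\<phi> \<in> schwartz" and \<psi>: "\<psi> \<in> schwartz" for \<phi> \<psi> c
  proof -
    have "(\<lambda>x. \<phi> x + c * \<psi> x) \<in> schwartz" by (intro schwartz_add schwartz_scale \<phi> \<psi>)
    moreover have "(LINT x|lborel. f x * (\<phi> x + c * \<psi> x)) = (LINT x|lborel. f x * \<phi> x) + c * (LINT x|lborel. f x * \<psi> x)"
    proof -
      have "(LINT x|lborel. f x * (\<phi> x + c * \<psi> x)) = (LINT x|lborel. f x * \<phi> x + c * (f x * \<psi> x))"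
        by (simp add: algebra_simps)
      also have "\<dots> = (LINT x|lborel. f x * \<phi> x) + (LINT x|lborel. c * (f x * \<psi> x))"
        by (intro Bochner_Integration.integral_add integrable_mult_right integrable_mult_schwartz f \<phi> \<psi>)
      finally show ?thesis by simp
    qed
    ultimately show ?thesis using \<phi> \<psi> by (simp add: distribution_of_def)
  qed
  have "cmod (distribution_of f \<phi>) \<le> (LINT x|lborel. cmod (f x)) * schwartz_norm 0 \<phi>" if \<phi>: "\<phi> \<in> schwartz" for \<phi>
  proof -
    have "cmod (distribution_of f \<phi>) \<le> (LINT x|lborel. cmod (f x * \<phi> x))"
      using \<phi> by (simp add: distribution_of_def integral_norm_bound)
    also have "\<dots> \<le> (LINT x|lborel. cmod (f x) * schwartz_norm 0 \<phi>)"
    proof (rule integral_mono)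
      show "integrable lborel (\<lambda>x. cmod (f x * \<phi> x))" by (intro integrable_norm integrable_mult_schwartz f \<phi>)
      show "integrable lborel (\<lambda>x. cmod (f x) * schwartz_norm 0 \<phi>)" by (intro integrable_mult_left integrable_norm f)
      show "cmod (f x * \<phi> x) \<le> cmod (f x) * schwartz_norm 0 \<phi>" for x
        using schwartz_norm_bound[OF \<phi>, of "[]" 0 x] by (simp add: norm_mult mult_left_mono)
    qed
    finally show ?thesis by simp
  qed
  then show "\<exists>C N. \<forall>\<phi>\<in>schwartz. cmod (distribution_of f \<phi>) \<le> C * schwartz_norm N \<phi>" by blast
qed

lemma bessel_dist_tempered:
  fixes f :: "'a::euclidean_space \<Rightarrow> complex"
  assumes f: "integrable lborel f"
  shows "bessel_dist s (distribution_of f) \<in> tempered"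
  unfolding tempered_def
proof (intro CollectI conjI allI ballI impI)
  show "bessel_dist s (distribution_of f) \<phi> = 0" if "\<phi> \<notin> schwartz" for \<phi> using that by (rule bessel_dist_off)
  show "bessel_dist s (distribution_of f) (\<lambda>x. \<phi> x + c * \<psi> x) = bessel_dist s (distribution_of f) \<phi> + c * bessel_dist s (distribution_of f) \<psi>"
    if \<phi>: "\<phi> \<in> schwartz" and \<psi>: "\<psi> \<in> schwartz" for \<phi> \<psi> c
  proof -
    have "(\<lambda>x. \<phi> x + c * \<psi> x) \<in> schwartz" by (intro schwartz_add schwartz_scale \<phi> \<psi>)
    moreover have "distribution_of f (\<lambda>x. bessel_op s \<phi> x + c * bessel_op s \<psi> x)
        = distribution_of f (bessel_op s \<phi>) + c * distribution_of f (bessel_op s \<psi>)"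
      using distribution_of_tempered[OF f] bessel_op_schwartz[OF \<phi>] bessel_op_schwartz[OF \<psi>] unfolding tempered_def by blast
    ultimately show ?thesis using \<phi> \<psi> by (simp add: bessel_dist_apply bessel_op_comb)
  qed
  obtain C N where C: "C \<ge> 0" "\<And>\<phi> x. \<phi> \<in> (schwartz :: ('a \<Rightarrow> complex) set) \<Longrightarrow> cmod (bessel_op s \<phi> x) \<le> C * schwartz_norm N \<phi>"
    using bessel_op_bound by blast
  have "cmod (bessel_dist s (distribution_of f) \<phi>) \<le> ((LINT x|lborel. cmod (f x)) * C) * schwartz_norm N \<phi>" if \<phi>: "\<phi> \<in> schwartz" for \<phi>
  proof -
    have "cmod (bessel_dist s (distribution_of f) \<phi>) \<le> (LINT x|lborel. cmod (f x * bessel_op s \<phi> x))"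
      using \<phi> by (simp add: bessel_dist_apply distribution_of_def bessel_op_schwartz integral_norm_bound)
    also have "\<dots> \<le> (LINT x|lborel. cmod (f x) * (C * schwartz_norm N \<phi>))"
    proof (rule integral_mono)
      show "integrable lborel (\<lambda>x. cmod (f x * bessel_op s \<phi> x))" by (intro integrable_norm integrable_mult_schwartz f bessel_op_schwartz \<phi>)
      show "integrable lborel (\<lambda>x. cmod (f x) * (C * schwartz_norm N \<phi>))" by (intro integrable_mult_left integrable_norm f)
      show "cmod (f x * bessel_op s \<phi> x) \<le> cmod (f x) * (C * schwartz_norm N \<phi>)" for x
        using C(2)[OF \<phi>, of x] by (simp add: norm_mult mult_left_mono)
    qed
    finally show ?thesis by (simp add: mult.assoc)
  qed
  then show "\<exists>C N. \<forall>\<phi>\<in>schwartz. cmod (bessel_dist s (distribution_of f) \<phi>) \<le> C * schwartz_norm N \<phi>" by blast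
qed

text \<open>A right inverse of \<^term>\<open>bessel_dist s\<close>, by Fourier inversion on test functions.\<close>

lemma bessel_dist_inverse:
  "bessel_dist s (bessel_dist (- s) (distribution_of f)) = distribution_of f"
proof
  fix \<phi>
  show "bessel_dist s (bessel_dist (- s) (distribution_of f)) \<phi> = distribution_of f \<phi>"
  proof (cases "\<phi> \<in> schwartz")
    case True
    then show ?thesis by (simp add: bessel_dist_apply bessel_op_schwartz bessel_op_inverse)
  next
    case False
    then show ?thesis by (simp add: bessel_dist_off distribution_of_def)
  qed
qed

lemma bessel_dist_diff: "bessel_dist s (u - v) = bessel_dist s u - bessel_dist s v"
proof
  fix \<phi> show "bessel_dist s (u - v) \<phi> = (bessel_dist s u - bessel_dist s v) \<phi>"
    by (cases "\<phi> \<in> schwartz") (auto simp: bessel_dist_apply bessel_dist_off)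
qed

lemma distribution_of_diff:
  assumes "integrable lborel f" "integrable lborel g"
  shows "distribution_of f - distribution_of g = distribution_of (\<lambda>x. f x - g x)"
proof
  fix \<phi>
  have "(LINT x|lborel. f x * \<phi> x) - (LINT x|lborel. g x * \<phi> x) = (LINT x|lborel. (f x - g x) * \<phi> x)" if "\<phi> \<in> schwartz"
    unfolding left_diff_distrib
    by (intro Bochner_Integration.integral_diff[symmetric] integrable_mult_schwartz assms that)
  then show "(distribution_of f - distribution_of g) \<phi> = distribution_of (\<lambda>x. f x - g x) \<phi>"
    by (simp add: distribution_of_def)
qed

text \<open>The duality between the potential of a function and the operation on distributions is Fubini's theorem.\<close>

lemma bessel_dist_distribution_of:
  fixes f :: "'a::euclidean_space \<Rightarrow> complex"
  assumes f: "integrable lborel f" and wf: "integrable lborel (\<lambda>\<eta>. of_real (jap (- s) \<eta>) * fourier f \<eta>)"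
  shows "bessel_dist s (distribution_of f) = distribution_of (potential s f)"
proof
  fix \<phi> :: "'a \<Rightarrow> complex"
  show "bessel_dist s (distribution_of f) \<phi> = distribution_of (potential s f) \<phi>"
  proof (cases "\<phi> \<in> schwartz")
    case False
    then show ?thesis by (simp add: bessel_dist_off distribution_of_def)
  next
    case \<phi>: True
    note [measurable] = borel_measurable_integrable[OF f] schwartz_measurable[OF \<phi>] borel_measurable_integrable[OF wf]
    let ?k = "complex_of_real (1 / (2 * pi) ^ DIM('a))"
    define h where "h \<xi> = of_real (jap (- s) \<xi>) * inv_fourier \<phi> \<xi>" for \<xi>
    define w where "w \<eta> = of_real (jap (- s) \<eta>) * fourier f \<eta>" for \<eta>
    have h: "h \<in> schwartz" unfolding h_def by (intro schwartz_mult_jap inv_fourier_schwartz \<phi>)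
    note [measurable] = schwartz_measurable[OF h]
    have w: "integrable lborel w" unfolding w_def by (rule wf)
    note [measurable] = borel_measurable_integrable[OF w]
    have "bessel_dist s (distribution_of f) \<phi> = (LINT x|lborel. f x * fourier h x)"
      using \<phi> by (simp add: bessel_dist_apply distribution_of_def bessel_op_schwartz bessel_op_def h_def[abs_def])
        (metis bessel_op_def bessel_op_schwartz)
    also have "\<dots> = (LINT x|lborel. LINT \<xi>|lborel. f x * (h \<xi> * cis (- (x \<bullet> \<xi>))))"
      unfolding fourier_def by simp
    also have "\<dots> = (LINT \<xi>|lborel. LINT x|lborel. f x * (h \<xi> * cis (- (x \<bullet> \<xi>))))"
      by (rule lborel_fubini(1)[OF _ integrable_norm[OF f] integrable_norm[OF schwartz_integrable[OF h]]]) (auto simp: norm_mult)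
    also have "\<dots> = (LINT \<xi>|lborel. h \<xi> * fourier f \<xi>)"
      unfolding fourier_def by (subst integral_mult_right_zero[symmetric]) (simp add: inner_commute mult_ac)
    also have "\<dots> = (LINT \<xi>|lborel. ?k * (LINT x|lborel. w \<xi> * (\<phi> x * cis (\<xi> \<bullet> x))))"
    proof (intro Bochner_Integration.integral_cong refl)
      fix \<xi> :: 'a
      have "(LINT x|lborel. w \<xi> * (\<phi> x * cis (\<xi> \<bullet> x))) = w \<xi> * (LINT x|lborel. \<phi> x * cis (\<xi> \<bullet> x))"
        by (rule integral_mult_right_zero)
      then show "h \<xi> * fourier f \<xi> = ?k * (LINT x|lborel. w \<xi> * (\<phi> x * cis (\<xi> \<bullet> x)))"
        by (simp only: h_def w_def inv_fourier_def mult_ac)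
    qed
    also have "\<dots> = ?k * (LINT \<xi>|lborel. LINT x|lborel. w \<xi> * (\<phi> x * cis (\<xi> \<bullet> x)))"
      by (rule integral_mult_right_zero)
    also have "(LINT \<xi>|lborel. LINT x|lborel. w \<xi> * (\<phi> x * cis (\<xi> \<bullet> x))) = (LINT x|lborel. LINT \<xi>|lborel. w \<xi> * (\<phi> x * cis (\<xi> \<bullet> x)))"
      by (rule lborel_fubini(1)[OF _ integrable_norm[OF w] integrable_norm[OF schwartz_integrable[OF \<phi>]]]) (auto simp: norm_mult)
    also have "?k * \<dots> = (LINT x|lborel. ?k * (LINT \<xi>|lborel. w \<xi> * (\<phi> x * cis (\<xi> \<bullet> x))))"
      by (rule integral_mult_right_zero[symmetric])
    also have "\<dots> = (LINT x|lborel. potential s f x * \<phi> x)"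
    proof (intro Bochner_Integration.integral_cong refl)
      fix x
      have "(\<lambda>\<xi>. w \<xi> * (\<phi> x * cis (\<xi> \<bullet> x))) = (\<lambda>\<xi>. \<phi> x * (w \<xi> * cis (x \<bullet> \<xi>)))" by (simp add: inner_commute mult_ac fun_eq_iff)
      then show "?k * (LINT \<xi>|lborel. w \<xi> * (\<phi> x * cis (\<xi> \<bullet> x))) = potential s f x * \<phi> x"
        by (simp only: integral_mult_right_zero potential_def inv_fourier_def w_def mult_ac)
    qed
    finally show ?thesis using \<phi> by (simp add: distribution_of_def)
  qed
qed

text \<open>The identification of a potential passes to limits: weakly on the side of \<open>u\<close>, by dominated convergence on the
  side of \<open>h\<close>.\<close>

lemma bessel_dist_limit:
  fixes u :: "nat \<Rightarrow> 'a::euclidean_space distribution"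
  assumes u: "\<And>\<phi>. \<phi> \<in> schwartz \<Longrightarrow> (\<lambda>j. u j \<phi>) \<longlonglongrightarrow> u' \<phi>"
    and h: "\<And>j. bessel_dist s (u j) = distribution_of (h j)"
    and m: "\<And>j. h j \<in> borel_measurable borel" "h' \<in> borel_measurable borel"
    and conv: "AE x in lborel. (\<lambda>j. h j x) \<longlonglongrightarrow> h' x" and bound: "\<And>j. AE x in lborel. cmod (h j x) \<le> A x"
    and A: "integrable lborel A"
  shows "bessel_dist s u' = distribution_of h'"
proof
  fix \<phi> :: "'a \<Rightarrow> complex"
  show "bessel_dist s u' \<phi> = distribution_of h' \<phi>"
  proof (cases "\<phi> \<in> schwartz")
    case False
    then show ?thesis by (simp add: bessel_dist_off distribution_of_def)
  next
    case \<phi>: True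
    note [measurable] = m schwartz_measurable[OF \<phi>]
    obtain C where C: "C \<ge> 0" "\<And>x. cmod (\<phi> x) \<le> C * jap 0 x" using schwartz_bound'[OF \<phi>] by blast
    have "(\<lambda>j. LINT x|lborel. h j x * \<phi> x) \<longlonglongrightarrow> (LINT x|lborel. h' x * \<phi> x)"
    proof (rule integral_dominated_convergence[where w="\<lambda>x. A x * C"])
      show "integrable lborel (\<lambda>x. A x * C)" using A by (rule integrable_mult_left)
      show "AE x in lborel. (\<lambda>j. h j x * \<phi> x) \<longlonglongrightarrow> h' x * \<phi> x"
        using conv by eventually_elim (intro tendsto_intros)
      show "AE x in lborel. norm (h j x * \<phi> x) \<le> A x * C" for j
        using bound[of j] by eventually_elim (use C in \<open>auto simp: norm_mult intro!: mult_mono intro: order_trans[OF norm_ge_zero]\<close>)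
    qed measurable
    moreover have "(LINT x|lborel. h j x * \<phi> x) = u j (bessel_op s \<phi>)" for j
      using fun_cong[OF h[of j], of \<phi>] \<phi> by (simp add: bessel_dist_apply distribution_of_def)
    ultimately have "(\<lambda>j. u j (bessel_op s \<phi>)) \<longlonglongrightarrow> (LINT x|lborel. h' x * \<phi> x)" by simp
    with u[OF bessel_op_schwartz[OF \<phi>], of s] have "u' (bessel_op s \<phi>) = (LINT x|lborel. h' x * \<phi> x)"
      by (rule LIMSEQ_unique)
    then show ?thesis using \<phi> by (simp add: bessel_dist_apply distribution_of_def)
  qed
qed

lemma Lp_norm_dist_bound:
  fixes h :: "'a::euclidean_space \<Rightarrow> complex"
  assumes [measurable]: "h \<in> borel_measurable borel" and A: "integrable lborel (\<lambda>x. A x powr p)"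
    and le: "AE x in lborel. cmod (h x) \<le> B * A x" and A0: "\<And>x. 0 \<le> A x" and B: "0 \<le> B" and p: "p > 0"
  shows "Lp_norm_dist p (distribution_of h) \<le> ennreal (B * (LINT x|lborel. A x powr p) powr (1 / p))"
proof -
  have le': "AE x in lborel. cmod (h x) powr p \<le> B powr p * A x powr p"
    using le
  proof eventually_elim
    case (elim x)
    have "cmod (h x) powr p \<le> (B * A x) powr p" using elim p by (intro powr_mono2) auto
    then show ?case by (simp add: powr_mult)
  qed
  have i: "integrable lborel (\<lambda>x. cmod (h x) powr p)"
    by (rule Bochner_Integration.integrable_bound[OF integrable_mult_right[OF A, of "B powr p"]]) (use le' in auto)
  have "Lp_norm_dist p (distribution_of h) \<le> ennreal ((LINT x|lborel. cmod (h x) powr p) powr (1 / p))"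
    unfolding Lp_norm_dist_def by (rule INF_lower) (use i in auto)
  also have "\<dots> \<le> ennreal (B * (LINT x|lborel. A x powr p) powr (1 / p))"
  proof (rule ennreal_leI)
    have "(LINT x|lborel. cmod (h x) powr p) \<le> (LINT x|lborel. B powr p * A x powr p)"
      by (intro integral_mono_AE i integrable_mult_right A le')
    then have "(LINT x|lborel. cmod (h x) powr p) powr (1 / p) \<le> (B powr p * (LINT x|lborel. A x powr p)) powr (1 / p)"
      using p by (intro powr_mono2 Bochner_Integration.integral_nonneg) auto
    also have "\<dots> = B * (LINT x|lborel. A x powr p) powr (1 / p)"
      using p B by (simp add: powr_mult powr_powr)
    finally show "(LINT x|lborel. cmod (h x) powr p) powr (1 / p) \<le> B * (LINT x|lborel. A x powr p) powr (1 / p)" .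
  qed
  finally show ?thesis .
qed

section \<open>Convergence along one realisation\<close>

lemma potential_measurable [measurable]:
  assumes [measurable]: "f \<in> borel_measurable borel"
  shows "potential s f \<in> borel_measurable borel"
  unfolding potential_def inv_fourier_def by measurable

lemma LIMSEQ_dist_le:
  fixes a :: "nat \<Rightarrow> complex"
  assumes "a \<longlonglongrightarrow> x" "b \<longlonglongrightarrow> y" "c \<longlonglongrightarrow> z" "\<forall>\<^sub>F j in sequentially. cmod (a j - b j) \<le> c j"
  shows "cmod (x - y) \<le> z"
  by (rule tendsto_le[OF _ assms(3) tendsto_norm[OF tendsto_diff[OF assms(1,2)]] assms(4)]) simp

text \<open>A single number \<open>A x\<close> controls, at the point \<open>x\<close>, the potentials of all truncations at all dyadic times. Chaining makes
  them Hoelder continuous in time and Cauchy in the truncation, with constants proportional to \<open>A x\<close>. As \<open>A\<close> belongs to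
  \<open>L\<^sup>p\<close>, pointwise bounds integrate to bounds of Sobolev norms that are uniform in time.\<close>

lemma pathwise_convergence:
  fixes \<psi> :: "nat \<Rightarrow> real \<Rightarrow> 'a::euclidean_space \<Rightarrow> complex" and \<rho> :: "'a \<Rightarrow> complex" and A :: "'a \<Rightarrow> real" and s :: real
  defines "g \<equiv> \<lambda>n t. potential s (\<lambda>y. \<rho> y * \<psi> n t y)"
  assumes T: "T > 0" and \<theta>: "\<theta> > 0" and p: "p > 0"
    and cont: "\<And>n. continuous_on ({0..T} \<times> UNIV) (\<lambda>(t, y). \<psi> n t y)"
    and zero0: "\<And>t y. t \<in> dyadics T \<Longrightarrow> \<psi> 0 t y = 0" and zerot: "\<And>n y. \<psi> n 0 y = 0"
    and \<rho>: "\<rho> \<in> schwartz" and supp: "\<And>y. norm y > R \<Longrightarrow> \<rho> y = 0"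
    and wint: "\<And>n t. t \<in> dyadics T \<Longrightarrow> integrable lborel (\<lambda>\<eta>. of_real (jap (- s) \<eta>) * fourier (\<lambda>y. \<rho> y * \<psi> n t y) \<eta>)"
    and A0: "\<And>x. 0 \<le> A x" and A1: "integrable lborel A" and Ap: "integrable lborel (\<lambda>x. A x powr p)"
    and inc: "AE x in lborel. \<forall>l i k j. i \<le> 2 ^ l \<longrightarrow> j < 2 ^ k \<longrightarrow>
        cmod (g (2 ^ l - 1 + i) (dyadic T k (Suc j)) x - g (2 ^ l - 1) (dyadic T k (Suc j)) x
            - (g (2 ^ l - 1 + i) (dyadic T k j) x - g (2 ^ l - 1) (dyadic T k j) x))
          \<le> A x * (2 powr - \<theta>) ^ l * (2 powr - \<theta>) ^ k"
  shows "\<exists>v. v \<in> C_sobolev T (- s) p \<and> converges_C_sobolev T (- s) p (\<lambda>n t. distribution_of (\<lambda>y. \<rho> y * \<psi> n t y)) v"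
proof -
  note [measurable] = schwartz_measurable[OF \<rho>]
  define r where "r = 2 powr - \<theta>"
  have "2 powr - \<theta> < 2 powr 0" using \<theta> by (intro powr_less_mono) auto
  then have r: "0 < r" "r < 1" by (auto simp: r_def)
  define f where "f n t y = \<rho> y * \<psi> n t y" for n t y
  have g: "g n t = potential s (f n t)" for n t by (simp add: g_def f_def[abs_def])
  obtain B where B: "\<And>n t y. t \<in> {0..T} \<Longrightarrow> norm y \<le> R \<Longrightarrow> cmod (\<psi> n t y) \<le> B n"
  proof -
    have "\<exists>b. \<forall>t y. t \<in> {0..T} \<longrightarrow> norm y \<le> R \<longrightarrow> cmod (\<psi> n t y) \<le> b" for n
    proof -
      have "compact ({0..T} \<times> cball (0::'a) R)" by (intro compact_Times) auto
      then have "bounded ((\<lambda>(t, y). \<psi> n t y) ` ({0..T} \<times> cball 0 R))"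
        by (intro compact_imp_bounded compact_continuous_image continuous_on_subset[OF cont]) auto
      then obtain b where "\<And>z. z \<in> (\<lambda>(t, y). \<psi> n t y) ` ({0..T} \<times> cball 0 R) \<Longrightarrow> norm z \<le> b"
        unfolding bounded_iff by blast
      then show ?thesis by (intro exI[of _ b]) force
    qed
    then show ?thesis using that by metis
  qed
  have \<psi>c: "continuous_on UNIV (\<psi> n t)" if "t \<in> {0..T}" for n t
  proof -
    have "continuous_on UNIV ((\<lambda>(t, y). \<psi> n t y) \<circ> (\<lambda>y. (t, y)))"
      using that by (intro continuous_on_compose continuous_intros continuous_on_subset[OF cont]) auto
    then show ?thesis by (simp add: comp_def)
  qed
  have fm[measurable]: "f n t \<in> borel_measurable borel" if "t \<in> {0..T}" for n t
    unfolding f_def using borel_measurable_continuous_onI[OF \<psi>c[OF that]] by measurable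
  have fb: "cmod (f n t y) \<le> cmod (\<rho> y) * B n" if "t \<in> {0..T}" for n t y
    using B[OF that, of y n] supp[of y] by (cases "norm y > R") (auto simp: f_def norm_mult mult_left_mono)
  have \<rho>B: "integrable lborel (\<lambda>y. cmod (\<rho> y) * B n)" for n
    by (intro integrable_mult_left integrable_norm schwartz_integrable \<rho>)
  have fint: "integrable lborel (f n t)" if "t \<in> {0..T}" for n t
    by (rule Bochner_Integration.integrable_bound[OF \<rho>B[of n]])
       (use fm[OF that] fb[OF that] in \<open>auto intro!: AE_I2 order_trans[OF _ abs_ge_self]\<close>)
  have D: "t \<in> {0..T}" if "t \<in> dyadics T" for t using dyadics_bounds[OF T that] by simp
  have gm: "g n t \<in> borel_measurable borel" if "t \<in> {0..T}" for n t
    unfolding g by (intro potential_measurable fm that)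
  have g_zero: "potential s (\<lambda>_. 0) x = 0" for x
    by (simp add: potential_def fourier_def inv_fourier_def)
  have g0: "g 0 t x = 0" if "t \<in> dyadics T" for t x using zero0[OF that] g_zero by (simp add: g_def)
  have gt: "g n 0 x = 0" for n x using zerot g_zero by (simp add: g_def)

  obtain C where C: "C \<ge> 0"
    and dc1: "\<And>(g :: nat \<Rightarrow> real \<Rightarrow> complex) A t t0 n. \<lbrakk>A \<ge> 0; \<And>t. t \<in> dyadics T \<Longrightarrow> g 0 t = 0; \<And>n. g n 0 = 0;
      \<And>l i k j. i \<le> 2 ^ l \<Longrightarrow> j < 2 ^ k \<Longrightarrow>
        cmod (g (2 ^ l - 1 + i) (dyadic T k (Suc j)) - g (2 ^ l - 1) (dyadic T k (Suc j))
            - (g (2 ^ l - 1 + i) (dyadic T k j) - g (2 ^ l - 1) (dyadic T k j)))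
          \<le> A * (2 powr - \<theta>) ^ l * (2 powr - \<theta>) ^ k;
      t \<in> dyadics T; t0 \<in> dyadics T\<rbrakk> \<Longrightarrow> cmod (g n t - g n t0) \<le> C * A * \<bar>t - t0\<bar> powr \<theta>"
    and dc2: "\<And>(g :: nat \<Rightarrow> real \<Rightarrow> complex) A t l n m. \<lbrakk>A \<ge> 0; \<And>t. t \<in> dyadics T \<Longrightarrow> g 0 t = 0; \<And>n. g n 0 = 0;
      \<And>l i k j. i \<le> 2 ^ l \<Longrightarrow> j < 2 ^ k \<Longrightarrow>
        cmod (g (2 ^ l - 1 + i) (dyadic T k (Suc j)) - g (2 ^ l - 1) (dyadic T k (Suc j))
            - (g (2 ^ l - 1 + i) (dyadic T k j) - g (2 ^ l - 1) (dyadic T k j)))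
          \<le> A * (2 powr - \<theta>) ^ l * (2 powr - \<theta>) ^ k;
      t \<in> dyadics T; 2 ^ l \<le> Suc n; 2 ^ l \<le> Suc m\<rbrakk> \<Longrightarrow> cmod (g n t - g m t) \<le> C * A * (2 powr - \<theta>) ^ l"
    by (rule double_chaining[OF T \<theta>]) blast
  define good where "good x \<longleftrightarrow> (\<forall>l i k j. i \<le> 2 ^ l \<longrightarrow> j < 2 ^ k \<longrightarrow>
        cmod (g (2 ^ l - 1 + i) (dyadic T k (Suc j)) x - g (2 ^ l - 1) (dyadic T k (Suc j)) x
            - (g (2 ^ l - 1 + i) (dyadic T k j) x - g (2 ^ l - 1) (dyadic T k j) x))
          \<le> A x * (2 powr - \<theta>) ^ l * (2 powr - \<theta>) ^ k)" for x
  have good: "AE x in lborel. good x" using inc unfolding good_def .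
  have H1: "cmod (g n t x - g n t0 x) \<le> C * A x * \<bar>t - t0\<bar> powr \<theta>" if "good x" "t \<in> dyadics T" "t0 \<in> dyadics T" for n t t0 x
    by (rule dc1[of "A x" "\<lambda>n t. g n t x", OF A0 g0 gt _ that(2,3)]) (use that(1) in \<open>auto simp: good_def\<close>)
  have H2: "cmod (g n t x - g m t x) \<le> C * A x * r ^ l" if "good x" "t \<in> dyadics T" "2 ^ l \<le> Suc n" "2 ^ l \<le> Suc m" for n m l t x
    unfolding r_def
    by (rule dc2[of "A x" "\<lambda>n t. g n t x", OF A0 g0 gt _ that(2,3,4)]) (use that(1) in \<open>auto simp: good_def\<close>)

  \<comment> \<open>The weighted Fourier transforms are known to be integrable at dyadic times only. At other times the potential is
    defined as a limit along dyadic times and identified in the sense of distributions further below.\<close>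
  define \<tau> where "\<tau> j t = dyadic_floor T j t" for j t
  have \<tau>D: "\<tau> j t \<in> dyadics T" if "t \<in> {0..T}" for j t
    unfolding \<tau>_def using that by (intro dyadic_floor_in[OF T]) auto
  have \<tau>lim: "(\<lambda>j. \<tau> j t) \<longlonglongrightarrow> t" if "t \<in> {0..T}" for t
    unfolding \<tau>_def using that by (intro dyadic_floor_tendsto[OF T]) auto
  have \<tau>close: "\<bar>\<tau> i t - \<tau> j t\<bar> \<le> T * (1 / 2) ^ N" if "t \<in> {0..T}" "N \<le> i" "N \<le> j" for t i j N
  proof -
    have *: "t - T * (1 / 2) ^ N \<le> \<tau> i t \<and> \<tau> i t \<le> t" if "N \<le> i" for i
    proof -
      have "t < \<tau> i t + T / 2 ^ i" "\<tau> i t \<le> t" using dyadic_floor_bounds[OF T, of t i] \<open>t \<in> {0..T}\<close> by (auto simp: \<tau>_def)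
      moreover have "T / 2 ^ i \<le> T / 2 ^ N" using T that by (intro divide_left_mono power_increasing) auto
      ultimately show ?thesis by (simp add: power_divide)
    qed
    show ?thesis using *[OF that(2)] *[OF that(3)] by linarith
  qed
  have \<tau>0: "\<tau> j 0 = 0" for j by (simp add: \<tau>_def dyadic_floor_def dyadic_index_def dyadic_def)
  define G where "G n t x = lim (\<lambda>j. g n (\<tau> j t) x)" for n t x
  have Gm: "G n t \<in> borel_measurable borel" if "t \<in> {0..T}" for n t
    unfolding G_def using gm[OF D[OF \<tau>D[OF that]]] by (intro borel_measurable_lim_metric)
  have Gconv: "(\<lambda>j. g n (\<tau> j t) x) \<longlonglongrightarrow> G n t x" if x: "good x" and t: "t \<in> {0..T}" for n t x
  proof -
    have "Cauchy (\<lambda>j. g n (\<tau> j t) x)"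
    proof (rule metric_CauchyI)
      fix e :: real assume e: "e > 0"
      have "(\<lambda>N. T * (1 / 2) ^ N) \<longlonglongrightarrow> T * 0" by (intro tendsto_intros LIMSEQ_power_zero) auto
      then have "(\<lambda>N. C * A x * (T * (1 / 2) ^ N) powr \<theta>) \<longlonglongrightarrow> C * A x * 0 powr \<theta>"
        using T \<theta> by (intro tendsto_mult tendsto_const tendsto_powr') auto
      then have "\<forall>\<^sub>F N in sequentially. C * A x * (T * (1 / 2) ^ N) powr \<theta> < e" using e by (intro order_tendstoD) auto
      then obtain N where N: "C * A x * (T * (1 / 2) ^ N) powr \<theta> < e" by (auto simp: eventually_sequentially)
      show "\<exists>M. \<forall>m\<ge>M. \<forall>n'\<ge>M. dist (g n (\<tau> m t) x) (g n (\<tau> n' t) x) < e"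
      proof (intro exI[of _ N] allI impI)
        fix i j assume "N \<le> i" "N \<le> j"
        have "cmod (g n (\<tau> i t) x - g n (\<tau> j t) x) \<le> C * A x * \<bar>\<tau> i t - \<tau> j t\<bar> powr \<theta>"
          by (intro H1 x \<tau>D t)
        also have "\<dots> \<le> C * A x * (T * (1 / 2) ^ N) powr \<theta>"
          using \<tau>close[OF t \<open>N \<le> i\<close> \<open>N \<le> j\<close>] C A0[of x] \<theta> by (intro mult_left_mono powr_mono2) auto
        finally show "dist (g n (\<tau> i t) x) (g n (\<tau> j t) x) < e" using N by (simp add: dist_norm)
      qed
    qed
    then show ?thesis unfolding G_def using Cauchy_convergent_iff convergent_LIMSEQ_iff by blast
  qed
  have GH1: "cmod (G n t x - G n t0 x) \<le> C * A x * \<bar>t - t0\<bar> powr \<theta>" if x: "good x" and t: "t \<in> {0..T}" "t0 \<in> {0..T}" for n t t0 x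
  proof (rule LIMSEQ_dist_le[OF Gconv[OF x t(1)] Gconv[OF x t(2)]])
    show "(\<lambda>j. C * A x * \<bar>\<tau> j t - \<tau> j t0\<bar> powr \<theta>) \<longlonglongrightarrow> C * A x * \<bar>t - t0\<bar> powr \<theta>"
      using \<theta> by (intro tendsto_mult tendsto_const tendsto_powr' tendsto_rabs tendsto_diff \<tau>lim t) auto
    show "\<forall>\<^sub>F j in sequentially. cmod (g n (\<tau> j t) x - g n (\<tau> j t0) x) \<le> C * A x * \<bar>\<tau> j t - \<tau> j t0\<bar> powr \<theta>"
      by (intro always_eventually allI H1 x \<tau>D t)
  qed
  have GH2: "cmod (G n t x - G m t x) \<le> C * A x * r ^ l" if x: "good x" and t: "t \<in> {0..T}" and l: "2 ^ l \<le> Suc n" "2 ^ l \<le> Suc m" for n m l t x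
    by (rule LIMSEQ_dist_le[OF Gconv[OF x t] Gconv[OF x t] tendsto_const]) (intro always_eventually allI H2 x \<tau>D t l)
  have Gz: "G n 0 x = 0" for n x unfolding G_def by (simp add: \<tau>0 gt)

  define Gl where "Gl t x = lim (\<lambda>n. G n t x)" for t x
  have Glm: "Gl t \<in> borel_measurable borel" if "t \<in> {0..T}" for t
    unfolding Gl_def using Gm[OF that] by (intro borel_measurable_lim_metric)
  have small: "\<exists>l. c * r ^ l < e" if "e > 0" for c e :: real
  proof -
    have "(\<lambda>l. c * r ^ l) \<longlonglongrightarrow> c * 0" using r by (intro tendsto_intros LIMSEQ_power_zero) auto
    then have "\<forall>\<^sub>F l in sequentially. c * r ^ l < e" using that by (intro order_tendstoD) auto
    then show ?thesis by (auto simp: eventually_sequentially)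
  qed
  have Glconv: "(\<lambda>n. G n t x) \<longlonglongrightarrow> Gl t x" if x: "good x" and t: "t \<in> {0..T}" for t x
  proof -
    have "Cauchy (\<lambda>n. G n t x)"
    proof (rule metric_CauchyI)
      fix e :: real assume e: "e > 0"
      obtain l where l: "C * A x * r ^ l < e" using small[OF e] by blast
      show "\<exists>M. \<forall>m\<ge>M. \<forall>n\<ge>M. dist (G m t x) (G n t x) < e"
      proof (intro exI[of _ "2 ^ l"] allI impI)
        fix m n :: nat assume "2 ^ l \<le> m" "2 ^ l \<le> n"
        then have "2 ^ l \<le> Suc m" "2 ^ l \<le> Suc n" by auto
        from GH2[OF x t this] l show "dist (G m t x) (G n t x) < e" by (simp add: dist_norm)
      qed
    qed
    then show ?thesis unfolding Gl_def using Cauchy_convergent_iff convergent_LIMSEQ_iff by blast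
  qed
  have GL1: "cmod (G n t x - Gl t x) \<le> C * A x * r ^ l" if x: "good x" and t: "t \<in> {0..T}" and l: "2 ^ l \<le> Suc n" for n l t x
  proof (rule LIMSEQ_dist_le[OF tendsto_const Glconv[OF x t] tendsto_const])
    show "\<forall>\<^sub>F m in sequentially. cmod (G n t x - G m t x) \<le> C * A x * r ^ l"
      unfolding eventually_sequentially by (intro exI[of _ "2 ^ l"] allI impI GH2 x t l) simp
  qed
  have GL2: "cmod (Gl t x - Gl t0 x) \<le> C * A x * \<bar>t - t0\<bar> powr \<theta>" if x: "good x" and t: "t \<in> {0..T}" "t0 \<in> {0..T}" for t t0 x
    by (rule LIMSEQ_dist_le[OF Glconv[OF x t(1)] Glconv[OF x t(2)] tendsto_const]) (intro always_eventually allI GH1 x t)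
  have Glz: "Gl 0 x = 0" for x unfolding Gl_def by (simp add: Gz)
  define K where "K = C * T powr \<theta>"
  have K0: "K \<ge> 0" unfolding K_def using C by simp
  have crude: "C * A x * \<bar>t - 0\<bar> powr \<theta> \<le> K * A x" if "t \<in> {0..T}" for t x
  proof -
    have "C * A x * \<bar>t - 0\<bar> powr \<theta> \<le> C * A x * T powr \<theta>" using that C A0[of x] \<theta> by (intro mult_left_mono powr_mono2) auto
    then show ?thesis by (simp add: K_def mult_ac)
  qed
  have zeroT: "0 \<in> {0..T}" using T by simp
  have gb: "cmod (g n t x) \<le> K * A x" if "good x" "t \<in> dyadics T" for n t x
    using H1[OF that(1) that(2) zero_in_dyadics, of n] crude[OF D[OF that(2)], of x] gt by simp
  have Gb: "cmod (G n t x) \<le> K * A x" if "good x" "t \<in> {0..T}" for n t x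
    using GH1[OF that zeroT, of n] crude[OF that(2), of x] Gz by simp
  have Glb: "cmod (Gl t x) \<le> K * A x" if "good x" "t \<in> {0..T}" for t x
    using GL2[OF that zeroT] crude[OF that(2), of x] Glz by simp
  have KA: "integrable lborel (\<lambda>x. K * A x)" using A1 by (rule integrable_mult_right)
  have Gint: "integrable lborel (G n t)" if "t \<in> {0..T}" for n t
  proof (rule Bochner_Integration.integrable_bound[OF KA])
    show "AE x in lborel. norm (G n t x) \<le> norm (K * A x)"
      using good by eventually_elim (use Gb[OF _ that] in \<open>auto intro: order_trans[OF _ abs_ge_self]\<close>)
  qed (use Gm[OF that] in simp)
  have Glint: "integrable lborel (Gl t)" if "t \<in> {0..T}" for t
  proof (rule Bochner_Integration.integrable_bound[OF KA])
    show "AE x in lborel. norm (Gl t x) \<le> norm (K * A x)"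
      using good by eventually_elim (use Glb[OF _ that] in \<open>auto intro: order_trans[OF _ abs_ge_self]\<close>)
  qed (use Glm[OF that] in simp)

  \<comment> \<open>The limit has the potential \<open>Gl\<close>; it is obtained from it by the inverse operator.\<close>
  define u where "u n t = distribution_of (f n t)" for n t
  define v where "v t = bessel_dist (- s) (distribution_of (Gl t))" for t
  have bu: "bessel_dist s (u n t) = distribution_of (G n t)" if t: "t \<in> {0..T}" for n t
  proof (rule bessel_dist_limit[where u="\<lambda>j. u n (\<tau> j t)" and h="\<lambda>j. g n (\<tau> j t)" and A="\<lambda>x. K * A x"])
    show "(\<lambda>j. u n (\<tau> j t) \<phi>) \<longlonglongrightarrow> u n t \<phi>" if \<phi>: "\<phi> \<in> schwartz" for \<phi>
    proof -
      note [measurable] = schwartz_measurable[OF \<phi>]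
      have "(\<lambda>j. LINT y|lborel. f n (\<tau> j t) y * \<phi> y) \<longlonglongrightarrow> (LINT y|lborel. f n t y * \<phi> y)"
      proof (rule integral_dominated_convergence[where w="\<lambda>y. cmod (complex_of_real (cmod (\<rho> y) * B n) * \<phi> y)"])
        show "integrable lborel (\<lambda>y. cmod (complex_of_real (cmod (\<rho> y) * B n) * \<phi> y))"
          by (intro integrable_norm integrable_mult_schwartz \<phi> integrable_of_real \<rho>B)
        show "AE y in lborel. (\<lambda>j. f n (\<tau> j t) y * \<phi> y) \<longlonglongrightarrow> f n t y * \<phi> y"
        proof (intro AE_I2)
          fix y
          have "((\<lambda>(t, y). \<psi> n t y) \<longlongrightarrow> \<psi> n t y) (at (t, y) within {0..T} \<times> UNIV)"
            using cont[of n] t unfolding continuous_on_def by force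
          then have "(\<lambda>j. (\<lambda>(t, y). \<psi> n t y) (\<tau> j t, y)) \<longlonglongrightarrow> (\<lambda>(t, y). \<psi> n t y) (t, y)"
            using continuous_on_tendsto_compose[OF cont[of n] tendsto_Pair[OF \<tau>lim[OF t] tendsto_const[of y]]] t D[OF \<tau>D[OF t]] by auto
          then show "(\<lambda>j. f n (\<tau> j t) y * \<phi> y) \<longlonglongrightarrow> f n t y * \<phi> y"
            unfolding f_def by (intro tendsto_intros) simp
        qed
        show "AE y in lborel. norm (f n (\<tau> j t) y * \<phi> y) \<le> cmod (complex_of_real (cmod (\<rho> y) * B n) * \<phi> y)" for j
          using fb[OF D[OF \<tau>D[OF t]]]
          by (intro AE_I2) (auto simp: norm_mult abs_mult intro!: mult_right_mono order_trans[OF _ mult_left_mono[OF abs_ge_self]])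
      qed (use fm[OF t] fm[OF D[OF \<tau>D[OF t]]] in measurable)
      then show ?thesis using \<phi> by (simp add: u_def distribution_of_def)
    qed
    show "bessel_dist s (u n (\<tau> j t)) = distribution_of (g n (\<tau> j t))" for j
      unfolding u_def g
    proof (rule bessel_dist_distribution_of)
      show "integrable lborel (f n (\<tau> j t))" by (rule fint[OF D[OF \<tau>D[OF t]]])
      show "integrable lborel (\<lambda>\<eta>. of_real (jap (- s) \<eta>) * fourier (f n (\<tau> j t)) \<eta>)"
        using wint[OF \<tau>D[OF t], of n j] by (simp add: f_def[abs_def])
    qed
    show "g n (\<tau> j t) \<in> borel_measurable borel" for j by (rule gm[OF D[OF \<tau>D[OF t]]])
    show "G n t \<in> borel_measurable borel" by (rule Gm[OF t])
    show "AE x in lborel. (\<lambda>j. g n (\<tau> j t) x) \<longlonglongrightarrow> G n t x" using good by eventually_elim (rule Gconv[OF _ t])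
    show "AE x in lborel. cmod (g n (\<tau> j t) x) \<le> K * A x" for j using good by eventually_elim (rule gb[OF _ \<tau>D[OF t]])
  qed (rule KA)
  have bv: "bessel_dist s (v t) = distribution_of (Gl t)" for t
    unfolding v_def by (rule bessel_dist_inverse)
  define P where "P = (LINT x|lborel. A x powr p) powr (1 / p)"
  have P0: "P \<ge> 0" by (simp add: P_def)
  have norm1: "sobolev_norm (- s) p w \<le> ennreal (b * P)"
    if "bessel_dist s w = distribution_of h" "h \<in> borel_measurable borel" "0 \<le> b" "\<And>x. good x \<Longrightarrow> cmod (h x) \<le> b * A x" for w h b
    unfolding sobolev_norm_eq that(1) P_def
  proof (rule Lp_norm_dist_bound[OF that(2) Ap _ A0 that(3) p])
    show "AE x in lborel. cmod (h x) \<le> b * A x" using good by eventually_elim (rule that(4))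
  qed
  have norm2: "sobolev_norm (- s) p (w - w') \<le> ennreal (b * P)"
    if "bessel_dist s w = distribution_of h" "bessel_dist s w' = distribution_of h'" "integrable lborel h" "integrable lborel h'"
      "0 \<le> b" "\<And>x. good x \<Longrightarrow> cmod (h x - h' x) \<le> b * A x" for w w' h h' b
  proof (rule norm1[of "w - w'" "\<lambda>x. h x - h' x"])
    show "bessel_dist s (w - w') = distribution_of (\<lambda>x. h x - h' x)"
      unfolding bessel_dist_diff that(1,2) by (rule distribution_of_diff[OF that(3,4)])
    show "(\<lambda>x. h x - h' x) \<in> borel_measurable borel"
      using borel_measurable_integrable[OF that(3)] borel_measurable_integrable[OF that(4)] by simp
  qed (use that in auto)
  have C_mem: "w \<in> C_sobolev T (- s) p"
    if temp: "\<And>t. t \<in> {0..T} \<Longrightarrow> w t \<in> tempered" and bw: "\<And>t. t \<in> {0..T} \<Longrightarrow> bessel_dist s (w t) = distribution_of (h t)"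
      and hint: "\<And>t. t \<in> {0..T} \<Longrightarrow> integrable lborel (h t)"
      and hb: "\<And>t x. t \<in> {0..T} \<Longrightarrow> good x \<Longrightarrow> cmod (h t x) \<le> K * A x"
      and hh: "\<And>t t0 x. t \<in> {0..T} \<Longrightarrow> t0 \<in> {0..T} \<Longrightarrow> good x \<Longrightarrow> cmod (h t x - h t0 x) \<le> C * A x * \<bar>t - t0\<bar> powr \<theta>"
    for w h
    unfolding C_sobolev_def
  proof (intro CollectI conjI ballI)
    fix t assume t: "t \<in> {0..T}"
    have "sobolev_norm (- s) p (w t) \<le> ennreal (K * P)"
      using borel_measurable_integrable[OF hint[OF t]] by (intro norm1[OF bw[OF t] _ K0 hb[OF t]]) auto
    also have "\<dots> < \<infinity>" by simp
    finally show "w t \<in> sobolev (- s) p" unfolding sobolev_def using temp[OF t] by simp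
  next
    fix t0 assume t0: "t0 \<in> {0..T}"
    show "((\<lambda>t. sobolev_norm (- s) p (w t - w t0)) \<longlongrightarrow> 0) (at t0 within {0..T})"
    proof (rule tendsto_sandwich[where f="\<lambda>_. 0" and h="\<lambda>t. ennreal (C * \<bar>t - t0\<bar> powr \<theta> * P)"])
      have "((\<lambda>t. C * \<bar>t - t0\<bar> powr \<theta> * P) \<longlongrightarrow> C * \<bar>t0 - t0\<bar> powr \<theta> * P) (at t0 within {0..T})"
        using \<theta> by (intro tendsto_mult tendsto_const tendsto_powr' tendsto_rabs tendsto_diff tendsto_ident_at) auto
      then have "((\<lambda>t. ennreal (C * \<bar>t - t0\<bar> powr \<theta> * P)) \<longlongrightarrow> ennreal (C * \<bar>t0 - t0\<bar> powr \<theta> * P)) (at t0 within {0..T})"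
        by (rule tendsto_ennrealI)
      then show "((\<lambda>t. ennreal (C * \<bar>t - t0\<bar> powr \<theta> * P)) \<longlongrightarrow> 0) (at t0 within {0..T})" by simp
      show "\<forall>\<^sub>F t in at t0 within {0..T}. sobolev_norm (- s) p (w t - w t0) \<le> ennreal (C * \<bar>t - t0\<bar> powr \<theta> * P)"
      proof -
        have "sobolev_norm (- s) p (w t - w t0) \<le> ennreal (C * \<bar>t - t0\<bar> powr \<theta> * P)" if t: "t \<in> {0..T}" for t
          by (rule norm2[OF bw[OF t] bw[OF t0] hint[OF t] hint[OF t0]]) (use C hh[OF t t0] in \<open>auto simp: mult_ac\<close>)
        then show ?thesis by (simp add: eventually_at_filter)
      qed
    qed auto
  qed
  have u_mem: "u n \<in> C_sobolev T (- s) p" for n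
  proof (rule C_mem[OF _ bu Gint])
    show "u n t \<in> tempered" if "t \<in> {0..T}" for t
      unfolding u_def by (rule distribution_of_tempered[OF fint[OF that]])
  qed (use Gb GH1 in auto)
  have v_mem: "v \<in> C_sobolev T (- s) p"
  proof (rule C_mem[OF _ bv Glint])
    show "v t \<in> tempered" if "t \<in> {0..T}" for t
      unfolding v_def by (rule bessel_dist_tempered[OF Glint[OF that]])
  qed (use Glb GL2 in auto)
  have SUP_le: "(SUP t\<in>{0..T}. sobolev_norm (- s) p (u n t - v t)) \<le> ennreal (C * r ^ l * P)" if l: "2 ^ l \<le> Suc n" for n l
  proof (rule SUP_least)
    fix t assume t: "t \<in> {0..T}"
    show "sobolev_norm (- s) p (u n t - v t) \<le> ennreal (C * r ^ l * P)"
      by (rule norm2[OF bu[OF t] bv Gint[OF t] Glint[OF t]]) (use C r GL1[OF _ t l] in \<open>auto simp: mult_ac\<close>)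
  qed
  have lim: "(\<lambda>n. SUP t\<in>{0..T}. sobolev_norm (- s) p (u n t - v t)) \<longlonglongrightarrow> 0"
  proof (rule order_tendstoI)
    fix a :: ennreal assume a: "0 < a"
    obtain e where e: "0 < e" "ennreal e < a"
    proof (cases a)
      case (real x)
      with a have "0 < x / 2" "ennreal (x / 2) < a" by (auto intro!: ennreal_lessI)
      then show ?thesis by (rule that)
    next
      case top
      then show ?thesis using that[of 1] by simp
    qed
    obtain l where l: "(C * P) * r ^ l < e" using small[OF e(1)] by blast
    show "\<forall>\<^sub>F n in sequentially. (SUP t\<in>{0..T}. sobolev_norm (- s) p (u n t - v t)) < a"
      unfolding eventually_sequentially
    proof (intro exI[of _ "2 ^ l"] allI impI)
      fix n :: nat assume "2 ^ l \<le> n"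
      then have "2 ^ l \<le> Suc n" by simp
      from SUP_le[OF this] have "(SUP t\<in>{0..T}. sobolev_norm (- s) p (u n t - v t)) \<le> ennreal (C * r ^ l * P)" .
      also have "\<dots> \<le> ennreal e" using l by (intro ennreal_leI) (simp add: mult_ac)
      also note e(2)
      finally show "(SUP t\<in>{0..T}. sobolev_norm (- s) p (u n t - v t)) < a" .
    qed
  qed auto
  have "converges_C_sobolev T (- s) p u v"
    unfolding converges_C_sobolev_def using u_mem v_mem lim by blast
  moreover have "u = (\<lambda>n t. distribution_of (\<lambda>y. \<rho> y * \<psi> n t y))"
    by (simp add: u_def f_def[abs_def] fun_eq_iff)
  ultimately show ?thesis using v_mem by auto
qed

section \<open>Increments of the truncated convolutions\<close>

lemma cmod_cis_minus_1: "cmod (cis x - 1) \<le> \<bar>x\<bar>" "cmod (cis x - 1) \<le> 2"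
proof -
  show "cmod (cis x - 1) \<le> \<bar>x\<bar>"
    using iexp_approx1[of x 0] by (simp add: cis_conv_exp)
  show "cmod (cis x - 1) \<le> 2"
    using norm_triangle_ineq4[of "cis x" 1] by simp
qed

lemma cmod_cis_minus_1_powr:
  assumes \<kappa>: "0 < \<kappa>" "\<kappa> \<le> 1" and x: "0 \<le> x"
  shows "(cmod (cis x - 1))\<^sup>2 \<le> 4 * x powr \<kappa>"
proof (cases "x \<le> 1")
  case True
  have "(cmod (cis x - 1))\<^sup>2 \<le> x\<^sup>2" using cmod_cis_minus_1(1)[of x] x by (intro power_mono) auto
  also have "x\<^sup>2 \<le> x powr \<kappa>"
  proof (cases "x = 0")
    case False
    then have "x\<^sup>2 = x powr 2" using x by simp
    also have "\<dots> \<le> x powr \<kappa>" using True \<kappa> x by (intro powr_mono') auto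
    finally show ?thesis .
  qed (use \<kappa> in auto)
  also have "\<dots> \<le> 4 * x powr \<kappa>" by simp
  finally show ?thesis .
next
  case False
  have "(cmod (cis x - 1))\<^sup>2 \<le> 2\<^sup>2" using cmod_cis_minus_1(2)[of x] by (intro power_mono) auto
  moreover have "1 \<le> x powr \<kappa>" using False \<kappa> by (intro ge_one_powr_ge_zero) auto
  ultimately show ?thesis by simp
qed

lemma sum4: "(\<Sum>j<4. F j) = F 0 + F 1 + F 2 + F (3::nat)" for F :: "nat \<Rightarrow> complex"
  by (simp add: eval_nat_numeral)

text \<open>The second-order difference, in the truncation and in time, is written as a combination of four terms. Only the
  frequencies between \<open>m\<close> and \<open>n\<close> survive. There the energy consists of the change of phase on \<open>[0, t0]\<close>, for which
  \<open>|e\<^bsup>ix\<^esup> - 1|\<^sup>2 \<le> 4 x\<^sup>\<kappa>\<close>, and of the new noise on \<open>[t0, t]\<close>. The factor \<open>\<langle>\<xi>\<rangle>\<^bsup>2\<kappa>\<^esup>\<close> is the price for the power \<open>\<kappa>\<close> of the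
  time increment.\<close>

lemma increment_energy:
  fixes \<xi> :: "'a::euclidean_space"
  assumes \<kappa>: "0 < \<kappa>" "\<kappa> \<le> 1" and mn: "m \<le> n" and t: "0 \<le> t0" "t0 \<le> t" "t \<le> T"
  shows "(\<integral>\<^sup>+t'\<in>{0..T}. ennreal ((cmod (\<Sum>j<4. [1, -1, -1, 1] ! j * oscillation ([n, m, n, m] ! j) ([t, t, t0, t0] ! j) t' \<xi>))\<^sup>2) \<partial>lborel)
    \<le> ennreal ((if real m < norm \<xi> \<and> norm \<xi> \<le> real n then 1 else 0) * ((4 * T + T powr (1 - \<kappa>)) * (t - t0) powr \<kappa> * jap (2 * \<kappa>) \<xi>))"
proof -
  define e :: real where "e = (if real m < norm \<xi> \<and> norm \<xi> \<le> real n then 1 else 0)"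
  define b where "b = 4 * ((t - t0) powr \<kappa> * jap (2 * \<kappa>) \<xi>)"
  have e0: "0 \<le> e" by (simp add: e_def)
  have b0: "0 \<le> b" by (simp add: b_def)
  have T0: "0 \<le> T" using t by simp
  have pt: "(cmod (\<Sum>j<4. [1, -1, -1, 1] ! j * oscillation ([n, m, n, m] ! j) ([t, t, t0, t0] ! j) t' \<xi>))\<^sup>2
      \<le> e * (b + indicator {t0..t} t')" if t': "t' \<in> {0..T}" for t'
  proof -
    let ?a = "(if t' \<le> t then cis ((t - t') * (norm \<xi>)\<^sup>2) else 0) - (if t' \<le> t0 then cis ((t0 - t') * (norm \<xi>)\<^sup>2) else 0)"
    have eq: "(\<Sum>j<4. [1, -1, -1, 1] ! j * oscillation ([n, m, n, m] ! j) ([t, t, t0, t0] ! j) t' \<xi>) = of_real e * ?a"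
      unfolding sum4 using mn t' by (auto simp: oscillation_def e_def)
    have "(cmod ?a)\<^sup>2 \<le> b + indicator {t0..t} t'"
    proof (cases "t' \<le> t0")
      case True
      have "?a = cis ((t0 - t') * (norm \<xi>)\<^sup>2) * (cis ((t - t0) * (norm \<xi>)\<^sup>2) - 1)"
        using True t by (simp add: right_diff_distrib cis_mult flip: distrib_right)
      then have "(cmod ?a)\<^sup>2 = (cmod (cis ((t - t0) * (norm \<xi>)\<^sup>2) - 1))\<^sup>2" by (simp add: norm_mult)
      also have "\<dots> \<le> 4 * ((t - t0) * (norm \<xi>)\<^sup>2) powr \<kappa>"
        using t by (intro cmod_cis_minus_1_powr \<kappa>) auto
      also have "((t - t0) * (norm \<xi>)\<^sup>2) powr \<kappa> = (t - t0) powr \<kappa> * ((norm \<xi>)\<^sup>2) powr \<kappa>"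
        by (rule powr_mult)
      also have "4 * ((t - t0) powr \<kappa> * ((norm \<xi>)\<^sup>2) powr \<kappa>) \<le> b"
      proof -
        have "jap (2 * \<kappa>) \<xi> = (1 + (norm \<xi>)\<^sup>2) powr \<kappa>" by (simp add: jap_def)
        then show ?thesis unfolding b_def using \<kappa> by (simp add: mult_left_mono powr_mono2)
      qed
      finally show ?thesis by (simp add: add_increasing2)
    next
      case False
      then show ?thesis using b0 by (auto simp: indicator_def)
    qed
    then have "e\<^sup>2 * (cmod ?a)\<^sup>2 \<le> e\<^sup>2 * (b + indicator {t0..t} t')" by (intro mult_left_mono) auto
    moreover have "e\<^sup>2 = e" by (simp add: e_def)
    ultimately show ?thesis unfolding eq by (simp add: norm_mult power_mult_distrib)
  qed
  have "(\<integral>\<^sup>+t'\<in>{0..T}. ennreal ((cmod (\<Sum>j<4. [1, -1, -1, 1] ! j * oscillation ([n, m, n, m] ! j) ([t, t, t0, t0] ! j) t' \<xi>))\<^sup>2) \<partial>lborel)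
      \<le> (\<integral>\<^sup>+t'. ennreal (e * b) * indicator {0..T} t' + ennreal e * indicator {t0..t} t' \<partial>lborel)"
  proof (intro nn_integral_mono)
    fix t'
    show "ennreal ((cmod (\<Sum>j<4. [1, -1, -1, 1] ! j * oscillation ([n, m, n, m] ! j) ([t, t, t0, t0] ! j) t' \<xi>))\<^sup>2) * indicator {0..T} t'
        \<le> ennreal (e * b) * indicator {0..T} t' + ennreal e * indicator {t0..t} t'"
    proof (cases "t' \<in> {0..T}")
      case True
      have "ennreal ((cmod (\<Sum>j<4. [1, -1, -1, 1] ! j * oscillation ([n, m, n, m] ! j) ([t, t, t0, t0] ! j) t' \<xi>))\<^sup>2)
          \<le> ennreal (e * b + e * indicator {t0..t} t')"
        using pt[OF True] by (intro ennreal_leI) (simp add: distrib_left)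
      also have "\<dots> = ennreal (e * b) + ennreal e * indicator {t0..t} t'"
        using e0 b0 by (subst ennreal_plus) (auto simp: ennreal_mult indicator_def)
      finally show ?thesis using True by simp
    qed simp
  qed
  also have "\<dots> = ennreal (e * b) * ennreal T + ennreal e * ennreal (t - t0)"
    using t T0 by (subst nn_integral_add) (auto simp: nn_integral_cmult_indicator)
  also have "\<dots> = ennreal (e * (b * T + (t - t0)))"
    using e0 b0 T0 t by (simp add: distrib_left mult.assoc flip: ennreal_mult ennreal_plus)
  also have "\<dots> \<le> ennreal (e * ((4 * T + T powr (1 - \<kappa>)) * (t - t0) powr \<kappa> * jap (2 * \<kappa>) \<xi>))"
  proof (intro ennreal_leI mult_left_mono e0)
    have "t - t0 = (t - t0) powr (1 - \<kappa>) * (t - t0) powr \<kappa>"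
      using t by (simp flip: powr_add)
    also have "\<dots> \<le> T powr (1 - \<kappa>) * (t - t0) powr \<kappa>"
      using t \<kappa> by (intro mult_right_mono powr_mono2) auto
    also have "\<dots> \<le> T powr (1 - \<kappa>) * (t - t0) powr \<kappa> * jap (2 * \<kappa>) \<xi>"
      using mult_left_mono[of 1 "jap (2 * \<kappa>) \<xi>" "T powr (1 - \<kappa>) * (t - t0) powr \<kappa>"] jap_mono[of 0 "2 * \<kappa>" \<xi>] \<kappa> by simp
    finally show "b * T + (t - t0) \<le> (4 * T + T powr (1 - \<kappa>)) * (t - t0) powr \<kappa> * jap (2 * \<kappa>) \<xi>"
      by (simp add: b_def algebra_simps)
  qed
  finally show ?thesis unfolding e_def .
qed

text \<open>A single term is written as a sum over a one-point set, which is the form taken by the energy of a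
  combination.\<close>

lemma single_energy:
  fixes \<xi> :: "'a::euclidean_space"
  assumes "T \<ge> 0"
  shows "(\<integral>\<^sup>+t'\<in>{0..T}. ennreal ((cmod (\<Sum>j\<in>{0::nat}. 1 * oscillation n t t' \<xi>))\<^sup>2) \<partial>lborel) \<le> ennreal (T * cutoff n \<xi>)"
proof -
  have "(\<integral>\<^sup>+t'\<in>{0..T}. ennreal ((cmod (\<Sum>j\<in>{0::nat}. 1 * oscillation n t t' \<xi>))\<^sup>2) \<partial>lborel)
      \<le> (\<integral>\<^sup>+t'. ennreal (cutoff n \<xi>) * indicator {0..T} t' \<partial>lborel)"
    by (intro nn_integral_mono) (auto simp: oscillation_def cutoff_def indicator_def)
  also have "\<dots> = ennreal (T * cutoff n \<xi>)"
    using assms by (simp add: nn_integral_cmult_indicator ennreal_mult mult.commute)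
  finally show ?thesis .
qed

lemma potential_sum:
  fixes g :: "'i \<Rightarrow> 'a::euclidean_space \<Rightarrow> complex"
  assumes J: "finite J" and g: "\<And>j. j \<in> J \<Longrightarrow> integrable lborel (g j)"
    and w: "\<And>j. j \<in> J \<Longrightarrow> integrable lborel (\<lambda>\<eta>. of_real (jap (- s) \<eta>) * fourier (g j) \<eta>)"
  shows "potential s (\<lambda>y. \<Sum>j\<in>J. c j * g j y) x = (\<Sum>j\<in>J. c j * potential s (g j) x)"
proof -
  have 1: "fourier (\<lambda>y. \<Sum>j\<in>J. c j * g j y) \<eta> = (\<Sum>j\<in>J. c j * fourier (g j) \<eta>)" for \<eta>
    unfolding fourier_eq_ft by (rule ft_sum[OF J g])
  have "potential s (\<lambda>y. \<Sum>j\<in>J. c j * g j y) x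
      = inv_fourier (\<lambda>\<eta>. \<Sum>j\<in>J. c j * (of_real (jap (- s) \<eta>) * fourier (g j) \<eta>)) x"
    unfolding potential_def 1 by (simp add: sum_distrib_left mult.left_commute)
  also have "\<dots> = (\<Sum>j\<in>J. c j * potential s (g j) x)"
    unfolding potential_def inv_fourier_eq_ft
    by (subst ft_sum[OF J w]) (auto simp: sum_distrib_left mult_ac)
  finally show ?thesis .
qed

context
  fixes M :: "'w measure" and T \<alpha> s R :: real and W :: "(real \<times> 'a::euclidean_space \<Rightarrow> real) \<Rightarrow> 'w \<Rightarrow> real"
    and \<Psi> :: "nat \<Rightarrow> real \<Rightarrow> 'a \<Rightarrow> 'w \<Rightarrow> complex" and \<rho> :: "'a \<Rightarrow> complex"
  assumes T: "T > 0" and M: "prob_space M" and W: "white_noise M T W"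
    and \<Psi>: "\<And>n. truncated_convolution M T W \<alpha> n (\<Psi> n)"
    and cont: "\<And>n \<omega>. continuous_on ({0..T} \<times> UNIV) (\<lambda>(t, x). \<Psi> n t x \<omega>)"
    and \<rho>: "\<rho> \<in> schwartz" and supp: "\<And>y. norm y > R \<Longrightarrow> \<rho> y = 0"
begin

lemma convolution_continuous:
  assumes "t \<in> {0..T}" shows "continuous_on UNIV (\<lambda>y. \<Psi> n t y \<omega>)"
proof -
  have "continuous_on UNIV ((\<lambda>(t, y). \<Psi> n t y \<omega>) \<circ> (\<lambda>y. (t, y)))"
    using assms by (intro continuous_on_compose continuous_intros continuous_on_subset[OF cont]) auto
  then show ?thesis by (simp add: comp_def)
qed

lemma convolution_measurable: "t \<in> {0..T} \<Longrightarrow> \<Psi> n t y \<in> borel_measurable M"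
  using \<Psi> unfolding truncated_convolution_def by blast

lemma convolution_spectrally_dominated:
  assumes t: "t \<in> {0..T}"
  shows "spectrally_dominated M (\<Psi> n t) (\<lambda>\<xi>. 1 / (2 * pi) ^ DIM('a) * (jap (- 2 * \<alpha>) \<xi> * (T * cutoff n \<xi>)))"
proof -
  have "spectrally_dominated M (\<lambda>y \<omega>. \<Sum>j\<in>{0::nat}. 1 * \<Psi> n t y \<omega>) (\<lambda>\<xi>. 1 / (2 * pi) ^ DIM('a) * (jap (- 2 * \<alpha>) \<xi> * (T * cutoff n \<xi>)))"
    using T by (intro truncated_convolution_spectrally_dominated[OF M W \<Psi>] single_energy t) auto
  then show ?thesis by simp
qed

lemma truncated_density_integrable:
  assumes "\<And>\<xi>. 0 \<le> v \<xi>" "\<And>\<xi>. v \<xi> \<le> c * (cutoff n \<xi> * jap q \<xi>)" and [measurable]: "v \<in> borel_measurable borel"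
  shows "integrable lborel (\<lambda>\<xi>::'a. jap r \<xi> * v \<xi>)"
proof (rule Bochner_Integration.integrable_bound)
  show "integrable lborel (\<lambda>\<xi>::'a. c * (cutoff n \<xi> * jap (r + q) \<xi>))"
    by (intro integrable_mult_right integrable_truncated_jap)
  show "AE \<xi> in lborel. norm (jap r \<xi> * v \<xi>) \<le> norm (c * (cutoff n \<xi> * jap (r + q) \<xi>))"
  proof (intro AE_I2)
    fix \<xi> :: 'a
    have "jap r \<xi> * v \<xi> \<le> jap r \<xi> * (c * (cutoff n \<xi> * jap q \<xi>))" by (intro mult_left_mono assms) auto
    also have "\<dots> = c * (cutoff n \<xi> * jap (r + q) \<xi>)" by (simp add: jap_add)
    also have "\<dots> \<le> norm (c * (cutoff n \<xi> * jap (r + q) \<xi>))" by simp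
    finally show "norm (jap r \<xi> * v \<xi>) \<le> norm (c * (cutoff n \<xi> * jap (r + q) \<xi>))"
      using assms(1)[of \<xi>] by simp
  qed
qed measurable

lemma convolution_weighted_integrable:
  assumes t: "t \<in> {0..T}"
  shows "AE \<omega> in M. integrable lborel (\<lambda>\<eta>. of_real (jap (- s) \<eta>) * fourier (\<lambda>y. \<rho> y * \<Psi> n t y \<omega>) \<eta>)"
proof (rule localised_process_weighted_integrable[OF M convolution_spectrally_dominated[OF t] convolution_continuous[OF t] _ _ \<rho> supp])
  show "0 \<le> 1 / (2 * pi) ^ DIM('a) * (jap (- 2 * \<alpha>) \<xi> * (T * cutoff n \<xi>))" for \<xi> :: 'a
    using T by auto
  then show "integrable lborel (\<lambda>\<xi>::'a. jap r \<xi> * (1 / (2 * pi) ^ DIM('a) * (jap (- 2 * \<alpha>) \<xi> * (T * cutoff n \<xi>))))" for r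
  proof (rule truncated_density_integrable[where c="1 / (2 * pi) ^ DIM('a) * T" and n=n and q="- 2 * \<alpha>"])
    show "1 / (2 * pi) ^ DIM('a) * (jap (- 2 * \<alpha>) \<xi> * (T * cutoff n \<xi>)) \<le> 1 / (2 * pi) ^ DIM('a) * T * (cutoff n \<xi> * jap (- 2 * \<alpha>) \<xi>)" for \<xi> :: 'a
      by (intro eq_refl) (simp only: mult_ac)
  qed measurable
qed auto

lemma convolution_localised_integrable:
  assumes t: "t \<in> {0..T}"
  shows "integrable lborel (\<lambda>y. \<rho> y * \<Psi> n t y \<omega>)"
proof (rule localised_process_integrable[OF M convolution_spectrally_dominated[OF t] convolution_continuous[OF t] _ _ \<rho> supp])
  show "0 \<le> 1 / (2 * pi) ^ DIM('a) * (jap (- 2 * \<alpha>) \<xi> * (T * cutoff n \<xi>))" for \<xi> :: 'a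
    using T by auto
  then show "integrable lborel (\<lambda>\<xi>::'a. jap r \<xi> * (1 / (2 * pi) ^ DIM('a) * (jap (- 2 * \<alpha>) \<xi> * (T * cutoff n \<xi>))))" for r
  proof (rule truncated_density_integrable[where c="1 / (2 * pi) ^ DIM('a) * T" and n=n and q="- 2 * \<alpha>"])
    show "1 / (2 * pi) ^ DIM('a) * (jap (- 2 * \<alpha>) \<xi> * (T * cutoff n \<xi>)) \<le> 1 / (2 * pi) ^ DIM('a) * T * (cutoff n \<xi> * jap (- 2 * \<alpha>) \<xi>)" for \<xi> :: 'a
      by (intro eq_refl) (simp only: mult_ac)
  qed measurable
qed auto

text \<open>The spectral density vanishes off the origin: for \<open>n = 0\<close> the ball of frequencies is a point, and for \<open>t = 0\<close> no noise
  has acted. Hence the chains in \<open>n\<close> and in \<open>t\<close> start from zero.\<close>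

lemma convolution_zero:
  assumes t: "t \<in> {0..T}" and zero: "n = 0 \<or> t = 0"
  shows "AE \<omega> in M. \<Psi> n t y \<omega> = 0"
proof -
  define v :: "'a \<Rightarrow> real" where "v \<xi> = (if \<xi> = 0 then T else 0)" for \<xi>
  have [measurable]: "v \<in> borel_measurable borel" unfolding v_def by measurable
  have energy: "(\<integral>\<^sup>+t'\<in>{0..T}. ennreal ((cmod (\<Sum>j\<in>{0::nat}. 1 * oscillation n t t' (\<xi>::'a)))\<^sup>2) \<partial>lborel) \<le> ennreal (v \<xi>)" for \<xi>
  proof (cases "\<xi> = 0")
    case True
    have "(\<integral>\<^sup>+t'\<in>{0..T}. ennreal ((cmod (\<Sum>j\<in>{0::nat}. 1 * oscillation n t t' \<xi>))\<^sup>2) \<partial>lborel) \<le> ennreal (T * cutoff n \<xi>)"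
      using T by (intro single_energy) auto
    then show ?thesis using True by (simp add: v_def cutoff_def)
  next
    case False
    have "oscillation n t t' \<xi> = 0" if "t' \<noteq> 0" for t'
      using False zero that by (auto simp: oscillation_def)
    then have "AE t' in lborel. oscillation n t t' \<xi> = 0"
      using AE_lborel_singleton[of "0::real"] by (auto elim!: eventually_mono)
    then have "(\<integral>\<^sup>+t'\<in>{0..T}. ennreal ((cmod (\<Sum>j\<in>{0::nat}. 1 * oscillation n t t' \<xi>))\<^sup>2) \<partial>lborel) = (\<integral>\<^sup>+t'. 0 \<partial>(lborel :: real measure))"
      by (intro nn_integral_cong_AE) (auto elim!: eventually_mono)
    then show ?thesis by simp
  qed
  have "spectrally_dominated M (\<lambda>y \<omega>. \<Sum>j\<in>{0::nat}. 1 * \<Psi> n t y \<omega>) (\<lambda>\<xi>. 1 / (2 * pi) ^ DIM('a) * (jap (- 2 * \<alpha>) \<xi> * v \<xi>))"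
    using T by (intro truncated_convolution_spectrally_dominated[OF M W \<Psi>] energy t) (auto simp: v_def)
  then have sd: "spectrally_dominated M (\<Psi> n t) (\<lambda>\<xi>. 1 / (2 * pi) ^ DIM('a) * (jap (- 2 * \<alpha>) \<xi> * v \<xi>))" by simp
  have "(\<integral>\<^sup>+\<omega>. ennreal (cmod (\<Sum>z\<in>{y}. 1 * \<Psi> n t z \<omega>) ^ (2 * 1)) \<partial>M)
       \<le> ennreal (moment_const 1) * (\<integral>\<^sup>+\<xi>. ennreal (1 / (2 * pi) ^ DIM('a) * (jap (- 2 * \<alpha>) \<xi> * v \<xi>) * (cmod (\<Sum>z\<in>{y}. 1 * cis (z \<bullet> \<xi>)))\<^sup>2) \<partial>lborel) ^ 1"
    by (rule sd[unfolded spectrally_dominated_def, THEN conjunct2, rule_format, of 1 "{y}" "\<lambda>_. 1"]) auto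
  also have "(\<integral>\<^sup>+\<xi>. ennreal (1 / (2 * pi) ^ DIM('a) * (jap (- 2 * \<alpha>) \<xi> * v \<xi>) * (cmod (\<Sum>z\<in>{y}. 1 * cis (z \<bullet> \<xi>)))\<^sup>2) \<partial>lborel) = (\<integral>\<^sup>+\<xi>. 0 \<partial>(lborel :: 'a measure))"
  proof (rule nn_integral_cong_AE)
    show "AE \<xi> in lborel. ennreal (1 / (2 * pi) ^ DIM('a) * (jap (- 2 * \<alpha>) \<xi> * v \<xi>) * (cmod (\<Sum>z\<in>{y}. 1 * cis (z \<bullet> \<xi>)))\<^sup>2) = 0"
      using AE_lborel_singleton[of "0::'a"] by eventually_elim (simp add: v_def)
  qed
  finally have "(\<integral>\<^sup>+\<omega>. ennreal ((cmod (\<Psi> n t y \<omega>))\<^sup>2) \<partial>M) = 0" by simp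
  then have "AE \<omega> in M. ennreal ((cmod (\<Psi> n t y \<omega>))\<^sup>2) = 0"
    using convolution_measurable[OF t, of n y] by (subst (asm) nn_integral_0_iff_AE) auto
  then show ?thesis by eventually_elim simp
qed

lemma convolution_zero_all:
  assumes t: "t \<in> {0..T}" and zero: "n = 0 \<or> t = 0"
  shows "AE \<omega> in M. \<forall>y. \<Psi> n t y \<omega> = 0"
proof -
  obtain Q :: "'a set" where Q: "countable Q" "\<And>X. open X \<Longrightarrow> X \<noteq> {} \<Longrightarrow> \<exists>q\<in>Q. q \<in> X"
    by (erule countable_dense_setE)
  have "AE \<omega> in M. \<forall>y\<in>Q. \<Psi> n t y \<omega> = 0"
    using Q(1) convolution_zero[OF t zero] by (subst AE_ball_countable) auto
  then show ?thesis
  proof eventually_elim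
    case (elim \<omega>)
    have "open {y. \<Psi> n t y \<omega> \<noteq> 0}"
      by (intro open_Collect_neq convolution_continuous t continuous_intros)
    then show ?case using Q(2)[of "{y. \<Psi> n t y \<omega> \<noteq> 0}"] elim by blast
  qed
qed

definition convolution_potential :: "nat \<Rightarrow> real \<Rightarrow> 'w \<Rightarrow> 'a \<Rightarrow> complex" where
  "convolution_potential n t \<omega> = potential s (\<lambda>y. \<rho> y * \<Psi> n t y \<omega>)"

lemma convolution_potential_measurable:
  assumes t: "t \<in> {0..T}"
  shows "(\<lambda>(\<omega>, x). convolution_potential n t \<omega> x) \<in> borel_measurable (M \<Otimes>\<^sub>M lborel)"
proof -
  note [measurable] = schwartz_measurable[OF \<rho>]
  have "(\<lambda>(y, \<omega>). \<Psi> n t y \<omega>) \<in> borel_measurable (borel \<Otimes>\<^sub>M M)"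
    by (intro continuous_process_measurable convolution_continuous convolution_measurable t)
  then have [measurable]: "(\<lambda>(\<omega>, y). \<Psi> n t y \<omega>) \<in> borel_measurable (M \<Otimes>\<^sub>M borel)"
    by (subst measurable_pair_swap_iff) (simp add: case_prod_unfold)
  have [measurable]: "(\<lambda>(\<omega>, \<eta>). fourier (\<lambda>y. \<rho> y * \<Psi> n t y \<omega>) \<eta>) \<in> borel_measurable (M \<Otimes>\<^sub>M borel)"
    unfolding fourier_def by measurable
  show ?thesis
    unfolding convolution_potential_def potential_def inv_fourier_def by measurable
qed

text \<open>By spectral domination the moment is governed by the integral of \<open>\<langle>\<xi>\<rangle>\<^bsup>-2\<alpha>\<^esup> \<langle>\<xi>\<rangle>\<^bsup>-2s\<^esup>\<close>, which converges because
  \<open>2 (\<alpha> + s) > d\<close>. The surplus in this inequality pays for three powers \<open>\<langle>\<xi>\<rangle>\<^sup>\<kappa>\<close>: two for the regularity in time, and one for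
  the decay in \<open>m\<close>, as only frequencies above \<open>m\<close> contribute. The decay in \<open>x\<close> comes from the localisation by \<open>\<rho>\<close>.\<close>

lemma increment_moment:
  assumes \<kappa>: "0 < \<kappa>" "\<kappa> \<le> 1" and s: "3 * \<kappa> - 2 * \<alpha> - 2 * s < - real DIM('a)" and K: "K > 0"
  obtains C where "C \<ge> 0"
    "\<And>m n t0 t x. m \<le> n \<Longrightarrow> 0 \<le> t0 \<Longrightarrow> t0 \<le> t \<Longrightarrow> t \<le> T \<Longrightarrow>
      (\<integral>\<^sup>+\<omega>. ennreal (cmod (convolution_potential n t \<omega> x - convolution_potential m t \<omega> x
          - (convolution_potential n t0 \<omega> x - convolution_potential m t0 \<omega> x)) ^ (2 * K)) \<partial>M)
      \<le> ennreal (C * ((t - t0) powr \<kappa> * (1 + real m) powr - \<kappa>) ^ K * jap (- real (2 * K * N)) x)"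
proof -
  let ?k = "1 / (2 * pi) ^ DIM('a)"
  define c1 where "c1 = 4 * T + T powr (1 - \<kappa>)"
  have c1: "c1 \<ge> 0" using T by (simp add: c1_def)
  obtain C0 where C0: "C0 \<ge> 0"
    "\<And>\<xi> x. cmod (potential s (\<lambda>y. \<rho> y * cis (y \<bullet> \<xi>)) x) \<le> C0 * jap (- s) \<xi> * jap (- real N) x"
    using symbol_bound[OF \<rho>, where s=s and N=N] by blast
  define I where "I = (LINT \<xi>|lborel. jap (3 * \<kappa> - 2 * \<alpha> - 2 * s) (\<xi>::'a))"
  have I0: "I \<ge> 0" unfolding I_def by (intro Bochner_Integration.integral_nonneg) auto
  define E where "E = ?k * c1 * C0\<^sup>2 * 2 powr \<kappa> * I"
  have E0: "E \<ge> 0" unfolding E_def using c1 I0 by auto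
  show ?thesis
  proof (rule that[of "moment_const K * E ^ K"])
    show "0 \<le> moment_const K * E ^ K" using E0 moment_const_pos[of K] by simp
    fix m n :: nat and t0 t :: real and x :: 'a assume mn: "m \<le> n" and t: "0 \<le> t0" "t0 \<le> t" "t \<le> T"
    define nn where "nn = (!) [n, m, n, m]"
    define tt where "tt = (!) [t, t, t0, t0]"
    define ee :: "nat \<Rightarrow> complex" where "ee = (!) [1, -1, -1, 1]"
    define v1 where "v1 \<xi> = (if real m < norm \<xi> \<and> norm \<xi> \<le> real n then 1 else 0) * (c1 * (t - t0) powr \<kappa> * jap (2 * \<kappa>) \<xi>)" for \<xi> :: 'a
    define v where "v \<xi> = ?k * (jap (- 2 * \<alpha>) \<xi> * v1 \<xi>)" for \<xi>
    define Z where "Z y \<omega> = (\<Sum>j<4. ee j * \<Psi> (nn j) (tt j) y \<omega>)" for y \<omega>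
    have [measurable]: "v1 \<in> borel_measurable borel" unfolding v1_def by measurable
    have v10: "0 \<le> v1 \<xi>" for \<xi> using c1 by (simp add: v1_def)
    have tT: "tt j \<in> {0..T}" if "j < 4" for j
    proof -
      have "j = 0 \<or> j = 1 \<or> j = 2 \<or> j = 3" using that by linarith
      then show ?thesis using t by (auto simp: tt_def)
    qed
    have Zs: "spectrally_dominated M Z v"
      unfolding Z_def v_def
    proof (rule truncated_convolution_spectrally_dominated[OF M W \<Psi> finite_lessThan _ v10])
      show "(\<integral>\<^sup>+t'\<in>{0..T}. ennreal ((cmod (\<Sum>j<4. ee j * oscillation (nn j) (tt j) t' \<xi>))\<^sup>2) \<partial>lborel) \<le> ennreal (v1 \<xi>)" for \<xi>
        unfolding ee_def nn_def tt_def v1_def c1_def by (rule increment_energy[OF \<kappa> mn t])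
    qed (use tT in auto)
    have Zc: "continuous_on UNIV (\<lambda>y. Z y \<omega>)" for \<omega>
      unfolding Z_def by (intro continuous_intros convolution_continuous tT) auto
    have v0: "0 \<le> v \<xi>" for \<xi> unfolding v_def using v10 by auto
    have [measurable]: "v \<in> borel_measurable borel" unfolding v_def by measurable
    have vi: "integrable lborel (\<lambda>\<xi>. jap r \<xi> * v \<xi>)" for r
    proof (rule truncated_density_integrable[OF v0])
      fix \<xi> :: 'a
      have "v1 \<xi> \<le> cutoff n \<xi> * (c1 * (t - t0) powr \<kappa> * jap (2 * \<kappa>) \<xi>)"
        unfolding v1_def using c1 by (intro mult_right_mono) (auto simp: cutoff_def)
      then have "v \<xi> \<le> ?k * (jap (- 2 * \<alpha>) \<xi> * (cutoff n \<xi> * (c1 * (t - t0) powr \<kappa> * jap (2 * \<kappa>) \<xi>)))"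
        unfolding v_def by (intro mult_left_mono) auto
      also have "\<dots> = (?k * c1 * (t - t0) powr \<kappa>) * (cutoff n \<xi> * jap (- 2 * \<alpha> + 2 * \<kappa>) \<xi>)"
        unfolding jap_add by (simp only: mult_ac)
      finally show "v \<xi> \<le> (?k * c1 * (t - t0) powr \<kappa>) * (cutoff n \<xi> * jap (- 2 * \<alpha> + 2 * \<kappa>) \<xi>)" .
    qed measurable
    have "(\<integral>\<^sup>+\<omega>. ennreal (cmod (convolution_potential n t \<omega> x - convolution_potential m t \<omega> x
          - (convolution_potential n t0 \<omega> x - convolution_potential m t0 \<omega> x)) ^ (2 * K)) \<partial>M)
       = (\<integral>\<^sup>+\<omega>. ennreal (cmod (potential s (\<lambda>y. \<rho> y * Z y \<omega>) x) ^ (2 * K)) \<partial>M)"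
    proof (intro nn_integral_cong_AE)
      have "AE \<omega> in M. \<forall>j\<in>{..<4}. integrable lborel (\<lambda>\<eta>. of_real (jap (- s) \<eta>) * fourier (\<lambda>y. \<rho> y * \<Psi> (nn j) (tt j) y \<omega>) \<eta>)"
        by (intro AE_finite_allI convolution_weighted_integrable tT) auto
      then show "AE \<omega> in M. ennreal (cmod (convolution_potential n t \<omega> x - convolution_potential m t \<omega> x
          - (convolution_potential n t0 \<omega> x - convolution_potential m t0 \<omega> x)) ^ (2 * K))
          = ennreal (cmod (potential s (\<lambda>y. \<rho> y * Z y \<omega>) x) ^ (2 * K))"
      proof eventually_elim
        case (elim \<omega>)
        have "potential s (\<lambda>y. \<rho> y * Z y \<omega>) x = potential s (\<lambda>y. \<Sum>j<4. ee j * (\<rho> y * \<Psi> (nn j) (tt j) y \<omega>)) x"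
          unfolding Z_def by (simp only: sum_distrib_left mult.left_commute)
        also have "\<dots> = (\<Sum>j<4. ee j * potential s (\<lambda>y. \<rho> y * \<Psi> (nn j) (tt j) y \<omega>) x)"
          by (rule potential_sum) (use elim convolution_localised_integrable tT in auto)
        also have "\<dots> = convolution_potential n t \<omega> x - convolution_potential m t \<omega> x
          - (convolution_potential n t0 \<omega> x - convolution_potential m t0 \<omega> x)"
          unfolding sum4 by (simp add: ee_def nn_def tt_def convolution_potential_def)
        finally show ?case by simp
      qed
    qed
    also have "\<dots> \<le> ennreal (moment_const K * (LINT \<xi>|lborel. v \<xi> * (cmod (potential s (\<lambda>y. \<rho> y * cis (y \<bullet> \<xi>)) x))\<^sup>2) ^ K)"
      by (rule potential_moment[OF M Zs Zc v0 vi \<rho> supp K])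
    also have "\<dots> \<le> ennreal (moment_const K * (E * ((t - t0) powr \<kappa> * (1 + real m) powr - \<kappa>) * jap (- 2 * real N) x) ^ K)"
    proof (intro ennreal_leI mult_left_mono power_mono less_imp_le[OF moment_const_pos] Bochner_Integration.integral_nonneg)
      show "0 \<le> v \<xi> * (cmod (potential s (\<lambda>y. \<rho> y * cis (y \<bullet> \<xi>)) x))\<^sup>2" for \<xi> using v0 by simp
      define B where "B = ?k * c1 * C0\<^sup>2 * 2 powr \<kappa> * ((t - t0) powr \<kappa> * (1 + real m) powr - \<kappa>) * jap (- 2 * real N) x"
      have B0: "0 \<le> B" unfolding B_def using c1 by auto
      have pt: "v \<xi> * (cmod (potential s (\<lambda>y. \<rho> y * cis (y \<bullet> \<xi>)) x))\<^sup>2 \<le> B * jap (3 * \<kappa> - 2 * \<alpha> - 2 * s) \<xi>" for \<xi>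
      proof (cases "real m < norm \<xi> \<and> norm \<xi> \<le> real n")
        case False
        then have "v \<xi> = 0" by (auto simp: v_def v1_def)
        then show ?thesis using B0 by simp
      next
        case True
        \<comment> \<open>Frequencies above \<open>m\<close> allow trading a factor \<open>\<langle>\<xi>\<rangle>\<^sup>\<kappa>\<close> for \<open>(1 + m)\<^bsup>-\<kappa>\<^esup>\<close>.\<close>
        have "(1 + real m) powr \<kappa> \<le> (2 * jap 1 \<xi>) powr \<kappa>"
          using True one_plus_norm_le_jap[of \<xi>] \<kappa> by (intro powr_mono2) auto
        then have "(1 + real m) powr \<kappa> \<le> 2 powr \<kappa> * jap \<kappa> \<xi>" by (simp add: powr_mult jap_powr)
        then have "1 \<le> 2 powr \<kappa> * jap \<kappa> \<xi> * (1 + real m) powr - \<kappa>"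
          by (simp add: powr_minus field_simps)
        then have "v \<xi> * (cmod (potential s (\<lambda>y. \<rho> y * cis (y \<bullet> \<xi>)) x))\<^sup>2
            \<le> (v \<xi> * (cmod (potential s (\<lambda>y. \<rho> y * cis (y \<bullet> \<xi>)) x))\<^sup>2) * (2 powr \<kappa> * jap \<kappa> \<xi> * (1 + real m) powr - \<kappa>)"
          using mult_left_mono[of 1 "2 powr \<kappa> * jap \<kappa> \<xi> * (1 + real m) powr - \<kappa>"
              "v \<xi> * (cmod (potential s (\<lambda>y. \<rho> y * cis (y \<bullet> \<xi>)) x))\<^sup>2"] v0[of \<xi>] by simp
        also have "\<dots> \<le> (v \<xi> * (C0 * jap (- s) \<xi> * jap (- real N) x)\<^sup>2) * (2 powr \<kappa> * jap \<kappa> \<xi> * (1 + real m) powr - \<kappa>)"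
          using v0[of \<xi>] by (intro mult_right_mono mult_left_mono power_mono C0) auto
        also have "\<dots> = B * jap (3 * \<kappa> - 2 * \<alpha> - 2 * s) \<xi>"
        proof -
          have j: "jap (3 * \<kappa> - 2 * \<alpha> - 2 * s) \<xi> = jap (- 2 * \<alpha>) \<xi> * jap (2 * \<kappa>) \<xi> * (jap (- s) \<xi>)\<^sup>2 * jap \<kappa> \<xi>"
          proof -
            have e: "3 * \<kappa> - 2 * \<alpha> - 2 * s = - 2 * \<alpha> + 2 * \<kappa> + - s * 2 + \<kappa>" by simp
            show ?thesis unfolding e jap_add by (simp add: jap_power)
          qed
          have x: "(jap (- real N) x)\<^sup>2 = jap (- 2 * real N) x" by (simp add: jap_power mult.commute)
          have vv: "v \<xi> = ?k * (jap (- 2 * \<alpha>) \<xi> * (c1 * (t - t0) powr \<kappa> * jap (2 * \<kappa>) \<xi>))"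
            using True by (simp add: v_def v1_def)
          show ?thesis unfolding j B_def vv x[symmetric] power_mult_distrib by (simp only: mult_ac)
        qed
        finally show ?thesis .
      qed
      have "(LINT \<xi>|lborel. v \<xi> * (cmod (potential s (\<lambda>y. \<rho> y * cis (y \<bullet> \<xi>)) x))\<^sup>2) \<le> (LINT \<xi>|lborel. B * jap (3 * \<kappa> - 2 * \<alpha> - 2 * s) (\<xi>::'a))"
      proof (rule integral_mono')
        show "integrable lborel (\<lambda>\<xi>::'a. B * jap (3 * \<kappa> - 2 * \<alpha> - 2 * s) \<xi>)"
          by (intro integrable_mult_right integrable_jap s)
      qed (use pt B0 in auto)
      also have "\<dots> = E * ((t - t0) powr \<kappa> * (1 + real m) powr - \<kappa>) * jap (- 2 * real N) x"
        unfolding integral_mult_right_zero I_def[symmetric] B_def E_def by (simp only: mult_ac)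
      finally show "(LINT \<xi>|lborel. v \<xi> * (cmod (potential s (\<lambda>y. \<rho> y * cis (y \<bullet> \<xi>)) x))\<^sup>2)
          \<le> E * ((t - t0) powr \<kappa> * (1 + real m) powr - \<kappa>) * jap (- 2 * real N) x" .
    qed
    also have "moment_const K * (E * ((t - t0) powr \<kappa> * (1 + real m) powr - \<kappa>) * jap (- 2 * real N) x) ^ K
        = moment_const K * E ^ K * ((t - t0) powr \<kappa> * (1 + real m) powr - \<kappa>) ^ K * jap (- real (2 * K * N)) x"
    proof -
      have "jap (- 2 * real N) x ^ K = jap (- real (2 * K * N)) x" by (simp add: jap_power mult_ac)
      then show ?thesis by (simp only: power_mult_distrib mult.assoc)
    qed
    finally show "(\<integral>\<^sup>+\<omega>. ennreal (cmod (convolution_potential n t \<omega> x - convolution_potential m t \<omega> x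
          - (convolution_potential n t0 \<omega> x - convolution_potential m t0 \<omega> x)) ^ (2 * K)) \<partial>M)
      \<le> ennreal (moment_const K * E ^ K * ((t - t0) powr \<kappa> * (1 + real m) powr - \<kappa>) ^ K * jap (- real (2 * K * N)) x)" .
  qed
qed

text \<open>Summing the moment bounds over all dyadic increments gives an almost surely finite constant for each
  point \<open>x\<close>. Its moment of order \<open>2 K\<close> decays faster than any power of \<open>x\<close>, so that by interpolation against
  a weight it is integrable in \<open>x\<close> together with its \<open>p\<close>-th power.\<close>

lemma pathwise_bound:
  assumes s: "s > real DIM('a) / 2 - \<alpha>" and p: "1 \<le> p"
  obtains \<theta> :: real where "\<theta> > 0"
    "AE \<omega> in M. \<exists>A. (\<forall>x. 0 \<le> A x) \<and> integrable lborel A \<and> integrable lborel (\<lambda>x. A x powr p) \<and>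
      (AE x in lborel. \<forall>l i k j. i \<le> 2 ^ l \<longrightarrow> j < 2 ^ k \<longrightarrow>
        cmod (convolution_potential (2 ^ l - 1 + i) (dyadic T k (Suc j)) \<omega> x - convolution_potential (2 ^ l - 1) (dyadic T k (Suc j)) \<omega> x
            - (convolution_potential (2 ^ l - 1 + i) (dyadic T k j) \<omega> x - convolution_potential (2 ^ l - 1) (dyadic T k j) \<omega> x))
          \<le> A x * (2 powr - \<theta>) ^ l * (2 powr - \<theta>) ^ k)"
proof -
  let ?d = "real DIM('a)"
  define \<kappa> where "\<kappa> = min 1 ((2 * (\<alpha> + s) - ?d) / 4)"
  have \<kappa>: "0 < \<kappa>" "\<kappa> \<le> 1" using s by (auto simp: \<kappa>_def)
  have X: "0 < 2 * (\<alpha> + s) - ?d" using s by (simp add: field_simps)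
  have "\<kappa> \<le> (2 * (\<alpha> + s) - ?d) / 4" unfolding \<kappa>_def by (rule min.cobounded2)
  then have "4 * \<kappa> \<le> 2 * (\<alpha> + s) - ?d" by simp
  then have \<kappa>s: "3 * \<kappa> - 2 * \<alpha> - 2 * s < - ?d" using X by argo
  \<comment> \<open>With \<open>r = 2\<^bsup>-\<theta>\<^esup>\<close> a moment of order \<open>2 K\<close> gains \<open>r\<^bsup>4 K\<^esup>\<close> per level, of which the normalisation of the increment takes
    \<open>r\<^bsup>2 K\<^esup>\<close>. The choice of \<open>K\<close> makes the remaining factor at most \<open>1/4\<close>, which beats the \<open>2\<^sup>l\<close> and \<open>2\<^sup>k\<close> increments of a level.\<close>
  define \<theta> where "\<theta> = \<kappa> / 4"
  define K where "K = nat \<lceil>max (4 / \<kappa>) p\<rceil>"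
  have K1: "4 / \<kappa> \<le> real K" "p \<le> real K" unfolding K_def by linarith+
  have K: "K > 0" using K1(2) p by linarith
  have K4: "4 \<le> \<kappa> * real K" using K1(1) \<kappa> by (simp add: field_simps)
  define q where "q = 2 * K"
  have q: "q > 0" "p \<le> real q" using K K1(2) by (auto simp: q_def)
  \<comment> \<open>The moments decay like \<open>\<langle>x\<rangle>\<^bsup>-q N\<^esup>\<close>. The weight \<open>\<langle>x\<rangle>\<^sup>w\<close> leaves them integrable, and \<open>\<langle>x\<rangle>\<^bsup>-w/q\<^esup>\<close> is integrable as well.\<close>
  define N where "N = 2 * DIM('a) + 2"
  define w where "w = real (q * N) - ?d - 1"
  obtain C where C: "C \<ge> 0"
    "\<And>m n t0 t x. m \<le> n \<Longrightarrow> 0 \<le> t0 \<Longrightarrow> t0 \<le> t \<Longrightarrow> t \<le> T \<Longrightarrow>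
      (\<integral>\<^sup>+\<omega>. ennreal (cmod (convolution_potential n t \<omega> x - convolution_potential m t \<omega> x
          - (convolution_potential n t0 \<omega> x - convolution_potential m t0 \<omega> x)) ^ (2 * K)) \<partial>M)
      \<le> ennreal (C * ((t - t0) powr \<kappa> * (1 + real m) powr - \<kappa>) ^ K * jap (- real (2 * K * N)) x)"
    using increment_moment[OF \<kappa> \<kappa>s K] by blast
  define r where "r = 2 powr - \<theta>"
  have r: "r > 0" by (simp add: r_def)
  define D where "D l k i j \<omega> x = convolution_potential (2 ^ l - 1 + i) (dyadic T k (Suc j)) \<omega> x - convolution_potential (2 ^ l - 1) (dyadic T k (Suc j)) \<omega> x
            - (convolution_potential (2 ^ l - 1 + i) (dyadic T k j) \<omega> x - convolution_potential (2 ^ l - 1) (dyadic T k j) \<omega> x)" for l k i j \<omega> x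
  define F where "F l k i j \<omega> x = ennreal ((cmod (D l k i j \<omega> x) / (r ^ l * r ^ k)) ^ q)" for l k i j \<omega> x
  define S where "S \<omega> x = (\<Sum>l. \<Sum>k. \<Sum>i\<le>2 ^ l. \<Sum>j<2 ^ k. F l k i j \<omega> x)" for \<omega> x
  have tt: "dyadic T k j \<in> {0..T}" if "j \<le> 2 ^ k" for k j
    using dyadics_bounds[OF T dyadic_in[OF that]] by simp
  have Fm: "(\<lambda>(\<omega>, x). F l k i j \<omega> x) \<in> borel_measurable (M \<Otimes>\<^sub>M lborel)" if "j < 2 ^ k" for l k i j
  proof -
    have j: "Suc j \<le> 2 ^ k" "j \<le> 2 ^ k" using that by auto
    note [measurable] = convolution_potential_measurable[OF tt[OF j(1)]] convolution_potential_measurable[OF tt[OF j(2)]]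
    show ?thesis unfolding F_def D_def by measurable
  qed
  have Fx: "F l k i j \<omega> \<in> borel_measurable borel" if "j < 2 ^ k" for l k i j \<omega>
  proof -
    have j: "Suc j \<le> 2 ^ k" "j \<le> 2 ^ k" using that by auto
    have "convolution_potential n t \<omega> \<in> borel_measurable borel" if "t \<in> {0..T}" for n t
      unfolding convolution_potential_def
      using borel_measurable_integrable[OF convolution_localised_integrable[OF that, of n \<omega>]] by (intro potential_measurable) simp
    note [measurable] = this[OF tt[OF j(1)]] this[OF tt[OF j(2)]]
    show ?thesis unfolding F_def D_def by measurable
  qed
  have F\<omega>: "(\<lambda>\<omega>. F l k i j \<omega> x) \<in> borel_measurable M" if "j < 2 ^ k" for l k i j x
    using measurable_compose[OF measurable_Pair2'[of x lborel M] Fm[OF that, of l i]] by simp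
  have Sm: "(\<lambda>(\<omega>, x). S \<omega> x) \<in> borel_measurable (M \<Otimes>\<^sub>M lborel)"
    unfolding S_def case_prod_unfold
    by (intro borel_measurable_suminf_order borel_measurable_sum) (use Fm in \<open>auto simp: case_prod_unfold\<close>)
  have Sx: "S \<omega> \<in> borel_measurable borel" for \<omega>
    unfolding S_def[abs_def] by (intro borel_measurable_suminf_order borel_measurable_sum) (use Fx in auto)
  define C1 where "C1 = C * (T powr \<kappa>) ^ K"
  have C10: "C1 \<ge> 0" using C by (simp add: C1_def)
  have EF: "(\<integral>\<^sup>+\<omega>. F l k i j \<omega> x \<partial>M) \<le> ennreal (C1 * jap (- real (q * N)) x * (1 / 4) ^ l * (1 / 4) ^ k)"
    if j: "j < 2 ^ k" for l k i j x
  proof -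
    have jj: "Suc j \<le> 2 ^ k" "j \<le> 2 ^ k" using j by auto
    have df: "dyadic T k (Suc j) - dyadic T k j = T / 2 ^ k"
      by (simp add: dyadic_def diff_divide_distrib[symmetric] algebra_simps)
    have ml: "1 + real (2 ^ l - 1) = 2 ^ l" by (simp add: of_nat_diff)
    have le: "dyadic T k j \<le> dyadic T k (Suc j)" using df T by (smt (verit) divide_nonneg_pos zero_less_power)
    have "(\<integral>\<^sup>+\<omega>. ennreal (cmod (D l k i j \<omega> x) ^ (2 * K)) \<partial>M)
        \<le> ennreal (C * ((T / 2 ^ k) powr \<kappa> * (2 ^ l) powr - \<kappa>) ^ K * jap (- real (2 * K * N)) x)"
      using C(2)[of "2 ^ l - 1" "2 ^ l - 1 + i" "dyadic T k j" "dyadic T k (Suc j)" x] tt[OF jj(1)] tt[OF jj(2)] le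
      unfolding D_def df ml by simp
    moreover have "(\<integral>\<^sup>+\<omega>. F l k i j \<omega> x \<partial>M) = ennreal (1 / (r ^ l * r ^ k) ^ q) * (\<integral>\<^sup>+\<omega>. ennreal (cmod (D l k i j \<omega> x) ^ (2 * K)) \<partial>M)"
    proof -
      have "F l k i j \<omega> x = ennreal (1 / (r ^ l * r ^ k) ^ q) * ennreal (cmod (D l k i j \<omega> x) ^ (2 * K))" for \<omega>
        unfolding F_def using r by (simp add: power_divide q_def flip: ennreal_mult)
      moreover have "(\<lambda>\<omega>. ennreal (cmod (D l k i j \<omega> x) ^ (2 * K))) \<in> borel_measurable M"
      proof -
        have "(\<lambda>\<omega>. ennreal ((r ^ l * r ^ k) ^ q) * F l k i j \<omega> x) \<in> borel_measurable M"
          using F\<omega>[OF j] by measurable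
        moreover have "ennreal ((r ^ l * r ^ k) ^ q) * F l k i j \<omega> x = ennreal (cmod (D l k i j \<omega> x) ^ (2 * K))" for \<omega>
          unfolding F_def using r by (simp add: power_divide q_def flip: ennreal_mult)
        ultimately show ?thesis by simp
      qed
      ultimately show ?thesis by (simp add: nn_integral_cmult)
    qed
    ultimately have "(\<integral>\<^sup>+\<omega>. F l k i j \<omega> x \<partial>M) \<le> ennreal (1 / (r ^ l * r ^ k) ^ q) *
        ennreal (C * ((T / 2 ^ k) powr \<kappa> * (2 ^ l) powr - \<kappa>) ^ K * jap (- real (2 * K * N)) x)"
      by (simp add: mult_left_mono)
    also have "\<dots> = ennreal (1 / (r ^ l * r ^ k) ^ q * (C * ((T / 2 ^ k) powr \<kappa> * (2 ^ l) powr - \<kappa>) ^ K * jap (- real (2 * K * N)) x))"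
      using r C(1) by (intro ennreal_mult[symmetric]) auto
    also have "\<dots> \<le> ennreal (C1 * jap (- real (q * N)) x * (1 / 4) ^ l * (1 / 4) ^ k)"
    proof (rule ennreal_leI)
      have a: "2 powr - \<kappa> = r ^ 4" by (simp add: r_def \<theta>_def powr_power)
      have p1: "(T / 2 ^ k) powr \<kappa> = T powr \<kappa> * (r ^ 4) ^ k"
      proof -
        have "(T / 2 ^ k) powr \<kappa> = T powr \<kappa> * (1 / 2 ^ k) powr \<kappa>" by (subst powr_mult[symmetric]) simp
        also have "(1 / 2 ^ k) powr \<kappa> = (2 powr - \<kappa>) ^ k"
          by (simp add: powr_divide powr_minus powr_power powr_powr mult.commute inverse_eq_divide power_divide flip: powr_realpow)
        finally show ?thesis unfolding a .
      qed
      have p2: "((2::real) ^ l) powr - \<kappa> = (r ^ 4) ^ l"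
        unfolding a[symmetric] by (simp add: powr_power powr_powr mult.commute flip: powr_realpow)
      have rq: "r ^ q \<le> 1 / 4"
      proof -
        have "r ^ q = 2 powr (- (\<kappa> * real K) / 2)" by (simp add: r_def \<theta>_def powr_power q_def)
        also have "\<dots> \<le> 2 powr - 2" using K4 by (intro powr_mono) auto
        finally show ?thesis by (simp add: powr_minus)
      qed
      have split: "((r ^ 4) ^ k * (r ^ 4) ^ l) ^ K = (r ^ l * r ^ k) ^ q * ((r ^ q) ^ l * (r ^ q) ^ k)"
        unfolding q_def by (simp add: algebra_simps flip: power_mult power_add)
      have "1 / (r ^ l * r ^ k) ^ q * ((T / 2 ^ k) powr \<kappa> * (2 ^ l) powr - \<kappa>) ^ K = (T powr \<kappa>) ^ K * ((r ^ q) ^ l * (r ^ q) ^ k)"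
      proof -
        have "((T / 2 ^ k) powr \<kappa> * (2 ^ l) powr - \<kappa>) ^ K = (T powr \<kappa>) ^ K * ((r ^ 4) ^ k * (r ^ 4) ^ l) ^ K"
          unfolding p1 p2 by (simp add: power_mult_distrib mult.assoc)
        then show ?thesis unfolding split using r by simp
      qed
      also have "\<dots> \<le> (T powr \<kappa>) ^ K * ((1 / 4) ^ l * (1 / 4) ^ k)"
        using r rq by (intro mult_left_mono mult_mono power_mono) auto
      finally have "C * jap (- real (q * N)) x * (1 / (r ^ l * r ^ k) ^ q * ((T / 2 ^ k) powr \<kappa> * (2 ^ l) powr - \<kappa>) ^ K)
          \<le> C * jap (- real (q * N)) x * ((T powr \<kappa>) ^ K * ((1 / 4) ^ l * (1 / 4) ^ k))"
        using C(1) by (intro mult_left_mono) auto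
      then show "1 / (r ^ l * r ^ k) ^ q * (C * ((T / 2 ^ k) powr \<kappa> * (2 ^ l) powr - \<kappa>) ^ K * jap (- real (2 * K * N)) x)
          \<le> C1 * jap (- real (q * N)) x * (1 / 4) ^ l * (1 / 4) ^ k"
        unfolding C1_def q_def by (simp only: mult_ac)
    qed
    finally show ?thesis .
  qed
  have ES: "(\<integral>\<^sup>+\<omega>. S \<omega> x \<partial>M) \<le> ennreal (8 * C1 * jap (- real (q * N)) x)" for x
  proof -
    define e where "e = 2 * C1 * jap (- real (q * N)) x"
    have e0: "e \<ge> 0" using C10 by (simp add: e_def)
    have "(\<integral>\<^sup>+\<omega>. S \<omega> x \<partial>M) = (\<Sum>l. \<Sum>k. \<Sum>i\<le>2 ^ l. \<Sum>j<2 ^ k. \<integral>\<^sup>+\<omega>. F l k i j \<omega> x \<partial>M)"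
    proof -
      have m1: "(\<lambda>\<omega>. \<Sum>i\<le>2 ^ l. \<Sum>j<2 ^ k. F l k i j \<omega> x) \<in> borel_measurable M" for l k
        by (intro borel_measurable_sum F\<omega>) auto
      have m2: "(\<lambda>\<omega>. \<Sum>k. \<Sum>i\<le>2 ^ l. \<Sum>j<2 ^ k. F l k i j \<omega> x) \<in> borel_measurable M" for l
        by (intro borel_measurable_suminf_order m1)
      have i1: "(\<integral>\<^sup>+\<omega>. (\<Sum>i\<le>2 ^ l. \<Sum>j<2 ^ k. F l k i j \<omega> x) \<partial>M) = (\<Sum>i\<le>2 ^ l. \<Sum>j<2 ^ k. \<integral>\<^sup>+\<omega>. F l k i j \<omega> x \<partial>M)" for l k
      proof -
        have "(\<integral>\<^sup>+\<omega>. (\<Sum>i\<le>2 ^ l. \<Sum>j<2 ^ k. F l k i j \<omega> x) \<partial>M) = (\<Sum>i\<le>2 ^ l. \<integral>\<^sup>+\<omega>. (\<Sum>j<2 ^ k. F l k i j \<omega> x) \<partial>M)"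
          by (rule nn_integral_sum) (intro borel_measurable_sum F\<omega>, simp)
        also have "\<dots> = (\<Sum>i\<le>2 ^ l. \<Sum>j<2 ^ k. \<integral>\<^sup>+\<omega>. F l k i j \<omega> x \<partial>M)"
          by (intro sum.cong refl nn_integral_sum F\<omega>) auto
        finally show ?thesis .
      qed
      show ?thesis unfolding S_def nn_integral_suminf[OF m2] nn_integral_suminf[OF m1] i1 by (rule refl)
    qed
    also have "\<dots> \<le> (\<Sum>l. \<Sum>k. ennreal (e * (1 / 2) ^ l * (1 / 2) ^ k))"
    proof (intro suminf_le summableI)
      fix l k
      have "(\<Sum>i\<le>2 ^ l. \<Sum>j<2 ^ k. \<integral>\<^sup>+\<omega>. F l k i j \<omega> x \<partial>M)
          \<le> (\<Sum>i\<le>(2::nat) ^ l. \<Sum>j<(2::nat) ^ k. ennreal (C1 * jap (- real (q * N)) x * (1 / 4) ^ l * (1 / 4) ^ k))"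
        by (intro sum_mono EF) auto
      also have "\<dots> = ennreal (\<Sum>i\<le>(2::nat) ^ l. \<Sum>j<(2::nat) ^ k. C1 * jap (- real (q * N)) x * (1 / 4) ^ l * (1 / 4) ^ k)"
        using C10 by (subst sum_ennreal; (subst sum_ennreal)?) (auto intro!: sum_nonneg)
      also have "\<dots> \<le> ennreal (e * (1 / 2) ^ l * (1 / 2) ^ k)"
      proof (rule ennreal_leI)
        have h: "(1 / 4 :: real) ^ l = (1 / 2) ^ l * (1 / 2) ^ l" for l by (simp flip: power_mult_distrib)
        have "(\<Sum>i\<le>(2::nat) ^ l. \<Sum>j<(2::nat) ^ k. C1 * jap (- real (q * N)) x * (1 / 4) ^ l * (1 / 4) ^ k)
            = (2 ^ l + 1) * (2 ^ k * (C1 * jap (- real (q * N)) x * (1 / 4) ^ l * (1 / 4) ^ k))"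
          by (simp add: algebra_simps)
        also have "\<dots> \<le> (2 * 2 ^ l) * (2 ^ k * (C1 * jap (- real (q * N)) x * (1 / 4) ^ l * (1 / 4) ^ k))"
          using C10 by (intro mult_right_mono) auto
        also have "\<dots> = e * ((2 ^ l * (1 / 2) ^ l) * (1 / 2) ^ l) * ((2 ^ k * (1 / 2) ^ k) * (1 / 2) ^ k)"
          unfolding h e_def by (simp only: mult_ac)
        also have "\<dots> = e * (1 / 2) ^ l * (1 / 2) ^ k" by (simp flip: power_mult_distrib)
        finally show "(\<Sum>i\<le>(2::nat) ^ l. \<Sum>j<(2::nat) ^ k. C1 * jap (- real (q * N)) x * (1 / 4) ^ l * (1 / 4) ^ k)
            \<le> e * (1 / 2) ^ l * (1 / 2) ^ k" .
      qed
      finally show "(\<Sum>i\<le>2 ^ l. \<Sum>j<2 ^ k. \<integral>\<^sup>+\<omega>. F l k i j \<omega> x \<partial>M) \<le> ennreal (e * (1 / 2) ^ l * (1 / 2) ^ k)" .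
    qed
    also have "\<dots> = (\<Sum>l. ennreal (e * (1 / 2) ^ l * 2))"
    proof (intro suminf_cong)
      fix l
      have "(\<lambda>k. e * (1 / 2) ^ l * (1 / 2) ^ k) sums (e * (1 / 2) ^ l * (1 / (1 - 1 / 2)))"
        by (intro sums_mult geometric_sums) auto
      then show "(\<Sum>k. ennreal (e * (1 / 2) ^ l * (1 / 2) ^ k)) = ennreal (e * (1 / 2) ^ l * 2)"
        using e0 by (intro suminf_ennreal_eq) auto
    qed
    also have "\<dots> = ennreal (e * 2 * 2)"
    proof (rule suminf_ennreal_eq)
      have "(\<lambda>l. (e * 2) * (1 / 2) ^ l) sums ((e * 2) * (1 / (1 - 1 / 2)))"
        by (intro sums_mult geometric_sums) auto
      then show "(\<lambda>l. e * (1 / 2) ^ l * 2) sums (e * 2 * 2)" by (simp add: mult_ac)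
    qed (use e0 in auto)
    finally show ?thesis by (simp add: e_def mult_ac)
  qed
  interpret prob_space M by (rule M)
  have "(\<integral>\<^sup>+\<omega>. (\<integral>\<^sup>+x. ennreal (jap w x) * S \<omega> x \<partial>lborel) \<partial>M) = (\<integral>\<^sup>+x. (\<integral>\<^sup>+\<omega>. ennreal (jap w x) * S \<omega> x \<partial>M) \<partial>lborel)"
  proof -
    note [measurable] = Sm
    interpret pair_sigma_finite M "lborel :: 'a measure" by standard
    show ?thesis by (rule Fubini'[symmetric]) measurable
  qed
  also have "\<dots> \<le> (\<integral>\<^sup>+x. ennreal (8 * C1 * jap (- ?d - 1) (x::'a)) \<partial>lborel)"
  proof (rule nn_integral_mono)
    fix x :: 'a
    have "(\<lambda>\<omega>. S \<omega> x) \<in> borel_measurable M"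
      unfolding S_def by (intro borel_measurable_suminf_order borel_measurable_sum) (use F\<omega> in auto)
    then have "(\<integral>\<^sup>+\<omega>. ennreal (jap w x) * S \<omega> x \<partial>M) = ennreal (jap w x) * (\<integral>\<^sup>+\<omega>. S \<omega> x \<partial>M)" by (rule nn_integral_cmult)
    also have "\<dots> \<le> ennreal (jap w x) * ennreal (8 * C1 * jap (- real (q * N)) x)" by (intro mult_left_mono ES) auto
    also have "\<dots> = ennreal (8 * C1 * (jap w x * jap (- real (q * N)) x))"
      using C10 by (subst ennreal_mult[symmetric]) (auto simp: mult_ac)
    also have "jap w x * jap (- real (q * N)) x = jap (- ?d - 1) x" unfolding w_def by (simp flip: jap_add)
    finally show "(\<integral>\<^sup>+\<omega>. ennreal (jap w x) * S \<omega> x \<partial>M) \<le> ennreal (8 * C1 * jap (- ?d - 1) x)" .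
  qed
  also have "\<dots> < \<infinity>"
  proof -
    have "integrable lborel (\<lambda>x::'a. 8 * C1 * jap (- ?d - 1) x)" by (intro integrable_mult_right integrable_jap) simp
    then show ?thesis using C10 by (subst nn_integral_eq_integral) auto
  qed
  finally have fin: "(\<integral>\<^sup>+\<omega>. (\<integral>\<^sup>+x. ennreal (jap w x) * S \<omega> x \<partial>lborel) \<partial>M) < \<infinity>" .
  have ae: "AE \<omega> in M. (\<integral>\<^sup>+x. ennreal (jap w x) * S \<omega> x \<partial>lborel) \<noteq> \<infinity>"
  proof (rule nn_integral_PInf_AE)
    note [measurable] = Sm
    show "(\<lambda>\<omega>. \<integral>\<^sup>+x. ennreal (jap w x) * S \<omega> x \<partial>lborel) \<in> borel_measurable M" by measurable
    show "(\<integral>\<^sup>+\<omega>. (\<integral>\<^sup>+x. ennreal (jap w x) * S \<omega> x \<partial>lborel) \<partial>M) \<noteq> \<infinity>" using fin by simp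
  qed
  have w0: "w * (a / real q) > ?d" if "1 \<le> a" for a
  proof -
    have "(?d + 1) / real q \<le> ?d + 1" using q(1) by (simp add: divide_le_eq)
    then have "real N - (?d + 1) / real q > ?d" unfolding N_def by simp
    moreover have "w / real q = real N - (?d + 1) / real q" using q(1) by (simp add: w_def field_simps)
    ultimately have wq: "w / real q > ?d" by simp
    then have "w / real q * 1 \<le> w / real q * a" using that by (intro mult_left_mono) auto
    with wq show ?thesis by simp
  qed
  show ?thesis
  proof (rule that[of \<theta>])
    show "\<theta> > 0" using \<kappa> by (simp add: \<theta>_def)
    show "AE \<omega> in M. \<exists>A. (\<forall>x. 0 \<le> A x) \<and> integrable lborel A \<and> integrable lborel (\<lambda>x. A x powr p) \<and>
      (AE x in lborel. \<forall>l i k j. i \<le> 2 ^ l \<longrightarrow> j < 2 ^ k \<longrightarrow>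
        cmod (convolution_potential (2 ^ l - 1 + i) (dyadic T k (Suc j)) \<omega> x - convolution_potential (2 ^ l - 1) (dyadic T k (Suc j)) \<omega> x
            - (convolution_potential (2 ^ l - 1 + i) (dyadic T k j) \<omega> x - convolution_potential (2 ^ l - 1) (dyadic T k j) \<omega> x))
          \<le> A x * (2 powr - \<theta>) ^ l * (2 powr - \<theta>) ^ k)"
      using ae
    proof eventually_elim
      case (elim \<omega>)
      note [measurable] = Sx[of \<omega>]
      define V where "V x = enn2real (S \<omega> x)" for x
      have V0: "V x \<ge> 0" for x by (simp add: V_def)
      have [measurable]: "V \<in> borel_measurable borel" unfolding V_def by measurable
      have "AE x in lborel. ennreal (jap w x) * S \<omega> x \<noteq> \<infinity>"
        by (rule nn_integral_PInf_AE) (use elim in auto)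
      then have Sfin: "AE x in lborel. S \<omega> x < \<infinity>"
        by eventually_elim (auto simp: ennreal_mult_eq_top_iff less_top)
      have Vi: "integrable lborel (\<lambda>x. jap w x * V x)"
      proof (rule integrableI_nonneg)
        have "(\<integral>\<^sup>+x. ennreal (jap w x * V x) \<partial>lborel) \<le> (\<integral>\<^sup>+x. ennreal (jap w x) * S \<omega> x \<partial>lborel)"
          by (intro nn_integral_mono) (auto simp: ennreal_mult V_def ennreal_enn2real_if intro!: mult_left_mono)
        then show "(\<integral>\<^sup>+x. ennreal (jap w x * V x) \<partial>lborel) < \<infinity>" using elim by (auto simp: less_top dest: le_less_trans)
      qed (auto simp: V0)
      have Vb: "integrable lborel (\<lambda>x. V x powr (a / real q))" if a: "1 \<le> a" "a \<le> real q" for a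
      proof (rule Bochner_Integration.integrable_bound)
        let ?b = "a / real q"
        have b: "0 < ?b" "?b \<le> 1" using a q by auto
        show "integrable lborel (\<lambda>x. jap (- (w * ?b)) x + jap w x * V x)"
          using w0[OF a(1)] by (intro Bochner_Integration.integrable_add Vi integrable_jap) auto
        show "AE x in lborel. norm (V x powr ?b) \<le> norm (jap (- (w * ?b)) x + jap w x * V x)"
        proof (intro AE_I2)
          fix x
          let ?u = "jap w x * V x"
          have "w * ?b > 0" using w0[OF a(1)] by linarith
          then have j1: "jap (- (w * ?b)) x \<le> 1" using jap_mono[of "- (w * ?b)" 0 x] by simp
          have u0: "0 \<le> ?u" using V0 by simp
          have ub: "?u powr ?b \<le> 1 + ?u"
          proof (cases "?u \<le> 1")
            case True
            then have "?u powr ?b \<le> 1 powr ?b" using u0 b by (intro powr_mono2) auto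
            then show ?thesis using u0 by simp
          next
            case False
            then have "?u powr ?b \<le> ?u powr 1" using b by (intro powr_mono) auto
            then show ?thesis using u0 by simp
          qed
          have "V x = ?u * jap (- w) x" by (simp add: jap_minus)
          then have "V x powr ?b = (?u * jap (- w) x) powr ?b" by (simp only:)
          also have "\<dots> = ?u powr ?b * jap (- (w * ?b)) x" by (simp add: powr_mult jap_powr)
          also have "\<dots> \<le> (1 + ?u) * jap (- (w * ?b)) x" by (intro mult_right_mono ub) auto
          also have "\<dots> \<le> jap (- (w * ?b)) x + ?u"
            using mult_left_mono[OF j1 u0] by (simp add: distrib_right)
          finally show "norm (V x powr ?b) \<le> norm (jap (- (w * ?b)) x + jap w x * V x)" using u0 by simp
        qed
      qed measurable
      define A where "A x = V x powr (1 / real q)" for x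
      have "integrable lborel A" using Vb[of 1] q K by (simp add: A_def[abs_def] q_def)
      moreover have "integrable lborel (\<lambda>x. A x powr p)" using Vb[OF p q(2)] by (simp add: A_def powr_powr)
      moreover have "AE x in lborel. \<forall>l i k j. i \<le> 2 ^ l \<longrightarrow> j < 2 ^ k \<longrightarrow> cmod (D l k i j \<omega> x) \<le> A x * r ^ l * r ^ k"
        using Sfin
      proof (eventually_elim, intro allI impI)
        fix x and l i k j :: nat assume fin: "S \<omega> x < \<infinity>" and i: "i \<le> 2 ^ l" and j: "j < 2 ^ k"
        have "F l k i j \<omega> x \<le> (\<Sum>j<2 ^ k. F l k i j \<omega> x)" using j by (intro member_le_sum) auto
        also have "\<dots> \<le> (\<Sum>i\<le>2 ^ l. \<Sum>j<2 ^ k. F l k i j \<omega> x)" using i by (intro member_le_sum) auto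
        also have "\<dots> \<le> (\<Sum>k. \<Sum>i\<le>2 ^ l. \<Sum>j<2 ^ k. F l k i j \<omega> x)"
          using sum_le_suminf[of "\<lambda>k. \<Sum>i\<le>2 ^ l. \<Sum>j<2 ^ k. F l k i j \<omega> x" "{k}"] by simp
        also have "\<dots> \<le> S \<omega> x"
          unfolding S_def using sum_le_suminf[of "\<lambda>l. \<Sum>k. \<Sum>i\<le>2 ^ l. \<Sum>j<2 ^ k. F l k i j \<omega> x" "{l}"] by simp
        also have "\<dots> = ennreal (V x)" using fin by (simp add: V_def)
        finally have le: "(cmod (D l k i j \<omega> x) / (r ^ l * r ^ k)) ^ q \<le> V x"
          using V0 by (simp add: F_def)
        let ?y = "cmod (D l k i j \<omega> x) / (r ^ l * r ^ k)"
        have y0: "0 \<le> ?y" using r by simp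
        have root: "(y ^ q) powr (1 / real q) = y" if "0 \<le> y" for y :: real
        proof (cases "y = 0")
          case False
          then have "y ^ q = y powr real q" using that by (simp add: powr_realpow)
          then show ?thesis using that q(1) by (simp add: powr_powr)
        qed (use q(1) in simp)
        have "?y = (?y ^ q) powr (1 / real q)" using root[OF y0] by (rule sym)
        also have "\<dots> \<le> A x" unfolding A_def using le y0 by (intro powr_mono2) auto
        finally show "cmod (D l k i j \<omega> x) \<le> A x * r ^ l * r ^ k"
          using r by (simp add: divide_le_eq mult.assoc)
      qed
      ultimately show ?case
        unfolding D_def r_def by (intro exI[of _ A]) (auto simp: A_def)
    qed
  qed
qed

end

section \<open>Almost sure convergence\<close>

text \<open>The pathwise argument needs paths that are continuous for every outcome. Redefining the process as zero on
  a measurable null set provides them without changing the property of being a truncated convolution.\<close>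

lemma truncated_convolution_restrict:
  fixes \<Psi> :: "real \<Rightarrow> 'a::euclidean_space \<Rightarrow> 'w \<Rightarrow> complex"
  assumes \<Psi>: "truncated_convolution M T W \<alpha> n \<Psi>" and N: "N \<in> null_sets M"
    and cont: "\<And>\<omega>. \<omega> \<in> space M - N \<Longrightarrow> continuous_on ({0..T} \<times> UNIV) (\<lambda>(t, x). \<Psi> t x \<omega>)"
  defines "\<Phi> \<equiv> \<lambda>t x \<omega>. if \<omega> \<in> space M - N then \<Psi> t x \<omega> else 0"
  shows "truncated_convolution M T W \<alpha> n \<Phi>"
    and "continuous_on ({0..T} \<times> UNIV) (\<lambda>(t, x). \<Phi> t x \<omega>)"
proof -
  have Nm: "space M - N \<in> sets M" using N by auto
  have eq: "AE \<omega> in M. \<omega> \<in> space M - N"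
    using AE_not_in[OF N] AE_space by eventually_elim simp
  show c: "continuous_on ({0..T} \<times> UNIV) (\<lambda>(t, x). \<Phi> t x \<omega>)" for \<omega>
  proof (cases "\<omega> \<in> space M - N")
    case True
    then show ?thesis using cont[OF True] by (simp add: \<Phi>_def)
  next
    case False
    then have "(\<lambda>(t, x). \<Phi> t x \<omega>) = (\<lambda>_. 0)" by (auto simp: \<Phi>_def)
    then show ?thesis by simp
  qed
  show "truncated_convolution M T W \<alpha> n \<Phi>"
    unfolding truncated_convolution_def
  proof (intro conjI ballI allI)
    fix t x assume t: "t \<in> {0..T}"
    have \<Psi>m: "\<Psi> t x \<in> borel_measurable M"
      using \<Psi> t unfolding truncated_convolution_def by blast
    show "\<Phi> t x \<in> borel_measurable M"
      unfolding \<Phi>_def by (rule measurable_If_set[OF \<Psi>m]) (use Nm in \<open>auto simp: Int_absorb1 Int_absorb2\<close>)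
    obtain X where X: "complex_wiener_integral M T W
        (\<lambda>(t', x'). indicator {0..t} t' * trunc_kernel \<alpha> n (t - t') (x - x')) X" "AE \<omega> in M. \<Psi> t x \<omega> = - \<i> * X \<omega>"
      using \<Psi> t unfolding truncated_convolution_def by blast
    have "AE \<omega> in M. \<Phi> t x \<omega> = - \<i> * X \<omega>"
      using X(2) eq by eventually_elim (simp add: \<Phi>_def)
    with X(1) show "\<exists>X. complex_wiener_integral M T W
        (\<lambda>(t', x'). indicator {0..t} t' * trunc_kernel \<alpha> n (t - t') (x - x')) X \<and> (AE \<omega> in M. \<Phi> t x \<omega> = - \<i> * X \<omega>)"
      by blast
  qed (use c in auto)
qed

theorem proposition1p1:
  fixes T \<alpha> s p :: real
    and \<rho> :: "'a::euclidean_space \<Rightarrow> real"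
    and M :: "'w measure"
    and W :: "(real \<times> 'a \<Rightarrow> real) \<Rightarrow> 'w \<Rightarrow> real"
    and \<Psi> :: "nat \<Rightarrow> real \<Rightarrow> 'a \<Rightarrow> 'w \<Rightarrow> complex"
  assumes "T > 0"
    and "\<alpha> > 0"
    and "s > real DIM('a) / 2 - \<alpha>"
    and "smooth \<rho>"
    and "compact (supp \<rho>)"
    and "2 \<le> p"
    and "prob_space M"
    and "white_noise M T W"
    and "\<And>n. truncated_convolution M T W \<alpha> n (\<Psi> n)"
  shows "\<exists>\<rho>\<Psi> :: 'w \<Rightarrow> real \<Rightarrow> 'a distribution.
    AE \<omega> in M. \<rho>\<Psi> \<omega> \<in> C_sobolev T (- s) p \<and>
      converges_C_sobolev T (- s) p
        (\<lambda>n t. distribution_of (\<lambda>x. of_real (\<rho> x) * \<Psi> n t x \<omega>)) (\<rho>\<Psi> \<omega>)"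
proof -
  define \<rho>' where "\<rho>' = (\<lambda>x. complex_of_real (\<rho> x))"
  have "supp \<rho>' = supp \<rho>" by (simp add: \<rho>'_def supp_def)
  then have \<rho>': "\<rho>' \<in> schwartz"
    using smooth_bounded_linear[OF bounded_linear_of_real assms(4)] assms(5)
    by (intro schwartz_of_compact_supp) (simp_all add: \<rho>'_def)
  obtain R where R: "\<And>y. y \<in> supp \<rho> \<Longrightarrow> norm y \<le> R"
    using compact_imp_bounded[OF assms(5)] unfolding bounded_iff by blast
  have supp: "\<rho>' y = 0" if "norm y > R" for y
    using R[of y] that partials_eq_0_outside_supp[of y \<rho> "[]"] by (auto simp: \<rho>'_def)
  have "AE \<omega> in M. \<forall>n. continuous_on ({0..T} \<times> UNIV) (\<lambda>(t, x). \<Psi> n t x \<omega>)"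
    using assms(9) by (auto simp: AE_all_countable truncated_convolution_def)
  then obtain N where N: "{\<omega> \<in> space M. \<not> (\<forall>n. continuous_on ({0..T} \<times> UNIV) (\<lambda>(t, x). \<Psi> n t x \<omega>))} \<subseteq> N"
      "emeasure M N = 0" "N \<in> sets M"
    by (rule AE_E)
  then have N0: "N \<in> null_sets M" by auto
  define \<Phi> where "\<Phi> n t x \<omega> = (if \<omega> \<in> space M - N then \<Psi> n t x \<omega> else 0)" for n t x \<omega>
  have cN: "continuous_on ({0..T} \<times> UNIV) (\<lambda>(t, x). \<Psi> n t x \<omega>)" if "\<omega> \<in> space M - N" for n \<omega>
    using N(1) that by blast
  note \<Phi>_restrict = truncated_convolution_restrict[OF assms(9) N0 cN, folded \<Phi>_def]
  have \<Phi>: "truncated_convolution M T W \<alpha> n (\<Phi> n)" for n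
    using \<Phi>_restrict(1)[of n] by (simp add: \<Phi>_def[abs_def])
  have cont: "continuous_on ({0..T} \<times> UNIV) (\<lambda>(t, x). \<Phi> n t x \<omega>)" for n \<omega>
    using \<Phi>_restrict(2)[of n \<omega>] by (simp add: \<Phi>_def[abs_def])
  note process = assms(1,7,8) \<Phi> cont \<rho>' supp
  have p1: "1 \<le> p" using assms(6) by simp
  obtain \<theta> :: real where \<theta>: "\<theta> > 0" and
    bound: "AE \<omega> in M. \<exists>A. (\<forall>x. 0 \<le> A x) \<and> integrable lborel A \<and> integrable lborel (\<lambda>x. A x powr p) \<and>
      (AE x in lborel. \<forall>l i k j. i \<le> 2 ^ l \<longrightarrow> j < 2 ^ k \<longrightarrow>
        cmod (convolution_potential s \<Phi> \<rho>' (2 ^ l - 1 + i) (dyadic T k (Suc j)) \<omega> x - convolution_potential s \<Phi> \<rho>' (2 ^ l - 1) (dyadic T k (Suc j)) \<omega> x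
            - (convolution_potential s \<Phi> \<rho>' (2 ^ l - 1 + i) (dyadic T k j) \<omega> x - convolution_potential s \<Phi> \<rho>' (2 ^ l - 1) (dyadic T k j) \<omega> x))
          \<le> A x * (2 powr - \<theta>) ^ l * (2 powr - \<theta>) ^ k)"
    using pathwise_bound[OF process assms(3) p1] by blast
  have conv: "convolution_potential s \<Phi> \<rho>' n t \<omega> = potential s (\<lambda>y. \<rho>' y * \<Phi> n t y \<omega>)" for n t \<omega>
    by (rule convolution_potential_def[OF process]) 
  have D: "t \<in> {0..T}" if "t \<in> dyadics T" for t
    using dyadics_bounds[OF assms(1) that] by simp
  have zero0: "AE \<omega> in M. \<forall>t\<in>dyadics T. \<forall>y. \<Phi> 0 t y \<omega> = 0"
    using convolution_zero_all[OF process D] by (subst AE_ball_countable[OF countable_dyadics]) auto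
  have zerot: "AE \<omega> in M. \<forall>n y. \<Phi> n 0 y \<omega> = 0"
    using convolution_zero_all[OF process, of R 0] assms(1) by (auto simp: AE_all_countable)
  have wint: "AE \<omega> in M. \<forall>n. \<forall>t\<in>dyadics T.
      integrable lborel (\<lambda>\<eta>. of_real (jap (- s) \<eta>) * fourier (\<lambda>y. \<rho>' y * \<Phi> n t y \<omega>) \<eta>)"
    using convolution_weighted_integrable[OF process D, where s=s]
    by (auto simp: AE_all_countable AE_ball_countable[OF countable_dyadics])
  \<comment> \<open>The limit is selected for each outcome separately.\<close>
  define L where "L \<omega> v \<longleftrightarrow> v \<in> C_sobolev T (- s) p \<and>
      converges_C_sobolev T (- s) p (\<lambda>n t. distribution_of (\<lambda>x. of_real (\<rho> x) * \<Psi> n t x \<omega>)) v" for \<omega> v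
  have "AE \<omega> in M. \<exists>v. v \<in> C_sobolev T (- s) p \<and>
      converges_C_sobolev T (- s) p (\<lambda>n t. distribution_of (\<lambda>x. of_real (\<rho> x) * \<Psi> n t x \<omega>)) v"
    using bound zero0 zerot wint AE_not_in[OF N0] AE_space
  proof eventually_elim
    case (elim \<omega>)
    then obtain A where A: "\<And>x. 0 \<le> A x" "integrable lborel A" "integrable lborel (\<lambda>x. A x powr p)"
      "AE x in lborel. \<forall>l i k j. i \<le> 2 ^ l \<longrightarrow> j < 2 ^ k \<longrightarrow>
        cmod (convolution_potential s \<Phi> \<rho>' (2 ^ l - 1 + i) (dyadic T k (Suc j)) \<omega> x - convolution_potential s \<Phi> \<rho>' (2 ^ l - 1) (dyadic T k (Suc j)) \<omega> x
            - (convolution_potential s \<Phi> \<rho>' (2 ^ l - 1 + i) (dyadic T k j) \<omega> x - convolution_potential s \<Phi> \<rho>' (2 ^ l - 1) (dyadic T k j) \<omega> x))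
          \<le> A x * (2 powr - \<theta>) ^ l * (2 powr - \<theta>) ^ k"
      by blast
    have "\<exists>v. v \<in> C_sobolev T (- s) p \<and> converges_C_sobolev T (- s) p (\<lambda>n t. distribution_of (\<lambda>y. \<rho>' y * \<Phi> n t y \<omega>)) v"
    proof (rule pathwise_convergence[where A=A and \<theta>=\<theta> and R=R])
      show "0 < p" using p1 by simp
      show "continuous_on ({0..T} \<times> UNIV) (\<lambda>(t, y). \<Phi> n t y \<omega>)" for n by (rule cont)
      show "\<Phi> 0 t y \<omega> = 0" if "t \<in> dyadics T" for t y using elim(2) that by blast
      show "\<Phi> n 0 y \<omega> = 0" for n y using elim(3) by blast
      show "integrable lborel (\<lambda>\<eta>. of_real (jap (- s) \<eta>) * fourier (\<lambda>y. \<rho>' y * \<Phi> n t y \<omega>) \<eta>)" if "t \<in> dyadics T" for n t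
        using elim(4) that by blast
    qed (fact assms(1) \<theta> \<rho>' supp A(1-3) A(4)[unfolded conv])+
    moreover have "\<Phi> n t x \<omega> = \<Psi> n t x \<omega>" for n t x using elim by (simp add: \<Phi>_def)
    ultimately show ?case by (simp add: \<rho>'_def)
  qed
  then have "AE \<omega> in M. \<exists>v. L \<omega> v" by (simp only: L_def)
  then have "AE \<omega> in M. L \<omega> (SOME v. L \<omega> v)"
  proof eventually_elim
    case (elim \<omega>)
    then show ?case by (rule someI_ex)
  qed
  then have "\<exists>\<rho>\<Psi>. AE \<omega> in M. L \<omega> (\<rho>\<Psi> \<omega>)" by (rule exI[of _ "\<lambda>\<omega>. SOME v. L \<omega> v"])
  then show ?thesis by (simp only: L_def)
qed

end
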